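(* For every positive $T$, every $\gamma\in[0,1]$ and every nonzero Hilbert--Schmidt operator $\Phi$ from $L^2(\mathbb{R})$ into $H^1(\mathbb{R})$, the inequalities $$\limsup_{\epsilon\to0}\epsilon\log\mathbb{P}_\epsilon^{|0}\le-\frac{1-\gamma}{2T\|\Phi\|_c^2}$$ and $$\limsup_{\epsilon\to0}\epsilon\log\mathbb{P}_\epsilon^{|1}\le-\frac{1+\gamma}{T\|\Phi\|_c^2}\left(\sqrt{1+\left(\frac{\gamma}{1+\gamma}\right)^2}-1\right)$$ hold.
   Context: Here $d=1$, $\sigma=1$, $\lambda=1$; functions are complex valued and $L^2(\mathbb{R})$ is a real Hilbert space with inner product $(u,v)=\Re\int u\bar v\,dx$. $\|\Phi\|_c$ is the norm of $\Phi$ as a continuous linear operator on $L^2(\mathbb{R})$. $W=\Phi W_c$ with $W_c=\sum_j\beta_je_j$, $(e_j)$ an orthonormal basis of $L^2(\mathbb{R})$, $(\beta_j)$ independent real Brownian motions. For $\epsilon>0$, $u_\epsilon$ (resp. $u_\epsilon^n$) is the (global) mild solution, with paths in $C([0,+\infty);H^1(\mathbb{R}))$, of $$i\,du-(\Delta u+|u|^2u)dt=\sqrt\epsilon\,dW$$ with initial datum $u_\epsilon(0)=\Psi_1(0,\cdot)$, $\Psi_1(0,x)=\sqrt2\,\mathrm{sech}(x)$ (resp. $u_\epsilon^n(0)=0$); mild means $u(t)=S(t)u(0)-i\int_0^tS(t-s)(|u|^2u)(s)ds-i\sqrt\epsilon\int_0^tS(t-s)dW(s)$ with $S(t)=e^{-it\Delta}$.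 The error probabilities (with unbounded window, $l=+\infty$) are $$\mathbb{P}_\epsilon^{|0}=\mathbb{P}\left(\int_{\mathbb{R}}|u_\epsilon^n(T,x)|^2dx\ge4(1-\gamma)\right),\qquad\mathbb{P}_\epsilon^{|1}=\mathbb{P}\left(\int_{\mathbb{R}}|u_\epsilon(T,x)|^2dx<4(1-\gamma)\right).$$ *)

theory Defs
  imports "HOL-Probability.Probability"
begin

section \<open>The space \<open>L\<^sup>2(\<real>)\<close> of complex-valued functions\<close>

definition sq_integrable :: "(real \<Rightarrow> complex) \<Rightarrow> bool" where
  "sq_integrable f \<longleftrightarrow> f \<in> borel_measurable lborel \<and> integrable lborel (\<lambda>x. (cmod (f x))\<^sup>2)"

definition ae_eq :: "(real \<Rightarrow> complex) \<Rightarrow> (real \<Rightarrow> complex) \<Rightarrow> bool" where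
  "ae_eq f g \<longleftrightarrow> sq_integrable f \<and> sq_integrable g \<and> (AE x in lborel. f x = g x)"

lemma sq_integrable_zero: "sq_integrable (\<lambda>x. 0)"
  by (simp add: sq_integrable_def)

lemma sq_integrable_mult: "sq_integrable f \<Longrightarrow> sq_integrable (\<lambda>x. c * f x)"
  by (auto simp: sq_integrable_def norm_mult power_mult_distrib)

lemma sq_integrable_scaleR: "sq_integrable f \<Longrightarrow> sq_integrable (\<lambda>x. c *\<^sub>R f x)"
  using sq_integrable_mult[of f "of_real c"] by (simp add: scaleR_conv_of_real)

lemma sq_integrable_uminus: "sq_integrable f \<Longrightarrow> sq_integrable (\<lambda>x. - f x)"
  by (auto simp: sq_integrable_def)

lemma integrable_mult_sq:
  fixes f g :: "real \<Rightarrow> 'a::{real_normed_algebra, second_countable_topology, banach}"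
  assumes [measurable]: "f \<in> borel_measurable lborel" "g \<in> borel_measurable lborel"
    and i: "integrable lborel (\<lambda>x. (norm (f x))\<^sup>2)" "integrable lborel (\<lambda>x. (norm (g x))\<^sup>2)"
  shows "integrable lborel (\<lambda>x. f x * g x)"
proof (rule Bochner_Integration.integrable_bound)
  show "integrable lborel (\<lambda>x. (norm (f x))\<^sup>2 + (norm (g x))\<^sup>2)"
    using i by (rule Bochner_Integration.integrable_add)
  show "(\<lambda>x. f x * g x) \<in> borel_measurable lborel" by simp
  have "norm (f x * g x) \<le> (norm (f x))\<^sup>2 + (norm (g x))\<^sup>2" for x
  proof -
    have "norm (f x * g x) \<le> norm (f x) * norm (g x)" by (rule norm_mult_ineq)
    also have "\<dots> \<le> 2 * norm (f x) * norm (g x)"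
      using mult_nonneg_nonneg[OF norm_ge_zero[of "f x"] norm_ge_zero[of "g x"]] by linarith
    also have "\<dots> \<le> (norm (f x))\<^sup>2 + (norm (g x))\<^sup>2" by (rule sum_squares_bound)
    finally show ?thesis .
  qed
  then show "AE x in lborel. norm (f x * g x) \<le> norm ((norm (f x))\<^sup>2 + (norm (g x))\<^sup>2)"
    by auto
qed

lemma sq_integrable_add:
  assumes "sq_integrable f" "sq_integrable g"
  shows "sq_integrable (\<lambda>x. f x + g x)"
proof -
  have [measurable]: "f \<in> borel_measurable lborel" "g \<in> borel_measurable lborel"
    and i: "integrable lborel (\<lambda>x. (cmod (f x))\<^sup>2)" "integrable lborel (\<lambda>x. (cmod (g x))\<^sup>2)"
    using assms by (auto simp: sq_integrable_def)
  have "integrable lborel (\<lambda>x. (cmod (f x + g x))\<^sup>2)"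
  proof (rule Bochner_Integration.integrable_bound)
    show "integrable lborel (\<lambda>x. 2 * (cmod (f x))\<^sup>2 + 2 * (cmod (g x))\<^sup>2)"
      using i by simp
    show "(\<lambda>x. (cmod (f x + g x))\<^sup>2) \<in> borel_measurable lborel" by simp
    have "(cmod (f x + g x))\<^sup>2 \<le> 2 * (cmod (f x))\<^sup>2 + 2 * (cmod (g x))\<^sup>2" for x
    proof -
      have "(cmod (f x + g x))\<^sup>2 \<le> (cmod (f x) + cmod (g x))\<^sup>2"
        by (intro power_mono norm_triangle_ineq norm_ge_zero)
      also have "\<dots> \<le> 2 * (cmod (f x))\<^sup>2 + 2 * (cmod (g x))\<^sup>2"
        using sum_squares_bound[of "cmod (f x)" "cmod (g x)"] by (simp add: power2_sum)
      finally show ?thesis .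
    qed
    then show "AE x in lborel. norm ((cmod (f x + g x))\<^sup>2)
        \<le> norm (2 * (cmod (f x))\<^sup>2 + 2 * (cmod (g x))\<^sup>2)"
      by auto
  qed
  then show ?thesis by (simp add: sq_integrable_def)
qed

lemma sq_integrable_diff:
  "sq_integrable f \<Longrightarrow> sq_integrable g \<Longrightarrow> sq_integrable (\<lambda>x. f x - g x)"
  using sq_integrable_add[OF _ sq_integrable_uminus, of f g] by simp

lemma measurable_cnj [measurable]: "cnj \<in> borel_measurable borel"
  by (intro borel_measurable_continuous_onI continuous_intros)

lemma integrable_mult_cnj:
  "sq_integrable f \<Longrightarrow> sq_integrable g \<Longrightarrow> integrable lborel (\<lambda>x. f x * cnj (g x))"
  by (rule integrable_mult_sq) (auto simp: sq_integrable_def intro: measurable_compose[OF _ measurable_cnj])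

lemma part_equivp_ae_eq: "part_equivp ae_eq"
proof (rule part_equivpI)
  show "\<exists>f. ae_eq f f" by (rule exI[of _ "\<lambda>x. 0"]) (simp add: ae_eq_def sq_integrable_zero)
  show "symp ae_eq" by (auto simp: symp_def ae_eq_def)
  show "transp ae_eq" by (auto simp: transp_def ae_eq_def)
qed

quotient_type l2 = "real \<Rightarrow> complex" / partial: ae_eq
  morphisms l2_fun l2_abs
  by (rule part_equivp_ae_eq)

instantiation l2 :: real_inner
begin

lift_definition zero_l2 :: l2 is "\<lambda>x. 0"
  by (simp add: ae_eq_def sq_integrable_zero)

lift_definition plus_l2 :: "l2 \<Rightarrow> l2 \<Rightarrow> l2" is "\<lambda>f g x. f x + g x"
  by (auto simp: ae_eq_def sq_integrable_add elim: eventually_elim2)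

lift_definition minus_l2 :: "l2 \<Rightarrow> l2 \<Rightarrow> l2" is "\<lambda>f g x. f x - g x"
  by (auto simp: ae_eq_def sq_integrable_diff elim: eventually_elim2)

lift_definition uminus_l2 :: "l2 \<Rightarrow> l2" is "\<lambda>f x. - f x"
  by (auto simp: ae_eq_def sq_integrable_uminus)

lift_definition scaleR_l2 :: "real \<Rightarrow> l2 \<Rightarrow> l2" is "\<lambda>r f x. r *\<^sub>R f x"
  by (auto simp: ae_eq_def sq_integrable_scaleR elim: eventually_mono)

lift_definition inner_l2 :: "l2 \<Rightarrow> l2 \<Rightarrow> real" is
  "\<lambda>f g. Re (\<integral>x. f x * cnj (g x) \<partial>lborel)"
proof -
  fix f f' g g' assume *: "ae_eq f f'" "ae_eq g g'"
  then have [measurable]: "f \<in> borel_measurable lborel" "g \<in> borel_measurable lborel"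
    "f' \<in> borel_measurable lborel" "g' \<in> borel_measurable lborel"
    by (auto simp: ae_eq_def sq_integrable_def)
  have "(\<integral>x. f x * cnj (g x) \<partial>lborel) = (\<integral>x. f' x * cnj (g' x) \<partial>lborel)"
    using * by (intro integral_cong_AE) (auto simp: ae_eq_def elim: eventually_elim2)
  then show "Re (\<integral>x. f x * cnj (g x) \<partial>lborel) = Re (\<integral>x. f' x * cnj (g' x) \<partial>lborel)"
    by simp
qed

definition norm_l2 :: "l2 \<Rightarrow> real" where "norm_l2 u = sqrt (inner u u)"
definition sgn_l2 :: "l2 \<Rightarrow> l2" where "sgn_l2 u = inverse (norm u) *\<^sub>R u"
definition dist_l2 :: "l2 \<Rightarrow> l2 \<Rightarrow> real" where "dist_l2 u v = norm (u - v)"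
definition uniformity_l2 :: "(l2 \<times> l2) filter" where
  "uniformity_l2 = (INF e\<in>{0<..}. principal {(u, v). dist u v < e})"
definition open_l2 :: "l2 set \<Rightarrow> bool" where
  "open_l2 U \<longleftrightarrow> (\<forall>u\<in>U. \<forall>\<^sub>F (u', v) in uniformity. u' = u \<longrightarrow> v \<in> U)"

lemma l2_self_inner:
  "Re (\<integral>x. f x * cnj (f x) \<partial>lborel) = (\<integral>x. (cmod (f x))\<^sup>2 \<partial>lborel)"
proof -
  have "(\<integral>x. f x * cnj (f x) \<partial>lborel) = (\<integral>x. complex_of_real ((cmod (f x))\<^sup>2) \<partial>lborel)"
    by (intro Bochner_Integration.integral_cong refl) (simp only: complex_norm_square)
  then show ?thesis by (simp only: integral_complex_of_real Re_complex_of_real)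
qed

instance
proof
  fix u v w :: l2 and r s :: real
  show "u + v + w = u + (v + w)"
    by transfer (simp add: ae_eq_def add.assoc sq_integrable_add)
  show "u + v = v + u"
    by transfer (simp add: ae_eq_def add.commute sq_integrable_add)
  show "0 + u = u"
    by transfer (simp add: ae_eq_def)
  show "- u + u = 0"
    by transfer (simp add: ae_eq_def sq_integrable_zero)
  show "u - v = u + - v"
    by transfer (simp add: ae_eq_def sq_integrable_diff)
  show "r *\<^sub>R (u + v) = r *\<^sub>R u + r *\<^sub>R v"
    by transfer (simp add: ae_eq_def scaleR_add_right sq_integrable_add sq_integrable_scaleR)
  show "(r + s) *\<^sub>R u = r *\<^sub>R u + s *\<^sub>R u"
    by transfer (simp add: ae_eq_def scaleR_add_left sq_integrable_add sq_integrable_scaleR)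
  show "r *\<^sub>R s *\<^sub>R u = (r * s) *\<^sub>R u"
    by transfer (simp add: ae_eq_def sq_integrable_scaleR)
  show "1 *\<^sub>R u = u"
    by transfer (simp add: ae_eq_def)
  show "inner u v = inner v u"
  proof transfer
    fix f g assume "ae_eq f f" "ae_eq g g"
    have "(\<integral>x. f x * cnj (g x) \<partial>lborel) = cnj (\<integral>x. g x * cnj (f x) \<partial>lborel)"
      by (subst Bochner_Integration.integral_cnj[symmetric]) (simp add: mult.commute)
    then show "Re (\<integral>x. f x * cnj (g x) \<partial>lborel) = Re (\<integral>x. g x * cnj (f x) \<partial>lborel)"
      by simp
  qed
  show "inner (u + v) w = inner u w + inner v w"
    by transfer (simp add: ae_eq_def distrib_right integrable_mult_cnj)
  show "inner (r *\<^sub>R u) v = r * inner u v"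
    by transfer simp
  show "0 \<le> inner u u"
    by transfer (simp only: l2_self_inner, simp)
  show "inner u u = 0 \<longleftrightarrow> u = 0"
  proof transfer
    fix f assume "ae_eq f f"
    then have f: "sq_integrable f" by (simp add: ae_eq_def)
    have "(\<integral>x. (cmod (f x))\<^sup>2 \<partial>lborel) = 0 \<longleftrightarrow> (AE x in lborel. (cmod (f x))\<^sup>2 = 0)"
      using f by (intro integral_nonneg_eq_0_iff_AE) (auto simp: sq_integrable_def)
    then show "(Re (\<integral>x. f x * cnj (f x) \<partial>lborel) = 0) = ae_eq f (\<lambda>x. 0)"
      using f by (simp add: l2_self_inner ae_eq_def sq_integrable_zero)
  qed
  show "norm u = sqrt (inner u u)" by (rule norm_l2_def)
  show "sgn u = inverse (norm u) *\<^sub>R u" by (rule sgn_l2_def)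
  show "dist u v = norm (u - v)" by (rule dist_l2_def)
  show "(uniformity :: (l2 \<times> l2) filter) = (INF e\<in>{0<..}. principal {(u, v). dist u v < e})"
    by (rule uniformity_l2_def)
  show "open U \<longleftrightarrow> (\<forall>u\<in>U. \<forall>\<^sub>F (u', v) in uniformity. u' = u \<longrightarrow> v \<in> U)" for U :: "l2 set"
    by (rule open_l2_def)
qed

end

text \<open>\<open>l2_fun u\<close> is some square-integrable representative of the class \<open>u\<close>; \<open>l2_of f\<close> is the
  class of \<open>f\<close> (with the junk value \<open>0\<close> if \<open>f\<close> is not square-integrable).\<close>

definition l2_of :: "(real \<Rightarrow> complex) \<Rightarrow> l2" where
  "l2_of f = (if sq_integrable f then l2_abs f else 0)"

lift_definition cscale :: "complex \<Rightarrow> l2 \<Rightarrow> l2" is "\<lambda>c f x. c * f x"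
  by (auto simp: ae_eq_def sq_integrable_mult elim: eventually_mono)


section \<open>Weak derivatives and \<open>H\<^sup>1(\<real>)\<close>\<close>

definition test_function :: "(real \<Rightarrow> real) \<Rightarrow> bool" where
  "test_function \<phi> \<longleftrightarrow>
     (\<forall>n. (deriv ^^ n) \<phi> differentiable_on UNIV) \<and> bounded {x. \<phi> x \<noteq> 0}"

lemma cont_compact_support_integrable:
  fixes g :: "real \<Rightarrow> real"
  assumes "continuous_on UNIV g" and "\<And>x. \<bar>x\<bar> > R \<Longrightarrow> g x = 0"
  shows "g \<in> borel_measurable lborel" "integrable lborel (\<lambda>x. (norm (g x))\<^sup>2)"
proof -
  show "g \<in> borel_measurable lborel"
    using assms(1) by (simp add: borel_measurable_continuous_onI)
  have "set_integrable lborel {- R..R} (\<lambda>x. (norm (g x))\<^sup>2)"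
    by (intro borel_integrable_atLeastAtMost' continuous_intros continuous_on_subset[OF assms(1)]) auto
  moreover have "(\<lambda>x. indicator {- R..R} x *\<^sub>R (norm (g x))\<^sup>2) = (\<lambda>x. (norm (g x))\<^sup>2)"
    using assms(2) by (force simp: indicator_def fun_eq_iff)
  ultimately show "integrable lborel (\<lambda>x. (norm (g x))\<^sup>2)"
    by (simp add: set_integrable_def)
qed

lemma test_function_integrable:
  assumes "test_function \<phi>" "sq_integrable f"
  shows "integrable lborel (\<lambda>x. f x * complex_of_real (\<phi> x))"
    and "integrable lborel (\<lambda>x. f x * complex_of_real (deriv \<phi> x))"
proof -
  have d: "(deriv ^^ n) \<phi> differentiable_on UNIV" for n
    using assms(1) by (auto simp: test_function_def)
  have c: "continuous_on UNIV \<phi>" "continuous_on UNIV (deriv \<phi>)"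
    using d[of 0] d[of 1] by (auto intro: differentiable_imp_continuous_on)
  obtain R where R: "\<And>x. \<bar>x\<bar> > R \<Longrightarrow> \<phi> x = 0"
    using assms(1) unfolding test_function_def bounded_iff by (auto simp: not_less) (metis not_le)
  have R': "deriv \<phi> x = 0" if "\<bar>x\<bar> > R" for x
  proof (rule DERIV_imp_deriv)
    have "open {x. \<bar>x\<bar> > R}" by (intro open_Collect_less continuous_intros)
    then show "(\<phi> has_field_derivative 0) (at x)"
      using that R
      by (intro has_field_derivative_transform_within_open[OF DERIV_const[of "0::real"]])
         (auto intro: sym)
  qed
  note i = cont_compact_support_integrable[OF c(1) R] cont_compact_support_integrable[OF c(2) R']
  show "integrable lborel (\<lambda>x. f x * complex_of_real (\<phi> x))"
    using assms(2) i by (intro integrable_mult_sq) (auto simp: sq_integrable_def)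
  show "integrable lborel (\<lambda>x. f x * complex_of_real (deriv \<phi> x))"
    using assms(2) i by (intro integrable_mult_sq) (auto simp: sq_integrable_def)
qed

text \<open>\<open>weak_deriv u v\<close>: the distributional derivative of \<open>u\<close> is the square-integrable function \<open>v\<close>.\<close>

lift_definition weak_deriv :: "l2 \<Rightarrow> l2 \<Rightarrow> bool" is
  "\<lambda>f g. \<forall>\<phi>. test_function \<phi> \<longrightarrow>
     (\<integral>x. f x * complex_of_real (deriv \<phi> x) \<partial>lborel)
       = - (\<integral>x. g x * complex_of_real (\<phi> x) \<partial>lborel)"
proof -
  fix f f' g g' assume *: "ae_eq f f'" "ae_eq g g'"
  have cong: "(\<integral>x. h x * complex_of_real (p x) \<partial>lborel)
      = (\<integral>x. h' x * complex_of_real (p x) \<partial>lborel)"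
    if "ae_eq h h'" "integrable lborel (\<lambda>x. h x * complex_of_real (p x))"
      "integrable lborel (\<lambda>x. h' x * complex_of_real (p x))" for h h' p
    using that by (intro integral_cong_AE) (auto simp: ae_eq_def elim: eventually_mono)
  have "(\<integral>x. f x * complex_of_real (deriv \<phi> x) \<partial>lborel)
         = (\<integral>x. f' x * complex_of_real (deriv \<phi> x) \<partial>lborel)"
       "(\<integral>x. g x * complex_of_real (\<phi> x) \<partial>lborel)
         = (\<integral>x. g' x * complex_of_real (\<phi> x) \<partial>lborel)"
    if "test_function \<phi>" for \<phi>
    using * that by (auto intro!: cong test_function_integrable simp: ae_eq_def)
  then show "(\<forall>\<phi>. test_function \<phi> \<longrightarrow> (\<integral>x. f x * complex_of_real (deriv \<phi> x) \<partial>lborel)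
        = - (\<integral>x. g x * complex_of_real (\<phi> x) \<partial>lborel)) =
      (\<forall>\<phi>. test_function \<phi> \<longrightarrow> (\<integral>x. f' x * complex_of_real (deriv \<phi> x) \<partial>lborel)
        = - (\<integral>x. g' x * complex_of_real (\<phi> x) \<partial>lborel))"
    by auto
qed

lemma weak_deriv_zero: "weak_deriv 0 0"
  by transfer simp

lemma weak_deriv_add: "weak_deriv u u' \<Longrightarrow> weak_deriv v v' \<Longrightarrow> weak_deriv (u + v) (u' + v')"
  by transfer (simp add: ae_eq_def distrib_right test_function_integrable)

lemma weak_deriv_scaleR: "weak_deriv u u' \<Longrightarrow> weak_deriv (r *\<^sub>R u) (r *\<^sub>R u')"
  by transfer simp

text \<open>\<open>H\<^sup>1(\<real>)\<close> is represented as the graph of the weak derivative inside \<open>L\<^sup>2 \<times> L\<^sup>2\<close>. Weak derivatives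
  are unique, so \<open>h1_l2\<close> below identifies this type with the subspace \<open>{u. \<exists>v. weak_deriv u v}\<close>
  of \<open>L\<^sup>2\<close>; the inner product of the graph is \<open>(u, v) + (u', v')\<close>.\<close>

typedef h1 = "{(u, u'). weak_deriv u u'}"
  by (rule exI[of _ "(0, 0)"]) (simp add: weak_deriv_zero)

setup_lifting type_definition_h1

instantiation h1 :: real_inner
begin

lift_definition zero_h1 :: h1 is 0
  by (simp add: zero_prod_def weak_deriv_zero)

lift_definition plus_h1 :: "h1 \<Rightarrow> h1 \<Rightarrow> h1" is "(+)"
  by (auto intro: weak_deriv_add)

lift_definition scaleR_h1 :: "real \<Rightarrow> h1 \<Rightarrow> h1" is "(*\<^sub>R)"
  by (auto intro: weak_deriv_scaleR)

lift_definition uminus_h1 :: "h1 \<Rightarrow> h1" is uminus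
  using weak_deriv_scaleR[of _ _ "-1"] by auto

lift_definition minus_h1 :: "h1 \<Rightarrow> h1 \<Rightarrow> h1" is "(-)"
proof -
  fix p q assume "p \<in> {(u, u'). weak_deriv u u'}" "q \<in> {(u, u'). weak_deriv u u'}"
  then show "p - q \<in> {(u, u'). weak_deriv u u'}"
    using weak_deriv_add[of "fst p" "snd p" "- fst q" "- snd q"]
      weak_deriv_scaleR[of "fst q" "snd q" "-1"] by (auto simp: case_prod_beta)
qed

lift_definition inner_h1 :: "h1 \<Rightarrow> h1 \<Rightarrow> real" is inner .

definition norm_h1 :: "h1 \<Rightarrow> real" where "norm_h1 u = sqrt (inner u u)"
definition sgn_h1 :: "h1 \<Rightarrow> h1" where "sgn_h1 u = inverse (norm u) *\<^sub>R u"
definition dist_h1 :: "h1 \<Rightarrow> h1 \<Rightarrow> real" where "dist_h1 u v = norm (u - v)"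
definition uniformity_h1 :: "(h1 \<times> h1) filter" where
  "uniformity_h1 = (INF e\<in>{0<..}. principal {(u, v). dist u v < e})"
definition open_h1 :: "h1 set \<Rightarrow> bool" where
  "open_h1 U \<longleftrightarrow> (\<forall>u\<in>U. \<forall>\<^sub>F (u', v) in uniformity. u' = u \<longrightarrow> v \<in> U)"

instance
proof
  fix u v w :: h1 and r s :: real
  show "u + v + w = u + (v + w)" by transfer (simp add: add.assoc)
  show "u + v = v + u" by transfer (simp add: add.commute)
  show "0 + u = u" by transfer simp
  show "- u + u = 0" by transfer simp
  show "u - v = u + - v" by transfer simp
  show "r *\<^sub>R (u + v) = r *\<^sub>R u + r *\<^sub>R v" by transfer (simp add: scaleR_add_right)
  show "(r + s) *\<^sub>R u = r *\<^sub>R u + s *\<^sub>R u" by transfer (simp add: scaleR_add_left)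
  show "r *\<^sub>R s *\<^sub>R u = (r * s) *\<^sub>R u" by transfer simp
  show "1 *\<^sub>R u = u" by transfer simp
  show "inner u v = inner v u" by transfer (simp add: inner_commute)
  show "inner (u + v) w = inner u w + inner v w" by transfer (simp add: inner_add_left)
  show "inner (r *\<^sub>R u) v = r * inner u v" by transfer simp
  show "0 \<le> inner u u" by transfer simp
  show "inner u u = 0 \<longleftrightarrow> u = 0" by transfer simp
  show "norm u = sqrt (inner u u)" by (rule norm_h1_def)
  show "sgn u = inverse (norm u) *\<^sub>R u" by (rule sgn_h1_def)
  show "dist u v = norm (u - v)" by (rule dist_h1_def)
  show "(uniformity :: (h1 \<times> h1) filter) = (INF e\<in>{0<..}. principal {(u, v). dist u v < e})"
    by (rule uniformity_h1_def)
  show "open U \<longleftrightarrow> (\<forall>u\<in>U. \<forall>\<^sub>F (u', v) in uniformity. u' = u \<longrightarrow> v \<in> U)" for U :: "h1 set"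
    by (rule open_h1_def)
qed

end

definition h1_l2 :: "h1 \<Rightarrow> l2" where
  "h1_l2 u = fst (Rep_h1 u)"


section \<open>Hilbert--Schmidt operators and the Schroedinger group\<close>

definition orthonormal_basis :: "(nat \<Rightarrow> 'a::real_inner) \<Rightarrow> bool" where
  "orthonormal_basis e \<longleftrightarrow>
     (\<forall>i j. inner (e i) (e j) = (if i = j then 1 else 0)) \<and> closure (span (range e)) = UNIV"

definition hilbert_schmidt :: "('a::real_inner \<Rightarrow> 'b::real_inner) \<Rightarrow> bool" where
  "hilbert_schmidt \<Phi> \<longleftrightarrow> bounded_linear \<Phi> \<and>
     (\<exists>e. orthonormal_basis e \<and> summable (\<lambda>j. (norm (\<Phi> (e j)))\<^sup>2))"

text \<open>\<open>A f g\<close> means that \<open>f\<close> lies in the domain of the (unbounded) operator \<open>A\<close> and \<open>A f = g\<close>;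
  \<open>group_generated_by A S\<close> says that \<open>S\<close> is the strongly continuous group \<open>S(t) = exp(tA)\<close>.\<close>

definition group_generated_by :: "('a::real_normed_vector \<Rightarrow> 'a \<Rightarrow> bool) \<Rightarrow> (real \<Rightarrow> 'a \<Rightarrow> 'a) \<Rightarrow> bool" where
  "group_generated_by A S \<longleftrightarrow>
     (\<forall>t. bounded_linear (S t)) \<and> S 0 = id \<and> (\<forall>s t. S (s + t) = S s \<circ> S t) \<and>
     (\<forall>f. continuous_on UNIV (\<lambda>t. S t f)) \<and>
     (\<forall>f g. ((\<lambda>h. (S h f - f) /\<^sub>R h) \<longlongrightarrow> g) (at 0) \<longleftrightarrow> A f g)"

text \<open>The operator \<open>-i\<Delta>\<close> with domain \<open>H\<^sup>2(\<real>)\<close>, so that \<open>S(t) = exp(-it\<Delta>)\<close>.\<close>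

definition minus_i_laplacian :: "l2 \<Rightarrow> l2 \<Rightarrow> bool" where
  "minus_i_laplacian f g \<longleftrightarrow>
     (\<exists>f' f''. weak_deriv f f' \<and> weak_deriv f' f'' \<and> g = cscale (- \<i>) f'')"

abbreviation schroedinger_group :: "(real \<Rightarrow> l2 \<Rightarrow> l2) \<Rightarrow> bool" where
  "schroedinger_group S \<equiv> group_generated_by minus_i_laplacian S"


section \<open>Brownian motions and stochastic integrals of deterministic functions\<close>

definition brownian_motion :: "'w measure \<Rightarrow> (real \<Rightarrow> 'w \<Rightarrow> real) \<Rightarrow> bool" where
  "brownian_motion M B \<longleftrightarrow>
     (\<forall>t\<ge>0. B t \<in> borel_measurable M) \<and>
     (AE \<omega> in M. B 0 \<omega> = 0) \<and>
     (AE \<omega> in M. continuous_on {0..} (\<lambda>t. B t \<omega>)) \<and>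
     (\<forall>s t. 0 \<le> s \<longrightarrow> s < t \<longrightarrow>
        distributed M lborel (\<lambda>\<omega>. B t \<omega> - B s \<omega>) (normal_density 0 (sqrt (t - s)))) \<and>
     (\<forall>n t. 0 \<le> t 0 \<longrightarrow> mono t \<longrightarrow>
        prob_space.indep_vars M (\<lambda>k. borel) (\<lambda>k \<omega>. B (t (Suc k)) \<omega> - B (t k) \<omega>) {..<n::nat})"

text \<open>Independence of the motions is independence of the path-valued random variables.\<close>

definition independent_brownian_motions :: "'w measure \<Rightarrow> (nat \<Rightarrow> real \<Rightarrow> 'w \<Rightarrow> real) \<Rightarrow> bool" where
  "independent_brownian_motions M \<beta> \<longleftrightarrow>
     (\<forall>j. brownian_motion M (\<beta> j)) \<and>
     prob_space.indep_vars M (\<lambda>j. \<Pi>\<^sub>M t\<in>{0..}. borel) (\<lambda>j \<omega>. \<lambda>t\<in>{0..}. \<beta> j t \<omega>) UNIV"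

definition step_fun :: "nat \<Rightarrow> (nat \<Rightarrow> real) \<Rightarrow> (nat \<Rightarrow> 'a::real_normed_vector) \<Rightarrow> real \<Rightarrow> 'a" where
  "step_fun n \<tau> c s = (\<Sum>k<n. indicator {\<tau> k<..\<tau> (Suc k)} s *\<^sub>R c k)"

definition step_integral ::
  "(real \<Rightarrow> 'w \<Rightarrow> real) \<Rightarrow> nat \<Rightarrow> (nat \<Rightarrow> real) \<Rightarrow> (nat \<Rightarrow> 'a::real_normed_vector) \<Rightarrow> 'w \<Rightarrow> 'a" where
  "step_integral B n \<tau> c \<omega> = (\<Sum>k<n. (B (\<tau> (Suc k)) \<omega> - B (\<tau> k) \<omega>) *\<^sub>R c k)"

text \<open>\<open>has_wiener_integral M B t f I\<close>: \<open>I = \<integral>\<^sub>0\<^sup>t f(s) dB(s)\<close>, obtained from step functions by the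
  Ito isometry: \<open>I\<close> is the limit in mean square of the integrals of step functions that converge
  to \<open>f\<close> in \<open>L\<^sup>2(0,t)\<close>. \<open>I\<close> is determined up to a null set.\<close>

definition has_wiener_integral ::
  "'w measure \<Rightarrow> (real \<Rightarrow> 'w \<Rightarrow> real) \<Rightarrow> real \<Rightarrow> (real \<Rightarrow> 'a::real_normed_vector) \<Rightarrow> ('w \<Rightarrow> 'a) \<Rightarrow> bool" where
  "has_wiener_integral M B t f I \<longleftrightarrow>
     f \<in> borel_measurable borel \<and> I \<in> borel_measurable M \<and>
     (\<exists>n \<tau> c. (\<forall>m. mono (\<tau> m) \<and> \<tau> m 0 = 0 \<and> \<tau> m (n m) = t) \<and>
        (\<lambda>m. \<integral>\<^sup>+s\<in>{0..t}. ennreal ((norm (step_fun (n m) (\<tau> m) (c m) s - f s))\<^sup>2) \<partial>lborel)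
          \<longlonglongrightarrow> 0 \<and>
        (\<lambda>m. \<integral>\<^sup>+\<omega>. ennreal ((norm (step_integral B (n m) (\<tau> m) (c m) \<omega> - I \<omega>))\<^sup>2) \<partial>M)
          \<longlonglongrightarrow> 0)"

text \<open>\<open>Z = \<integral>\<^sub>0\<^sup>t \<Psi>(s) dW\<^sub>c(s)\<close> for \<open>W\<^sub>c = \<Sum>\<^sub>j \<beta>\<^sub>j e\<^sub>j\<close> and Hilbert--Schmidt \<open>\<Psi>(s)\<close>, that is,
  \<open>Z = \<Sum>\<^sub>j \<integral>\<^sub>0\<^sup>t \<Psi>(s) e\<^sub>j d\<beta>\<^sub>j(s)\<close> with convergence in mean square.\<close>

definition has_cylindrical_integral ::
  "'w measure \<Rightarrow> (nat \<Rightarrow> real \<Rightarrow> 'w \<Rightarrow> real) \<Rightarrow> (nat \<Rightarrow> l2) \<Rightarrow> real \<Rightarrow>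
    (real \<Rightarrow> l2 \<Rightarrow> 'a::real_normed_vector) \<Rightarrow> ('w \<Rightarrow> 'a) \<Rightarrow> bool" where
  "has_cylindrical_integral M \<beta> e t \<Psi> Z \<longleftrightarrow>
     Z \<in> borel_measurable M \<and>
     (\<exists>J. (\<forall>j. has_wiener_integral M (\<beta> j) t (\<lambda>s. \<Psi> s (e j)) (J j)) \<and>
        (\<lambda>n. \<integral>\<^sup>+\<omega>. ennreal ((norm ((\<Sum>j<n. J j \<omega>) - Z \<omega>))\<^sup>2) \<partial>M) \<longlonglongrightarrow> 0)"


section \<open>The stochastic nonlinear Schroedinger equation\<close>

text \<open>\<open>|u|\<^sup>2u\<close>; elements of \<open>H\<^sup>1(\<real>)\<close> are bounded, so this is always square-integrable.\<close>

definition cubic :: "h1 \<Rightarrow> l2" where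
  "cubic u = l2_of (\<lambda>x. complex_of_real ((cmod (l2_fun (h1_l2 u) x))\<^sup>2) * l2_fun (h1_l2 u) x)"

text \<open>Mild solutions of \<open>i du - (\<Delta>u + |u|\<^sup>2u) dt = \<surd>\<epsilon> dW\<close>, \<open>W = \<Phi>W\<^sub>c\<close>, with paths in
  \<open>C([0,\<infinity>); H\<^sup>1(\<real>))\<close>; the mild equation is read as an identity in \<open>L\<^sup>2(\<real>)\<close>.
  Adaptedness is not demanded: the noise is additive, so it follows from pathwise uniqueness.\<close>

definition mild_solution ::
  "'w measure \<Rightarrow> (nat \<Rightarrow> real \<Rightarrow> 'w \<Rightarrow> real) \<Rightarrow> (nat \<Rightarrow> l2) \<Rightarrow> (real \<Rightarrow> l2 \<Rightarrow> l2) \<Rightarrow> (l2 \<Rightarrow> h1) \<Rightarrow>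
    real \<Rightarrow> l2 \<Rightarrow> (real \<Rightarrow> 'w \<Rightarrow> h1) \<Rightarrow> bool" where
  "mild_solution M \<beta> e S \<Phi> \<epsilon> u0 u \<longleftrightarrow>
     (\<forall>t\<ge>0. u t \<in> borel_measurable M) \<and>
     (AE \<omega> in M. continuous_on {0..} (\<lambda>t. u t \<omega>)) \<and>
     (\<forall>t\<ge>0. \<exists>Z. has_cylindrical_integral M \<beta> e t (\<lambda>s f. S (t - s) (h1_l2 (\<Phi> f))) Z \<and>
        (AE \<omega> in M. h1_l2 (u t \<omega>) =
           S t u0 - cscale \<i> (integral {0..t} (\<lambda>s. S (t - s) (cubic (u s \<omega>))))
             - cscale \<i> (sqrt \<epsilon> *\<^sub>R Z \<omega>)))"

definition soliton :: l2 where
  "soliton = l2_of (\<lambda>x. complex_of_real (sqrt 2 / cosh x))"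

definition mass :: "h1 \<Rightarrow> real" where
  "mass u = (\<integral>x. (cmod (l2_fun (h1_l2 u) x))\<^sup>2 \<partial>lborel)"

text \<open>The logarithm on \<open>[0, \<infinity>)\<close> with \<open>log 0 = -\<infinity>\<close> (the library has \<open>ln 0 = 0\<close>).\<close>

definition elog :: "real \<Rightarrow> ereal" where
  "elog p = (if p = 0 then - \<infinity> else ereal (ln p))"

end

theory Submission
  imports Defs
begin

text \<open>Apply the unitary group and the nonlinear phase rotation alternately on small time steps of length
  \<open>h\<close>. In the interaction picture one step is \<open>v \<mapsto> A v + \<xi>\<close> with a norm-preserving \<open>A\<close> and a Gaussian
  increment \<open>\<xi>\<close>, independent of the past, whose covariance is at most \<open>\<epsilon> h a\<close>, where \<open>a = \<parallel>\<Phi>\<parallel>\<^sub>c\<^sup>2\<close>, and whose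
  trace is of order \<open>\<epsilon> h\<close>. So the nonlinearity is invisible to the mass, and Gaussian integration gives,
  step by step,
  \<open>E exp (- \<parallel>v\<parallel>\<^sup>2 / \<rho>) \<le> exp (- \<parallel>v\<^sub>0\<parallel>\<^sup>2 / (\<rho> + 2 \<epsilon> a T))\<close> and, for \<open>v\<^sub>0 = 0\<close>,
  \<open>E exp (\<parallel>v\<parallel>\<^sup>2 / (8 \<epsilon> a T)) \<le> C\<close> with \<open>C\<close> independent of \<open>\<epsilon>\<close>. Paths of the mild solution are bounded in
  \<open>H\<^sup>1\<close>, hence bounded functions, so the cubic term may be truncated pathwise and the scheme converges to
  the solution along a fast sequence of grids; Fatou's lemma transfers both bounds to \<open>u(T)\<close>.
  Chernoff's inequality yields the first exponent, and, with \<open>\<rho> = \<epsilon> r\<close> optimised over \<open>r\<close>, the exponent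
  \<open>2 (1 - \<surd>(1 - \<gamma>))\<^sup>2 / (a T)\<close>, which is at least the second one claimed.\<close>

section \<open>Smooth bump functions\<close>

text \<open>Formally both bounds come from Ito's formula for the mass, but a mild solution takes
  values outside the domain of the Laplacian. The scheme is a finite recursion in finitely many
  Gaussian variables, and its bounds are uniform in the grid, the number of modes and the truncation
  level. Isometry and complex linearity of the group are not part of its definition; both come from
  skew symmetry of the generator, which rests on integration by parts for weak derivatives, hence on
  du Bois-Reymond's lemma with explicit smooth bumps.

  The two exponential moments differ in quality. For the negative one the parameter
  \<open>\<rho>\<close> moves by twice the variance bound per step. For the positive one the trace
  of the infinite-dimensional noise must be kept out of the exponent: each step then costs
  \<open>4 * \<epsilon> * a * h\<close>, and a reserve of \<open>4 * \<epsilon> * a * T\<close>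
  makes the trace a mere factor independent of \<epsilon>. The sum is the constant \<open>8\<close>,
  which is exactly what the first exponent allows when the threshold is
  \<open>4 * (1 - \<gamma>)\<close>.\<close>

definition bump_term :: "real \<Rightarrow> real \<Rightarrow> real \<Rightarrow> nat \<Rightarrow> nat \<Rightarrow> real \<Rightarrow> real" where
  "bump_term m a b k l x =
     (if a < x \<and> x < b
      then (1 / (x - a)) ^ k * (1 / (b - x)) ^ l * exp (- (1 / (x - a) + 1 / (b - x)) / m) else 0)"

text \<open>Only the \<open>k\<close>-th term of the series of \<open>exp (y / m)\<close> is
  kept.\<close>

lemma power_exp_bound:
  fixes y m :: real
  assumes "0 \<le> y" "0 < m"
  shows "y ^ k * exp (- y / m) \<le> m ^ k * fact k"
proof -
  have "(y / m) ^ k / fact k \<le> exp (y / m)"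
  proof -
    have s: "(\<lambda>n. (y / m) ^ n /\<^sub>R fact n) sums exp (y / m)"
      by (rule exp_converges)
    have "(\<Sum>n\<in>{k}. (y / m) ^ n /\<^sub>R fact n) \<le> (\<Sum>n. (y / m) ^ n /\<^sub>R fact n)"
      using assms s by (intro sum_le_suminf) (auto simp: sums_iff)
    then show ?thesis using s by (simp add: sums_iff field_simps)
  qed
  then have "(y / m) ^ k \<le> exp (y / m) * fact k"
    by (simp only: pos_divide_le_eq fact_gt_zero)
  then have "y ^ k \<le> m ^ k * (exp (y / m) * fact k)"
    using assms by (simp add: power_divide field_simps)
  then have "y ^ k * exp (- y / m) \<le> m ^ k * (exp (y / m) * fact k) * exp (- y / m)"
    by (intro mult_right_mono) auto
  also have "\<dots> = m ^ k * fact k"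
    by (simp add: exp_minus field_simps)
  finally show ?thesis .
qed

text \<open>The exponential beats every power, so two spare factors \<open>1 / (x - a)\<close> or
  \<open>1 / (b - x)\<close> can be paid for. Quadratic decay makes the derivative at the end point
  exist and vanish.\<close>

lemma bump_term_bound:
  assumes "0 < m"
  shows "\<bar>bump_term m a b k l x\<bar> \<le> (m ^ (k + 2) * fact (k + 2) * (m ^ l * fact l)) * (x - a)\<^sup>2"
    and "\<bar>bump_term m a b k l x\<bar> \<le> (m ^ k * fact k * (m ^ (l + 2) * fact (l + 2))) * (x - b)\<^sup>2"
proof -
  have *: "\<bar>bump_term m a b k l x\<bar> * (1 / (x - a)) ^ i * (1 / (b - x)) ^ j
      \<le> m ^ (k + i) * fact (k + i) * (m ^ (l + j) * fact (l + j))" if x: "a < x" "x < b" for i j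
  proof -
    define y z where "y = 1 / (x - a)" and "z = 1 / (b - x)"
    have yz: "0 \<le> y" "0 \<le> z" using x by (auto simp: y_def z_def)
    have "\<bar>bump_term m a b k l x\<bar> * y ^ i * z ^ j
        = (y ^ (k + i) * exp (- y / m)) * (z ^ (l + j) * exp (- z / m))"
    proof -
      have "exp (- (y + z) / m) = exp (- y / m) * exp (- z / m)"
        by (simp add: exp_add[symmetric] add_divide_distrib diff_divide_distrib)
      then show ?thesis
        using x yz by (simp add: bump_term_def abs_mult power_add flip: y_def z_def)
    qed
    also have "\<dots> \<le> (m ^ (k + i) * fact (k + i)) * (m ^ (l + j) * fact (l + j))"
      using assms yz by (intro mult_mono power_exp_bound) auto
    finally show ?thesis by (simp add: y_def z_def)
  qed
  show "\<bar>bump_term m a b k l x\<bar> \<le> (m ^ (k + 2) * fact (k + 2) * (m ^ l * fact l)) * (x - a)\<^sup>2"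
  proof (cases "a < x \<and> x < b")
    case True
    then show ?thesis using *[of 2 0] by (simp add: power_divide divide_le_eq)
  next
    case False
    have "0 \<le> (m ^ (k + 2) * fact (k + 2) * (m ^ l * fact l)) * (x - a)\<^sup>2"
      using assms by (intro mult_nonneg_nonneg) auto
    then show ?thesis by (simp only: bump_term_def False if_False abs_zero)
  qed
  show "\<bar>bump_term m a b k l x\<bar> \<le> (m ^ k * fact k * (m ^ (l + 2) * fact (l + 2))) * (x - b)\<^sup>2"
  proof (cases "a < x \<and> x < b")
    case True
    then show ?thesis using *[of 0 2] by (simp add: power_divide divide_le_eq power2_commute[of b])
  next
    case False
    have "0 \<le> (m ^ k * fact k * (m ^ (l + 2) * fact (l + 2))) * (x - b)\<^sup>2"
      using assms by (intro mult_nonneg_nonneg) auto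
    then show ?thesis by (simp only: bump_term_def False if_False abs_zero)
  qed
qed

lemma DERIV_zero_if_quadratic:
  fixes f :: "real \<Rightarrow> real"
  assumes "\<And>x. \<bar>f x\<bar> \<le> C * (x - a)\<^sup>2"
  shows "(f has_field_derivative 0) (at a)"
proof -
  have fa: "f a = 0" using assms[of a] by simp
  have "((\<lambda>h. f (a + h) / h) \<longlongrightarrow> 0) (at 0)"
  proof (rule Lim_null_comparison)
    show "\<forall>\<^sub>F h in at 0. norm (f (a + h) / h) \<le> C * \<bar>h\<bar>"
    proof (rule eventually_at_filter[THEN iffD2], rule always_eventually, intro allI impI)
      fix h :: real assume "h \<noteq> 0"
      then have "norm (f (a + h) / h) \<le> (C * h\<^sup>2) / \<bar>h\<bar>"
        using assms[of "a + h"] by (simp add: divide_right_mono)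
      also have "\<dots> = C * \<bar>h\<bar>"
        using \<open>h \<noteq> 0\<close> by (cases "0 \<le> h") (auto simp: power2_eq_square)
      finally show "norm (f (a + h) / h) \<le> C * \<bar>h\<bar>" .
    qed
    have "((\<lambda>h::real. C * \<bar>h\<bar>) \<longlongrightarrow> C * \<bar>0\<bar>) (at 0)" by (intro tendsto_intros)
    then show "((\<lambda>h::real. C * \<bar>h\<bar>) \<longlongrightarrow> 0) (at 0)" by simp
  qed
  then show ?thesis using fa by (simp add: DERIV_def)
qed

text \<open>Differentiation only raises the exponents \<open>k\<close> and \<open>l\<close>, so the
  span of these functions is closed under derivatives and its members are smooth across
  \<open>a\<close> and \<open>b\<close>. The parameter \<open>m\<close> stays free because the
  functions with \<open>k = l = 0\<close> increase to the indicator of the open interval as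
  \<open>m\<close> grows.\<close>

lemma DERIV_bump_term:
  assumes "0 < m" "a < b"
  shows "(bump_term m a b k l has_field_derivative
     (- real k * bump_term m a b (k + 1) l x + real l * bump_term m a b k (l + 1) x
      + (1 / m) * (bump_term m a b (k + 2) l x - bump_term m a b k (l + 2) x))) (at x)"
proof -
  consider "x < a" | "x > b" | "x = a" | "x = b" | "a < x" "x < b" using assms by linarith
  then show ?thesis
  proof cases
    case 1
    then show ?thesis
      using has_field_derivative_transform_within_open[of "\<lambda>_. 0" 0 x "{..<a}" "bump_term m a b k l"]
      by (simp add: bump_term_def)
  next
    case 2
    then show ?thesis
      using has_field_derivative_transform_within_open[of "\<lambda>_. 0" 0 x "{b<..}" "bump_term m a b k l"]
      by (simp add: bump_term_def)
  next
    case 3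
    then have z: "bump_term m a b i j x = 0" for i j by (simp add: bump_term_def)
    show ?thesis
      unfolding z using DERIV_zero_if_quadratic[OF bump_term_bound(1)[OF assms(1), of a b k l]] 3 by simp
  next
    case 4
    then have z: "bump_term m a b i j x = 0" for i j by (simp add: bump_term_def)
    show ?thesis
      unfolding z using DERIV_zero_if_quadratic[OF bump_term_bound(2)[OF assms(1), of a b k l]] 4 by simp
  next
    case 5
    define g where "g = (\<lambda>x. (1 / (x - a)) ^ k * (1 / (b - x)) ^ l * exp (- (1 / (x - a) + 1 / (b - x)) / m))"
    define y z where "y = 1 / (x - a)" and "z = 1 / (b - x)"
    have ne: "x - a \<noteq> 0" "b - x \<noteq> 0" using 5 by auto
    define E where "E = exp (- (y + z) / m)"
    have dy: "((\<lambda>x. 1 / (x - a)) has_field_derivative - y * y) (at x)"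
      using ne by (auto intro!: derivative_eq_intros simp: y_def)
    have dz: "((\<lambda>x. 1 / (b - x)) has_field_derivative z * z) (at x)"
      using ne by (auto intro!: derivative_eq_intros simp: z_def)
    have dyk: "((\<lambda>x. (1 / (x - a)) ^ k) has_field_derivative - real k * y ^ k * y) (at x)"
    proof -
      have "real k * (- y * y * y ^ (k - Suc 0)) = - real k * y ^ k * y"
        by (cases k) (auto simp: algebra_simps)
      then show ?thesis using DERIV_power[OF dy, of k] by (simp only: y_def[symmetric])
    qed
    have dzl: "((\<lambda>x. (1 / (b - x)) ^ l) has_field_derivative real l * z ^ l * z) (at x)"
    proof -
      have "real l * (z * z * z ^ (l - Suc 0)) = real l * z ^ l * z"
        by (cases l) (auto simp: algebra_simps)
      then show ?thesis using DERIV_power[OF dz, of l] by (simp only: z_def[symmetric])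
    qed
    have dE: "((\<lambda>x. exp (- (1 / (x - a) + 1 / (b - x)) / m)) has_field_derivative
        E * (- (- y * y + z * z) / m)) (at x)"
      unfolding E_def y_def z_def
      by (rule DERIV_fun_exp[OF DERIV_cdivide[OF DERIV_minus[OF DERIV_add[OF dy dz]]], unfolded y_def z_def])
    note D = DERIV_mult[OF DERIV_mult[OF dyk dzl] dE]
    have eq: "(- real k * y ^ k * y * z ^ l + real l * z ^ l * z * y ^ k) * E
          + E * (- (- y * y + z * z) / m) * (y ^ k * z ^ l)
       = - real k * (y ^ (k + 1) * z ^ l * E) + real l * (y ^ k * z ^ (l + 1) * E)
         + 1 / m * (y ^ (k + 2) * z ^ l * E - y ^ k * z ^ (l + 2) * E)"
      by (simp add: algebra_simps diff_divide_distrib)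
    have g: "(g has_field_derivative
       (- real k * bump_term m a b (k + 1) l x + real l * bump_term m a b k (l + 1) x
      + (1 / m) * (bump_term m a b (k + 2) l x - bump_term m a b k (l + 2) x))) (at x)"
    proof -
      have "bump_term m a b i j x = y ^ i * z ^ j * E" for i j
        using 5 by (simp only: bump_term_def y_def[symmetric] z_def[symmetric] E_def if_True simp_thms)
      then show ?thesis
        using D unfolding g_def eq[symmetric] y_def[symmetric] z_def[symmetric] E_def[symmetric]
        by (simp only: eq)
    qed
    show ?thesis
      by (rule has_field_derivative_transform_within_open[OF g, of "{a<..<b}"])
        (use 5 in \<open>simp_all only: g_def bump_term_def open_greaterThanLessThan greaterThanLessThan_iff if_True simp_thms\<close>)
  qed
qed

text \<open>Smoothness is obtained from a class of differentiable functions that is closed under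
  differentiation.\<close>

inductive bump_comb :: "(real \<Rightarrow> real) \<Rightarrow> bool" where
  zero: "bump_comb (\<lambda>x. 0)"
| step: "bump_comb f \<Longrightarrow> 0 < m \<Longrightarrow> a < b \<Longrightarrow> bump_comb (\<lambda>x. f x + c * bump_term m a b k l x)"

lemma bump_comb_deriv:
  assumes "bump_comb f"
  shows "\<exists>f'. bump_comb f' \<and> (\<forall>x. (f has_field_derivative f' x) (at x))"
  using assms
proof induction
  case zero
  then show ?case by (auto intro!: exI[of _ "\<lambda>x. 0"] bump_comb.zero)
next
  case (step f m a b c k l)
  then obtain f' where f': "bump_comb f'" "\<And>x. (f has_field_derivative f' x) (at x)" by auto
  let ?T = "bump_term m a b"
  have "bump_comb (\<lambda>x. (((f' x + (- c * real k) * ?T (k + 1) l x) + (c * real l) * ?T k (l + 1) x)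
      + (c / m) * ?T (k + 2) l x) + (- c / m) * ?T k (l + 2) x)"
    by (intro bump_comb.step f'(1) step)
  moreover have "((\<lambda>x. f x + c * ?T k l x) has_field_derivative
    ((((f' x + (- c * real k) * ?T (k + 1) l x) + (c * real l) * ?T k (l + 1) x)
      + (c / m) * ?T (k + 2) l x) + (- c / m) * ?T k (l + 2) x)) (at x)" for x
    by (rule derivative_eq_intros f'(2) DERIV_bump_term step refl)+ (simp add: algebra_simps diff_divide_distrib)
  ultimately show ?case by blast
qed

lemma bump_comb_funpow_deriv: "bump_comb f \<Longrightarrow> bump_comb ((deriv ^^ n) f)"
proof (induction n)
  case (Suc n)
  then obtain f' where f': "bump_comb f'" "\<And>x. ((deriv ^^ n) f has_field_derivative f' x) (at x)"
    using bump_comb_deriv by blast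
  then have "(deriv ^^ Suc n) f = f'" by (auto simp: fun_eq_iff DERIV_imp_deriv)
  then show ?case using f' by simp
qed simp

lemma bump_comb_differentiable: "bump_comb f \<Longrightarrow> f differentiable_on UNIV"
  using bump_comb_deriv real_differentiable_def by (fastforce simp: differentiable_on_def)

lemma bump_comb_bounded: "bump_comb f \<Longrightarrow> \<exists>R>0. \<forall>x. \<bar>x\<bar> \<ge> R \<longrightarrow> f x = 0"
proof (induction rule: bump_comb.induct)
  case zero
  then show ?case by (auto intro: exI[of _ 1])
next
  case (step f m a b c k l)
  then obtain R where R: "R > 0" "\<forall>x. \<bar>x\<bar> \<ge> R \<longrightarrow> f x = 0" by auto
  show ?case
    by (rule exI[of _ "max R (max \<bar>a\<bar> \<bar>b\<bar>)"]) (use R in \<open>auto simp: bump_term_def\<close>)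
qed

lemma bump_comb_continuous: "bump_comb f \<Longrightarrow> continuous_on UNIV f"
  using bump_comb_differentiable differentiable_imp_continuous_on by blast

text \<open>Weak derivatives are tested with derivatives of test functions. A vanishing total
  integral makes the primitive vanish again to the right of the support.\<close>

lemma bump_comb_primitive:
  assumes f: "bump_comb f" and R: "\<And>x. \<bar>x\<bar> \<ge> R \<Longrightarrow> f x = 0" and I: "(\<integral>x. f x \<partial>lborel) = 0"
  shows "\<exists>\<phi>. test_function \<phi> \<and> deriv \<phi> = f"
proof -
  \<comment> \<open>Starting at \<open>- R - 1\<close> instead of \<open>- R\<close> leaves a
    margin: the indefinite integral is only one-sided at its lower end, but there
    \<open>\<phi>\<close> is zero in a whole neighbourhood.\<close>
  define \<phi> where "\<phi> = (\<lambda>x. integral {- R - 1..x} f)"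
  have cf: "continuous_on S f" for S
    using bump_comb_continuous[OF f] continuous_on_subset by blast
  have D: "(\<phi> has_field_derivative f x) (at x)" for x
  proof (cases "x \<ge> - R - 1/2")
    case True
    have "((\<lambda>u. integral {- R - 1..u} f) has_vector_derivative f x) (at x within {- R - 1..x + 1})"
      using True by (intro integral_has_vector_derivative cf) auto
    then have "(\<phi> has_field_derivative f x) (at x within {- R - 1<..<x + 1})"
      unfolding \<phi>_def has_real_derivative_iff_has_vector_derivative[symmetric]
      by (rule DERIV_subset) auto
    then show ?thesis
      using True by (subst (asm) at_within_open) auto
  next
    case False
    have "\<phi> u = 0" if "u < - R" for u
    proof -
      have "\<phi> u = integral {- R - 1..u} (\<lambda>x. 0)"
        unfolding \<phi>_def using that by (intro integral_cong R) auto
      then show ?thesis by simp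
    qed
    then have "(\<phi> has_field_derivative 0) (at x)"
      using False
      by (intro has_field_derivative_transform_within_open[of "\<lambda>x. 0" 0 x "{..< - R}" \<phi>]) auto
    then show ?thesis using R[of x] False by simp
  qed
  have dphi: "deriv \<phi> = f" using D by (auto simp: fun_eq_iff DERIV_imp_deriv)
  have "(deriv ^^ n) \<phi> differentiable_on UNIV" for n
  proof (cases n)
    case 0
    then show ?thesis using D real_differentiable_def by (fastforce simp: differentiable_on_def)
  next
    case (Suc k)
    then have "(deriv ^^ n) \<phi> = (deriv ^^ k) f"
      using dphi by (simp add: funpow_swap1)
    then show ?thesis using bump_comb_differentiable[OF bump_comb_funpow_deriv[OF f]] by simp
  qed
  moreover have "\<phi> x = 0" if "x \<notin> {- R - 1..R + 1}" for x
  proof (cases "x < - R - 1")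
    case False
    then have "x > R + 1" using that by auto
    have "set_integrable lborel {- R - 1..x} f"
      by (intro borel_integrable_atLeastAtMost' cf)
    then have "\<phi> x = (LINT y:{- R - 1..x}|lborel. f y)"
      unfolding \<phi>_def by (rule set_borel_integral_eq_integral(2)[symmetric])
    also have "\<dots> = (\<integral>x. f x \<partial>lborel)"
      unfolding set_lebesgue_integral_def
    proof (intro Bochner_Integration.integral_cong refl)
      fix y show "indicat_real {- R - 1..x} y *\<^sub>R f y = f y"
        using R[of y] \<open>x > R + 1\<close> by (cases "\<bar>y\<bar> \<ge> R") (auto simp: indicator_def)
    qed
    finally show ?thesis using I by simp
  qed (simp add: \<phi>_def)
  then have "{x. \<phi> x \<noteq> 0} \<subseteq> {- R - 1..R + 1}" by blast
  then have "bounded {x. \<phi> x \<noteq> 0}" using bounded_closed_interval bounded_subset by blast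
  ultimately show ?thesis using dphi by (auto simp: test_function_def)
qed

section \<open>Completeness of \<open>L\<^sup>2\<close> and pointwise maps\<close>

lemma sq_integrable_l2_fun: "sq_integrable (l2_fun u)"
  using Quotient_rep_reflp[OF Quotient_l2, of u] by (simp add: ae_eq_def)

lemma l2_fun_measurable [measurable]: "l2_fun u \<in> borel_measurable borel"
  using sq_integrable_l2_fun[of u] by (simp add: sq_integrable_def)

lemma l2_fun_l2_of: "sq_integrable f \<Longrightarrow> AE x in lborel. l2_fun (l2_of f) x = f x"
  using Quotient_rep_abs[OF Quotient_l2, of f] by (simp add: ae_eq_def l2_of_def)

lemma l2_of_l2_fun: "l2_of (l2_fun u) = u"
  by (simp add: l2_of_def sq_integrable_l2_fun Quotient_abs_rep[OF Quotient_l2])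

lemma l2_of_cong:
  assumes "sq_integrable f" "g \<in> borel_measurable borel" "AE x in lborel. g x = f x"
  shows "sq_integrable g" "l2_of g = l2_of f"
proof -
  have [measurable]: "f \<in> borel_measurable lborel" using assms(1) by (simp add: sq_integrable_def)
  have "integrable lborel (\<lambda>x. (cmod (g x))\<^sup>2) \<longleftrightarrow> integrable lborel (\<lambda>x. (cmod (f x))\<^sup>2)"
    using assms by (intro integrable_cong_AE) auto
  then show g: "sq_integrable g" using assms by (simp add: sq_integrable_def)
  have "ae_eq g f" using assms g by (simp add: ae_eq_def)
  then have "l2_abs g = l2_abs f"
    using Quotient_rel[OF Quotient_l2, of g f] by blast
  then show "l2_of g = l2_of f" using assms g by (simp add: l2_of_def)
qed

lemma l2_eqI: "(AE x in lborel. l2_fun u x = l2_fun v x) \<Longrightarrow> u = v"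
  using l2_of_cong(2)[OF sq_integrable_l2_fun l2_fun_measurable, of u v] by (simp add: l2_of_l2_fun)

lemma l2_of_plus: "sq_integrable f \<Longrightarrow> sq_integrable g \<Longrightarrow> l2_of f + l2_of g = l2_of (\<lambda>x. f x + g x)"
  by (simp add: l2_of_def sq_integrable_add plus_l2.abs_eq ae_eq_def)

lemma l2_of_minus: "sq_integrable f \<Longrightarrow> sq_integrable g \<Longrightarrow> l2_of f - l2_of g = l2_of (\<lambda>x. f x - g x)"
  by (simp add: l2_of_def sq_integrable_diff minus_l2.abs_eq ae_eq_def)

lemma l2_of_scaleR: "sq_integrable f \<Longrightarrow> r *\<^sub>R l2_of f = l2_of (\<lambda>x. r *\<^sub>R f x)"
  by (simp add: l2_of_def sq_integrable_scaleR scaleR_l2.abs_eq ae_eq_def)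

lemma l2_of_cscale: "sq_integrable f \<Longrightarrow> cscale c (l2_of f) = l2_of (\<lambda>x. c * f x)"
  by (simp add: l2_of_def sq_integrable_mult cscale.abs_eq ae_eq_def)

lemma l2_fun_plus: "AE x in lborel. l2_fun (u + v) x = l2_fun u x + l2_fun v x"
  using l2_fun_l2_of[OF sq_integrable_add[OF sq_integrable_l2_fun sq_integrable_l2_fun], of u v]
    l2_of_plus[OF sq_integrable_l2_fun sq_integrable_l2_fun, of u v] by (simp add: l2_of_l2_fun)

lemma l2_fun_minus: "AE x in lborel. l2_fun (u - v) x = l2_fun u x - l2_fun v x"
  using l2_fun_l2_of[OF sq_integrable_diff[OF sq_integrable_l2_fun sq_integrable_l2_fun], of u v]
    l2_of_minus[OF sq_integrable_l2_fun sq_integrable_l2_fun, of u v] by (simp add: l2_of_l2_fun)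

lemma l2_fun_scaleR: "AE x in lborel. l2_fun (r *\<^sub>R u) x = r *\<^sub>R l2_fun u x"
  using l2_fun_l2_of[OF sq_integrable_scaleR[OF sq_integrable_l2_fun], of r u]
    l2_of_scaleR[OF sq_integrable_l2_fun, of r u] by (simp add: l2_of_l2_fun)

lemma l2_fun_cscale: "AE x in lborel. l2_fun (cscale c u) x = c * l2_fun u x"
  using l2_fun_l2_of[OF sq_integrable_mult[OF sq_integrable_l2_fun], of c u]
    l2_of_cscale[OF sq_integrable_l2_fun, of c u] by (simp add: l2_of_l2_fun)

lemma norm_l2_sq: "(norm (u::l2))\<^sup>2 = (\<integral>x. (cmod (l2_fun u x))\<^sup>2 \<partial>lborel)"
  by (simp add: power2_norm_eq_inner inner_l2.rep_eq l2_self_inner)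

lemma norm_l2_of_sq: "sq_integrable f \<Longrightarrow> (norm (l2_of f))\<^sup>2 = (\<integral>x. (cmod (f x))\<^sup>2 \<partial>lborel)"
  unfolding norm_l2_sq
  by (rule integral_cong_AE) (use l2_fun_l2_of[of f] in \<open>auto elim: eventually_mono simp: sq_integrable_def\<close>)

lemma integrable_l2_fun_sq: "integrable lborel (\<lambda>x. (cmod (l2_fun u x))\<^sup>2)"
  using sq_integrable_l2_fun[of u] by (simp add: sq_integrable_def)

lemma norm_l2_le_AE:
  assumes "AE x in lborel. cmod (l2_fun u x) \<le> K * cmod (l2_fun v x)" "0 \<le> K"
  shows "norm u \<le> K * norm v"
proof -
  have "(norm u)\<^sup>2 \<le> (\<integral>x. K\<^sup>2 * (cmod (l2_fun v x))\<^sup>2 \<partial>lborel)"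
    unfolding norm_l2_sq
  proof (rule integral_mono_AE)
    show "AE x in lborel. (cmod (l2_fun u x))\<^sup>2 \<le> K\<^sup>2 * (cmod (l2_fun v x))\<^sup>2"
      using assms(1) by eventually_elim (metis norm_ge_zero power_mono power_mult_distrib)
  qed (auto intro: integrable_l2_fun_sq)
  also have "\<dots> = (K * norm v)\<^sup>2" by (simp add: norm_l2_sq power_mult_distrib)
  finally show ?thesis using assms(2) by (simp add: power2_le_iff_abs_le)
qed

lemma cscale_add: "cscale c (u + v) = cscale c u + cscale c v"
  by (rule l2_eqI)
    (use l2_fun_cscale[of c "u + v"] l2_fun_plus[of u v] l2_fun_plus[of "cscale c u" "cscale c v"]
      l2_fun_cscale[of c u] l2_fun_cscale[of c v] in \<open>eventually_elim; simp add: distrib_left\<close>)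

lemma cscale_diff: "cscale c (u - v) = cscale c u - cscale c v"
  by (rule l2_eqI)
    (use l2_fun_cscale[of c "u - v"] l2_fun_minus[of u v] l2_fun_minus[of "cscale c u" "cscale c v"]
      l2_fun_cscale[of c u] l2_fun_cscale[of c v] in \<open>eventually_elim; simp add: right_diff_distrib\<close>)

lemma cscale_scaleR: "cscale c (r *\<^sub>R u) = r *\<^sub>R cscale c u"
  by (rule l2_eqI)
    (use l2_fun_cscale[of c "r *\<^sub>R u"] l2_fun_scaleR[of r u] l2_fun_scaleR[of r "cscale c u"]
      l2_fun_cscale[of c u] in \<open>eventually_elim; simp\<close>)

lemma cscale_cscale: "cscale c (cscale d u) = cscale (c * d) u"
  by (rule l2_eqI)
    (use l2_fun_cscale[of c "cscale d u"] l2_fun_cscale[of d u] l2_fun_cscale[of "c * d" u]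
      in \<open>eventually_elim; simp\<close>)

lemma cscale_one: "cscale 1 u = u"
  by (rule l2_eqI) (use l2_fun_cscale[of 1 u] in \<open>eventually_elim; simp\<close>)

lemma cscale_minus_one: "cscale (-1) u = - u"
proof -
  have "cscale (-1) u = (-1) *\<^sub>R u"
    by (rule l2_eqI) (use l2_fun_cscale[of "-1" u] l2_fun_scaleR[of "-1" u] in \<open>eventually_elim; simp\<close>)
  then show ?thesis by simp
qed

lemma norm_cscale: "norm (cscale c u) = cmod c * norm u"
proof -
  have le: "norm (cscale c u) \<le> cmod c * norm u" for c u
    by (rule norm_l2_le_AE) (use l2_fun_cscale[of c u] in \<open>eventually_elim; simp add: norm_mult\<close>, simp)
  show ?thesis
  proof (cases "c = 0")
    case True
    then show ?thesis using le[of c u] by simp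
  next
    case False
    have "cmod c * norm u = cmod c * norm (cscale (inverse c) (cscale c u))"
      using False by (simp add: cscale_cscale cscale_one)
    also have "\<dots> \<le> cmod c * (cmod (inverse c) * norm (cscale c u))"
      by (intro mult_left_mono le) simp
    also have "\<dots> = norm (cscale c u)" using False by (simp add: norm_inverse)
    finally show ?thesis using le[of c u] by simp
  qed
qed

lemma bounded_linear_cscale: "bounded_linear (cscale c)"
  by (rule bounded_linear_intro[of _ "cmod c"]) (simp_all add: cscale_add cscale_scaleR norm_cscale mult.commute)

section \<open>Superposition operators\<close>

lemma sq_integrable_comp:
  assumes "g \<in> borel_measurable borel" "\<And>z. cmod (g z) \<le> K * cmod z" "sq_integrable f"
  shows "sq_integrable (\<lambda>x. g (f x))"
proof -
  have [measurable]: "g \<in> borel_measurable borel" "f \<in> borel_measurable borel"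
    using assms by (auto simp: sq_integrable_def)
  have "integrable lborel (\<lambda>x. (cmod (g (f x)))\<^sup>2)"
  proof (rule Bochner_Integration.integrable_bound)
    show "integrable lborel (\<lambda>x. K\<^sup>2 * (cmod (f x))\<^sup>2)"
      using assms(3) by (simp add: sq_integrable_def)
    show "AE x in lborel. norm ((cmod (g (f x)))\<^sup>2) \<le> norm (K\<^sup>2 * (cmod (f x))\<^sup>2)"
    proof (rule AE_I2)
      fix x show "norm ((cmod (g (f x)))\<^sup>2) \<le> norm (K\<^sup>2 * (cmod (f x))\<^sup>2)"
        using power_mono[OF assms(2), of "f x" 2] by (simp add: power_mult_distrib)
    qed
  qed measurable
  then show ?thesis by (simp add: sq_integrable_def)
qed

text \<open>The superposition (Nemytskii) operator of \<open>g\<close>. It is meaningful for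
  \<open>g\<close> of linear growth; otherwise \<open>l2_of\<close> may return its default value
  \<open>0\<close>.\<close>

definition pmap :: "(complex \<Rightarrow> complex) \<Rightarrow> l2 \<Rightarrow> l2" where
  "pmap g u = l2_of (\<lambda>x. g (l2_fun u x))"

lemma l2_fun_pmap:
  assumes "g \<in> borel_measurable borel" "\<And>z. cmod (g z) \<le> K * cmod z"
  shows "AE x in lborel. l2_fun (pmap g u) x = g (l2_fun u x)"
  unfolding pmap_def by (intro l2_fun_l2_of sq_integrable_comp[OF assms] sq_integrable_l2_fun)

lemma norm_pmap_eq:
  assumes "g \<in> borel_measurable borel" "\<And>z. cmod (g z) = cmod z"
  shows "norm (pmap g u) = norm u"
proof -
  note A = l2_fun_pmap[OF assms(1), of 1 u]
  have "norm (pmap g u) \<le> 1 * norm u" "norm u \<le> 1 * norm (pmap g u)"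
    by (rule norm_l2_le_AE; use A in \<open>auto elim: eventually_mono simp: assms(2)\<close>)+
  then show ?thesis by simp
qed

lemma pmap_lipschitz:
  assumes "g \<in> borel_measurable borel" "\<And>z w. cmod (g z - g w) \<le> K * cmod (z - w)" "g 0 = 0" "0 \<le> K"
  shows "norm (pmap g u - pmap g v) \<le> K * norm (u - v)"
proof (rule norm_l2_le_AE)
  have g0: "cmod (g z) \<le> K * cmod z" for z using assms(2)[of z 0] assms(3) by simp
  show "AE x in lborel. cmod (l2_fun (pmap g u - pmap g v) x) \<le> K * cmod (l2_fun (u - v) x)"
    using l2_fun_minus[of u v] l2_fun_minus[of "pmap g u" "pmap g v"]
      l2_fun_pmap[OF assms(1) g0, of u] l2_fun_pmap[OF assms(1) g0, of v]
    by eventually_elim (simp add: assms(2))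
qed fact

text \<open>Riesz-Fischer: a fast subsequence converges almost everywhere, and Fatou's lemma shows
  that the pointwise limit is the limit in norm. Completeness makes continuous
  \<open>l2\<close>-valued functions integrable, as the mild equation requires.\<close>

instance l2 :: banach
proof
  fix X :: "nat \<Rightarrow> l2" assume X: "Cauchy X"
  have "\<exists>r. strict_mono r \<and> (\<forall>k. norm (X (r (Suc k)) - X (r k)) < (1/2) ^ k)"
  proof -
    have "\<exists>N. \<forall>m\<ge>N. \<forall>n\<ge>N. norm (X m - X n) < (1/2) ^ k" for k
      using X[unfolded Cauchy_def dist_norm] by simp
    then obtain N where N: "\<And>k m n. m \<ge> N k \<Longrightarrow> n \<ge> N k \<Longrightarrow> norm (X m - X n) < (1/2) ^ k"
      by metis
    define r where "r = rec_nat (N 0) (\<lambda>k m. max (Suc m) (N (Suc k)))"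
    have r: "r 0 = N 0" "r (Suc k) = max (Suc (r k)) (N (Suc k))" for k by (auto simp: r_def)
    have rN: "r k \<ge> N k" for k by (cases k) (auto simp: r)
    have "r (Suc k) \<ge> N k" for k using rN[of k] by (simp add: r)
    then have "strict_mono r" "norm (X (r (Suc k)) - X (r k)) < (1/2) ^ k" for k
      by (auto simp: strict_mono_Suc_iff r intro!: N rN less_max_iff_disj[THEN iffD2])
    then show ?thesis by blast
  qed
  then obtain r where r: "strict_mono r" "\<And>k. norm (X (r (Suc k)) - X (r k)) < (1/2) ^ k" by blast
  define f where "f k = l2_fun (X (r k))" for k
  have [measurable]: "f k \<in> borel_measurable borel" for k by (simp add: f_def)
  have d: "(\<integral>\<^sup>+x. ennreal ((cmod (f m x - f k x))\<^sup>2) \<partial>lborel) = ennreal ((norm (X (r m) - X (r k)))\<^sup>2)" for m k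
  proof -
    have "(\<integral>\<^sup>+x. ennreal ((cmod (f m x - f k x))\<^sup>2) \<partial>lborel)
        = (\<integral>\<^sup>+x. ennreal ((cmod (l2_fun (X (r m) - X (r k)) x))\<^sup>2) \<partial>lborel)"
      by (rule nn_integral_cong_AE)
        (use l2_fun_minus[of "X (r m)" "X (r k)"] in \<open>eventually_elim; simp add: f_def\<close>)
    also have "\<dots> = ennreal ((norm (X (r m) - X (r k)))\<^sup>2)"
      by (simp add: nn_integral_eq_integral integrable_l2_fun_sq norm_l2_sq)
    finally show ?thesis .
  qed
  \<comment> \<open>weighting the increments by \<open>2\<^sup>k\<close> makes the weighted square sum integrable\<close>
  have "(\<integral>\<^sup>+x. (\<Sum>k. ennreal (2 ^ k * (cmod (f (Suc k) x - f k x))\<^sup>2)) \<partial>lborel)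
      = (\<Sum>k. ennreal (2 ^ k * (norm (X (r (Suc k)) - X (r k)))\<^sup>2))"
    by (subst nn_integral_suminf) (simp_all add: ennreal_mult nn_integral_cmult d)
  also have "\<dots> \<le> (\<Sum>k. ennreal ((1/2) ^ k))"
  proof (intro suminf_le ennreal_leI)
    fix k
    have "(norm (X (r (Suc k)) - X (r k)))\<^sup>2 \<le> ((1/2) ^ k)\<^sup>2"
      using r(2)[of k] by (intro power_mono) auto
    then have "2 ^ k * (norm (X (r (Suc k)) - X (r k)))\<^sup>2 \<le> 2 ^ k * ((1/2) ^ k)\<^sup>2" by simp
    also have "\<dots> = (1/2) ^ k" by (simp add: power2_eq_square power_mult_distrib[symmetric])
    finally show "2 ^ k * (norm (X (r (Suc k)) - X (r k)))\<^sup>2 \<le> (1/2) ^ k" .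
  qed auto
  also have "\<dots> < \<infinity>"
    by (subst suminf_ennreal2) (auto intro: summable_geometric)
  finally have "AE x in lborel. (\<Sum>k. ennreal (2 ^ k * (cmod (f (Suc k) x - f k x))\<^sup>2)) \<noteq> \<infinity>"
    by (intro nn_integral_PInf_AE) (auto simp: less_top)
  then have conv: "AE x in lborel. convergent (\<lambda>k. f k x)"
  proof eventually_elim
    case (elim x)
    define a where "a k = cmod (f (Suc k) x - f k x)" for k
    have s: "summable (\<lambda>k. 2 ^ k * (a k)\<^sup>2)"
      using elim by (intro summable_suminf_not_top) (auto simp: a_def)
    have "summable a"
    proof (rule summable_comparison_test)
      show "summable (\<lambda>k. (1/2) ^ k + 2 ^ k * (a k)\<^sup>2)"
        by (intro summable_add s summable_geometric) simp
      \<comment> \<open>Either \<open>a k\<close> is below the geometric bound, or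
        \<open>2 ^ k * a k\<close> is at least \<open>1\<close>, and one more factor
        \<open>a k\<close> gives the quadratic term.\<close>
      have "a k \<le> (1/2) ^ k + 2 ^ k * (a k)\<^sup>2" for k
      proof (cases "a k \<le> (1/2) ^ k")
        case True
        have "0 \<le> 2 ^ k * (a k)\<^sup>2" by simp
        then show ?thesis using True by linarith
      next
        case False
        then have "1 \<le> 2 ^ k * a k" by (simp add: power_divide field_simps)
        then have "1 * a k \<le> 2 ^ k * a k * a k" by (intro mult_right_mono) (auto simp: a_def)
        moreover have "0 \<le> (1/2::real) ^ k" by simp
        ultimately show ?thesis unfolding power2_eq_square mult.assoc mult_1 by linarith
      qed
      then show "\<exists>N. \<forall>n\<ge>N. norm (a n) \<le> (1/2) ^ n + 2 ^ n * (a n)\<^sup>2"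
        by (auto simp: a_def)
    qed
    then have "summable (\<lambda>k. f (Suc k) x - f k x)"
      unfolding a_def by (rule summable_norm_cancel)
    then obtain L where "(\<lambda>n. \<Sum>k<n. f (Suc k) x - f k x) \<longlonglongrightarrow> L"
      by (auto simp: summable_def sums_def)
    then have "(\<lambda>n. f n x - f 0 x) \<longlonglongrightarrow> L" by (simp only: sum_lessThan_telescope[of "\<lambda>k. f k x"])
    then have "(\<lambda>n. f n x - f 0 x + f 0 x) \<longlonglongrightarrow> L + f 0 x" by (intro tendsto_intros)
    then show "convergent (\<lambda>k. f k x)" by (auto simp: convergent_def)
  qed
  define g where "g x = lim (\<lambda>k. f k x)" for x
  have [measurable]: "g \<in> borel_measurable borel" unfolding g_def by measurable
  have lim: "AE x in lborel. (\<lambda>k. f k x) \<longlonglongrightarrow> g x"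
    using conv by eventually_elim (simp add: g_def convergent_LIMSEQ_iff)
  \<comment> \<open>Fatou's lemma passes the Cauchy estimate between two members of the subsequence
    to the pointwise limit.\<close>
  have B: "(\<integral>\<^sup>+x. ennreal ((cmod (g x - f k x))\<^sup>2) \<partial>lborel) \<le> ennreal e"
    if "\<And>m. m \<ge> k \<Longrightarrow> (norm (X (r m) - X (r k)))\<^sup>2 \<le> e" for k e
  proof -
    have "(\<integral>\<^sup>+x. ennreal ((cmod (g x - f k x))\<^sup>2) \<partial>lborel)
        = (\<integral>\<^sup>+x. liminf (\<lambda>m. ennreal ((cmod (f m x - f k x))\<^sup>2)) \<partial>lborel)"
    proof (rule nn_integral_cong_AE, use lim in eventually_elim)
      case (elim x)
      have "(\<lambda>m. ennreal ((cmod (f m x - f k x))\<^sup>2)) \<longlonglongrightarrow> ennreal ((cmod (g x - f k x))\<^sup>2)"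
        by (intro tendsto_intros elim)
      then show ?case by (rule lim_imp_Liminf[OF sequentially_bot, symmetric])
    qed
    also have "\<dots> \<le> liminf (\<lambda>m. \<integral>\<^sup>+x. ennreal ((cmod (f m x - f k x))\<^sup>2) \<partial>lborel)"
      by (intro nn_integral_liminf) measurable
    also have "\<dots> \<le> ennreal e"
      unfolding d by (rule Liminf_le)
        (use that in \<open>auto simp: eventually_sequentially intro!: exI[of _ k] ennreal_leI\<close>)
    finally show ?thesis .
  qed
  have ex: "\<exists>K. \<forall>k\<ge>K. (\<forall>m\<ge>k. (norm (X (r m) - X (r k)))\<^sup>2 \<le> e\<^sup>2)" if "e > 0" for e
  proof -
    obtain K where K: "\<And>m n. m \<ge> K \<Longrightarrow> n \<ge> K \<Longrightarrow> norm (X m - X n) < e"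
      using X \<open>e > 0\<close> unfolding Cauchy_def dist_norm by blast
    have "r k \<ge> k" for k by (rule seq_suble[OF r(1)])
    then have "norm (X (r m) - X (r k)) < e" if "m \<ge> k" "k \<ge> K" for m k
      using that by (meson K le_trans)
    then show ?thesis by (intro exI[of _ K]) (auto intro!: power_mono[OF less_imp_le] simp del: power_mono_iff power_strict_mono)
  qed
  \<comment> \<open>The radius \<open>1\<close> only serves to show that \<open>g\<close> differs
    from one \<open>f K\<close> by a square-integrable function.\<close>
  obtain K where "\<And>m. m \<ge> K \<Longrightarrow> (norm (X (r m) - X (r K)))\<^sup>2 \<le> 1\<^sup>2" using ex[of 1] by auto
  then have "(\<integral>\<^sup>+x. ennreal ((cmod (g x - f K x))\<^sup>2) \<partial>lborel) \<le> ennreal 1"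
    using B[of K 1] by simp
  then have "(\<integral>\<^sup>+x. ennreal ((cmod (g x - f K x))\<^sup>2) \<partial>lborel) < \<infinity>"
    by (rule order.strict_trans1) simp
  then have "sq_integrable (\<lambda>x. g x - f K x)"
    by (simp add: sq_integrable_def integrable_iff_bounded)
  then have "sq_integrable (\<lambda>x. (g x - f K x) + f K x)"
    by (rule sq_integrable_add) (simp add: f_def sq_integrable_l2_fun)
  then have g: "sq_integrable g" by simp
  have n: "ennreal ((norm (l2_of g - X (r k)))\<^sup>2) = (\<integral>\<^sup>+x. ennreal ((cmod (g x - f k x))\<^sup>2) \<partial>lborel)" for k
  proof -
    have s: "sq_integrable (\<lambda>x. g x - f k x)"
      using sq_integrable_diff[OF g sq_integrable_l2_fun, of "X (r k)"] by (simp add: f_def)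
    have "l2_of g - X (r k) = l2_of (\<lambda>x. g x - f k x)"
      using l2_of_minus[OF g sq_integrable_l2_fun, of "X (r k)"] by (simp add: l2_of_l2_fun f_def)
    then show ?thesis using s
      by (simp add: norm_l2_of_sq nn_integral_eq_integral sq_integrable_def)
  qed
  have "(\<lambda>k. X (r k)) \<longlonglongrightarrow> l2_of g"
  proof (rule LIMSEQ_I)
    fix e :: real assume "e > 0"
    then obtain K where K: "\<And>k m. k \<ge> K \<Longrightarrow> m \<ge> k \<Longrightarrow> (norm (X (r m) - X (r k)))\<^sup>2 \<le> (e/2)\<^sup>2"
      using ex[of "e/2"] by auto
    have "norm (X (r k) - l2_of g) < e" if "k \<ge> K" for k
    proof -
      have "ennreal ((norm (l2_of g - X (r k)))\<^sup>2) \<le> ennreal ((e/2)\<^sup>2)"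
        unfolding n by (rule B) (use K that in auto)
      then have "norm (l2_of g - X (r k)) \<le> e/2"
        using \<open>e > 0\<close> by (simp add: power2_le_iff_abs_le)
      then show ?thesis using \<open>e > 0\<close> by (simp add: norm_minus_commute)
    qed
    then show "\<exists>no. \<forall>n\<ge>no. norm (X (r n) - l2_of g) < e" by blast
  qed
  then have "X \<longlonglongrightarrow> l2_of g" by (rule Cauchy_converges_subseq[OF X r(1), unfolded comp_def])
  then show "convergent X" by (auto simp: convergent_def)
qed

section \<open>Weak derivatives and absolute continuity\<close>

text \<open>Fubini's theorem on the plane cut along its diagonal. The diagonal belongs to the first
  half; in the second half open and closed rays differ by a null set.\<close>

lemma integral_mult_split:
  fixes f g :: "real \<Rightarrow> complex"
  assumes f: "integrable lborel f" and g: "integrable lborel g"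
  shows "(\<integral>x. f x \<partial>lborel) * (\<integral>y. g y \<partial>lborel)
    = (\<integral>x. f x * (\<integral>y. indicator {..x} y *\<^sub>R g y \<partial>lborel) \<partial>lborel)
      + (\<integral>y. g y * (\<integral>x. indicator {..y} x *\<^sub>R f x \<partial>lborel) \<partial>lborel)"
proof -
  have [measurable]: "f \<in> borel_measurable borel" "g \<in> borel_measurable borel"
    using f g by auto
  have P: "integrable (lborel \<Otimes>\<^sub>M lborel) (\<lambda>(x, y). f x * g y)"
  proof (rule lborel_pair.Fubini_integrable)
    show "integrable lborel (\<lambda>x. \<integral>y. norm (case (x, y) of (x, y) \<Rightarrow> f x * g y) \<partial>lborel)"
      using f g by (simp add: norm_mult integrable_norm)
    show "AE x in lborel. integrable lborel (\<lambda>y. case (x, y) of (x, y) \<Rightarrow> f x * g y)"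
      using g by simp
  qed measurable
  have P1: "integrable (lborel \<Otimes>\<^sub>M lborel) (\<lambda>(x, y). indicat_real {..x} y *\<^sub>R (f x * g y))"
    by (rule Bochner_Integration.integrable_bound[OF P])
      (auto simp: indicator_def norm_mult split_beta')
  have P2: "integrable (lborel \<Otimes>\<^sub>M lborel) (\<lambda>(x, y). indicat_real {..<y} x *\<^sub>R (f x * g y))"
    by (rule Bochner_Integration.integrable_bound[OF P])
      (auto simp: indicator_def norm_mult split_beta')
  have "(\<integral>x. f x \<partial>lborel) * (\<integral>y. g y \<partial>lborel) = (\<integral>x. (\<integral>y. f x * g y \<partial>lborel) \<partial>lborel)"
    by simp
  also have "\<dots> = (\<integral>(x, y). f x * g y \<partial>(lborel \<Otimes>\<^sub>M lborel))"
    using P by (rule lborel_pair.integral_fst)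
  also have "\<dots> = (\<integral>z. (case z of (x, y) \<Rightarrow> indicat_real {..x} y *\<^sub>R (f x * g y))
      + (case z of (x, y) \<Rightarrow> indicat_real {..<y} x *\<^sub>R (f x * g y)) \<partial>(lborel \<Otimes>\<^sub>M lborel))"
    by (intro Bochner_Integration.integral_cong) (auto simp: indicator_def)
  also have "\<dots> = (\<integral>(x, y). indicat_real {..x} y *\<^sub>R (f x * g y) \<partial>(lborel \<Otimes>\<^sub>M lborel))
      + (\<integral>(x, y). indicat_real {..<y} x *\<^sub>R (f x * g y) \<partial>(lborel \<Otimes>\<^sub>M lborel))"
    using P1 P2 by (rule Bochner_Integration.integral_add)
  also have "(\<integral>(x, y). indicat_real {..x} y *\<^sub>R (f x * g y) \<partial>(lborel \<Otimes>\<^sub>M lborel))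
      = (\<integral>x. (\<integral>y. indicat_real {..x} y *\<^sub>R (f x * g y) \<partial>lborel) \<partial>lborel)"
    by (rule lborel_pair.integral_fst[OF P1, symmetric])
  also have "\<dots> = (\<integral>x. f x * (\<integral>y. indicator {..x} y *\<^sub>R g y \<partial>lborel) \<partial>lborel)"
    by (simp flip: mult_scaleR_right)
  also have "(\<integral>(x, y). indicat_real {..<y} x *\<^sub>R (f x * g y) \<partial>(lborel \<Otimes>\<^sub>M lborel))
      = (\<integral>y. (\<integral>x. indicat_real {..<y} x *\<^sub>R (f x * g y) \<partial>lborel) \<partial>lborel)"
    by (rule lborel_pair.integral_snd[OF P2, symmetric])
  also have "\<dots> = (\<integral>y. g y * (\<integral>x. indicator {..y} x *\<^sub>R f x \<partial>lborel) \<partial>lborel)"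
  proof (intro Bochner_Integration.integral_cong refl)
    fix y
    have "(\<integral>x. indicat_real {..<y} x *\<^sub>R (f x * g y) \<partial>lborel)
        = (\<integral>x. g y * (indicat_real {..y} x *\<^sub>R f x) \<partial>lborel)"
    proof (rule integral_cong_AE)
      show "AE x in lborel. indicat_real {..<y} x *\<^sub>R (f x * g y) = g y * (indicat_real {..y} x *\<^sub>R f x)"
        using AE_lborel_singleton[of y] by eventually_elim (auto simp: indicator_def)
    qed measurable
    then show "(\<integral>x. indicat_real {..<y} x *\<^sub>R (f x * g y) \<partial>lborel)
        = g y * (\<integral>x. indicator {..y} x *\<^sub>R f x \<partial>lborel)"
      by (simp only: integral_mult_right_zero)
  qed
  finally show ?thesis .
qed

text \<open>\<open>F\<close> is a locally absolutely continuous primitive of \<open>f\<close>. The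
  fundamental theorem of calculus serves as the definition, so no almost everywhere
  differentiability of \<open>F\<close> is involved.\<close>

definition abs_cont :: "(real \<Rightarrow> complex) \<Rightarrow> (real \<Rightarrow> complex) \<Rightarrow> bool" where
  "abs_cont F f \<longleftrightarrow> (\<forall>a b. set_integrable lborel {a..b} f) \<and>
     (\<forall>a b. a \<le> b \<longrightarrow> F b - F a = (LINT x:{a..b}|lborel. f x))"

lemma abs_cont_continuous:
  assumes "abs_cont F f"
  shows "continuous_on S F"
proof -
  have "isCont F x" for x
  proof -
    have "f integrable_on {x - 1..x + 1}"
      using assms set_borel_integral_eq_integral(1) by (auto simp: abs_cont_def)
    then have "continuous_on {x - 1..x + 1} (\<lambda>y. F (x - 1) + integral {x - 1..y} f)"
      by (intro continuous_intros indefinite_integral_continuous_1)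
    moreover have "F (x - 1) + integral {x - 1..y} f = F y" if "y \<in> {x - 1..x + 1}" for y
      using assms that set_borel_integral_eq_integral(2)[of "{x - 1..y}" f] unfolding abs_cont_def
      by (metis add.commute atLeastAtMost_iff diff_add_cancel)
    ultimately have "continuous_on {x - 1..x + 1} F" by (subst continuous_on_cong[OF refl, of _ F]) auto
    then show ?thesis
      by (rule continuous_on_interior) auto
  qed
  then show ?thesis by (simp add: continuous_at_imp_continuous_on)
qed

lemma abs_cont_measurable: "abs_cont F f \<Longrightarrow> F \<in> borel_measurable borel"
  by (intro borel_measurable_continuous_onI abs_cont_continuous)

lemma abs_cont_mult_integrable:
  assumes "abs_cont F f" "set_integrable lborel {a..b} g"
  shows "set_integrable lborel {a..b} (\<lambda>x. F x * g x)"
proof -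
  have "bounded (F ` {a..b})"
    by (intro compact_imp_bounded compact_continuous_image abs_cont_continuous[OF assms(1)]) simp
  then obtain B where B: "\<And>x. x \<in> {a..b} \<Longrightarrow> norm (F x) \<le> B"
    by (auto simp: bounded_iff simp del: atLeastAtMost_iff)
  have [measurable]: "F \<in> borel_measurable borel" by (rule abs_cont_measurable[OF assms(1)])
  have i: "integrable lborel (\<lambda>x. B *\<^sub>R norm (indicat_real {a..b} x *\<^sub>R g x))"
    using assms(2) unfolding set_integrable_def
    by (intro integrable_scaleR_right Bochner_Integration.integrable_norm)
  have [measurable]: "(\<lambda>x. indicat_real {a..b} x *\<^sub>R g x) \<in> borel_measurable borel"
    using assms(2) unfolding set_integrable_def by auto
  have "integrable lborel (\<lambda>x. F x * (indicat_real {a..b} x *\<^sub>R g x))"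
  proof (rule Bochner_Integration.integrable_bound[OF i])
    show "AE x in lborel. norm (F x * (indicat_real {a..b} x *\<^sub>R g x))
        \<le> norm (B *\<^sub>R norm (indicat_real {a..b} x *\<^sub>R g x))"
    proof (rule AE_I2)
      fix x
      show "norm (F x * (indicat_real {a..b} x *\<^sub>R g x)) \<le> norm (B *\<^sub>R norm (indicat_real {a..b} x *\<^sub>R g x))"
        using mult_right_mono[OF B[of x], of "cmod (g x)"]
        by (auto simp: indicator_def norm_mult intro: order_trans[OF _ abs_ge_self])
    qed
  qed measurable
  then show ?thesis by (simp add: set_integrable_def)
qed

text \<open>The diagonal split is applied to \<open>f\<close> and \<open>g\<close> cut off to
  \<open>[a, b]\<close>; the inner integrals are then \<open>G x - G a\<close> and
  \<open>F x - F a\<close>.\<close>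

lemma abs_cont_parts:
  assumes F: "abs_cont F f" and G: "abs_cont G g" and "a \<le> b"
  shows "F b * G b - F a * G a
    = (LINT x:{a..b}|lborel. G x * f x) + (LINT x:{a..b}|lborel. F x * g x)"
proof -
  have i: "set_integrable lborel {a..b} f" "set_integrable lborel {a..b} g"
    "set_integrable lborel {a..b} (\<lambda>x. G x * f x)" "set_integrable lborel {a..b} (\<lambda>x. F x * g x)"
    using F G abs_cont_mult_integrable[of G g a b f] abs_cont_mult_integrable[of F f a b g]
    unfolding abs_cont_def by blast+
  let ?f = "\<lambda>x. indicator {a..b} x *\<^sub>R f x" and ?g = "\<lambda>x. indicator {a..b} x *\<^sub>R g x"
  have *: "(\<integral>y. indicator {..x} y *\<^sub>R (indicator {a..b} y *\<^sub>R h y) \<partial>lborel) = H x - H a"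
    if "abs_cont H h" "x \<in> {a..b}" for H h and x
  proof -
    have "(\<integral>y. indicator {..x} y *\<^sub>R (indicator {a..b} y *\<^sub>R h y) \<partial>lborel) = (LINT y:{a..x}|lborel. h y)"
      unfolding set_lebesgue_integral_def using that(2)
      by (intro Bochner_Integration.integral_cong) (auto simp: indicator_def)
    then show ?thesis using that by (simp add: abs_cont_def)
  qed
  have t: "(\<integral>x. ?f x \<partial>lborel) = F b - F a" "(\<integral>x. ?g x \<partial>lborel) = G b - G a"
    using F G \<open>a \<le> b\<close> by (simp_all add: abs_cont_def set_lebesgue_integral_def)
  have "(F b - F a) * (G b - G a) = (\<integral>x. ?f x * (G x - G a) \<partial>lborel) + (\<integral>x. ?g x * (F x - F a) \<partial>lborel)"
  proof -
    have "(F b - F a) * (G b - G a)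
      = (\<integral>x. ?f x * (\<integral>y. indicator {..x} y *\<^sub>R ?g y \<partial>lborel) \<partial>lborel)
      + (\<integral>y. ?g y * (\<integral>x. indicator {..y} x *\<^sub>R ?f x \<partial>lborel) \<partial>lborel)"
      unfolding t[symmetric] using i by (intro integral_mult_split) (simp_all add: set_integrable_def)
    also have "(\<integral>x. ?f x * (\<integral>y. indicator {..x} y *\<^sub>R ?g y \<partial>lborel) \<partial>lborel) = (\<integral>x. ?f x * (G x - G a) \<partial>lborel)"
      by (intro Bochner_Integration.integral_cong refl) (use *[OF G] in \<open>auto simp: indicator_def\<close>)
    also have "(\<integral>x. ?g x * (\<integral>y. indicator {..x} y *\<^sub>R ?f y \<partial>lborel) \<partial>lborel) = (\<integral>x. ?g x * (F x - F a) \<partial>lborel)"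
      by (intro Bochner_Integration.integral_cong refl) (use *[OF F] in \<open>auto simp: indicator_def\<close>)
    finally show ?thesis .
  qed
  also have "(\<integral>x. ?f x * (G x - G a) \<partial>lborel) = (LINT x:{a..b}|lborel. G x * f x) - (F b - F a) * G a"
  proof -
    have "(\<integral>x. ?f x * (G x - G a) \<partial>lborel) = (\<integral>x. indicator {a..b} x *\<^sub>R (G x * f x) - ?f x * G a \<partial>lborel)"
      by (intro Bochner_Integration.integral_cong refl) (auto simp: algebra_simps)
    also have "\<dots> = (LINT x:{a..b}|lborel. G x * f x) - (\<integral>x. ?f x * G a \<partial>lborel)"
      unfolding set_lebesgue_integral_def using i
      by (intro Bochner_Integration.integral_diff) (auto simp: set_integrable_def simp del: mult_scaleR_left)
    also have "(\<integral>x. ?f x * G a \<partial>lborel) = (F b - F a) * G a"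
      by (simp only: integral_mult_left_zero t)
    finally show ?thesis .
  qed
  also have "(\<integral>x. ?g x * (F x - F a) \<partial>lborel) = (LINT x:{a..b}|lborel. F x * g x) - (G b - G a) * F a"
  proof -
    have "(\<integral>x. ?g x * (F x - F a) \<partial>lborel) = (\<integral>x. indicator {a..b} x *\<^sub>R (F x * g x) - ?g x * F a \<partial>lborel)"
      by (intro Bochner_Integration.integral_cong refl) (auto simp: algebra_simps)
    also have "\<dots> = (LINT x:{a..b}|lborel. F x * g x) - (\<integral>x. ?g x * F a \<partial>lborel)"
      unfolding set_lebesgue_integral_def using i
      by (intro Bochner_Integration.integral_diff) (auto simp: set_integrable_def simp del: mult_scaleR_left)
    also have "(\<integral>x. ?g x * F a \<partial>lborel) = (G b - G a) * F a"
      by (simp only: integral_mult_left_zero t)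
    finally show ?thesis .
  qed
  finally show ?thesis by (simp add: algebra_simps)
qed

lemma abs_cont_exists:
  assumes "\<And>a b. set_integrable lborel {a..b} f"
  shows "\<exists>F. abs_cont F f"
proof
  let ?F = "\<lambda>x. LBINT y=0..ereal x. f y"
  have "?F b - ?F a = (LINT x:{a..b}|lborel. f x)" if "a \<le> b" for a b
  proof -
    define m M where "m = min 0 (min a b)" and "M = max 0 (max a b)"
    have e: "min 0 (min (ereal a) (ereal b)) = ereal m" "max 0 (max (ereal a) (ereal b)) = ereal M"
      by (simp_all add: m_def M_def zero_ereal_def min_def max_def)
    have "m \<le> M" by (simp add: m_def M_def)
    then have "interval_lebesgue_integrable lborel (ereal m) (ereal M) f"
      unfolding interval_lebesgue_integrable_def by (auto intro: set_integrable_subset[OF assms[of m M]])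
    then have "?F a + (LBINT y=ereal a..ereal b. f y) = ?F b"
      by (intro interval_integral_sum) (simp only: e)
    moreover have "(LBINT y=ereal a..ereal b. f y) = (LINT x:{a..b}|lborel. f x)"
      by (rule interval_integral_Icc[OF that])
    ultimately show ?thesis by (simp add: algebra_simps)
  qed
  then show "abs_cont ?F f" using assms by (simp add: abs_cont_def)
qed

lemma sq_integrable_imp_set_integrable:
  assumes "sq_integrable f"
  shows "set_integrable lborel {a..b} f"
proof -
  have "sq_integrable (\<lambda>x. of_real (indicator {a..b} x))"
  proof -
    have "(\<lambda>x. (cmod (of_real (indicator {a..b} x)))\<^sup>2) = (\<lambda>x. indicat_real {a..b} x)"
      by (auto simp: indicator_def)
    then show ?thesis
      unfolding sq_integrable_def by (auto intro!: integrable_real_indicator simp: emeasure_lborel_Icc_eq)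
  qed
  then have "integrable lborel (\<lambda>x. of_real (indicator {a..b} x) * f x)"
    using assms by (intro integrable_mult_sq) (auto simp: sq_integrable_def)
  then show ?thesis by (simp add: set_integrable_def scaleR_conv_of_real)
qed

section \<open>The du Bois-Reymond lemma\<close>

lemma bump_integrable:
  assumes "set_integrable lborel {a..b} w" "bump_comb f" "\<And>x. x \<notin> {a..b} \<Longrightarrow> f x = 0"
  shows "integrable lborel (\<lambda>x. w x * complex_of_real (f x))"
proof -
  have c: "continuous_on S f" for S
    using bump_comb_continuous[OF assms(2)] continuous_on_subset by blast
  have [measurable]: "f \<in> borel_measurable borel"
    by (intro borel_measurable_continuous_onI c)
  have [measurable]: "(\<lambda>x. indicat_real {a..b} x *\<^sub>R w x) \<in> borel_measurable borel"
    using assms(1) unfolding set_integrable_def by auto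
  have "bounded (f ` {a..b})" by (intro compact_imp_bounded compact_continuous_image c) simp
  then obtain B where "\<And>x. x \<in> {a..b} \<Longrightarrow> norm (f x) \<le> B"
    by (auto simp: bounded_iff simp del: atLeastAtMost_iff)
  then have B: "\<bar>f x\<bar> \<le> max B 0" for x
    using assms(3)[of x] by (cases "x \<in> {a..b}") (auto simp: le_max_iff_disj)
  have "integrable lborel (\<lambda>x. (indicat_real {a..b} x *\<^sub>R w x) * complex_of_real (f x))"
  proof (rule Bochner_Integration.integrable_bound)
    show "integrable lborel (\<lambda>x. max B 0 *\<^sub>R norm (indicat_real {a..b} x *\<^sub>R w x))"
      using assms(1) unfolding set_integrable_def
      by (intro integrable_scaleR_right Bochner_Integration.integrable_norm)
    show "AE x in lborel. norm ((indicat_real {a..b} x *\<^sub>R w x) * complex_of_real (f x))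
        \<le> norm (max B 0 *\<^sub>R norm (indicat_real {a..b} x *\<^sub>R w x))"
    proof (rule AE_I2)
      fix x
      show "norm ((indicat_real {a..b} x *\<^sub>R w x) * complex_of_real (f x))
        \<le> norm (max B 0 *\<^sub>R norm (indicat_real {a..b} x *\<^sub>R w x))"
        using mult_right_mono[OF B[of x], of "norm (indicat_real {a..b} x *\<^sub>R w x)"]
        by (simp add: norm_mult ac_simps abs_mult)
    qed
  qed measurable
  also have "(\<lambda>x. (indicat_real {a..b} x *\<^sub>R w x) * complex_of_real (f x)) = (\<lambda>x. w x * complex_of_real (f x))"
    using assms(3) by (auto simp: indicator_def fun_eq_iff)
  finally show ?thesis .
qed

text \<open>Open intervals are an intersection-stable generator of the Borel sets, so the vanishing
  spreads to all Borel sets by Dynkin's argument.\<close>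

lemma AE_zero_if_interval_integrals_zero:
  fixes w :: "real \<Rightarrow> complex"
  assumes w: "integrable lborel w" and z: "\<And>a b. (LINT x:{a<..<b}|lborel. w x) = 0"
  shows "AE x in lborel. w x = 0"
proof (rule sigma_finite_measure.density_zero[OF sigma_finite_lborel w])
  have G: "(borel :: real measure) = sigma UNIV (range (\<lambda>(a, b). {a<..<b}))"
    using borel_eq_box[where 'a = real] by (simp add: box_real)
  fix A :: "real set" assume "A \<in> sets lborel"
  then have A: "A \<in> sigma_sets UNIV (range (\<lambda>(a, b). {a<..<b}))"
    by (simp add: G)
  have si: "set_integrable lborel B w" if "B \<in> sets borel" for B
    using w that unfolding set_integrable_def by (intro integrable_mult_indicator) auto
  \<comment> \<open>Passing to complements needs the integral over the whole line, a limit of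
    integrals over \<open>(-n, n)\<close>.\<close>
  have U: "(\<integral>x. w x \<partial>lborel) = 0"
  proof -
    have "(\<lambda>n. LINT x:{- real n<..<real n}|lborel. w x) \<longlonglongrightarrow> (\<integral>x. w x \<partial>lborel)"
      unfolding set_lebesgue_integral_def
    proof (rule integral_dominated_convergence[where w = "\<lambda>x. norm (w x)"])
      show "AE x in lborel. (\<lambda>i. indicat_real {- real i<..<real i} x *\<^sub>R w x) \<longlonglongrightarrow> w x"
      proof (rule AE_I2)
        fix x :: real
        obtain N where N: "\<bar>x\<bar> < real N" using reals_Archimedean2 by blast
        show "(\<lambda>i. indicat_real {- real i<..<real i} x *\<^sub>R w x) \<longlonglongrightarrow> w x"
          by (rule tendsto_eventually, rule eventually_sequentiallyI[of N])
            (use N in \<open>auto simp: indicator_def\<close>)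
      qed
    qed (use w in \<open>auto simp: indicator_def\<close>)
    then show ?thesis by (simp add: z LIMSEQ_const_iff)
  qed
  show "(LINT x:A|lborel. w x) = 0"
    using _ _ A
  proof (rule sigma_sets_induct_disjoint)
    show "Int_stable (range (\<lambda>(a::real, b). {a<..<b}))"
    proof (rule Int_stableI_image)
      fix p q :: "real \<times> real"
      show "\<exists>k\<in>UNIV. (case p of (a, b) \<Rightarrow> {a<..<b}) \<inter> (case q of (a, b) \<Rightarrow> {a<..<b}) = (case k of (a, b) \<Rightarrow> {a<..<b})"
        by (rule bexI[of _ "(max (fst p) (fst q), min (snd p) (snd q))"]) (auto simp: split_beta')
    qed
    show "(LINT x:B|lborel. w x) = 0" if "B \<in> range (\<lambda>(a::real, b). {a<..<b})" for B
      using that z by auto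
    show "(LINT x:UNIV - B|lborel. w x) = 0"
      if B: "B \<in> sigma_sets UNIV (range (\<lambda>(a, b). {a<..<b}))" "(LINT x:B|lborel. w x) = 0" for B
    proof -
      have "B \<in> sets borel" using B(1)
        by (simp add: G)
      then have "(LINT x:B \<union> (UNIV - B)|lborel. w x) = (LINT x:B|lborel. w x) + (LINT x:UNIV - B|lborel. w x)"
        by (intro set_integral_Un si) auto
      then show ?thesis using B U by (simp add: set_lebesgue_integral_def)
    qed
    show "(LINT x:(\<Union>i. B i)|lborel. w x) = 0"
      if B: "disjoint_family B" "range B \<subseteq> sigma_sets UNIV (range (\<lambda>(a, b). {a<..<b}))"
        "\<And>i. (LINT x:B i|lborel. w x) = 0" for B :: "nat \<Rightarrow> real set"
    proof -
      have "B i \<in> sets borel" for i using B(2)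
        by (auto simp: G)
      then have "(LINT x:(\<Union>i. B i)|lborel. w x) = (\<Sum>i. LINT x:B i|lborel. w x)"
        using B(1) by (intro lebesgue_integral_countable_add si) (auto simp: disjoint_family_on_def)
      then show ?thesis using B(3) by simp
    qed
  qed (auto simp: set_lebesgue_integral_def)
qed

text \<open>If two bumps have the same integral, their difference is the derivative of a test
  function. Hence \<open>w\<close> integrated against a bump is the integral of the bump times a
  constant \<open>c\<close> that does not depend on the bump. Letting the bumps grow to indicators
  shows that \<open>w - c\<close> has integral zero over every interval.\<close>

lemma du_bois_reymond:
  fixes w :: "real \<Rightarrow> complex"
  assumes [measurable]: "w \<in> borel_measurable borel"
    and w: "\<And>a b. set_integrable lborel {a..b} w"
    and z: "\<And>\<phi>. test_function \<phi> \<Longrightarrow> (\<integral>x. w x * complex_of_real (deriv \<phi> x) \<partial>lborel) = 0"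
  shows "\<exists>c. AE x in lborel. w x = c"
proof -
  define B where "B m a b = bump_term m a b 0 0" for m a b
  have B01: "0 \<le> B m a b x" "B m a b x \<le> 1" "x \<notin> {a..b} \<Longrightarrow> B m a b x = 0" if "0 < m" for m a b x
  proof -
    have "- (1 / (x - a) + 1 / (b - x)) / m \<le> 0" if "a < x" "x < b"
    proof -
      have "0 \<le> 1 / (x - a) + 1 / (b - x)" using that by (intro add_nonneg_nonneg) auto
      then show ?thesis using \<open>0 < m\<close> by (intro divide_nonpos_pos) linarith+
    qed
    then show "0 \<le> B m a b x" "B m a b x \<le> 1" "x \<notin> {a..b} \<Longrightarrow> B m a b x = 0"
      by (auto simp: B_def bump_term_def)
  qed
  have Bpos: "0 < B m a b x" if "a < x" "x < b" for m a b x
    using that by (simp add: B_def bump_term_def)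
  have Bc: "bump_comb (\<lambda>x. c * B m a b x + d * B m' a' b' x)"
    if "0 < m" "a < b" "0 < m'" "a' < b'" for c d m a b m' a' b'
    using bump_comb.step[OF bump_comb.step[OF bump_comb.zero that(1,2), of c 0 0] that(3,4), of d 0 0]
    by (simp add: B_def)
  have Bc1: "bump_comb (B m a b)" if "0 < m" "a < b" for m a b
    using Bc[OF that that, of 1 0] by simp
  have Bi: "integrable lborel (\<lambda>x. v x * complex_of_real (B m a b x))"
    if "0 < m" "a < b" "set_integrable lborel {a..b} v" for v m a b
    by (rule bump_integrable[OF that(3) Bc1[OF that(1,2)]]) (use B01(3)[OF that(1)] in simp)
  have Bi1: "integrable lborel (B m a b)" if "0 < m" "a < b" for m a b
  proof -
    have "integrable lborel (\<lambda>x. Re (1 * complex_of_real (B m a b x)))"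
      using that by (intro integrable_Re Bi borel_integrable_atLeastAtMost' continuous_intros)
    then show ?thesis by simp
  qed
  have B_sub: "(\<integral>x. B m a b x \<partial>lborel) > 0" if "0 < m" "a < b" for m a b
  proof -
    have "\<not> (AE x in lborel. B m a b x = 0)"
    proof
      assume "AE x in lborel. B m a b x = 0"
      then have "AE x in lborel. x \<notin> {a<..<b}"
      proof eventually_elim
        case (elim x)
        then show ?case using Bpos[of a x b m] by auto
      qed
      then have "{a<..<b} \<in> null_sets lborel"
        by (subst AE_iff_null_sets) auto
      then show False using \<open>a < b\<close> by (simp add: null_sets_def)
    qed
    then have "(\<integral>x. B m a b x \<partial>lborel) \<noteq> 0"
      using Bi1[OF that] B01(1)[OF that(1)] by (subst integral_nonneg_eq_0_iff_AE) auto
    moreover have "(\<integral>x. B m a b x \<partial>lborel) \<ge> 0"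
      by (intro Bochner_Integration.integral_nonneg B01(1) that(1))
    ultimately show ?thesis by linarith
  qed
  define I where "I m a b = (\<integral>x. B m a b x \<partial>lborel)" for m a b
  \<comment> \<open>The constant is read off from a reference bump on the unit interval.\<close>
  define c where "c = (\<integral>x. w x * complex_of_real (B 1 0 1 x) \<partial>lborel) / complex_of_real (I 1 0 1)"
  have I0: "I 1 0 1 > 0" using B_sub[of 1 0 1] by (simp add: I_def)
  have eqc: "(\<integral>x. w x * complex_of_real (B m a b x) \<partial>lborel) = complex_of_real (I m a b) * c"
    if "0 < m" "a < b" for m a b
  proof -
    \<comment> \<open>Subtracting \<open>r\<close> times the reference bump makes the total integral
      zero, so that a primitive is a test function.\<close>
    define r where "r = I m a b / I 1 0 1"
    define f where "f x = 1 * B m a b x + (- r) * B 1 0 1 x" for x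
    have f: "bump_comb f" unfolding f_def using that by (intro Bc) auto
    then obtain R where R: "\<And>x. \<bar>x\<bar> \<ge> R \<Longrightarrow> f x = 0" using bump_comb_bounded by blast
    have "(\<integral>x. f x \<partial>lborel) = I m a b - r * I 1 0 1"
      unfolding f_def I_def using Bi1[OF that] Bi1[of 1 0 1] by simp
    also have "\<dots> = 0" using I0 by (simp add: r_def)
    finally obtain \<phi> where "test_function \<phi>" "deriv \<phi> = f"
      using bump_comb_primitive[OF f R] by blast
    then have "0 = (\<integral>x. w x * complex_of_real (f x) \<partial>lborel)" using z by metis
    also have "\<dots> = (\<integral>x. w x * complex_of_real (B m a b x) - complex_of_real r * (w x * complex_of_real (B 1 0 1 x)) \<partial>lborel)"
      by (intro Bochner_Integration.integral_cong) (auto simp: f_def algebra_simps)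
    also have "\<dots> = (\<integral>x. w x * complex_of_real (B m a b x) \<partial>lborel) - complex_of_real r * (\<integral>x. w x * complex_of_real (B 1 0 1 x) \<partial>lborel)"
      using Bi[OF that w] Bi[of 1 0 1, OF _ _ w] by simp
    finally show ?thesis using I0 by (simp add: r_def c_def field_simps)
  qed
  have wc: "set_integrable lborel {a..b} (\<lambda>x. w x - c)" for a b
    by (intro set_integral_diff w borel_integrable_atLeastAtMost' continuous_intros)
  have lim0: "(LINT x:{a<..<b}|lborel. w x - c) = 0" for a b
  proof (cases "a < b")
    case True
    have "(\<lambda>n. \<integral>x. (w x - c) * complex_of_real (B (real (Suc n)) a b x) \<partial>lborel)
        \<longlonglongrightarrow> (\<integral>x. indicat_real {a<..<b} x *\<^sub>R (w x - c) \<partial>lborel)"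
    proof (rule integral_dominated_convergence[where w = "\<lambda>x. norm (indicat_real {a..b} x *\<^sub>R (w x - c))"])
      show "(\<lambda>x. (w x - c) * complex_of_real (B (real (Suc n)) a b x)) \<in> borel_measurable lborel" for n
        using Bi[OF _ True wc, of "real (Suc n)"] by auto
      show "integrable lborel (\<lambda>x. norm (indicat_real {a..b} x *\<^sub>R (w x - c)))"
        using wc[of a b] unfolding set_integrable_def by (rule Bochner_Integration.integrable_norm)
      show "AE x in lborel. (\<lambda>n. (w x - c) * complex_of_real (B (real (Suc n)) a b x))
          \<longlonglongrightarrow> indicat_real {a<..<b} x *\<^sub>R (w x - c)"
      proof (rule AE_I2)
        fix x
        have "(\<lambda>n. B (real (Suc n)) a b x) \<longlonglongrightarrow> indicator {a<..<b} x"
        proof (cases "a < x \<and> x < b")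
          case True
          define y where "y = 1 / (x - a) + 1 / (b - x)"
          have "(\<lambda>n. exp (- y * (1 / real (Suc n)))) \<longlonglongrightarrow> exp (- y * 0)"
            by (intro tendsto_intros LIMSEQ_Suc[OF lim_1_over_n])
          then show ?thesis using True by (simp add: B_def bump_term_def y_def[symmetric])
        qed (auto simp: B_def bump_term_def indicator_def)
        then have "(\<lambda>n. (w x - c) * complex_of_real (B (real (Suc n)) a b x))
            \<longlonglongrightarrow> (w x - c) * complex_of_real (indicator {a<..<b} x)"
          by (intro tendsto_intros)
        then show "(\<lambda>n. (w x - c) * complex_of_real (B (real (Suc n)) a b x))
          \<longlonglongrightarrow> indicat_real {a<..<b} x *\<^sub>R (w x - c)"
          by (simp add: scaleR_conv_of_real mult.commute)
      qed
      show "AE x in lborel. norm ((w x - c) * complex_of_real (B (real (Suc n)) a b x))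
          \<le> norm (indicat_real {a..b} x *\<^sub>R (w x - c))" for n
      proof (rule AE_I2)
        fix x
        show "norm ((w x - c) * complex_of_real (B (real (Suc n)) a b x))
          \<le> norm (indicat_real {a..b} x *\<^sub>R (w x - c))"
          using B01(1,2)[of "real (Suc n)" a b x] B01(3)[of "real (Suc n)" x a b]
          by (cases "x \<in> {a..b}") (auto simp: norm_mult intro!: mult_left_le)
      qed
    qed measurable
    moreover have "(\<integral>x. (w x - c) * complex_of_real (B (real (Suc n)) a b x) \<partial>lborel) = 0" for n
    proof -
      have "(\<integral>x. (w x - c) * complex_of_real (B (real (Suc n)) a b x) \<partial>lborel)
        = (\<integral>x. w x * complex_of_real (B (real (Suc n)) a b x) - c * complex_of_real (B (real (Suc n)) a b x) \<partial>lborel)"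
        by (simp add: algebra_simps)
      also have "\<dots> = (\<integral>x. w x * complex_of_real (B (real (Suc n)) a b x) \<partial>lborel)
          - c * complex_of_real (I (real (Suc n)) a b)"
        using Bi[OF _ True w, of "real (Suc n)"] Bi1[OF _ True, of "real (Suc n)"]
        by (simp add: I_def)
      finally show ?thesis using eqc[OF _ True, of "real (Suc n)"] by (simp add: mult.commute)
    qed
    ultimately show ?thesis by (simp add: set_lebesgue_integral_def LIMSEQ_const_iff)
  qed (simp add: set_lebesgue_integral_def)
  \<comment> \<open>\<open>w - c\<close> is only locally integrable, hence the cut-off to
    \<open>(-n, n)\<close>.\<close>
  have "AE x in lborel. indicat_real {- real n<..<real n} x *\<^sub>R (w x - c) = 0" for n
  proof (rule AE_zero_if_interval_integrals_zero)
    have "set_integrable lborel {- real n<..<real n} (\<lambda>x. w x - c)"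
      by (rule set_integrable_subset[OF wc[of "- real n" "real n"]]) auto
    then show "complex_integrable lborel (\<lambda>x. indicat_real {- real n<..<real n} x *\<^sub>R (w x - c))"
      by (simp add: set_integrable_def)
    fix a b
    have "(LINT x:{a<..<b}|lborel. indicat_real {- real n<..<real n} x *\<^sub>R (w x - c))
      = (LINT x:{max a (- real n)<..<min b (real n)}|lborel. w x - c)"
      unfolding set_lebesgue_integral_def
      by (intro Bochner_Integration.integral_cong) (auto simp: indicator_def)
    then show "(LINT x:{a<..<b}|lborel. indicat_real {- real n<..<real n} x *\<^sub>R (w x - c)) = 0"
      by (simp add: lim0)
  qed
  then have "AE x in lborel. \<forall>n. indicat_real {- real n<..<real n} x *\<^sub>R (w x - c) = 0"
    unfolding AE_all_countable by blast
  then have "AE x in lborel. w x = c"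
  proof eventually_elim
    case (elim x)
    obtain n where "\<bar>x\<bar> < real n" using reals_Archimedean2 by blast
    then show ?case using elim[rule_format, of n] by (auto simp: indicator_def)
  qed
  then show ?thesis by blast
qed

lemma abs_cont_cnj: "abs_cont F f \<Longrightarrow> abs_cont (\<lambda>x. cnj (F x)) (\<lambda>x. cnj (f x))"
proof -
  assume a: "abs_cont F f"
  have "set_integrable lborel {a..b} (\<lambda>x. cnj (f x))" for a b
    using a integrable_cnj[of lborel "\<lambda>x. indicator {a..b} x *\<^sub>R f x"]
    by (simp add: abs_cont_def set_integrable_def)
  moreover have "(LINT x:{a..b}|lborel. cnj (f x)) = cnj (LINT x:{a..b}|lborel. f x)" for a b
    unfolding set_lebesgue_integral_def by (simp flip: Bochner_Integration.integral_cnj)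
  ultimately show ?thesis using a by (simp add: abs_cont_def flip: complex_cnj_diff)
qed

text \<open>By integration by parts, \<open>u\<close> minus any primitive of \<open>u'\<close> has
  weak derivative zero; du Bois-Reymond makes this difference a constant, which is added to the
  primitive.\<close>

lemma weak_deriv_abs_cont:
  assumes "weak_deriv u u'"
  shows "\<exists>F. abs_cont F (l2_fun u') \<and> (AE x in lborel. F x = l2_fun u x)"
proof -
  obtain F where F: "abs_cont F (l2_fun u')"
    using abs_cont_exists sq_integrable_imp_set_integrable[OF sq_integrable_l2_fun] by blast
  have [measurable]: "F \<in> borel_measurable borel" by (rule abs_cont_measurable[OF F])
  have Fi: "set_integrable lborel {a..b} F" for a b
    by (intro borel_integrable_atLeastAtMost' abs_cont_continuous[OF F])
  define w where "w x = l2_fun u x - F x" for x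
  have "\<exists>c. AE x in lborel. w x = c"
  proof (rule du_bois_reymond)
    show "w \<in> borel_measurable borel" by (simp add: w_def[abs_def])
    show "set_integrable lborel {a..b} w" for a b
      unfolding w_def by (intro set_integral_diff Fi sq_integrable_imp_set_integrable sq_integrable_l2_fun)
    fix \<phi> assume \<phi>: "test_function \<phi>"
    have d: "(deriv ^^ n) \<phi> differentiable_on UNIV" for n
      using \<phi> by (auto simp: test_function_def)
    have c: "continuous_on S \<phi>" "continuous_on S (deriv \<phi>)" for S
      using d[of 0] d[of 1] by (auto intro: differentiable_imp_continuous_on continuous_on_subset)
    have D: "(\<phi> has_field_derivative deriv \<phi> x) (at x)" for x
      using d[of 0] by (simp add: differentiable_on_def DERIV_deriv_iff_real_differentiable)
    obtain R0 where R0: "\<And>x. \<phi> x \<noteq> 0 \<Longrightarrow> \<bar>x\<bar> \<le> R0"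
      using \<phi> unfolding test_function_def bounded_iff by auto
    \<comment> \<open>The extra \<open>1\<close> puts every point with
      \<open>R \<le> \<bar>x\<bar>\<close> into an open set on which \<open>\<phi>\<close> vanishes,
      so its derivative vanishes there as well.\<close>
    define R where "R = \<bar>R0\<bar> + 1"
    have R: "\<phi> x = 0" "deriv \<phi> x = 0" if "\<bar>x\<bar> \<ge> R" for x
    proof -
      show "\<phi> x = 0" using R0[of x] that by (cases "\<phi> x = 0") (auto simp: R_def)
      have "open {x. \<bar>x\<bar> > \<bar>R0\<bar>}" by (intro open_Collect_less continuous_intros)
      then have "(\<phi> has_field_derivative 0) (at x)"
      proof (rule has_field_derivative_transform_within_open[OF DERIV_const[of "0::real"]])
        show "x \<in> {x. \<bar>R0\<bar> < \<bar>x\<bar>}" using that by (simp add: R_def)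
        show "0 = \<phi> y" if "y \<in> {x. \<bar>R0\<bar> < \<bar>x\<bar>}" for y
          using R0[of y] that by (cases "\<phi> y = 0") auto
      qed
      then show "deriv \<phi> x = 0" by (rule DERIV_imp_deriv)
    qed
    have "R > 0" by (simp add: R_def)
    have Gi: "set_integrable lborel {a..b} (\<lambda>x. complex_of_real (deriv \<phi> x))" for a b
      by (intro borel_integrable_atLeastAtMost' continuous_intros c)
    have G: "abs_cont (\<lambda>x. complex_of_real (\<phi> x)) (\<lambda>x. complex_of_real (deriv \<phi> x))"
      unfolding abs_cont_def
    proof (intro conjI allI impI Gi)
      fix a b :: real assume "a \<le> b"
      show "complex_of_real (\<phi> b) - complex_of_real (\<phi> a)
          = (LINT x:{a..b}|lborel. complex_of_real (deriv \<phi> x))"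
        unfolding set_lebesgue_integral_def
      proof (rule integral_FTC_atLeastAtMost[OF \<open>a \<le> b\<close>, symmetric])
        show "((\<lambda>x. complex_of_real (\<phi> x)) has_vector_derivative complex_of_real (deriv \<phi> x))
            (at x within {a..b})" for x
          using D[of x] has_vector_derivative_at_within has_vector_derivative_of_real
          by (blast intro: has_real_derivative_iff_has_vector_derivative[THEN iffD1])
        show "continuous_on {a..b} (\<lambda>x. complex_of_real (deriv \<phi> x))"
          by (intro continuous_intros c)
      qed
    qed
    have ext: "(LINT x:{- R..R}|lborel. h x) = (\<integral>x. h x \<partial>lborel)"
      if "\<And>x. \<bar>x\<bar> \<ge> R \<Longrightarrow> h x = 0" for h :: "real \<Rightarrow> complex"
      unfolding set_lebesgue_integral_def
    proof (intro Bochner_Integration.integral_cong refl)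
      fix x show "indicat_real {- R..R} x *\<^sub>R h x = h x"
        using that[of x] by (cases "\<bar>x\<bar> \<ge> R") (auto simp: indicator_def)
    qed
    have "complex_of_real (\<phi> R) = 0" "complex_of_real (\<phi> (- R)) = 0" using R \<open>R > 0\<close> by simp_all
    then have "0 = (LINT x:{- R..R}|lborel. complex_of_real (\<phi> x) * l2_fun u' x)
        + (LINT x:{- R..R}|lborel. F x * complex_of_real (deriv \<phi> x))"
      using abs_cont_parts[OF F G, of "- R" R] \<open>R > 0\<close> by simp
    also have "\<dots> = (\<integral>x. l2_fun u' x * complex_of_real (\<phi> x) \<partial>lborel)
        + (\<integral>x. F x * complex_of_real (deriv \<phi> x) \<partial>lborel)"
      by (subst (1 2) ext) (auto simp: R mult.commute)
    also have "(\<integral>x. l2_fun u' x * complex_of_real (\<phi> x) \<partial>lborel)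
        = - (\<integral>x. l2_fun u x * complex_of_real (deriv \<phi> x) \<partial>lborel)"
      using assms \<phi> by (simp add: weak_deriv.rep_eq)
    finally have 1: "(\<integral>x. l2_fun u x * complex_of_real (deriv \<phi> x) \<partial>lborel)
      = (\<integral>x. F x * complex_of_real (deriv \<phi> x) \<partial>lborel)" by simp
    have "integrable lborel (\<lambda>x. indicat_real {- R..R} x *\<^sub>R (F x * complex_of_real (deriv \<phi> x)))"
      using abs_cont_mult_integrable[OF F Gi, of "- R" R] by (simp add: set_integrable_def)
    also have "(\<lambda>x. indicat_real {- R..R} x *\<^sub>R (F x * complex_of_real (deriv \<phi> x)))
        = (\<lambda>x. F x * complex_of_real (deriv \<phi> x))"
    proof
      fix x show "indicat_real {- R..R} x *\<^sub>R (F x * complex_of_real (deriv \<phi> x)) = F x * complex_of_real (deriv \<phi> x)"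
        using R[of x] by (cases "\<bar>x\<bar> \<ge> R") (auto simp: indicator_def)
    qed
    finally have 2: "integrable lborel (\<lambda>x. F x * complex_of_real (deriv \<phi> x))" .
    show "(\<integral>x. w x * complex_of_real (deriv \<phi> x) \<partial>lborel) = 0"
      using 1 2 test_function_integrable(2)[OF \<phi> sq_integrable_l2_fun, of u]
      by (simp add: w_def left_diff_distrib)
  qed
  then obtain c where c: "AE x in lborel. w x = c" by blast
  show ?thesis
  proof (intro exI conjI)
    show "abs_cont (\<lambda>x. F x + c) (l2_fun u')" using F by (simp add: abs_cont_def)
    show "AE x in lborel. F x + c = l2_fun u x"
      using c by eventually_elim (simp add: w_def algebra_simps)
  qed
qed

section \<open>The Sobolev bound on the line\<close>

lemma l2_unit_interval:
  assumes [measurable]: "F \<in> borel_measurable borel" and F: "AE x in lborel. F x = l2_fun u x"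
  shows "set_integrable lborel {x..x + 1} (\<lambda>y. cmod (F y))"
    and "(LINT y:{x..x+1}|lborel. cmod (F y)) \<le> 1 + (norm u)\<^sup>2"
proof -
  have si: "sq_integrable F" using l2_of_cong(1)[OF sq_integrable_l2_fun _ F] by simp
  show i: "set_integrable lborel {x..x + 1} (\<lambda>y. cmod (F y))"
    using set_integrable_norm[OF sq_integrable_imp_set_integrable[OF si]] .
  have s: "integrable lborel (\<lambda>y. (cmod (F y))\<^sup>2)" using si by (simp add: sq_integrable_def)
  have "(LINT y:{x..x+1}|lborel. cmod (F y)) \<le> (\<integral>y. indicator {x..x+1} y + (cmod (F y))\<^sup>2 \<partial>lborel)"
    unfolding set_lebesgue_integral_def
  proof (rule integral_mono)
    show "integrable lborel (\<lambda>y. indicator {x..x+1} y *\<^sub>R cmod (F y))"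
      using i by (simp add: set_integrable_def)
    show "integrable lborel (\<lambda>y. indicator {x..x+1} y + (cmod (F y))\<^sup>2)"
      using s by (intro Bochner_Integration.integrable_add integrable_real_indicator)
        (auto simp: emeasure_lborel_Icc_eq)
    fix y
    \<comment> \<open>The inequality \<open>t \<le> 1 + t^2\<close> stands in for Cauchy-Schwarz,
      since the value of the bound does not matter.\<close>
    have "cmod (F y) \<le> 1 + (cmod (F y))\<^sup>2"
      using sum_squares_bound[of 1 "cmod (F y)"] norm_ge_zero[of "F y"]
      unfolding power_one mult_1_right by linarith
    then show "indicator {x..x+1} y *\<^sub>R cmod (F y) \<le> indicator {x..x+1} y + (cmod (F y))\<^sup>2"
      by (auto simp: indicator_def)
  qed
  also have "\<dots> = 1 + (\<integral>y. (cmod (F y))\<^sup>2 \<partial>lborel)"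
    using s by (subst Bochner_Integration.integral_add)
      (auto simp: emeasure_lborel_Icc_eq intro!: integrable_real_indicator)
  also have "(\<integral>y. (cmod (F y))\<^sup>2 \<partial>lborel) = (norm u)\<^sup>2"
    unfolding norm_l2_sq using F by (intro integral_cong_AE) (auto elim: eventually_mono)
  finally show "(LINT y:{x..x+1}|lborel. cmod (F y)) \<le> 1 + (norm u)\<^sup>2" .
qed

text \<open>The one-dimensional Sobolev embedding with a crude constant: \<open>F x\<close> is
  compared with the average of \<open>F\<close> over \<open>[x, x + 1]\<close>, where the
  oscillation is at most the integral of the modulus of \<open>u'\<close>. An explicit bound by the
  two norms is what later fixes the truncation level.\<close>

lemma weak_deriv_AE_bounded:
  assumes "weak_deriv u u'"
  shows "AE x in lborel. cmod (l2_fun u x) \<le> 2 + (norm u)\<^sup>2 + (norm u')\<^sup>2"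
proof -
  obtain F where F: "abs_cont F (l2_fun u')" and Fu: "AE x in lborel. F x = l2_fun u x"
    using weak_deriv_abs_cont[OF assms] by blast
  have [measurable]: "F \<in> borel_measurable borel" by (rule abs_cont_measurable[OF F])
  note i1 = l2_unit_interval[OF \<open>F \<in> borel_measurable borel\<close> Fu]
  note i2 = l2_unit_interval[where u = u', OF l2_fun_measurable AE_I2[OF refl]]
  have bound: "cmod (F x) \<le> 2 + (norm u)\<^sup>2 + (norm u')\<^sup>2" for x
  proof -
    have b: "cmod (F x) \<le> cmod (F y) + (1 + (norm u')\<^sup>2)" if y: "y \<in> {x..x + 1}" for y
    proof -
      have "cmod (F y - F x) = cmod (LINT t:{x..y}|lborel. l2_fun u' t)"
        using F y by (simp add: abs_cont_def)
      also have "\<dots> \<le> (LINT t:{x..y}|lborel. cmod (l2_fun u' t))"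
        by (rule set_integral_norm_bound[OF sq_integrable_imp_set_integrable[OF sq_integrable_l2_fun]])
      also have "\<dots> \<le> (LINT t:{x..x+1}|lborel. cmod (l2_fun u' t))"
        unfolding set_lebesgue_integral_def
      proof (rule integral_mono)
        show "integrable lborel (\<lambda>t. indicat_real {x..x + 1} t *\<^sub>R cmod (l2_fun u' t))"
          using i2(1)[of x] by (simp add: set_integrable_def)
        have "set_integrable lborel {x..y} (\<lambda>t. cmod (l2_fun u' t))"
          by (rule set_integrable_subset[OF i2(1)[of x]]) (use y in auto)
        then show "integrable lborel (\<lambda>t. indicat_real {x..y} t *\<^sub>R cmod (l2_fun u' t))"
          by (simp add: set_integrable_def)
        show "indicat_real {x..y} t *\<^sub>R cmod (l2_fun u' t) \<le> indicat_real {x..x + 1} t *\<^sub>R cmod (l2_fun u' t)" for t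
          using y by (auto simp: indicator_def)
      qed
      also have "\<dots> \<le> 1 + (norm u')\<^sup>2" by (rule i2(2))
      finally have "cmod (F y - F x) \<le> 1 + (norm u')\<^sup>2" .
      moreover have "cmod (F x) \<le> cmod (F y) + cmod (F y - F x)"
        by (metis add.commute diff_add_cancel norm_minus_commute norm_triangle_ineq)
      ultimately show ?thesis by linarith
    qed
    have ic: "set_integrable lborel {x..x+1} (\<lambda>_. K::real)" for K
      by (intro borel_integrable_atLeastAtMost' continuous_intros)
    have K: "(LINT y:{x..x+1}|lborel. K) = K" for K :: real
      by (subst set_integral_const) (auto simp: emeasure_lborel_Icc_eq)
    have "cmod (F x) = (LINT y:{x..x+1}|lborel. cmod (F x))" by (simp add: K)
    also have "\<dots> \<le> (LINT y:{x..x+1}|lborel. cmod (F y) + (1 + (norm u')\<^sup>2))"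
      by (rule set_integral_mono[OF ic set_integral_add(1)[OF i1(1) ic] b])
    also have "\<dots> = (LINT y:{x..x+1}|lborel. cmod (F y)) + (1 + (norm u')\<^sup>2)"
      by (subst set_integral_add(2)[OF i1(1) ic]) (simp only: K)
    also have "\<dots> \<le> (1 + (norm u)\<^sup>2) + (1 + (norm u')\<^sup>2)"
      using i1(2)[of x] by simp
    finally show ?thesis by simp
  qed
  show ?thesis using Fu
  proof eventually_elim
    case (elim x)
    then show ?case using bound[of x] by simp
  qed
qed

lemma h1_AE_bounded: "AE x in lborel. cmod (l2_fun (h1_l2 u) x) \<le> 2 + (norm u)\<^sup>2"
proof -
  obtain v v' where R: "Rep_h1 u = (v, v')" "weak_deriv v v'"
    using Rep_h1[of u] by auto
  have "(norm u)\<^sup>2 = (norm v)\<^sup>2 + (norm v')\<^sup>2"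
    by (simp add: power2_norm_eq_inner inner_h1.rep_eq R(1) inner_prod_def)
  then show ?thesis using weak_deriv_AE_bounded[OF R(2)] R(1) by (simp add: h1_l2_def add.assoc)
qed

section \<open>The embedding of \<open>h1\<close> into \<open>l2\<close> and skew symmetry of the
  generator\<close>

lemma h1_l2_linear: "linear h1_l2"
  by (rule linearI) (simp_all add: h1_l2_def plus_h1.rep_eq scaleR_h1.rep_eq)

lemma norm_h1_l2_le: "norm (h1_l2 u) \<le> norm u"
proof -
  have "(norm (h1_l2 u))\<^sup>2 \<le> (norm u)\<^sup>2"
    by (simp add: power2_norm_eq_inner inner_h1.rep_eq inner_prod_def h1_l2_def)
  then show ?thesis by (rule power2_le_imp_le) simp
qed

lemma bounded_linear_h1_l2: "bounded_linear h1_l2"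
  using h1_l2_linear norm_h1_l2_le
  by (intro bounded_linear_intro[of _ 1]) (auto simp: linear_add linear_scale)

text \<open>This disposes of boundary terms at infinity. If \<open>g\<close> had a nonzero integral
  \<open>I\<close>, then \<open>\<bar>k t\<bar> + \<bar>k (- t)\<bar>\<close> would be at least
  \<open>\<bar>I\<bar> / 2\<close> for all large \<open>t\<close>, against the integrability of
  \<open>k\<close>.\<close>

lemma integral_zero_if_primitive_integrable:
  fixes k g :: "real \<Rightarrow> real"
  assumes k: "integrable lborel k" and g: "integrable lborel g"
    and kg: "\<And>a b. a \<le> b \<Longrightarrow> k b - k a = (LINT x:{a..b}|lborel. g x)"
  shows "(\<integral>x. g x \<partial>lborel) = 0"
proof (rule ccontr)
  assume ne: "(\<integral>x. g x \<partial>lborel) \<noteq> 0"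
  define \<delta> where "\<delta> = \<bar>\<integral>x. g x \<partial>lborel\<bar> / 2"
  have "\<delta> > 0" using ne by (simp add: \<delta>_def)
  have "((\<lambda>t. LINT x:{- t..t}|lborel. g x) \<longlongrightarrow> (\<integral>x. g x \<partial>lborel)) at_top"
    unfolding set_lebesgue_integral_def
  proof (rule integral_dominated_convergence_at_top[where w = "\<lambda>x. norm (g x)"])
    show "AE x in lborel. ((\<lambda>t. indicat_real {- t..t} x *\<^sub>R g x) \<longlongrightarrow> g x) at_top"
    proof (rule AE_I2)
      fix x :: real
      show "((\<lambda>t. indicat_real {- t..t} x *\<^sub>R g x) \<longlongrightarrow> g x) at_top"
        by (rule tendsto_eventually, rule eventually_mono[OF eventually_ge_at_top[of "\<bar>x\<bar>"]])
          (auto simp: indicator_def)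
    qed
    show "\<forall>\<^sub>F t in at_top. AE x in lborel. norm (indicat_real {- t..t} x *\<^sub>R g x) \<le> norm (g x)"
      by (auto simp: indicator_def)
  qed (use g in auto)
  then have "\<forall>\<^sub>F t in at_top. dist (LINT x:{- t..t}|lborel. g x) (\<integral>x. g x \<partial>lborel) < \<delta>"
    using \<open>\<delta> > 0\<close> by (rule tendstoD)
  then obtain N where N: "\<And>t. t \<ge> N \<Longrightarrow> dist (LINT x:{- t..t}|lborel. g x) (\<integral>x. g x \<partial>lborel) < \<delta>"
    by (auto simp: eventually_at_top_linorder)
  have low: "\<delta> \<le> \<bar>k t\<bar> + \<bar>k (- t)\<bar>" if "t \<ge> max N 0" for t
  proof -
    have "k t - k (- t) = (LINT x:{- t..t}|lborel. g x)" using that by (intro kg) auto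
    moreover have "\<bar>(LINT x:{- t..t}|lborel. g x) - (\<integral>x. g x \<partial>lborel)\<bar> < \<delta>"
      using N[of t] that by (simp add: dist_real_def)
    ultimately show ?thesis unfolding \<delta>_def by linarith
  qed
  have k': "integrable lborel (\<lambda>x. k (- x))"
    using lborel_integrable_real_affine[of k "-1" 0] k by simp
  define J where "J = (\<integral>x. \<bar>k x\<bar> + \<bar>k (- x)\<bar> \<partial>lborel)"
  have "\<delta> * real m \<le> J" for m
  proof -
    define A where "A = {max N 0..max N 0 + real m}"
    have iA: "integrable lborel (\<lambda>x. \<delta> * indicator A x)"
      by (intro integrable_mult_right integrable_real_indicator) (auto simp: A_def emeasure_lborel_Icc_eq)
    have "\<delta> * real m = (\<integral>x. \<delta> * indicator A x \<partial>lborel)"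
      by (simp add: A_def)
    also have "\<dots> \<le> J"
      unfolding J_def using k k' by (intro integral_mono iA) (auto simp: A_def indicator_def intro!: low)
    finally show ?thesis .
  qed
  moreover obtain m where "J / \<delta> < real m" using reals_Archimedean2 by blast
  ultimately show False using \<open>\<delta> > 0\<close> by (metis linorder_not_less mult.commute pos_divide_less_eq)
qed

text \<open>The imaginary part of \<open>f * cnj f'\<close> has derivative
  \<open>Im (f * cnj f'')\<close>, because \<open>f' * cnj f'\<close> is real. Both
  \<open>f * cnj f'\<close> and \<open>f * cnj f''\<close> are integrable as products of two
  square-integrable functions, so this derivative has total integral zero.\<close>

lemma inner_minus_i_laplacian:
  assumes "minus_i_laplacian f g"
  shows "inner f g = 0"
proof -
  obtain f' f'' where w: "weak_deriv f f'" "weak_deriv f' f''" and g: "g = cscale (- \<i>) f''"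
    using assms by (auto simp: minus_i_laplacian_def)
  obtain F where F: "abs_cont F (l2_fun f')" "AE x in lborel. F x = l2_fun f x"
    using weak_deriv_abs_cont[OF w(1)] by blast
  obtain F1 where F1: "abs_cont F1 (l2_fun f'')" "AE x in lborel. F1 x = l2_fun f' x"
    using weak_deriv_abs_cont[OF w(2)] by blast
  have [measurable]: "F \<in> borel_measurable borel" "F1 \<in> borel_measurable borel"
    by (rule abs_cont_measurable F F1)+
  have sF: "sq_integrable F" "sq_integrable F1"
    using l2_of_cong(1)[OF sq_integrable_l2_fun _ F(2)] l2_of_cong(1)[OF sq_integrable_l2_fun _ F1(2)] by auto
  have "(\<integral>x. Im (F x * cnj (l2_fun f'' x)) \<partial>lborel) = 0"
  proof (rule integral_zero_if_primitive_integrable[where k = "\<lambda>x. Im (F x * cnj (F1 x))"])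
    show "integrable lborel (\<lambda>x. Im (F x * cnj (F1 x)))"
      by (intro integrable_Im integrable_mult_cnj sF)
    show ig: "integrable lborel (\<lambda>x. Im (F x * cnj (l2_fun f'' x)))"
      by (intro integrable_Im integrable_mult_cnj sF sq_integrable_l2_fun)
    fix a b :: real assume "a \<le> b"
    have e: "F b * cnj (F1 b) - F a * cnj (F1 a)
      = (LINT x:{a..b}|lborel. cnj (F1 x) * l2_fun f' x) + (LINT x:{a..b}|lborel. F x * cnj (l2_fun f'' x))"
      by (rule abs_cont_parts[OF F(1) abs_cont_cnj[OF F1(1)] \<open>a \<le> b\<close>])
    have "(LINT x:{a..b}|lborel. cnj (F1 x) * l2_fun f' x)
        = (\<integral>x. complex_of_real (indicator {a..b} x * (cmod (F1 x))\<^sup>2) \<partial>lborel)"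
      unfolding set_lebesgue_integral_def
    proof (rule integral_cong_AE)
      show "AE x in lborel. indicat_real {a..b} x *\<^sub>R (cnj (F1 x) * l2_fun f' x)
          = complex_of_real (indicator {a..b} x * (cmod (F1 x))\<^sup>2)"
        using F1(2) by eventually_elim (simp add: scaleR_conv_of_real complex_norm_square mult.commute
            del: of_real_power)
    qed measurable
    then have i1: "Im (LINT x:{a..b}|lborel. cnj (F1 x) * l2_fun f' x) = 0"
      by (simp only: integral_complex_of_real Im_complex_of_real)
    have "integrable lborel (\<lambda>x. indicat_real {a..b} x *\<^sub>R (F x * cnj (l2_fun f'' x)))"
      by (intro integrable_mult_indicator integrable_mult_cnj sF sq_integrable_l2_fun) simp
    then have i2: "Im (LINT x:{a..b}|lborel. F x * cnj (l2_fun f'' x))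
        = (LINT x:{a..b}|lborel. Im (F x * cnj (l2_fun f'' x)))"
      unfolding set_lebesgue_integral_def by (subst integral_Im[symmetric]) auto
    show "Im (F b * cnj (F1 b)) - Im (F a * cnj (F1 a)) = (LINT x:{a..b}|lborel. Im (F x * cnj (l2_fun f'' x)))"
      using arg_cong[OF e, of Im] i1 i2 by simp
  qed
  moreover have "inner f g = Re (\<integral>x. \<i> * (F x * cnj (l2_fun f'' x)) \<partial>lborel)"
  proof -
    have "(\<integral>x. l2_fun f x * cnj (l2_fun g x) \<partial>lborel) = (\<integral>x. \<i> * (F x * cnj (l2_fun f'' x)) \<partial>lborel)"
      unfolding g
      by (rule integral_cong_AE) (measurable, use F(2) l2_fun_cscale[of "- \<i>" f''] in \<open>eventually_elim; simp\<close>)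
    then show ?thesis by (simp add: inner_l2.rep_eq)
  qed
  moreover have "integrable lborel (\<lambda>x. F x * cnj (l2_fun f'' x))"
    by (intro integrable_mult_cnj sF sq_integrable_l2_fun)
  ultimately show ?thesis by (simp add: integral_Im del: times_complex.simps)
qed

section \<open>The free Schroedinger group\<close>

lemma has_vector_derivative_iff_quotient:
  fixes f :: "real \<Rightarrow> 'a::real_normed_vector"
  shows "(f has_vector_derivative D) (at x) \<longleftrightarrow> ((\<lambda>h. (f (x + h) - f x) /\<^sub>R h) \<longlongrightarrow> D) (at 0)"
proof -
  have "(f has_vector_derivative D) (at x) \<longleftrightarrow>
      ((\<lambda>h. norm (f (x + h) - f x - h *\<^sub>R D) / norm h) \<longlongrightarrow> 0) (at 0)"
    by (simp add: has_vector_derivative_def has_derivative_at bounded_linear_scaleR_left)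
  also have "\<dots> \<longleftrightarrow> ((\<lambda>h. norm ((f (x + h) - f x) /\<^sub>R h - D)) \<longlongrightarrow> 0) (at 0)"
  proof (rule tendsto_cong)
    show "\<forall>\<^sub>F h in at 0. norm (f (x + h) - f x - h *\<^sub>R D) / norm h = norm ((f (x + h) - f x) /\<^sub>R h - D)"
      unfolding eventually_at_filter
    proof (rule always_eventually, intro allI impI)
      fix h :: real assume "h \<noteq> 0"
      then have "(f (x + h) - f x) /\<^sub>R h - D = (f (x + h) - f x - h *\<^sub>R D) /\<^sub>R h"
        by (simp add: scaleR_diff_right)
      then show "norm (f (x + h) - f x - h *\<^sub>R D) / norm h = norm ((f (x + h) - f x) /\<^sub>R h - D)"
        by (simp add: divide_inverse_commute)
    qed
  qed
  also have "\<dots> \<longleftrightarrow> ((\<lambda>h. (f (x + h) - f x) /\<^sub>R h) \<longlongrightarrow> D) (at 0)"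
    by (simp add: tendsto_norm_zero_iff LIM_zero_iff)
  finally show ?thesis .
qed

lemma weak_deriv_cscale:
  assumes "weak_deriv u v"
  shows "weak_deriv (cscale c u) (cscale c v)"
proof -
  have *: "(\<integral>x. l2_fun (cscale c w) x * complex_of_real (p x) \<partial>lborel)
      = c * (\<integral>x. l2_fun w x * complex_of_real (p x) \<partial>lborel)"
    if i: "integrable lborel (\<lambda>x. l2_fun w x * complex_of_real (p x))"
      "integrable lborel (\<lambda>x. l2_fun (cscale c w) x * complex_of_real (p x))" for w p
  proof -
    have "(\<integral>x. l2_fun (cscale c w) x * complex_of_real (p x) \<partial>lborel)
        = (\<integral>x. c * (l2_fun w x * complex_of_real (p x)) \<partial>lborel)"
      by (rule integral_cong_AE)
        (use i l2_fun_cscale[of c w] in \<open>auto elim: eventually_mono simp: mult.assoc\<close>)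
    then show ?thesis by simp
  qed
  show ?thesis
    using assms unfolding weak_deriv.rep_eq
    by (auto simp: * test_function_integrable sq_integrable_l2_fun)
qed

lemma minus_i_laplacian_cscale:
  assumes "minus_i_laplacian f g"
  shows "minus_i_laplacian (cscale c f) (cscale c g)"
proof -
  obtain f' f'' where w: "weak_deriv f f'" "weak_deriv f' f''" and g: "g = cscale (- \<i>) f''"
    using assms by (auto simp: minus_i_laplacian_def)
  have "cscale c g = cscale (- \<i>) (cscale c f'')" by (simp add: g cscale_cscale mult.commute)
  then show ?thesis using w weak_deriv_cscale unfolding minus_i_laplacian_def by blast
qed

lemma minus_i_laplacian_diff:
  assumes "minus_i_laplacian f1 g1" "minus_i_laplacian f2 g2"
  shows "minus_i_laplacian (f1 - f2) (g1 - g2)"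
proof -
  have d: "weak_deriv (u - v) (u' - v')" if "weak_deriv u u'" "weak_deriv v v'" for u u' v v'
    using weak_deriv_add[OF that(1) weak_deriv_scaleR[OF that(2), of "-1"]] by simp
  from assms obtain f1' f1'' f2' f2'' where
    "weak_deriv f1 f1'" "weak_deriv f1' f1''" "g1 = cscale (- \<i>) f1''"
    "weak_deriv f2 f2'" "weak_deriv f2' f2''" "g2 = cscale (- \<i>) f2''"
    by (auto simp: minus_i_laplacian_def)
  then have "weak_deriv (f1 - f2) (f1' - f2')" "weak_deriv (f1' - f2') (f1'' - f2'')"
    "g1 - g2 = cscale (- \<i>) (f1'' - f2'')" by (auto simp: d cscale_diff)
  then show ?thesis unfolding minus_i_laplacian_def by blast
qed

text \<open>The derivative of the squared norm is \<open>2 * inner (y t) (y' t)\<close>, which is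
  zero by skew symmetry. Besides an orbit, \<open>y\<close> will also be a difference of two
  orbits.\<close>

lemma norm_conserved:
  fixes y :: "real \<Rightarrow> l2"
  assumes "\<And>t. (y has_vector_derivative y' t) (at t)" "\<And>t. minus_i_laplacian (y t) (y' t)"
  shows "norm (y t) = norm (y 0)"
proof -
  have D: "((\<lambda>t. inner (y t) (y t)) has_vector_derivative (inner (y t) (y' t) + inner (y' t) (y t))) (at t)" for t
    by (rule bounded_bilinear.has_vector_derivative[OF bounded_bilinear_inner assms(1) assms(1)])
  have "((\<lambda>t. inner (y t) (y t)) has_real_derivative 0) (at t)" for t
    using D[of t] inner_minus_i_laplacian[OF assms(2), of t]
    by (simp add: has_real_derivative_iff_has_vector_derivative inner_commute)
  then have "inner (y t) (y t) = inner (y 0) (y 0)"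
    using DERIV_isconst_all[of "\<lambda>t. inner (y t) (y t)"] by blast
  then show ?thesis by (simp add: norm_eq_sqrt_inner)
qed

locale schroedinger =
  fixes S :: "real \<Rightarrow> l2 \<Rightarrow> l2"
  assumes group: "schroedinger_group S"
begin

lemma linear_S: "bounded_linear (S t)"
  and S_0: "S 0 u = u"
  and S_add: "S (s + t) u = S s (S t u)"
  and continuous_S: "continuous_on UNIV (\<lambda>t. S t u)"
  and generator: "((\<lambda>h. (S h f - f) /\<^sub>R h) \<longlongrightarrow> g) (at 0) \<longleftrightarrow> minus_i_laplacian f g"
  using group by (auto simp: group_generated_by_def)

lemma orbit_derivative:
  assumes "minus_i_laplacian f g"
  shows "((\<lambda>t. S t f) has_vector_derivative S t g) (at t)" "minus_i_laplacian (S t f) (S t g)"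
proof -
  have lim: "((\<lambda>h. S t ((S h f - f) /\<^sub>R h)) \<longlongrightarrow> S t g) (at 0)"
    using assms by (intro bounded_linear.tendsto[OF linear_S]) (simp add: generator)
  interpret bounded_linear "S t" by (rule linear_S)
  have e: "S t ((S h f - f) /\<^sub>R h) = (S (t + h) f - S t f) /\<^sub>R h" for h
    by (simp add: scaleR diff S_add)
  show "((\<lambda>t. S t f) has_vector_derivative S t g) (at t)"
    using lim unfolding e by (simp add: has_vector_derivative_iff_quotient)
  have "S (t + h) f = S h (S t f)" for h using S_add[of h t f] by (simp add: add.commute)
  then show "minus_i_laplacian (S t f) (S t g)"
    using lim unfolding e by (simp add: generator[symmetric])
qed

text \<open>Averages of \<open>S s f\<close> over \<open>s\<close> in \<open>[0, x]\<close> lie in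
  the domain, because \<open>S r\<close> merely shifts the interval of integration, and they tend to
  \<open>f\<close> as \<open>x\<close> tends to \<open>0\<close>.\<close>

lemma domain_dense: "\<exists>X. X \<longlonglongrightarrow> f \<and> (\<forall>n::nat. \<exists>g. minus_i_laplacian (X n) g)"
proof -
  \<comment> \<open>The primitive starts at \<open>- 1\<close> rather than \<open>0\<close> so that
    it is differentiable from both sides at \<open>0\<close>.\<close>
  define P where "P x = integral {- 1..x} (\<lambda>s. S s f)" for x
  have c: "continuous_on A (\<lambda>s. S s f)" for A
    using continuous_S continuous_on_subset by blast
  have i: "(\<lambda>s. S s f) integrable_on {a..b}" for a b
    by (intro integrable_continuous_interval c)
  have DP: "(P has_vector_derivative S x f) (at x)" if "x > - 1" for x
  proof -
    have "(P has_vector_derivative S x f) (at x within {- 1..x + 1})"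
      unfolding P_def[abs_def] using that by (intro integral_has_vector_derivative c) auto
    then have "(P has_vector_derivative S x f) (at x within {- 1<..<x + 1})"
      by (rule has_vector_derivative_within_subset) auto
    then show ?thesis using that by (subst (asm) at_within_open) auto
  qed
  have shift: "S r (P x - P 0) = P (x + r) - P r" if "x \<ge> 0" "r > - 1" for x r
  proof -
    interpret bounded_linear "S r" by (rule linear_S)
    have 1: "P x - P 0 = integral {0..x} (\<lambda>s. S s f)"
      using Henstock_Kurzweil_Integration.integral_combine[of "- 1" 0 x "\<lambda>s. S s f"] that i
      by (simp add: P_def algebra_simps)
    have 2: "P (x + r) - P r = integral {r..x + r} (\<lambda>s. S s f)"
      using Henstock_Kurzweil_Integration.integral_combine[of "- 1" r "x + r" "\<lambda>s. S s f"] that i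
      by (simp add: P_def algebra_simps)
    have "S r (integral {0..x} (\<lambda>s. S s f)) = integral {0..x} (\<lambda>s. S r (S s f))"
      using integral_linear[OF i linear_S, of 0 x r] by (simp add: comp_def)
    also have "\<dots> = integral {0..x} (\<lambda>s. S (s + r) f)"
      by (simp add: S_add[symmetric] add.commute)
    also have "\<dots> = integral {r..x + r} (\<lambda>s. S s f)"
      using integral_shift_Icc_real[of 0 x "\<lambda>s. S s f" r] i c
      by (simp add: comp_def add.commute)
    finally show ?thesis using 1 2 by simp
  qed
  have dom: "minus_i_laplacian ((P x - P 0) /\<^sub>R x) ((S x f - S 0 f) /\<^sub>R x)" if "x > 0" for x
  proof -
    have "((\<lambda>r. (P (x + r) - P x) /\<^sub>R r) \<longlongrightarrow> S x f) (at 0)" "((\<lambda>r. (P (0 + r) - P 0) /\<^sub>R r) \<longlongrightarrow> S 0 f) (at 0)"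
      using DP[of x] DP[of 0] that by (auto simp: has_vector_derivative_iff_quotient)
    then have "((\<lambda>r. ((P (x + r) - P x) /\<^sub>R r - (P (0 + r) - P 0) /\<^sub>R r) /\<^sub>R x) \<longlongrightarrow> (S x f - S 0 f) /\<^sub>R x) (at 0)"
      by (intro tendsto_intros)
    moreover have "\<forall>\<^sub>F r in at 0. ((P (x + r) - P x) /\<^sub>R r - (P (0 + r) - P 0) /\<^sub>R r) /\<^sub>R x
        = (S r ((P x - P 0) /\<^sub>R x) - (P x - P 0) /\<^sub>R x) /\<^sub>R r"
    proof -
      have "\<forall>\<^sub>F r in at 0. r > (-1::real)"
        by (rule order_tendstoD(1)[OF tendsto_ident_at]) simp
      then show ?thesis
      proof eventually_elim
        case (elim r)
        interpret bounded_linear "S r" by (rule linear_S)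
        show ?case
          using shift[of x r] elim that
          by (simp add: scaleR scaleR_diff_right[symmetric] mult.commute)
      qed
    qed
    ultimately have "((\<lambda>r. (S r ((P x - P 0) /\<^sub>R x) - (P x - P 0) /\<^sub>R x) /\<^sub>R r) \<longlongrightarrow> (S x f - S 0 f) /\<^sub>R x) (at 0)"
      by (rule Lim_transform_eventually)
    then show ?thesis by (simp only: generator)
  qed
  have "((\<lambda>r. (P (0 + r) - P 0) /\<^sub>R r) \<longlongrightarrow> S 0 f) (at 0)"
    using DP[of 0] by (simp add: has_vector_derivative_iff_quotient)
  then have "((\<lambda>r. (P r - P 0) /\<^sub>R r) \<longlongrightarrow> f) (at 0)" by (simp add: S_0)
  moreover have "(\<lambda>n. 1 / real (Suc n)) \<longlonglongrightarrow> 0"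
    by (rule LIMSEQ_Suc[OF lim_1_over_n])
  then have "filterlim (\<lambda>n. 1 / real (Suc n)) (at 0) sequentially"
    unfolding filterlim_at by auto
  ultimately have "(\<lambda>n. (P (1 / real (Suc n)) - P 0) /\<^sub>R (1 / real (Suc n))) \<longlonglongrightarrow> f"
    by (rule filterlim_compose)
  moreover have "\<exists>g. minus_i_laplacian ((P (1 / real (Suc n)) - P 0) /\<^sub>R (1 / real (Suc n))) g" for n
    using dom[of "1 / real (Suc n)"] by (intro exI) simp
  ultimately show ?thesis by (intro exI[of _ "\<lambda>n. (P (1 / real (Suc n)) - P 0) /\<^sub>R (1 / real (Suc n))"]) blast
qed

text \<open>Conservation of the norm along orbits in the domain, extended by density and
  continuity.\<close>

lemma norm_S: "norm (S t f) = norm f"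
proof -
  obtain X where X: "X \<longlonglongrightarrow> f" "\<And>n::nat. \<exists>g. minus_i_laplacian (X n) g" using domain_dense by blast
  have e: "norm (S t (X n)) = norm (X n)" for n
  proof -
    obtain g where "minus_i_laplacian (X n) g" using X by blast
    from norm_conserved[of "\<lambda>t. S t (X n)" "\<lambda>t. S t g", OF orbit_derivative[OF this], of t]
    show ?thesis by (simp add: S_0)
  qed
  have "(\<lambda>n. norm (S t (X n))) \<longlonglongrightarrow> norm (S t f)"
    by (intro tendsto_norm bounded_linear.tendsto[OF linear_S] X)
  moreover have "(\<lambda>n. norm (S t (X n))) \<longlonglongrightarrow> norm f" unfolding e by (intro tendsto_norm X)
  ultimately show ?thesis by (rule LIMSEQ_unique)
qed

text \<open>The group is given as real linear only. The function
  \<open>- i S(t)(i f) - S(t) f\<close> solves the same equation with initial value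
  \<open>0\<close>, so its conserved norm is zero.\<close>

lemma S_i: "S t (cscale \<i> f) = cscale \<i> (S t f)"
proof -
  have e: "S t (cscale \<i> f) = cscale \<i> (S t f)" if f: "minus_i_laplacian f g" for f g
  proof -
    let ?y = "\<lambda>t. cscale (- \<i>) (S t (cscale \<i> f)) - S t f"
    have "norm (?y t) = norm (?y 0)"
    proof (rule norm_conserved)
      have A: "minus_i_laplacian (cscale \<i> f) (cscale \<i> g)" by (rule minus_i_laplacian_cscale[OF f])
      show "(?y has_vector_derivative cscale (- \<i>) (S t (cscale \<i> g)) - S t g) (at t)" for t
        by (intro has_vector_derivative_diff orbit_derivative f A
            bounded_linear.has_vector_derivative[OF bounded_linear_cscale])
      show "minus_i_laplacian (?y t) (cscale (- \<i>) (S t (cscale \<i> g)) - S t g)" for t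
        by (intro minus_i_laplacian_diff minus_i_laplacian_cscale orbit_derivative f A)
    qed
    also have "\<dots> = 0" by (simp add: S_0 cscale_cscale cscale_one)
    finally have "cscale \<i> (cscale (- \<i>) (S t (cscale \<i> f))) = cscale \<i> (S t f)" by simp
    then show ?thesis by (simp add: cscale_cscale cscale_one)
  qed
  obtain X where X: "X \<longlonglongrightarrow> f" "\<And>n::nat. \<exists>g. minus_i_laplacian (X n) g" using domain_dense by blast
  have "S t (cscale \<i> (X n)) = cscale \<i> (S t (X n))" for n using X(2) e by blast
  moreover have "(\<lambda>n. S t (cscale \<i> (X n))) \<longlonglongrightarrow> S t (cscale \<i> f)"
    by (intro bounded_linear.tendsto[OF linear_S] bounded_linear.tendsto[OF bounded_linear_cscale] X)
  moreover have "(\<lambda>n. cscale \<i> (S t (X n))) \<longlonglongrightarrow> cscale \<i> (S t f)"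
    by (intro bounded_linear.tendsto[OF linear_S] bounded_linear.tendsto[OF bounded_linear_cscale] X)
  ultimately show ?thesis by (simp add: LIMSEQ_unique)
qed

lemma S_diff: "S t (u - v) = S t u - S t v"
  and S_plus: "S t (u + v) = S t u + S t v"
  and S_scaleR: "S t (r *\<^sub>R u) = r *\<^sub>R S t u"
  and S_sum: "S t (sum w I) = (\<Sum>i\<in>I. S t (w i))"
  and S_zero: "S t 0 = 0"
  using linear_S[of t] by (simp_all add: bounded_linear.linear linear_diff linear_add linear_scale linear_sum linear_0)

lemma S_cancel: "S (- t) (S t u) = u" "S t (S (- t) u) = u"
  using S_add[of "- t" t u] S_add[of t "- t" u] by (simp_all add: S_0)

text \<open>Isometry upgrades strong continuity to joint continuity in time and state.\<close>

lemma continuous_on_S_comp: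
  assumes "continuous_on A G" "continuous_on A \<tau>"
  shows "continuous_on A (\<lambda>s. S (\<tau> s) (G s))"
  unfolding continuous_on_def
proof
  fix s assume s: "s \<in> A"
  have G: "(G \<longlongrightarrow> G s) (at s within A)" "(\<tau> \<longlongrightarrow> \<tau> s) (at s within A)"
    using assms s by (auto simp: continuous_on_def)
  have "isCont (\<lambda>t. S t (G s)) (\<tau> s)"
    using continuous_S by (simp add: continuous_on_eq_continuous_at)
  then have "((\<lambda>r. S (\<tau> r) (G s)) \<longlongrightarrow> S (\<tau> s) (G s)) (at s within A)"
    using G(2) by (rule isCont_tendsto_compose)
  moreover have "((\<lambda>r. S (\<tau> r) (G r - G s)) \<longlongrightarrow> 0) (at s within A)"
  proof (rule tendsto_norm_zero_cancel)
    have "((\<lambda>r. norm (G r - G s)) \<longlongrightarrow> 0) (at s within A)"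
      using G(1) by (intro tendsto_norm_zero LIM_zero)
    then show "((\<lambda>r. norm (S (\<tau> r) (G r - G s))) \<longlongrightarrow> 0) (at s within A)" by (simp add: norm_S)
  qed
  ultimately have "((\<lambda>r. S (\<tau> r) (G r - G s) + S (\<tau> r) (G s)) \<longlongrightarrow> 0 + S (\<tau> s) (G s)) (at s within A)"
    by (rule tendsto_add[rotated])
  then show "((\<lambda>r. S (\<tau> r) (G r)) \<longlongrightarrow> S (\<tau> s) (G s)) (at s within A)" by (simp add: S_diff)
qed

end

section \<open>Splitting error for the truncated nonlinearity\<close>

definition trunc_sq :: "real \<Rightarrow> complex \<Rightarrow> real" where
  "trunc_sq R z = (min (cmod z) R)\<^sup>2"

text \<open>The exact flow over time \<open>h\<close> of the ordinary differential equation
  \<open>i z' = trunc_sq R z * z\<close>: the modulus is constant along it, so the flow is a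
  rotation.\<close>

definition kick :: "real \<Rightarrow> real \<Rightarrow> complex \<Rightarrow> complex" where
  "kick R h z = cis (- (h * trunc_sq R z)) * z"

definition trunc_cubic :: "real \<Rightarrow> complex \<Rightarrow> complex" where
  "trunc_cubic R z = complex_of_real (trunc_sq R z) * z"

lemma trunc_sq_bounds: "0 \<le> R \<Longrightarrow> 0 \<le> trunc_sq R z" "0 \<le> R \<Longrightarrow> trunc_sq R z \<le> R\<^sup>2"
  by (auto simp: trunc_sq_def intro!: power_mono)

lemma measurable_trunc_sq [measurable]: "trunc_sq R \<in> borel_measurable borel"
  unfolding trunc_sq_def[abs_def] by measurable

lemma measurable_kick [measurable]: "kick R h \<in> borel_measurable borel"
  unfolding kick_def[abs_def] cis_conv_exp
  by (intro borel_measurable_continuous_onI continuous_intros) (auto simp: trunc_sq_def intro!: continuous_intros)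

lemma measurable_trunc_cubic [measurable]: "trunc_cubic R \<in> borel_measurable borel"
  unfolding trunc_cubic_def[abs_def] by measurable

text \<open>Whichever of the two factors \<open>z\<close>, \<open>w\<close> has the smaller modulus can be paired with the
  difference of the truncations, which vanishes if that modulus exceeds \<open>R\<close>.\<close>

lemma trunc_mult_lipschitz:
  fixes E :: "real \<Rightarrow> complex"
  assumes E: "\<And>a b. cmod (E a - E b) \<le> L * \<bar>a - b\<bar>" "E 0 = 0" and "0 \<le> L" "0 \<le> R"
  shows "cmod (E (trunc_sq R z) * z - E (trunc_sq R w) * w) \<le> 3 * (L * R\<^sup>2) * cmod (z - w)"
proof -
  have main: "cmod (E (trunc_sq R z) * z - E (trunc_sq R w) * w) \<le> 3 * (L * R\<^sup>2) * cmod (z - w)"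
    if le: "cmod w \<le> cmod z" for z w
  proof -
    have 1: "cmod (E (trunc_sq R z) * (z - w)) \<le> L * R\<^sup>2 * cmod (z - w)"
    proof -
      have "cmod (E (trunc_sq R z)) \<le> L * trunc_sq R z"
        using E(1)[of "trunc_sq R z" 0] E(2) trunc_sq_bounds(1)[OF \<open>0 \<le> R\<close>] by simp
      also have "\<dots> \<le> L * R\<^sup>2" using trunc_sq_bounds(2)[OF \<open>0 \<le> R\<close>] \<open>0 \<le> L\<close> by (intro mult_left_mono)
      finally show ?thesis by (simp add: norm_mult mult_right_mono)
    qed
    have 2: "\<bar>trunc_sq R z - trunc_sq R w\<bar> * cmod w \<le> 2 * R\<^sup>2 * cmod (z - w)"
    proof (cases "R \<le> cmod w")
      case True
      then have "min (cmod w) R = R" "min (cmod z) R = R" using le by auto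
      then show ?thesis by (simp add: trunc_sq_def)
    next
      case False
      define m where "m = min (cmod z) R"
      have m: "cmod w \<le> m" "m \<le> R" "m \<le> cmod z" using False le by (auto simp: m_def)
      have m0: "0 \<le> m" using m(1) norm_ge_zero order_trans by blast
      have t: "trunc_sq R z - trunc_sq R w = (m - cmod w) * (m + cmod w)"
      proof -
        have "min (cmod w) R = cmod w" using False by simp
        then show ?thesis by (simp add: trunc_sq_def m_def[symmetric] power2_eq_square algebra_simps)
      qed
      have "(m - cmod w) * (m + cmod w) \<le> cmod (z - w) * (2 * R)"
        using m m0 norm_triangle_ineq2[of z w] False by (intro mult_mono) auto
      then have "\<bar>trunc_sq R z - trunc_sq R w\<bar> * cmod w \<le> (cmod (z - w) * (2 * R)) * R"
        using t m m0 False \<open>0 \<le> R\<close> by (intro mult_mono) auto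
      then show ?thesis by (simp add: power2_eq_square algebra_simps)
    qed
    have "cmod ((E (trunc_sq R z) - E (trunc_sq R w)) * w) \<le> L * (2 * R\<^sup>2 * cmod (z - w))"
    proof -
      have "cmod ((E (trunc_sq R z) - E (trunc_sq R w)) * w) \<le> (L * \<bar>trunc_sq R z - trunc_sq R w\<bar>) * cmod w"
        unfolding norm_mult by (intro mult_right_mono E) simp
      also have "\<dots> \<le> L * (2 * R\<^sup>2 * cmod (z - w))"
        unfolding mult.assoc[of L] by (rule mult_left_mono[OF 2 \<open>0 \<le> L\<close>])
      finally show ?thesis .
    qed
    moreover have "E (trunc_sq R z) * z - E (trunc_sq R w) * w
        = E (trunc_sq R z) * (z - w) + (E (trunc_sq R z) - E (trunc_sq R w)) * w"
      by (simp add: algebra_simps)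
    ultimately have "cmod (E (trunc_sq R z) * z - E (trunc_sq R w) * w)
        \<le> L * R\<^sup>2 * cmod (z - w) + L * (2 * R\<^sup>2 * cmod (z - w))"
      using 1 norm_triangle_ineq by (smt (verit))
    then show ?thesis by (simp add: algebra_simps)
  qed
  show ?thesis
  proof (cases "cmod w \<le> cmod z")
    case True
    then show ?thesis by (rule main)
  next
    case False
    then show ?thesis using main[of z w] by (simp add: norm_minus_commute)
  qed
qed

lemma cis_diff_bound: "cmod (cis a - cis b) \<le> \<bar>a - b\<bar>"
proof -
  have "cis a - cis b = cis b * (cis (a - b) - 1)" by (simp add: cis_mult algebra_simps)
  then have "cmod (cis a - cis b) = cmod (cis (a - b) - 1)" by (simp add: norm_mult)
  then show ?thesis using iexp_approx1[of "a - b" 0] by (simp add: cis_conv_exp)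
qed

text \<open>Gronwall's lemma needs a Lipschitz constant of order \<open>h\<close> per step, and only
  the increment over the identity has one.\<close>

lemma kick_increment_lipschitz:
  assumes "0 \<le> h" "0 \<le> R"
  shows "cmod ((kick R h z - z) - (kick R h w - w)) \<le> 3 * (h * R\<^sup>2) * cmod (z - w)"
proof -
  have "cmod ((cis (- (h * trunc_sq R z)) - 1) * z - (cis (- (h * trunc_sq R w)) - 1) * w)
      \<le> 3 * (h * R\<^sup>2) * cmod (z - w)"
  proof (rule trunc_mult_lipschitz[where E = "\<lambda>a. cis (- (h * a)) - 1"])
    show "cmod ((cis (- (h * a)) - 1) - (cis (- (h * b)) - 1)) \<le> h * \<bar>a - b\<bar>" for a b
    proof -
      have "- (h * a) - - (h * b) = h * (b - a)" by (simp add: algebra_simps)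
      then have "\<bar>- (h * a) - - (h * b)\<bar> = h * \<bar>a - b\<bar>"
        using assms by (simp add: abs_mult abs_minus_commute)
      then show ?thesis using cis_diff_bound[of "- (h * a)" "- (h * b)"] by simp
    qed
  qed (use assms in auto)
  then show ?thesis by (simp add: kick_def algebra_simps)
qed

lemma trunc_cubic_lipschitz:
  assumes "0 \<le> R"
  shows "cmod (trunc_cubic R z - trunc_cubic R w) \<le> 3 * R\<^sup>2 * cmod (z - w)"
  using trunc_mult_lipschitz[of complex_of_real 1 R z w] assms
  by (simp add: trunc_cubic_def norm_of_real flip: of_real_diff)

text \<open>Taylor expansion: \<open>i * (exp (- i \<theta>) - 1)\<close> is \<open>\<theta>\<close>
  up to an error \<open>\<theta>^2\<close>. The local errors of \<open>T / h\<close> steps therefore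
  add up to order \<open>h\<close>.\<close>

lemma kick_local_error:
  assumes "0 \<le> h" "0 \<le> R"
  shows "cmod (\<i> * (kick R h z - z) - complex_of_real h * trunc_cubic R z) \<le> (h * R\<^sup>2)\<^sup>2 * cmod z"
proof -
  define \<theta> where "\<theta> = h * trunc_sq R z"
  have \<theta>: "0 \<le> \<theta>" "\<theta> \<le> h * R\<^sup>2"
    using assms trunc_sq_bounds[OF assms(2)] by (auto simp: \<theta>_def intro!: mult_left_mono)
  have "\<i> * (kick R h z - z) - complex_of_real h * trunc_cubic R z
      = \<i> * (cis (- \<theta>) - (1 + \<i> * complex_of_real (- \<theta>))) * z"
    by (simp add: kick_def trunc_cubic_def \<theta>_def algebra_simps)
  then have "cmod (\<i> * (kick R h z - z) - complex_of_real h * trunc_cubic R z)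
      = cmod (cis (- \<theta>) - (1 + \<i> * complex_of_real (- \<theta>))) * cmod z"
    by (simp add: norm_mult)
  also have "\<dots> \<le> \<theta>\<^sup>2 * cmod z"
  proof (rule mult_right_mono)
    have "cmod (cis (- \<theta>) - (1 + \<i> * complex_of_real (- \<theta>))) \<le> \<theta>\<^sup>2 / 2"
      using iexp_approx1[of "- \<theta>" 1] by (simp add: cis_conv_exp power2_eq_square)
    then show "cmod (cis (- \<theta>) - (1 + \<i> * complex_of_real (- \<theta>))) \<le> \<theta>\<^sup>2"
      using zero_le_power2[of \<theta>] by linarith
  qed simp
  also have "\<dots> \<le> (h * R\<^sup>2)\<^sup>2 * cmod z"
    using \<theta> by (intro mult_right_mono power_mono) auto
  finally show ?thesis .
qed

lemma norm_kick: "cmod (kick R h z) = cmod z"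
  by (simp add: kick_def norm_mult)

lemma norm_pmap_kick: "norm (pmap (kick R h) u) = norm u"
  by (rule norm_pmap_eq) (auto simp: norm_kick)

lemma AE_pmap_kick: "AE x in lborel. l2_fun (pmap (kick R h) u) x = kick R h (l2_fun u x)"
  by (rule l2_fun_pmap[where K = 1]) (auto simp: norm_kick)

lemma AE_pmap_trunc_cubic:
  "0 \<le> R \<Longrightarrow> AE x in lborel. l2_fun (pmap (trunc_cubic R) u) x = trunc_cubic R (l2_fun u x)"
  by (rule l2_fun_pmap[where K = "R\<^sup>2"])
    (auto simp: trunc_cubic_def norm_mult trunc_sq_bounds intro!: mult_right_mono)

lemma pmap_kick_increment_lipschitz:
  assumes "0 \<le> h" "0 \<le> R"
  shows "norm ((pmap (kick R h) u - u) - (pmap (kick R h) v - v)) \<le> 3 * (h * R\<^sup>2) * norm (u - v)"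
proof (rule norm_l2_le_AE)
  show "AE x in lborel. cmod (l2_fun ((pmap (kick R h) u - u) - (pmap (kick R h) v - v)) x)
      \<le> 3 * (h * R\<^sup>2) * cmod (l2_fun (u - v) x)"
    using l2_fun_minus[of "pmap (kick R h) u - u" "pmap (kick R h) v - v"] l2_fun_minus[of u v]
      l2_fun_minus[of "pmap (kick R h) u" u] l2_fun_minus[of "pmap (kick R h) v" v]
      AE_pmap_kick[of R h u] AE_pmap_kick[of R h v]
    by eventually_elim (simp add: kick_increment_lipschitz[OF assms])
qed (use assms in simp)

lemma pmap_kick_local_error:
  assumes "0 \<le> h" "0 \<le> R"
  shows "norm (cscale \<i> (pmap (kick R h) u - u) - h *\<^sub>R pmap (trunc_cubic R) u) \<le> (h * R\<^sup>2)\<^sup>2 * norm u"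
proof (rule norm_l2_le_AE)
  show "AE x in lborel. cmod (l2_fun (cscale \<i> (pmap (kick R h) u - u) - h *\<^sub>R pmap (trunc_cubic R) u) x)
      \<le> (h * R\<^sup>2)\<^sup>2 * cmod (l2_fun u x)"
    using l2_fun_minus[of "cscale \<i> (pmap (kick R h) u - u)" "h *\<^sub>R pmap (trunc_cubic R) u"]
      l2_fun_minus[of "pmap (kick R h) u" u] l2_fun_cscale[of \<i> "pmap (kick R h) u - u"]
      l2_fun_scaleR[of h "pmap (trunc_cubic R) u"] AE_pmap_kick[of R h u] AE_pmap_trunc_cubic[OF assms(2), of u]
  proof eventually_elim
    case (elim x)
    then show ?case using kick_local_error[OF assms, of "l2_fun u x"] by (simp add: scaleR_conv_of_real)
  qed
qed simp

lemma pmap_trunc_cubic_lipschitz: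
  "0 \<le> R \<Longrightarrow> norm (pmap (trunc_cubic R) u - pmap (trunc_cubic R) v) \<le> 3 * R\<^sup>2 * norm (u - v)"
  by (rule pmap_lipschitz) (simp_all add: trunc_cubic_lipschitz, simp add: trunc_cubic_def)

lemma continuous_on_pmap_trunc_cubic:
  fixes A :: "real set"
  assumes "0 \<le> R" "continuous_on A u"
  shows "continuous_on A (\<lambda>s. pmap (trunc_cubic R) (u s))"
  unfolding continuous_on_iff
proof (intro ballI allI impI)
  fix s e :: real assume "s \<in> A" "0 < e"
  define L where "L = 3 * R\<^sup>2 + 1"
  have "0 < L" unfolding L_def using zero_le_power2[of R] by linarith
  with \<open>0 < e\<close> have "0 < e / L" by simp
  then obtain d where d: "0 < d" "\<And>s'. s' \<in> A \<Longrightarrow> dist s' s < d \<Longrightarrow> dist (u s') (u s) < e / L"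
    using assms(2) \<open>s \<in> A\<close> unfolding continuous_on_iff by meson
  have "dist (pmap (trunc_cubic R) (u s')) (pmap (trunc_cubic R) (u s)) < e" if "s' \<in> A" "dist s' s < d" for s'
  proof -
    have "dist (pmap (trunc_cubic R) (u s')) (pmap (trunc_cubic R) (u s)) \<le> 3 * R\<^sup>2 * dist (u s') (u s)"
      using pmap_trunc_cubic_lipschitz[OF assms(1)] by (simp add: dist_norm)
    also have "\<dots> \<le> L * dist (u s') (u s)" by (intro mult_right_mono) (auto simp: L_def)
    also have "\<dots> < e" using d(2)[OF that] \<open>0 < L\<close> by (simp add: pos_less_divide_eq mult.commute)
    finally show ?thesis .
  qed
  then show "\<exists>d>0. \<forall>x'\<in>A. dist x' s < d \<longrightarrow> dist (pmap (trunc_cubic R) (u x')) (pmap (trunc_cubic R) (u s)) < e"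
    using d(1) by blast
qed

text \<open>The Sobolev bound shows that the truncation is inactive at such a level
  \<open>R\<close>.\<close>

lemma cubic_eq_pmap:
  assumes "2 + (norm u)\<^sup>2 \<le> R"
  shows "cubic u = pmap (trunc_cubic R) (h1_l2 u)"
  unfolding cubic_def pmap_def
proof (rule l2_of_cong(2))
  have "0 \<le> R" using assms zero_le_power2[of "norm u"] by linarith
  show "sq_integrable (\<lambda>x. trunc_cubic R (l2_fun (h1_l2 u) x))"
    by (rule sq_integrable_comp[where g = "trunc_cubic R" and K = "R\<^sup>2" and f = "l2_fun (h1_l2 u)"])
      (use \<open>0 \<le> R\<close> in \<open>auto simp: trunc_cubic_def[of R z for z] norm_mult trunc_sq_bounds sq_integrable_l2_fun
        intro!: mult_right_mono\<close>)
  show "AE x in lborel. complex_of_real ((cmod (l2_fun (h1_l2 u) x))\<^sup>2) * l2_fun (h1_l2 u) x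
      = trunc_cubic R (l2_fun (h1_l2 u) x)"
    using h1_AE_bounded[of u]
  proof eventually_elim
    case (elim x)
    then have "min (cmod (l2_fun (h1_l2 u) x)) R = cmod (l2_fun (h1_l2 u) x)" using assms by simp
    then show ?case by (simp add: trunc_cubic_def trunc_sq_def)
  qed
qed measurable

lemma discrete_gronwall:
  fixes a b :: "nat \<Rightarrow> real"
  assumes le: "\<And>n. n \<le> N \<Longrightarrow> a n \<le> b n + c * (\<Sum>k<n. a k)" and "0 \<le> c" and b: "\<And>n. 0 \<le> b n"
  shows "a N \<le> b N + c * (1 + c) ^ N * (\<Sum>k<N. b k)"
proof -
  \<comment> \<open>The partial sums, not the single terms, obey a one-step recursion: factor
    \<open>1 + c\<close>, gain \<open>b n\<close>.\<close>
  have "(\<Sum>k<n. a k) \<le> (1 + c) ^ n * (\<Sum>k<n. b k)" if "n \<le> N" for n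
    using that
  proof (induction n)
    case (Suc n)
    have "(\<Sum>k<Suc n. a k) \<le> (1 + c) * (\<Sum>k<n. a k) + b n"
      using le[of n] Suc.prems by (simp add: algebra_simps)
    also have "\<dots> \<le> (1 + c) * ((1 + c) ^ n * (\<Sum>k<n. b k)) + 1 * b n"
      using Suc \<open>0 \<le> c\<close> by (intro add_mono mult_left_mono) auto
    also have "\<dots> \<le> (1 + c) * ((1 + c) ^ n * (\<Sum>k<n. b k)) + (1 + c) ^ Suc n * b n"
      using \<open>0 \<le> c\<close> b by (intro add_left_mono mult_right_mono one_le_power) auto
    also have "\<dots> = (1 + c) ^ Suc n * (\<Sum>k<Suc n. b k)" by (simp add: algebra_simps)
    finally show ?case .
  qed simp
  from mult_left_mono[OF this[OF order_refl] \<open>0 \<le> c\<close>] le[of N] show ?thesis by (simp add: mult.assoc)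
qed

lemma norm_sum4:
  fixes p q r s :: "'a::real_normed_vector"
  shows "norm (p + q + r - s) \<le> norm p + norm q + norm r + norm s"
  using norm_triangle_ineq4[of "p + q + r" s] norm_triangle_ineq[of "p + q" r] norm_triangle_ineq[of p q]
  by linarith

context schroedinger
begin

text \<open>In the interaction picture both sequences accumulate increments from \<open>u0\<close>.
  Their difference consists of the quadrature error for \<open>H\<close>, with modulus of continuity
  \<open>\<omega>\<close>, the local error of the kick, the difference of the kicks at the two
  states, and the mismatch of the noises. The third is absorbed by Gronwall's lemma; the others make
  up \<open>d\<close>.\<close>

lemma scheme_error:
  fixes u :: "real \<Rightarrow> l2" and z \<xi> v :: "nat \<Rightarrow> l2" and R h B \<omega> :: real and N :: nat
  defines "H \<equiv> \<lambda>s. S (- s) (pmap (trunc_cubic R) (u s))"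
  assumes h: "0 \<le> h" and R: "0 \<le> R"
    and u: "\<And>n. n \<le> N \<Longrightarrow> u (n * h) = S (n * h) u0
        - cscale \<i> (integral {0..n * h} (\<lambda>s. S (n * h - s) (pmap (trunc_cubic R) (u s)))) - z n"
    and cont: "continuous_on {0..N * h} u"
    and B: "\<And>s. s \<in> {0..N * h} \<Longrightarrow> norm (u s) \<le> B"
    and \<omega>: "\<And>s t. s \<in> {0..N * h} \<Longrightarrow> t \<in> {0..N * h} \<Longrightarrow> \<bar>s - t\<bar> \<le> h \<Longrightarrow> norm (H s - H t) \<le> \<omega>"
    and v: "v 0 = u0" "\<And>n. v (Suc n) = S (- (n * h)) (pmap (kick R h) (S (n * h) (v n))) + \<xi> n"
  defines "d \<equiv> \<lambda>n. norm (S (- (n * h)) (z n) + (\<Sum>k<n. \<xi> k)) + N * (h * \<omega> + (h * R\<^sup>2)\<^sup>2 * B)"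
  shows "norm (S (- (N * h)) (u (N * h)) - v N)
    \<le> d N + 3 * (h * R\<^sup>2) * (1 + 3 * (h * R\<^sup>2)) ^ N * (\<Sum>k<N. d k)"
proof -
  define t where "t n = real n * h" for n
  have t: "t n = real n * h" "real n * h = t n" for n by (rule t_def, rule t_def[symmetric])
  have tmono: "m \<le> n \<Longrightarrow> t m \<le> t n" for m n using h by (simp add: t_def mult_right_mono)
  have t0: "0 \<le> t n" for n using h by (simp add: t_def)
  have tS: "t (Suc n) = t n + h" for n by (simp add: t_def algebra_simps)
  define x where "x n = S (- t n) (u (t n))" for n
  define a where "a k w = S (- t k) (pmap (kick R h) (S (t k) w)) - w" for k w
  have B0: "0 \<le> B"
  proof -
    have "norm (u 0) \<le> B" using t0[of N] by (intro B) (simp add: t_def)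
    then show ?thesis using norm_ge_zero[of "u 0"] by linarith
  qed
  have \<omega>0: "0 \<le> \<omega>"
  proof -
    have "norm (H 0 - H 0) \<le> \<omega>" using t0[of N] h by (intro \<omega>) (simp_all add: t_def)
    then show ?thesis by simp
  qed
  have cH: "continuous_on {0..t N} H"
    unfolding H_def using cont R
    by (intro continuous_on_S_comp continuous_on_pmap_trunc_cubic continuous_intros) (auto simp: t_def)
  have iH: "H integrable_on {p..q}" if "0 \<le> p" "q \<le> t N" for p q
    using that by (intro integrable_continuous_interval continuous_on_subset[OF cH]) auto
  have xe: "x n = u0 - cscale \<i> (integral {0..t n} H) - S (- t n) (z n)" if n: "n \<le> N" for n
  proof -
    have i: "(\<lambda>s. S (t n - s) (pmap (trunc_cubic R) (u s))) integrable_on {0..t n}"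
      using cont R tmono[OF n] unfolding t(2)
      by (intro integrable_continuous_interval continuous_on_S_comp continuous_on_pmap_trunc_cubic continuous_intros)
        (auto intro: continuous_on_subset)
    have "S (- t n) (integral {0..t n} (\<lambda>s. S (t n - s) (pmap (trunc_cubic R) (u s)))) = integral {0..t n} H"
      using integral_linear[OF i linear_S[of "- t n"]] by (simp add: comp_def H_def S_add[symmetric])
    then show ?thesis
      using u[OF n] unfolding x_def t(2) by (simp add: S_diff S_cancel S_i)
  qed
  have vs: "v (Suc n) = v n + (a n (v n) + \<xi> n)" for n
    unfolding v(2) a_def t_def by simp
  have ve: "v n = u0 + (\<Sum>k<n. a k (v k) + \<xi> k)" for n
    by (induction n) (simp_all only: vs v(1) sum.lessThan_Suc add.assoc lessThan_0 sum.empty add_0_right)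
  have split: "integral {0..t n} H = (\<Sum>k<n. integral {t k..t (Suc k)} H)" if "n \<le> N" for n
    using that
  proof (induction n)
    case (Suc n)
    have "integral {0..t (Suc n)} H = integral {0..t n} H + integral {t n..t (Suc n)} H"
      using Suc.prems t0 tmono
      by (intro Henstock_Kurzweil_Integration.integral_combine[symmetric] iH) auto
    then show ?case using Suc by simp
  qed (simp add: t_def)
  have loc1: "norm (integral {t k..t (Suc k)} H - h *\<^sub>R H (t k)) \<le> h * \<omega>" if k: "k < N" for k
  proof -
    have sub: "{t k..t (Suc k)} \<subseteq> {0..t N}" using t0[of k] tmono[of "Suc k" N] k by auto
    have "integral {t k..t (Suc k)} H - h *\<^sub>R H (t k) = integral {t k..t (Suc k)} (\<lambda>s. H s - H (t k))"
      using sub iH[of "t k" "t (Suc k)"] t0[of k] tmono[of "Suc k" N] tmono[of k "Suc k"] k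
      by (subst Henstock_Kurzweil_Integration.integral_diff) (auto simp: tS)
    also have "norm \<dots> \<le> \<omega> * (t (Suc k) - t k)"
    proof (rule integral_bound)
      show "continuous_on {t k..t (Suc k)} (\<lambda>s. H s - H (t k))"
        by (intro continuous_intros continuous_on_subset[OF cH sub])
      show "norm (H s - H (t k)) \<le> \<omega>" if "s \<in> {t k..t (Suc k)}" for s
        using that sub h by (intro \<omega>) (auto simp: tS t(2))
    qed (use h in \<open>simp add: tS\<close>)
    finally show ?thesis by (simp add: tS mult.commute)
  qed
  have loc2: "norm (- cscale \<i> (h *\<^sub>R H (t k)) - a k (x k)) \<le> (h * R\<^sup>2)\<^sup>2 * B" if k: "k < N" for k
  proof -
    let ?u = "u (t k)"
    have "- cscale \<i> (h *\<^sub>R H (t k)) - a k (x k)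
        = - S (- t k) (cscale \<i> (h *\<^sub>R pmap (trunc_cubic R) ?u) + (pmap (kick R h) ?u - ?u))"
      by (simp add: H_def a_def x_def S_cancel S_plus S_diff S_scaleR S_i cscale_scaleR)
    then have "norm (- cscale \<i> (h *\<^sub>R H (t k)) - a k (x k))
        = norm (cscale \<i> (h *\<^sub>R pmap (trunc_cubic R) ?u) + (pmap (kick R h) ?u - ?u))"
      by (simp add: norm_S)
    \<comment> \<open>Multiplication by \<open>i\<close> is an isometry and turns the expression
      into the local error of the kick.\<close>
    also have "\<dots> = norm (cscale \<i> (cscale \<i> (h *\<^sub>R pmap (trunc_cubic R) ?u) + (pmap (kick R h) ?u - ?u)))"
      by (simp add: norm_cscale)
    also have "\<dots> = norm (cscale \<i> (pmap (kick R h) ?u - ?u) - h *\<^sub>R pmap (trunc_cubic R) ?u)"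
      by (simp add: cscale_add cscale_cscale cscale_minus_one)
    also have "\<dots> \<le> (h * R\<^sup>2)\<^sup>2 * norm ?u" by (rule pmap_kick_local_error[OF h R])
    also have "\<dots> \<le> (h * R\<^sup>2)\<^sup>2 * B"
      using t0[of k] tmono[of k N] k by (intro mult_left_mono B) (auto simp: t(2))
    finally show ?thesis .
  qed
  have lip: "norm (a k w - a k w') \<le> 3 * (h * R\<^sup>2) * norm (w - w')" for k w w'
  proof -
    have "a k w - a k w' = S (- t k) ((pmap (kick R h) (S (t k) w) - S (t k) w) - (pmap (kick R h) (S (t k) w') - S (t k) w'))"
      by (simp add: a_def S_diff S_cancel)
    then have "norm (a k w - a k w') \<le> 3 * (h * R\<^sup>2) * norm (S (t k) w - S (t k) w')"
      using pmap_kick_increment_lipschitz[OF h R] by (simp add: norm_S)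
    then show ?thesis by (simp add: S_diff[symmetric] norm_S)
  qed
  have err: "norm (x n - v n) \<le> d n + 3 * (h * R\<^sup>2) * (\<Sum>k<n. norm (x k - v k))" if n: "n \<le> N" for n
  proof -
    let ?A = "\<Sum>k<n. integral {t k..t (Suc k)} H - h *\<^sub>R H (t k)"
    let ?C = "\<Sum>k<n. - cscale \<i> (h *\<^sub>R H (t k)) - a k (x k)"
    let ?D = "\<Sum>k<n. a k (x k) - a k (v k)"
    let ?E = "S (- t n) (z n) + (\<Sum>k<n. \<xi> k)"
    have cs: "cscale \<i> (\<Sum>k<n. w k) = (\<Sum>k<n. cscale \<i> (w k))" for w :: "nat \<Rightarrow> l2"
      using bounded_linear_cscale[of \<i>] by (simp add: bounded_linear.linear linear_sum)
    \<comment> \<open>\<open>\<xi>\<close> is to approximate minus the rotated noise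
      \<open>z\<close>, hence the plus sign inside the noise error \<open>?E\<close>.\<close>
    have split_err: "x n - v n = - cscale \<i> ?A + ?C + ?D - ?E"
    proof -
      have A: "cscale \<i> ?A = cscale \<i> (integral {0..t n} H) - (\<Sum>k<n. cscale \<i> (h *\<^sub>R H (t k)))"
      proof -
        have "cscale \<i> ?A = cscale \<i> ((\<Sum>k<n. integral {t k..t (Suc k)} H) - (\<Sum>k<n. h *\<^sub>R H (t k)))"
          by (simp only: sum_subtractf)
        also have "\<dots> = cscale \<i> (\<Sum>k<n. integral {t k..t (Suc k)} H) - cscale \<i> (\<Sum>k<n. h *\<^sub>R H (t k))"
          by (rule cscale_diff)
        finally show ?thesis by (simp only: split[OF n] cs)
      qed
      have C: "?C = - (\<Sum>k<n. cscale \<i> (h *\<^sub>R H (t k))) - (\<Sum>k<n. a k (x k))"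
        by (simp only: sum_subtractf sum_negf)
      have V: "v n = u0 + ((\<Sum>k<n. a k (v k)) + (\<Sum>k<n. \<xi> k))"
        by (simp only: ve[of n] sum.distrib)
      have D: "?D = (\<Sum>k<n. a k (x k)) - (\<Sum>k<n. a k (v k))"
        by (rule sum_subtractf)
      show ?thesis unfolding xe[OF n] V A C D by (simp only: algebra_simps) simp
    qed
    have 1: "norm (x n - v n) \<le> norm ?A + norm ?C + norm ?D + norm ?E"
      unfolding split_err
      using norm_sum4[of "- cscale \<i> ?A" ?C ?D ?E] by (simp only: norm_minus_cancel norm_cscale norm_ii mult_1)
    have bA: "norm ?A \<le> (\<Sum>k<n. h * \<omega>)" using n by (intro sum_norm_le loc1) auto
    have bC: "norm ?C \<le> (\<Sum>k<n. (h * R\<^sup>2)\<^sup>2 * B)" using n by (intro sum_norm_le loc2) auto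
    have bD: "norm ?D \<le> (\<Sum>k<n. 3 * (h * R\<^sup>2) * norm (x k - v k))" by (intro sum_norm_le lip)
    have "real n * (h * \<omega> + (h * R\<^sup>2)\<^sup>2 * B) \<le> real N * (h * \<omega> + (h * R\<^sup>2)\<^sup>2 * B)"
      using n h \<omega>0 B0 by (intro mult_right_mono) auto
    then have AC: "(\<Sum>k<n. h * \<omega>) + (\<Sum>k<n. (h * R\<^sup>2)\<^sup>2 * B) \<le> real N * (h * \<omega> + (h * R\<^sup>2)\<^sup>2 * B)"
      by (simp add: distrib_left)
    have 2: "norm ?A + norm ?C + norm ?D + norm ?E
        \<le> (\<Sum>k<n. h * \<omega>) + (\<Sum>k<n. (h * R\<^sup>2)\<^sup>2 * B) + (\<Sum>k<n. 3 * (h * R\<^sup>2) * norm (x k - v k)) + norm ?E"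
      by (intro add_mono bA bC bD order_refl)
    have 3: "(\<Sum>k<n. h * \<omega>) + (\<Sum>k<n. (h * R\<^sup>2)\<^sup>2 * B) + (\<Sum>k<n. 3 * (h * R\<^sup>2) * norm (x k - v k)) + norm ?E
        \<le> real N * (h * \<omega> + (h * R\<^sup>2)\<^sup>2 * B) + (\<Sum>k<n. 3 * (h * R\<^sup>2) * norm (x k - v k)) + norm ?E"
      by (intro add_mono AC order_refl)
    have 4: "real N * (h * \<omega> + (h * R\<^sup>2)\<^sup>2 * B) + (\<Sum>k<n. 3 * (h * R\<^sup>2) * norm (x k - v k)) + norm ?E
        = d n + 3 * (h * R\<^sup>2) * (\<Sum>k<n. norm (x k - v k))"
      unfolding d_def t_def sum_distrib_left by (simp only: ac_simps)
    show ?thesis by (rule order_trans[OF 1 order_trans[OF 2 order_trans[OF 3 eq_refl[OF 4]]]])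
  qed
  have d0: "0 \<le> d n" for n
    unfolding d_def using h \<omega>0 B0 by (intro add_nonneg_nonneg mult_nonneg_nonneg) auto
  have "norm (x N - v N) \<le> d N + 3 * (h * R\<^sup>2) * (1 + 3 * (h * R\<^sup>2)) ^ N * (\<Sum>k<N. d k)"
    by (rule discrete_gronwall[OF err]) (use h d0 in auto)
  then show ?thesis by (simp only: x_def t_def)
qed

end

section \<open>Stochastic integrals of step functions\<close>

lemma orthonormal_basis_inner: "orthonormal_basis e \<Longrightarrow> inner (e i) (e j) = (if i = j then 1 else 0)"
  by (simp add: orthonormal_basis_def)

lemma orthonormal_expansion_norm:
  fixes e :: "nat \<Rightarrow> 'a::real_inner"
  assumes "orthonormal_basis e"
  shows "(norm (\<Sum>k<n. a k *\<^sub>R e k))\<^sup>2 = (\<Sum>k<n. (a k)\<^sup>2)"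
proof -
  have "(norm (\<Sum>k<n. a k *\<^sub>R e k))\<^sup>2 = (\<Sum>i<n. \<Sum>j<n. a i * (a j * inner (e i) (e j)))"
    by (simp add: power2_norm_eq_inner inner_sum_left inner_sum_right)
      (simp add: mult.left_commute orthonormal_basis_inner[OF assms] if_distrib cong: if_cong)
  also have "\<dots> = (\<Sum>k<n. (a k)\<^sup>2)"
    by (simp add: orthonormal_basis_inner[OF assms] if_distrib power2_eq_square cong: if_cong)
  finally show ?thesis .
qed

text \<open>By Pythagoras the partial sums are the best approximations from the spans of the first
  \<open>n\<close> vectors, and every element of the dense span lies in one of these.\<close>

lemma orthonormal_basis_expansion:
  fixes e :: "nat \<Rightarrow> 'a::real_inner"
  assumes e: "orthonormal_basis e"
  shows "(\<lambda>n. \<Sum>k<n. inner x (e k) *\<^sub>R e k) \<longlonglongrightarrow> x"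
proof -
  define P where "P n = (\<Sum>k<n. inner x (e k) *\<^sub>R e k)" for n
  have orth: "inner (x - P n) (e k) = 0" if "k < n" for k n
    using that by (simp add: P_def inner_diff_left inner_sum_left orthonormal_basis_inner[OF e] if_distrib cong: if_cong)
  have Pspan: "P n \<in> span (e ` {..<n})" for n
    unfolding P_def by (intro span_sum span_scale span_base) auto
  have best: "norm (x - P n) \<le> norm (x - y)" if y: "y \<in> span (e ` {..<n})" for y n
  proof -
    have "orthogonal (x - P n) (P n - y)"
      by (rule orthogonal_to_span[OF span_diff[OF Pspan y]]) (auto simp: orthogonal_def orth)
    then have "(norm ((x - P n) + (P n - y)))\<^sup>2 = (norm (x - P n))\<^sup>2 + (norm (P n - y))\<^sup>2"
      by (rule norm_add_Pythagorean)
    then have "(norm (x - P n))\<^sup>2 \<le> (norm (x - y))\<^sup>2" by simp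
    then show ?thesis by (rule power2_le_imp_le) simp
  qed
  have union: "\<exists>n. y \<in> span (e ` {..<n})" if "y \<in> span (range e)" for y
    using that
  proof (rule span_induct)
    show "subspace {y. \<exists>n. y \<in> span (e ` {..<n})}"
    proof (rule subspaceI)
      fix y z assume "y \<in> {y. \<exists>n. y \<in> span (e ` {..<n})}" "z \<in> {y. \<exists>n. y \<in> span (e ` {..<n})}"
      then obtain m n where "y \<in> span (e ` {..<m})" "z \<in> span (e ` {..<n})" by auto
      then have "y \<in> span (e ` {..<max m n})" "z \<in> span (e ` {..<max m n})"
        by (meson image_mono lessThan_subset_iff max.cobounded1 max.cobounded2 span_mono subsetD)+
      then show "y + z \<in> {y. \<exists>n. y \<in> span (e ` {..<n})}" using span_add by blast
    qed (auto intro: span_zero span_scale)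
    fix y assume "y \<in> range e"
    then obtain k where "y = e k" by auto
    then show "\<exists>n. y \<in> span (e ` {..<n})" by (auto intro!: exI[of _ "Suc k"] span_base)
  qed
  show ?thesis
    unfolding P_def[symmetric]
  proof (rule LIMSEQ_I)
    fix r :: real assume "0 < r"
    have "x \<in> closure (span (range e))" using e by (simp add: orthonormal_basis_def)
    then obtain y where y: "y \<in> span (range e)" "dist y x < r"
      using \<open>0 < r\<close> unfolding closure_approachable by blast
    then obtain m where m: "y \<in> span (e ` {..<m})" using union by blast
    have "norm (P n - x) < r" if "m \<le> n" for n
    proof -
      have "y \<in> span (e ` {..<n})"
        using m that by (meson image_mono lessThan_subset_iff span_mono subsetD)
      from best[OF this] y(2) show ?thesis by (simp add: dist_norm norm_minus_commute)
    qed
    then show "\<exists>no. \<forall>n\<ge>no. norm (P n - x) < r" by blast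
  qed
qed

lemma parseval:
  fixes e :: "nat \<Rightarrow> 'a::real_inner"
  assumes e: "orthonormal_basis e"
  shows "(\<lambda>k. (inner x (e k))\<^sup>2) sums (norm x)\<^sup>2"
proof -
  have "(\<lambda>n. (norm (\<Sum>k<n. inner x (e k) *\<^sub>R e k))\<^sup>2) \<longlonglongrightarrow> (norm x)\<^sup>2"
    by (intro tendsto_intros orthonormal_basis_expansion e)
  then show ?thesis by (simp add: sums_def orthonormal_expansion_norm[OF e])
qed

definition weakly_measurable :: "'w measure \<Rightarrow> ('w \<Rightarrow> 'a::real_inner) \<Rightarrow> bool" where
  "weakly_measurable M X \<longleftrightarrow> (\<forall>c. (\<lambda>\<omega>. inner (X \<omega>) c) \<in> borel_measurable M)"

lemma weakly_measurableI: "X \<in> borel_measurable M \<Longrightarrow> weakly_measurable M X"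
  unfolding weakly_measurable_def
  by (auto intro!: measurable_compose[of X M borel] borel_measurable_continuous_onI continuous_intros)

lemma weakly_measurable_add: "weakly_measurable M X \<Longrightarrow> weakly_measurable M Y \<Longrightarrow> weakly_measurable M (\<lambda>\<omega>. X \<omega> + Y \<omega>)"
  by (auto simp: weakly_measurable_def inner_add_left intro!: borel_measurable_add)

lemma weakly_measurable_diff: "weakly_measurable M X \<Longrightarrow> weakly_measurable M Y \<Longrightarrow> weakly_measurable M (\<lambda>\<omega>. X \<omega> - Y \<omega>)"
  by (auto simp: weakly_measurable_def inner_diff_left intro!: borel_measurable_diff)

lemma weakly_measurable_scaleR:
  "g \<in> borel_measurable M \<Longrightarrow> weakly_measurable M X \<Longrightarrow> weakly_measurable M (\<lambda>\<omega>. g \<omega> *\<^sub>R X \<omega>)"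
  by (auto simp: weakly_measurable_def intro!: borel_measurable_times)

lemma weakly_measurable_const: "weakly_measurable M (\<lambda>\<omega>. c)"
  by (simp add: weakly_measurable_def)

lemma weakly_measurable_sum:
  "(\<And>i. i \<in> I \<Longrightarrow> weakly_measurable M (X i)) \<Longrightarrow> weakly_measurable M (\<lambda>\<omega>. \<Sum>i\<in>I. X i \<omega>)"
  by (induction I rule: infinite_finite_induct) (auto intro: weakly_measurable_add weakly_measurable_const)

text \<open>The space \<open>L\<^sup>2\<close> is not an instance of \<open>second_countable_topology\<close>; measurability of norms
  therefore goes through an orthonormal basis.\<close>

lemma weakly_measurable_norm:
  fixes e :: "nat \<Rightarrow> 'a::real_inner" and X :: "'w \<Rightarrow> 'a"
  assumes "orthonormal_basis e" "weakly_measurable M X"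
  shows "(\<lambda>\<omega>. norm (X \<omega>)) \<in> borel_measurable M"
proof -
  have "norm (X \<omega>) = sqrt (\<Sum>k. (inner (X \<omega>) (e k))\<^sup>2)" for \<omega>
    using parseval[OF assms(1), of "X \<omega>"] by (simp add: sums_iff)
  moreover have [measurable]: "(\<lambda>\<omega>. inner (X \<omega>) (e k)) \<in> borel_measurable M" for k
    using assms(2) by (simp add: weakly_measurable_def)
  ultimately show ?thesis by simp
qed

section \<open>Brownian increments and the isometry for step functions\<close>

locale white_noise = prob_space M for M :: "'w measure" +
  fixes \<beta> :: "nat \<Rightarrow> real \<Rightarrow> 'w \<Rightarrow> real"
  assumes noise: "independent_brownian_motions M \<beta>"
begin

definition inc :: "nat \<Rightarrow> real \<Rightarrow> real \<Rightarrow> 'w \<Rightarrow> real" where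
  "inc j a b \<omega> = \<beta> j b \<omega> - \<beta> j a \<omega>"

lemma brownian: "brownian_motion M (\<beta> j)"
  using noise by (simp add: independent_brownian_motions_def)

lemma measurable_inc: "0 \<le> a \<Longrightarrow> 0 \<le> b \<Longrightarrow> inc j a b \<in> borel_measurable M"
  unfolding inc_def[abs_def] using brownian[of j] by (auto simp: brownian_motion_def intro!: borel_measurable_diff)

lemma distributed_inc:
  "0 \<le> a \<Longrightarrow> a < b \<Longrightarrow> distributed M lborel (inc j a b) (normal_density 0 (sqrt (b - a)))"
  using brownian[of j] by (simp add: brownian_motion_def inc_def[abs_def])

lemma indep_inc_modes:
  assumes "\<And>j. 0 \<le> a j" "\<And>j. 0 \<le> b j"
  shows "indep_vars (\<lambda>_. borel) (\<lambda>j. inc j (a j) (b j)) UNIV"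
proof -
  have "indep_vars (\<lambda>j. \<Pi>\<^sub>M t\<in>{0..}. borel) (\<lambda>j \<omega>. \<lambda>t\<in>{0..}. \<beta> j t \<omega>) UNIV"
    using noise by (simp add: independent_brownian_motions_def)
  then have "indep_vars (\<lambda>_. borel) (\<lambda>j \<omega>. (\<lambda>p. p (b j) - p (a j)) (\<lambda>t\<in>{0..}. \<beta> j t \<omega>)) UNIV"
    by (rule indep_vars_compose2) (use assms in auto)
  then show ?thesis using assms by (simp add: inc_def[abs_def])
qed

lemma inc_moments:
  assumes "0 \<le> a" "a \<le> b"
  shows "integrable M (\<lambda>\<omega>. (inc j a b \<omega>)\<^sup>2)" "expectation (\<lambda>\<omega>. (inc j a b \<omega>)\<^sup>2) = b - a"
    "integrable M (inc j a b)" "expectation (inc j a b) = 0"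
proof -
  have "integrable M (\<lambda>\<omega>. (inc j a b \<omega>)\<^sup>2) \<and> expectation (\<lambda>\<omega>. (inc j a b \<omega>)\<^sup>2) = b - a
    \<and> integrable M (inc j a b) \<and> expectation (inc j a b) = 0"
  proof (cases "a = b")
    case True
    then show ?thesis by (simp add: inc_def[abs_def])
  next
    case False
    then have ab: "a < b" using assms by simp
    note D = distributed_inc[OF assms(1) ab, of j]
    have s: "0 < sqrt (b - a)" using ab by simp
    have "integrable lborel (\<lambda>x. normal_density 0 (sqrt (b - a)) x * x\<^sup>2)"
      "(\<integral>x. normal_density 0 (sqrt (b - a)) x * x\<^sup>2 \<partial>lborel) = b - a"
      using integrable_normal_moment[OF s, of 0 2] integral_normal_moment_even[OF s, of 0 1] ab
      by (simp_all add: power2_eq_square)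
    moreover have "integrable lborel (\<lambda>x. normal_density 0 (sqrt (b - a)) x * x)"
      "(\<integral>x. normal_density 0 (sqrt (b - a)) x * x \<partial>lborel) = 0"
      using integrable_normal_moment_nz_1[OF s, of 0] integral_normal_moment_nz_1[OF s, of 0] by auto
    ultimately show ?thesis
      using distributed_integrable[OF D, of "\<lambda>x. x\<^sup>2"] distributed_integral[OF D, of "\<lambda>x. x\<^sup>2"]
        distributed_integrable[OF D, of "\<lambda>x. x"] distributed_integral[OF D, of "\<lambda>x. x"] by simp
  qed
  then show "integrable M (\<lambda>\<omega>. (inc j a b \<omega>)\<^sup>2)" "expectation (\<lambda>\<omega>. (inc j a b \<omega>)\<^sup>2) = b - a"
    "integrable M (inc j a b)" "expectation (inc j a b) = 0" by auto
qed

text \<open>For one motion, polarisation writes the product of two increments through squares of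
  single increments, whatever the overlap of the intervals, so a common refinement is never formed.
  For different motions the mean is zero by independence.\<close>

lemma inc_covariance:
  assumes "0 \<le> a" "a \<le> b" "0 \<le> c" "c \<le> d"
  shows "integrable M (\<lambda>\<omega>. inc i a b \<omega> * inc j c d \<omega>)"
    "expectation (\<lambda>\<omega>. inc i a b \<omega> * inc j c d \<omega>)
      = (if i = j then (\<integral>s. indicator {a<..b} s * indicator {c<..d} s \<partial>lborel) else 0)"
proof -
  have [measurable]: "inc i a b \<in> borel_measurable M" "inc j c d \<in> borel_measurable M"
    using assms by (auto intro: measurable_inc)
  show i: "integrable M (\<lambda>\<omega>. inc i a b \<omega> * inc j c d \<omega>)"
  proof -
    show ?thesis
    proof (rule Bochner_Integration.integrable_bound)
      show "integrable M (\<lambda>\<omega>. (inc i a b \<omega>)\<^sup>2 + (inc j c d \<omega>)\<^sup>2)"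
        using assms by (intro Bochner_Integration.integrable_add inc_moments)
      have "\<bar>x * y\<bar> \<le> x\<^sup>2 + y\<^sup>2" for x y :: real
      proof -
        have "2 * (\<bar>x\<bar> * \<bar>y\<bar>) \<le> x\<^sup>2 + y\<^sup>2"
          using sum_squares_bound[of "\<bar>x\<bar>" "\<bar>y\<bar>"] by (simp add: mult.assoc)
        moreover have "0 \<le> \<bar>x\<bar> * \<bar>y\<bar>" by simp
        ultimately show ?thesis unfolding abs_mult by linarith
      qed
      then show "AE \<omega> in M. norm (inc i a b \<omega> * inc j c d \<omega>) \<le> norm ((inc i a b \<omega>)\<^sup>2 + (inc j c d \<omega>)\<^sup>2)"
        by (intro AE_I2) (simp add: order_trans[OF _ abs_ge_self])
    qed measurable
  qed
  show "expectation (\<lambda>\<omega>. inc i a b \<omega> * inc j c d \<omega>)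
      = (if i = j then (\<integral>s. indicator {a<..b} s * indicator {c<..d} s \<partial>lborel) else 0)"
  proof (cases "i = j")
    case True
    have "integrable M (\<lambda>\<omega>. (\<beta> i p \<omega> - \<beta> i q \<omega>)\<^sup>2) \<and>
      expectation (\<lambda>\<omega>. (\<beta> i p \<omega> - \<beta> i q \<omega>)\<^sup>2) = \<bar>p - q\<bar>" if "0 \<le> p" "0 \<le> q" for p q
    proof (cases "q \<le> p")
      case True
      then show ?thesis using inc_moments[of q p i] that by (simp add: inc_def)
    next
      case False
      then show ?thesis using inc_moments[of p q i] that by (simp add: inc_def power2_commute)
    qed
    then have sq: "integrable M (\<lambda>\<omega>. (\<beta> i p \<omega> - \<beta> i q \<omega>)\<^sup>2)"
      "expectation (\<lambda>\<omega>. (\<beta> i p \<omega> - \<beta> i q \<omega>)\<^sup>2) = \<bar>p - q\<bar>" if "0 \<le> p" "0 \<le> q" for p q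
      using that by auto
    have eq: "inc i a b \<omega> * inc i c d \<omega> = ((\<beta> i b \<omega> - \<beta> i c \<omega>)\<^sup>2 + (\<beta> i a \<omega> - \<beta> i d \<omega>)\<^sup>2
        - (\<beta> i b \<omega> - \<beta> i d \<omega>)\<^sup>2 - (\<beta> i a \<omega> - \<beta> i c \<omega>)\<^sup>2) / 2" for \<omega>
      by (simp add: inc_def power2_eq_square algebra_simps)
    then have "expectation (\<lambda>\<omega>. inc i a b \<omega> * inc i c d \<omega>) = (\<bar>b - c\<bar> + \<bar>a - d\<bar> - \<bar>b - d\<bar> - \<bar>a - c\<bar>) / 2"
      unfolding eq using assms by (simp add: sq)
    also have "\<dots> = measure lborel {max a c<..min b d}"
    proof (cases "max a c \<le> min b d")
      case True
      then show ?thesis using assms by (auto simp: max_def min_def abs_if split: if_splits)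
    next
      case False
      then have "{max a c<..min b d} = {}" by auto
      then show ?thesis using False assms by (auto simp: max_def min_def abs_if split: if_splits)
    qed
    also have "\<dots> = (\<integral>s. indicator {max a c<..min b d} s \<partial>lborel)" by simp
    also have "\<dots> = (\<integral>s. indicator {a<..b} s * indicator {c<..d} s \<partial>lborel)"
      by (intro Bochner_Integration.integral_cong) (auto simp: indicator_def)
    finally show ?thesis using True by simp
  next
    case False
    \<comment> \<open>Motion \<open>i\<close> gets the interval \<open>(a, b]\<close> and every
      other motion gets \<open>(c, d]\<close>, so that one independent family covers both
      factors.\<close>
    define a' b' where "a' k = (if k = i then a else c)" and "b' k = (if k = i then b else d)" for k
    have "indep_vars (\<lambda>_. borel) (\<lambda>k. inc k (a' k) (b' k)) {i, j}"
      by (rule indep_vars_subset[OF indep_inc_modes]) (use assms in \<open>auto simp: a'_def b'_def\<close>)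
    then have "expectation (\<lambda>\<omega>. \<Prod>k\<in>{i, j}. inc k (a' k) (b' k) \<omega>) = (\<Prod>k\<in>{i, j}. expectation (inc k (a' k) (b' k)))"
      by (intro indep_vars_lebesgue_integral) (use assms in \<open>auto simp: a'_def b'_def intro: inc_moments\<close>)
    then show ?thesis using False assms by (simp add: a'_def b'_def inc_moments)
  qed
qed

text \<open>\<open>step_pair n X f\<close>: \<open>X\<close> is the stochastic integral of the step functions \<open>f i\<close>, \<open>i < n\<close>,
  against the first \<open>n\<close> Brownian motions.\<close>

inductive step_pair :: "nat \<Rightarrow> ('w \<Rightarrow> l2) \<Rightarrow> (nat \<Rightarrow> real \<Rightarrow> l2) \<Rightarrow> bool" for n where
  zero: "step_pair n (\<lambda>\<omega>. 0) (\<lambda>i s. 0)"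
| step: "step_pair n X f \<Longrightarrow> j < n \<Longrightarrow> 0 \<le> a \<Longrightarrow> a \<le> b \<Longrightarrow>
    step_pair n (\<lambda>\<omega>. X \<omega> + inc j a b \<omega> *\<^sub>R c) (\<lambda>i s. f i s + (if i = j then indicator {a<..b} s *\<^sub>R c else 0))"

lemma step_pair_mono: "step_pair n X f \<Longrightarrow> n \<le> m \<Longrightarrow> step_pair m X f"
  by (induction rule: step_pair.induct) (auto intro: step_pair.intros)

lemma step_pair_add:
  "step_pair n Y g \<Longrightarrow> step_pair n X f \<Longrightarrow> step_pair n (\<lambda>\<omega>. X \<omega> + Y \<omega>) (\<lambda>i s. f i s + g i s)"
proof (induction rule: step_pair.induct)
  case (step Y g j a b c)
  from step_pair.step[OF step.IH[OF step.prems] step.hyps(2-4), of c]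
  show ?case by (simp add: add.assoc)
qed simp

lemma step_pair_uminus: "step_pair n X f \<Longrightarrow> step_pair n (\<lambda>\<omega>. - X \<omega>) (\<lambda>i s. - f i s)"
proof (induction rule: step_pair.induct)
  case (step X f j a b c)
  from step_pair.step[OF step.IH step.hyps(2-4), of "- c"]
  have "step_pair n (\<lambda>\<omega>. - X \<omega> + inc j a b \<omega> *\<^sub>R - c)
    (\<lambda>i s. - f i s + (if i = j then indicat_real {a<..b} s *\<^sub>R - c else 0))" .
  moreover have "(\<lambda>i s. - f i s + (if i = j then indicat_real {a<..b} s *\<^sub>R - c else 0))
      = (\<lambda>i s. - (f i s + (if i = j then indicat_real {a<..b} s *\<^sub>R c else 0)))"
    by (auto simp: fun_eq_iff)
  ultimately show ?case by simp
qed (simp add: step_pair.zero)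

lemma step_pair_diff:
  "step_pair n X f \<Longrightarrow> step_pair n Y g \<Longrightarrow> step_pair n (\<lambda>\<omega>. X \<omega> - Y \<omega>) (\<lambda>i s. f i s - g i s)"
  using step_pair_add[OF step_pair_uminus, of n Y g X f] by simp

lemma step_pair_sum:
  fixes m :: nat
  shows "(\<And>j. j < m \<Longrightarrow> step_pair n (X j) (f j)) \<Longrightarrow> step_pair n (\<lambda>\<omega>. \<Sum>j<m. X j \<omega>) (\<lambda>i s. \<Sum>j<m. f j i s)"
proof (induction m)
  case (Suc m)
  have "step_pair n (\<lambda>\<omega>. (\<Sum>j<m. X j \<omega>) + X m \<omega>) (\<lambda>i s. (\<Sum>j<m. f j i s) + f m i s)"
    by (rule step_pair_add) (use Suc in auto)
  then show ?case by simp
qed (simp add: step_pair.zero)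

lemma step_pair_single:
  assumes "j < n" "0 \<le> a" "a \<le> b"
  shows "step_pair n (\<lambda>\<omega>. inc j a b \<omega> *\<^sub>R c) (\<lambda>i s. if i = j then indicator {a<..b} s *\<^sub>R c else 0)"
  using step_pair.step[OF step_pair.zero assms, of c] by simp

lemma step_pair_step_integral:
  assumes "j < n" "mono \<tau>" "0 \<le> \<tau> 0"
  shows "step_pair n (step_integral (\<beta> j) m \<tau> c) (\<lambda>i s. if i = j then step_fun m \<tau> c s else 0)"
proof -
  have "0 \<le> \<tau> k" for k using assms(2,3) monoD[OF assms(2), of 0 k] by simp
  then have "step_pair n (\<lambda>\<omega>. \<Sum>k<m. inc j (\<tau> k) (\<tau> (Suc k)) \<omega> *\<^sub>R c k)
    (\<lambda>i s. \<Sum>k<m. if i = j then indicator {\<tau> k<..\<tau> (Suc k)} s *\<^sub>R c k else 0)"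
    using assms by (intro step_pair_sum step_pair_single) (auto intro: monoD)
  moreover have "(\<lambda>i s. \<Sum>k<m. if i = j then indicat_real {\<tau> k<..\<tau> (Suc k)} s *\<^sub>R c k else 0)
      = (\<lambda>i s. if i = j then step_fun m \<tau> c s else 0)"
    by (auto simp: step_fun_def fun_eq_iff)
  ultimately show ?thesis by (simp add: step_integral_def[abs_def] inc_def)
qed

text \<open>The isometry in polarised form: both sides are bilinear, so a double induction reduces
  it to two increments with constant coefficients.\<close>

lemma step_pair_inner:
  assumes "step_pair n X f" "step_pair n Y g"
  shows "integrable M (\<lambda>\<omega>. inner (X \<omega>) (Y \<omega>)) \<and> (\<forall>i. integrable lborel (\<lambda>s. inner (f i s) (g i s))) \<and>
    expectation (\<lambda>\<omega>. inner (X \<omega>) (Y \<omega>)) = (\<Sum>i<n. \<integral>s. inner (f i s) (g i s) \<partial>lborel)"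
  using assms(1)
proof (induction rule: step_pair.induct)
  case (step X f j a b c)
  let ?I = "\<lambda>i s. if i = j then indicat_real {a<..b} s *\<^sub>R c else 0"
  have "integrable M (\<lambda>\<omega>. inner (inc j a b \<omega> *\<^sub>R c) (Y \<omega>)) \<and>
      (\<forall>i. integrable lborel (\<lambda>s. inner (?I i s) (g i s))) \<and>
      expectation (\<lambda>\<omega>. inner (inc j a b \<omega> *\<^sub>R c) (Y \<omega>)) = (\<Sum>i<n. \<integral>s. inner (?I i s) (g i s) \<partial>lborel)"
    using assms(2)
  proof (induction rule: step_pair.induct)
    case (step Y g j' a' b' c')
    let ?J = "\<lambda>i s. if i = j' then indicat_real {a'<..b'} s *\<^sub>R c' else 0"
    have ii: "integrable lborel (\<lambda>s. indicat_real {a<..b} s * indicat_real {a'<..b'} s)"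
      by (rule Bochner_Integration.integrable_bound[of lborel "indicat_real {a<..b}"])
        (use \<open>a \<le> b\<close> in \<open>auto simp: indicator_def intro!: integrable_real_indicator\<close>)
    have I: "(\<lambda>s. inner (?I i s) (?J i s)) = (\<lambda>s. (if i = j \<and> i = j' then
        (indicat_real {a<..b} s * indicat_real {a'<..b'} s) * inner c c' else 0))" for i
      by (auto simp: fun_eq_iff)
    have 1: "integrable M (\<lambda>\<omega>. inner (inc j a b \<omega> *\<^sub>R c) (inc j' a' b' \<omega> *\<^sub>R c'))"
      "expectation (\<lambda>\<omega>. inner (inc j a b \<omega> *\<^sub>R c) (inc j' a' b' \<omega> *\<^sub>R c'))
        = (if j = j' then (\<integral>s. indicator {a<..b} s * indicator {a'<..b'} s \<partial>lborel) else 0) * inner c c'"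
      using inc_covariance[OF \<open>0 \<le> a\<close> \<open>a \<le> b\<close> step.hyps(3,4), of j j']
      by (simp_all add: mult.assoc[symmetric] mult.commute[of "inc j' a' b' _"])
    have 2: "integrable lborel (\<lambda>s. inner (?I i s) (?J i s))" for i
      unfolding I using ii by (cases "i = j"; cases "j = j'") simp_all
    have "(\<integral>s. inner (?I i s) (?J i s) \<partial>lborel)
        = (if i = j then (if j = j' then (\<integral>s. indicator {a<..b} s * indicator {a'<..b'} s \<partial>lborel) else 0) * inner c c' else 0)" for i
      unfolding I by auto
    then have 3: "(\<Sum>i<n. \<integral>s. inner (?I i s) (?J i s) \<partial>lborel)
        = (if j = j' then (\<integral>s. indicator {a<..b} s * indicator {a'<..b'} s \<partial>lborel) else 0) * inner c c'"
      using \<open>j < n\<close> by simp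
    show ?case
      using step.IH 1 2 3 by (simp add: inner_add_right sum.distrib)
  qed simp
  then show ?case using step.IH by (simp add: inner_add_left sum.distrib)
qed simp

lemma step_pair_isometry:
  assumes "step_pair n X f"
  shows "(\<integral>\<^sup>+\<omega>. ennreal ((norm (X \<omega>))\<^sup>2) \<partial>M) = (\<Sum>i<n. \<integral>\<^sup>+s. ennreal ((norm (f i s))\<^sup>2) \<partial>lborel)"
proof -
  note I = step_pair_inner[OF assms assms]
  have "(\<integral>\<^sup>+\<omega>. ennreal ((norm (X \<omega>))\<^sup>2) \<partial>M) = ennreal (expectation (\<lambda>\<omega>. inner (X \<omega>) (X \<omega>)))"
    unfolding power2_norm_eq_inner using I by (intro nn_integral_eq_integral) auto
  also have "\<dots> = ennreal (\<Sum>i<n. \<integral>s. inner (f i s) (f i s) \<partial>lborel)" using I by simp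
  also have "\<dots> = (\<Sum>i<n. ennreal (\<integral>s. inner (f i s) (f i s) \<partial>lborel))"
    by (rule sum_ennreal[symmetric]) (auto intro: Bochner_Integration.integral_nonneg)
  also have "\<dots> = (\<Sum>i<n. \<integral>\<^sup>+s. ennreal ((norm (f i s))\<^sup>2) \<partial>lborel)"
    unfolding power2_norm_eq_inner using I by (intro sum.cong refl nn_integral_eq_integral[symmetric]) auto
  finally show ?thesis .
qed

lemma step_pair_measurable:
  assumes "step_pair n X f"
  shows "weakly_measurable M X" "weakly_measurable borel (f i)"
proof -
  have "weakly_measurable M X \<and> (\<forall>i. weakly_measurable borel (f i))"
    using assms
  proof (induction rule: step_pair.induct)
    case (step X f j a b c)
    have "weakly_measurable borel (\<lambda>s. if i = j then indicat_real {a<..b} s *\<^sub>R c else 0)" for i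
      by (cases "i = j") (auto intro!: weakly_measurable_scaleR weakly_measurable_const)
    then show ?case
      using step by (auto intro!: weakly_measurable_add weakly_measurable_scaleR measurable_inc weakly_measurable_const)
  qed (auto intro: weakly_measurable_const)
  then show "weakly_measurable M X" "weakly_measurable borel (f i)" by auto
qed

end

section \<open>From step functions to cylindrical integrals\<close>

lemma norm_sq_sum2_le: "(norm (x + y))\<^sup>2 \<le> 2 * (norm x)\<^sup>2 + 2 * (norm (y::'a::real_normed_vector))\<^sup>2"
proof -
  have "(norm (x + y))\<^sup>2 \<le> (norm x + norm y)\<^sup>2"
    by (intro power_mono norm_triangle_ineq norm_ge_zero)
  also have "\<dots> \<le> 2 * (norm x)\<^sup>2 + 2 * (norm y)\<^sup>2"
    using sum_squares_bound[of "norm x" "norm y"] by (simp add: power2_sum)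
  finally show ?thesis .
qed

lemma nn_integral_norm_sq_add_le:
  fixes e :: "nat \<Rightarrow> 'a::real_inner" and X Y :: "'w \<Rightarrow> 'a"
  assumes e: "orthonormal_basis e" and X: "weakly_measurable M X" and Y: "weakly_measurable M Y"
  shows "(\<integral>\<^sup>+\<omega>. ennreal ((norm (X \<omega> + Y \<omega>))\<^sup>2) \<partial>M)
    \<le> 2 * (\<integral>\<^sup>+\<omega>. ennreal ((norm (X \<omega>))\<^sup>2) \<partial>M) + 2 * (\<integral>\<^sup>+\<omega>. ennreal ((norm (Y \<omega>))\<^sup>2) \<partial>M)"
proof -
  note [measurable] = weakly_measurable_norm[OF e X] weakly_measurable_norm[OF e Y]
  have "(\<integral>\<^sup>+\<omega>. ennreal ((norm (X \<omega> + Y \<omega>))\<^sup>2) \<partial>M)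
    \<le> (\<integral>\<^sup>+\<omega>. 2 * ennreal ((norm (X \<omega>))\<^sup>2) + 2 * ennreal ((norm (Y \<omega>))\<^sup>2) \<partial>M)"
  proof (rule nn_integral_mono)
    fix \<omega>
    have "ennreal ((norm (X \<omega> + Y \<omega>))\<^sup>2) \<le> ennreal (2 * (norm (X \<omega>))\<^sup>2 + 2 * (norm (Y \<omega>))\<^sup>2)"
      by (intro ennreal_leI norm_sq_sum2_le)
    then show "ennreal ((norm (X \<omega> + Y \<omega>))\<^sup>2) \<le> 2 * ennreal ((norm (X \<omega>))\<^sup>2) + 2 * ennreal ((norm (Y \<omega>))\<^sup>2)"
      by (simp add: ennreal_plus ennreal_mult)
  qed
  then show ?thesis by (simp add: nn_integral_add nn_integral_cmult)
qed

lemma nn_integral_norm_sq_sum_le: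
  fixes e :: "nat \<Rightarrow> 'a::real_inner" and X :: "nat \<Rightarrow> 'w \<Rightarrow> 'a"
  assumes e: "orthonormal_basis e" and X: "\<And>j. j < n \<Longrightarrow> weakly_measurable M (X j)"
  shows "(\<integral>\<^sup>+\<omega>. ennreal ((norm (\<Sum>j<n. X j \<omega>))\<^sup>2) \<partial>M)
    \<le> of_nat n * (\<Sum>j<n. \<integral>\<^sup>+\<omega>. ennreal ((norm (X j \<omega>))\<^sup>2) \<partial>M)"
proof -
  have [measurable]: "j < n \<Longrightarrow> (\<lambda>\<omega>. norm (X j \<omega>)) \<in> borel_measurable M" for j
    by (rule weakly_measurable_norm[OF e X])
  have "(\<integral>\<^sup>+\<omega>. ennreal ((norm (\<Sum>j<n. X j \<omega>))\<^sup>2) \<partial>M)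
    \<le> (\<integral>\<^sup>+\<omega>. of_nat n * (\<Sum>j<n. ennreal ((norm (X j \<omega>))\<^sup>2)) \<partial>M)"
  proof (rule nn_integral_mono)
    fix \<omega>
    have "(norm (\<Sum>j<n. X j \<omega>))\<^sup>2 \<le> (\<Sum>j<n. norm (X j \<omega>))\<^sup>2"
      by (intro power_mono norm_sum norm_ge_zero)
    also have "\<dots> \<le> real n * (\<Sum>j<n. (norm (X j \<omega>))\<^sup>2)"
      using sum_squared_le_sum_of_squares[of "\<lambda>j. norm (X j \<omega>)" "{..<n}"] by (simp add: mult.commute)
    finally have "ennreal ((norm (\<Sum>j<n. X j \<omega>))\<^sup>2) \<le> ennreal (real n * (\<Sum>j<n. (norm (X j \<omega>))\<^sup>2))"
      by (rule ennreal_leI)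
    then show "ennreal ((norm (\<Sum>j<n. X j \<omega>))\<^sup>2) \<le> of_nat n * (\<Sum>j<n. ennreal ((norm (X j \<omega>))\<^sup>2))"
      by (simp add: ennreal_mult sum_nonneg sum_ennreal ennreal_of_nat_eq_real_of_nat)
  qed
  also have "\<dots> = of_nat n * (\<Sum>j<n. \<integral>\<^sup>+\<omega>. ennreal ((norm (X j \<omega>))\<^sup>2) \<partial>M)"
    by (subst nn_integral_cmult, measurable) (subst nn_integral_sum, auto)
  finally show ?thesis .
qed

lemma step_fun_outside:
  assumes "mono \<tau>" "\<tau> 0 = 0" "\<tau> n = t" "s \<notin> {0..t}"
  shows "step_fun n \<tau> c s = 0"
  unfolding step_fun_def
proof (rule sum.neutral, intro ballI)
  fix k assume "k \<in> {..<n}"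
  then have "\<tau> (Suc k) \<le> t" "0 \<le> \<tau> k"
    using monoD[OF assms(1), of "Suc k" n] monoD[OF assms(1), of 0 k] assms by auto
  then show "indicat_real {\<tau> k<..\<tau> (Suc k)} s *\<^sub>R c k = 0"
    using assms(4) by (auto simp: indicator_def)
qed

context white_noise
begin

text \<open>The integrand is extended by zero outside \<open>[0, t]\<close>. The step functions
  vanish there too, so all comparisons can take place on the whole line.\<close>

lemma wiener_integral_step_pairs:
  assumes I: "has_wiener_integral M (\<beta> j) t f I" and "j < n"
  obtains X :: "nat \<Rightarrow> 'w \<Rightarrow> l2" and F where
    "\<And>m. step_pair n (X m) (\<lambda>i s. if i = j then F m s else 0)"
    "(\<lambda>m. \<integral>\<^sup>+s. ennreal ((norm (F m s - indicator {0..t} s *\<^sub>R f s))\<^sup>2) \<partial>lborel) \<longlonglongrightarrow> 0"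
    "(\<lambda>m. \<integral>\<^sup>+\<omega>. ennreal ((norm (X m \<omega> - I \<omega>))\<^sup>2) \<partial>M) \<longlonglongrightarrow> 0"
proof -
  from I obtain k \<tau> c where
    \<tau>: "\<And>m. mono (\<tau> m) \<and> \<tau> m 0 = 0 \<and> \<tau> m (k m) = t"
    and 1: "(\<lambda>m. \<integral>\<^sup>+s\<in>{0..t}. ennreal ((norm (step_fun (k m) (\<tau> m) (c m) s - f s))\<^sup>2) \<partial>lborel) \<longlonglongrightarrow> 0"
    and 2: "(\<lambda>m. \<integral>\<^sup>+\<omega>. ennreal ((norm (step_integral (\<beta> j) (k m) (\<tau> m) (c m) \<omega> - I \<omega>))\<^sup>2) \<partial>M) \<longlonglongrightarrow> 0"
    unfolding has_wiener_integral_def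
    by (elim conjE exE) (rule that, erule spec, assumption, assumption)
  show ?thesis
  proof (rule that[of "\<lambda>m. step_integral (\<beta> j) (k m) (\<tau> m) (c m)" "\<lambda>m. step_fun (k m) (\<tau> m) (c m)"])
    show "step_pair n (step_integral (\<beta> j) (k m) (\<tau> m) (c m))
        (\<lambda>i s. if i = j then step_fun (k m) (\<tau> m) (c m) s else 0)" for m
      using \<tau>[of m] \<open>j < n\<close> by (intro step_pair_step_integral) auto
    have "(\<integral>\<^sup>+s\<in>{0..t}. ennreal ((norm (step_fun (k m) (\<tau> m) (c m) s - f s))\<^sup>2) \<partial>lborel)
        = (\<integral>\<^sup>+s. ennreal ((norm (step_fun (k m) (\<tau> m) (c m) s - indicator {0..t} s *\<^sub>R f s))\<^sup>2) \<partial>lborel)" for m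
    proof (rule nn_integral_cong)
      fix s
      show "ennreal ((norm (step_fun (k m) (\<tau> m) (c m) s - f s))\<^sup>2) * indicator {0..t} s
          = ennreal ((norm (step_fun (k m) (\<tau> m) (c m) s - indicator {0..t} s *\<^sub>R f s))\<^sup>2)"
        using \<tau>[of m] step_fun_outside[of "\<tau> m" "k m" t s "c m"] by (cases "s \<in> {0..t}") auto
    qed
    with 1 show "(\<lambda>m. \<integral>\<^sup>+s. ennreal ((norm (step_fun (k m) (\<tau> m) (c m) s - indicator {0..t} s *\<^sub>R f s))\<^sup>2) \<partial>lborel) \<longlonglongrightarrow> 0"
      by simp
  qed (rule 2)
qed

text \<open>The isometry is used for step functions only. Approximating step functions are inserted
  once between the integrals and once between the integrands, each time at the price of a factor
  \<open>2\<close>, and their own errors disappear in the limit. This explains the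
  \<open>4\<close>.\<close>

lemma wiener_integrals_step_error:
  assumes e: "orthonormal_basis (e :: nat \<Rightarrow> l2)"
    and I: "\<And>j. has_wiener_integral M (\<beta> j) t (f j) (J j)" and Y: "step_pair n Y g"
  shows "(\<integral>\<^sup>+\<omega>. ennreal ((norm ((\<Sum>j<n. J j \<omega>) - Y \<omega>))\<^sup>2) \<partial>M)
    \<le> 4 * (\<Sum>j<n. \<integral>\<^sup>+s. ennreal ((norm (indicator {0..t} s *\<^sub>R f j s - g j s))\<^sup>2) \<partial>lborel)"
proof -
  define P where "P j X F \<longleftrightarrow> (\<forall>m. step_pair n (X m) (\<lambda>i s. if i = j then F m s else 0)) \<and>
    (\<lambda>m. \<integral>\<^sup>+s. ennreal ((norm (F m s - indicator {0..t} s *\<^sub>R f j s))\<^sup>2) \<partial>lborel) \<longlonglongrightarrow> 0 \<and>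
    (\<lambda>m. \<integral>\<^sup>+\<omega>. ennreal ((norm (X m \<omega> - J j \<omega>))\<^sup>2) \<partial>M) \<longlonglongrightarrow> 0" for j X F
  have "\<exists>X F. P j X F" if j: "j < n" for j
  proof (rule wiener_integral_step_pairs[OF I j])
    fix X F
    assume "\<And>m. step_pair n (X m) (\<lambda>i s. if i = j then F m s else 0)"
      "(\<lambda>m. \<integral>\<^sup>+s. ennreal ((norm (F m s - indicator {0..t} s *\<^sub>R f j s))\<^sup>2) \<partial>lborel) \<longlonglongrightarrow> 0"
      "(\<lambda>m. \<integral>\<^sup>+\<omega>. ennreal ((norm (X m \<omega> - J j \<omega>))\<^sup>2) \<partial>M) \<longlonglongrightarrow> 0"
    then have "P j X F" unfolding P_def by (intro conjI allI)
    then show ?thesis by blast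
  qed
  then obtain X F where "\<And>j. j < n \<Longrightarrow> P j (X j) (F j)" by metis
  then have XF: "\<And>j m. j < n \<Longrightarrow> step_pair n (X j m) (\<lambda>i s. if i = j then F j m s else 0)"
    and Flim: "\<And>j. j < n \<Longrightarrow> (\<lambda>m. \<integral>\<^sup>+s. ennreal ((norm (F j m s - indicator {0..t} s *\<^sub>R f j s))\<^sup>2) \<partial>lborel) \<longlonglongrightarrow> 0"
    and Xlim: "\<And>j. j < n \<Longrightarrow> (\<lambda>m. \<integral>\<^sup>+\<omega>. ennreal ((norm (X j m \<omega> - J j \<omega>))\<^sup>2) \<partial>M) \<longlonglongrightarrow> 0"
    unfolding P_def by simp_all
  have "f j \<in> borel_measurable borel" "J j \<in> borel_measurable M" for j
    using I[of j] by (simp_all add: has_wiener_integral_def)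
  then have wJ: "weakly_measurable M (J j)" and wf: "weakly_measurable borel (\<lambda>s. indicat_real {0..t} s *\<^sub>R f j s)" for j
    by (auto intro: weakly_measurableI weakly_measurable_scaleR[OF _ weakly_measurableI])
  have wX: "weakly_measurable M (X j m)" if "j < n" for j m
    by (rule step_pair_measurable(1)[OF XF[OF that]])
  have wF: "weakly_measurable borel (F j m)" if "j < n" for j m
    using step_pair_measurable(2)[OF XF[OF that], where i = j] by simp
  have wY: "weakly_measurable M Y" "weakly_measurable borel (g i)" for i
    using step_pair_measurable[OF Y] by auto
  have SX: "step_pair n (\<lambda>\<omega>. \<Sum>j<n. X j m \<omega>) (\<lambda>i s. if i < n then F i m s else 0)" for m
  proof -
    have "step_pair n (\<lambda>\<omega>. \<Sum>j<n. X j m \<omega>) (\<lambda>i s. \<Sum>j<n. if i = j then F j m s else 0)"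
      by (intro step_pair_sum XF)
    then show ?thesis by (simp cong: if_cong)
  qed
  define d where "d j = (\<integral>\<^sup>+s. ennreal ((norm (indicator {0..t} s *\<^sub>R f j s - g j s))\<^sup>2) \<partial>lborel)" for j
  let ?LHS = "\<integral>\<^sup>+\<omega>. ennreal ((norm ((\<Sum>j<n. J j \<omega>) - Y \<omega>))\<^sup>2) \<partial>M"
  define a where "a m = 2 * (of_nat n * (\<Sum>j<n. \<integral>\<^sup>+\<omega>. ennreal ((norm (X j m \<omega> - J j \<omega>))\<^sup>2) \<partial>M))
    + 4 * (\<Sum>j<n. \<integral>\<^sup>+s. ennreal ((norm (F j m s - indicator {0..t} s *\<^sub>R f j s))\<^sup>2) \<partial>lborel)" for m
  have le: "?LHS \<le> a m + 4 * (\<Sum>j<n. d j)" for m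
  proof -
    have 1: "?LHS \<le> 2 * (\<integral>\<^sup>+\<omega>. ennreal ((norm ((\<Sum>j<n. X j m \<omega>) - Y \<omega>))\<^sup>2) \<partial>M)
        + 2 * (\<integral>\<^sup>+\<omega>. ennreal ((norm (\<Sum>j<n. J j \<omega> - X j m \<omega>))\<^sup>2) \<partial>M)"
    proof -
      have "?LHS = (\<integral>\<^sup>+\<omega>. ennreal ((norm (((\<Sum>j<n. X j m \<omega>) - Y \<omega>) + (\<Sum>j<n. J j \<omega> - X j m \<omega>)))\<^sup>2) \<partial>M)"
        by (simp add: sum_subtractf)
      also have "\<dots> \<le> 2 * (\<integral>\<^sup>+\<omega>. ennreal ((norm ((\<Sum>j<n. X j m \<omega>) - Y \<omega>))\<^sup>2) \<partial>M)
        + 2 * (\<integral>\<^sup>+\<omega>. ennreal ((norm (\<Sum>j<n. J j \<omega> - X j m \<omega>))\<^sup>2) \<partial>M)"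
        by (rule nn_integral_norm_sq_add_le[OF e])
          (auto intro!: weakly_measurable_diff weakly_measurable_sum wX wY wJ)
      finally show ?thesis .
    qed
    have 2: "(\<integral>\<^sup>+\<omega>. ennreal ((norm (\<Sum>j<n. J j \<omega> - X j m \<omega>))\<^sup>2) \<partial>M)
        \<le> of_nat n * (\<Sum>j<n. \<integral>\<^sup>+\<omega>. ennreal ((norm (X j m \<omega> - J j \<omega>))\<^sup>2) \<partial>M)"
      unfolding norm_minus_commute[of "X _ m _"]
      by (rule nn_integral_norm_sq_sum_le[OF e]) (auto intro!: weakly_measurable_diff wX wJ)
    have 3: "(\<integral>\<^sup>+\<omega>. ennreal ((norm ((\<Sum>j<n. X j m \<omega>) - Y \<omega>))\<^sup>2) \<partial>M)
        = (\<Sum>j<n. \<integral>\<^sup>+s. ennreal ((norm (F j m s - g j s))\<^sup>2) \<partial>lborel)"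
      by (subst step_pair_isometry[OF step_pair_diff[OF SX Y]]) simp
    have 4: "(\<Sum>j<n. \<integral>\<^sup>+s. ennreal ((norm (F j m s - g j s))\<^sup>2) \<partial>lborel)
      \<le> (\<Sum>j<n. 2 * (\<integral>\<^sup>+s. ennreal ((norm (F j m s - indicator {0..t} s *\<^sub>R f j s))\<^sup>2) \<partial>lborel) + 2 * d j)"
    proof (rule sum_mono)
      fix j assume "j \<in> {..<n}"
      then have "weakly_measurable lborel (\<lambda>s. F j m s - indicator {0..t} s *\<^sub>R f j s)"
        "weakly_measurable lborel (\<lambda>s. indicator {0..t} s *\<^sub>R f j s - g j s)"
        using weakly_measurable_diff[OF wF wf, of j m j] weakly_measurable_diff[OF wf wY(2), of j j]
        by (simp_all add: weakly_measurable_def)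
      from nn_integral_norm_sq_add_le[OF e this]
      show "(\<integral>\<^sup>+s. ennreal ((norm (F j m s - g j s))\<^sup>2) \<partial>lborel)
        \<le> 2 * (\<integral>\<^sup>+s. ennreal ((norm (F j m s - indicator {0..t} s *\<^sub>R f j s))\<^sup>2) \<partial>lborel) + 2 * d j"
        by (simp add: d_def)
    qed
    have "?LHS \<le> 2 * (\<Sum>j<n. 2 * (\<integral>\<^sup>+s. ennreal ((norm (F j m s - indicator {0..t} s *\<^sub>R f j s))\<^sup>2) \<partial>lborel) + 2 * d j)
      + 2 * (of_nat n * (\<Sum>j<n. \<integral>\<^sup>+\<omega>. ennreal ((norm (X j m \<omega> - J j \<omega>))\<^sup>2) \<partial>M))"
      by (rule order_trans[OF 1]) (intro add_mono mult_left_mono 2 order_trans[OF eq_refl[OF 3] 4] zero_le)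
    also have "\<dots> = a m + 4 * (\<Sum>j<n. d j)"
      unfolding a_def sum.distrib sum_distrib_left[symmetric] distrib_left mult.assoc[symmetric]
      by (simp add: ac_simps)
    finally show ?thesis .
  qed
  have "a \<longlonglongrightarrow> 2 * (of_nat n * (\<Sum>j<n. 0)) + 4 * (\<Sum>j<n. 0)"
    unfolding a_def[abs_def] by (intro tendsto_intros ennreal_tendsto_cmult tendsto_sum Xlim Flim) auto
  then have "(\<lambda>m. a m + 4 * (\<Sum>j<n. d j)) \<longlonglongrightarrow> 0 + 4 * (\<Sum>j<n. d j)"
    by (intro tendsto_intros) simp
  from LIMSEQ_le_const[OF this, of ?LHS] le show ?thesis by (simp add: d_def)
qed

text \<open>Inserting the partial sums of the series costs another factor \<open>2\<close>. Beyond
  index \<open>n\<close> the functions \<open>g j\<close> vanish, so the tail of the series on the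
  right measures the modes that \<open>Y\<close> neglects.\<close>

lemma cylindrical_integral_step_error:
  assumes e: "orthonormal_basis (e :: nat \<Rightarrow> l2)"
    and Z: "has_cylindrical_integral M \<beta> e t \<Psi> (Z :: 'w \<Rightarrow> l2)" and Y: "step_pair n Y g"
  shows "(\<integral>\<^sup>+\<omega>. ennreal ((norm (Z \<omega> - Y \<omega>))\<^sup>2) \<partial>M)
    \<le> 8 * (\<Sum>j. \<integral>\<^sup>+s. ennreal ((norm (indicator {0..t} s *\<^sub>R \<Psi> s (e j) - g j s))\<^sup>2) \<partial>lborel)"
proof -
  from Z obtain J where J: "\<And>j. has_wiener_integral M (\<beta> j) t (\<lambda>s. \<Psi> s (e j)) (J j)"
    and lim: "(\<lambda>n. \<integral>\<^sup>+\<omega>. ennreal ((norm ((\<Sum>j<n. J j \<omega>) - Z \<omega>))\<^sup>2) \<partial>M) \<longlonglongrightarrow> 0"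
    and Zm: "Z \<in> borel_measurable M"
    unfolding has_cylindrical_integral_def
    by (elim conjE exE) (rule that, erule spec, assumption, assumption)
  have wJ: "weakly_measurable M (J j)" for j
    using J[of j] by (auto simp: has_wiener_integral_def intro!: weakly_measurableI)
  have wZ: "weakly_measurable M Z" by (rule weakly_measurableI[OF Zm])
  have wY: "weakly_measurable M Y" using step_pair_measurable[OF Y] by auto
  define d where "d j = (\<integral>\<^sup>+s. ennreal ((norm (indicator {0..t} s *\<^sub>R \<Psi> s (e j) - g j s))\<^sup>2) \<partial>lborel)" for j
  let ?LHS = "\<integral>\<^sup>+\<omega>. ennreal ((norm (Z \<omega> - Y \<omega>))\<^sup>2) \<partial>M"
  let ?a = "\<lambda>m. \<integral>\<^sup>+\<omega>. ennreal ((norm ((\<Sum>j<m. J j \<omega>) - Z \<omega>))\<^sup>2) \<partial>M"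
  have le: "?LHS \<le> 2 * ?a m + 8 * (\<Sum>j. d j)" if "n \<le> m" for m
  proof -
    have 1: "?LHS \<le> 2 * ?a m + 2 * (\<integral>\<^sup>+\<omega>. ennreal ((norm ((\<Sum>j<m. J j \<omega>) - Y \<omega>))\<^sup>2) \<partial>M)"
    proof -
      have "?LHS = (\<integral>\<^sup>+\<omega>. ennreal ((norm ((Z \<omega> - (\<Sum>j<m. J j \<omega>)) + ((\<Sum>j<m. J j \<omega>) - Y \<omega>)))\<^sup>2) \<partial>M)"
        by simp
      also have "\<dots> \<le> 2 * (\<integral>\<^sup>+\<omega>. ennreal ((norm (Z \<omega> - (\<Sum>j<m. J j \<omega>)))\<^sup>2) \<partial>M)
        + 2 * (\<integral>\<^sup>+\<omega>. ennreal ((norm ((\<Sum>j<m. J j \<omega>) - Y \<omega>))\<^sup>2) \<partial>M)"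
        by (rule nn_integral_norm_sq_add_le[OF e])
          (auto intro!: weakly_measurable_diff weakly_measurable_sum wZ wY wJ)
      finally show ?thesis by (simp only: norm_minus_commute[of "Z _"])
    qed
    have 2: "(\<integral>\<^sup>+\<omega>. ennreal ((norm ((\<Sum>j<m. J j \<omega>) - Y \<omega>))\<^sup>2) \<partial>M) \<le> 4 * (\<Sum>j<m. d j)"
      unfolding d_def by (rule wiener_integrals_step_error[OF e J step_pair_mono[OF Y that]])
    have 3: "(\<Sum>j<m. d j) \<le> (\<Sum>j. d j)" by (rule sum_le_suminf) auto
    have "?LHS \<le> 2 * ?a m + 2 * (4 * (\<Sum>j. d j))"
      by (rule order_trans[OF 1])
        (intro add_mono mult_left_mono order_refl order_trans[OF 2] 3 zero_le)
    then show ?thesis by (simp add: mult.assoc[symmetric])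
  qed
  have "(\<lambda>m. 2 * ?a m + 8 * (\<Sum>j. d j)) \<longlonglongrightarrow> 2 * 0 + 8 * (\<Sum>j. d j)"
    by (intro tendsto_intros ennreal_tendsto_cmult lim) auto
  from LIMSEQ_le_const[OF this, of ?LHS] le show ?thesis by (auto simp: d_def)
qed

end

text \<open>\<open>hilbert_schmidt\<close> provides summability for some basis, while the noise
  comes with its own. For each \<open>i\<close>, the square sum of the functional
  \<open>x \<mapsto> inner (L x) (e i)\<close> over finitely many vectors of \<open>e\<close> is at
  most its square sum over \<open>f\<close>; summation over \<open>i\<close> and Parseval's identity
  then compare the bases.\<close>

lemma hilbert_schmidt_other_basis:
  fixes L :: "l2 \<Rightarrow> l2"
  assumes L: "bounded_linear L" and e: "orthonormal_basis e" and f: "orthonormal_basis f"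
    and s: "summable (\<lambda>k. (norm (L (f k)))\<^sup>2)"
  shows "summable (\<lambda>j. (norm (L (e j)))\<^sup>2)"
proof -
  interpret L: bounded_linear L by (rule L)
  have si: "summable (\<lambda>k. (inner (L (f k)) (e i))\<^sup>2)" for i
  proof (rule summable_comparison_test'[OF s])
    fix k
    have "\<bar>inner (L (f k)) (e i)\<bar> \<le> norm (L (f k)) * norm (e i)" by (rule Cauchy_Schwarz_ineq2)
    also have "norm (e i) = 1" by (simp add: norm_eq_sqrt_inner orthonormal_basis_inner[OF e])
    finally show "norm ((inner (L (f k)) (e i))\<^sup>2) \<le> (norm (L (f k)))\<^sup>2"
      by (simp add: abs_le_square_iff[symmetric])
  qed
  have row: "(\<Sum>j<J. (inner (L (e j)) (e i))\<^sup>2) \<le> (\<Sum>k. (inner (L (f k)) (e i))\<^sup>2)" for i J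
  proof -
    define l where "l x = inner (L x) (e i)" for x
    \<comment> \<open>\<open>z\<close> represents the functional on the first \<open>J\<close>
      vectors: \<open>l z\<close> and the squared norm of \<open>z\<close> are both
      \<open>A\<close>. With \<open>z\<close> expanded in \<open>f\<close>, Cauchy-Schwarz gives
      \<open>A^2 \<le> A * B\<close>.\<close>
    define z where "z = (\<Sum>j<J. l (e j) *\<^sub>R e j)"
    define A where "A = (\<Sum>j<J. (l (e j))\<^sup>2)"
    define B where "B = (\<Sum>k. (l (f k))\<^sup>2)"
    have lz: "l z = A"
      by (simp add: l_def z_def A_def L.sum L.scaleR inner_sum_left power2_eq_square)
    have nz: "(norm z)\<^sup>2 = A" by (simp add: z_def A_def orthonormal_expansion_norm[OF e])
    have "(\<lambda>n. (l (\<Sum>k<n. inner z (f k) *\<^sub>R f k))\<^sup>2) \<longlonglongrightarrow> (l z)\<^sup>2"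
      unfolding l_def by (intro tendsto_intros L.tendsto orthonormal_basis_expansion f)
    moreover have "(l (\<Sum>k<n. inner z (f k) *\<^sub>R f k))\<^sup>2 \<le> A * B" for n
    proof -
      have "(l (\<Sum>k<n. inner z (f k) *\<^sub>R f k))\<^sup>2 = (\<Sum>k<n. inner z (f k) * l (f k))\<^sup>2"
        by (simp add: l_def L.sum L.scaleR inner_sum_left)
      also have "\<dots> \<le> (\<Sum>k<n. (inner z (f k))\<^sup>2) * (\<Sum>k<n. (l (f k))\<^sup>2)"
        by (rule Cauchy_Schwarz_ineq_sum)
      also have "\<dots> \<le> A * B"
      proof (rule mult_mono)
        show "(\<Sum>k<n. (inner z (f k))\<^sup>2) \<le> A"
          using parseval[OF f, of z] sum_le_suminf[of "\<lambda>k. (inner z (f k))\<^sup>2" "{..<n}"] nz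
          by (simp add: sums_iff)
        show "(\<Sum>k<n. (l (f k))\<^sup>2) \<le> B"
          unfolding B_def l_def by (rule sum_le_suminf[OF si]) auto
        show "0 \<le> A" by (simp add: A_def sum_nonneg)
      qed (simp add: sum_nonneg)
      finally show ?thesis .
    qed
    ultimately have "A\<^sup>2 \<le> A * B" unfolding lz by (intro LIMSEQ_le_const2) auto
    then have "A \<le> B \<or> A = 0"
    proof (cases "A = 0")
      case False
      moreover have "0 \<le> A" unfolding A_def by (intro sum_nonneg) simp
      ultimately have "0 < A" by simp
      then show ?thesis using \<open>A\<^sup>2 \<le> A * B\<close> by (simp add: power2_eq_square)
    qed simp
    moreover have "0 \<le> B" unfolding B_def l_def by (rule suminf_nonneg[OF si]) auto
    ultimately show ?thesis by (auto simp: A_def B_def l_def)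
  qed
  define \<Sigma> where "\<Sigma> = (\<Sum>k. (norm (L (f k)))\<^sup>2)"
  have fin: "(\<Sum>j<J. \<Sum>i<I. (inner (L (e j)) (e i))\<^sup>2) \<le> \<Sigma>" for I J
  proof -
    have "(\<Sum>j<J. \<Sum>i<I. (inner (L (e j)) (e i))\<^sup>2) = (\<Sum>i<I. \<Sum>j<J. (inner (L (e j)) (e i))\<^sup>2)"
      by (rule sum.swap)
    also have "\<dots> \<le> (\<Sum>i<I. \<Sum>k. (inner (L (f k)) (e i))\<^sup>2)" by (intro sum_mono row)
    also have "\<dots> = (\<Sum>k. \<Sum>i<I. (inner (L (f k)) (e i))\<^sup>2)" by (rule suminf_sum[OF si, symmetric])
    also have "\<dots> \<le> \<Sigma>"
      unfolding \<Sigma>_def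
    proof (rule suminf_le[OF _ summable_sum[OF si] s])
      fix k show "(\<Sum>i<I. (inner (L (f k)) (e i))\<^sup>2) \<le> (norm (L (f k)))\<^sup>2"
        using parseval[OF e, of "L (f k)"] sum_le_suminf[of "\<lambda>i. (inner (L (f k)) (e i))\<^sup>2" "{..<I}"]
        by (simp add: sums_iff)
    qed
    finally show ?thesis .
  qed
  have "(\<Sum>j<J. (norm (L (e j)))\<^sup>2) \<le> \<Sigma>" for J
  proof (rule LIMSEQ_le_const2)
    show "(\<lambda>I. \<Sum>j<J. \<Sum>i<I. (inner (L (e j)) (e i))\<^sup>2) \<longlonglongrightarrow> (\<Sum>j<J. (norm (L (e j)))\<^sup>2)"
      using parseval[OF e] by (intro tendsto_sum) (simp add: sums_def)
  qed (use fin in blast)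
  then show ?thesis by (intro summableI_nonneg_bounded[where x = \<Sigma>]) auto
qed

lemma hilbert_schmidt_summable:
  fixes \<Phi> :: "l2 \<Rightarrow> h1"
  assumes "hilbert_schmidt \<Phi>" "orthonormal_basis e"
  shows "summable (\<lambda>j. (norm (h1_l2 (\<Phi> (e j))))\<^sup>2)"
proof -
  obtain f where f: "orthonormal_basis f" "summable (\<lambda>j. (norm (\<Phi> (f j)))\<^sup>2)" and \<Phi>: "bounded_linear \<Phi>"
    using assms(1) by (auto simp: hilbert_schmidt_def)
  have "summable (\<lambda>j. (norm (h1_l2 (\<Phi> (f j))))\<^sup>2)"
    by (rule summable_comparison_test'[OF f(2)]) (simp add: norm_h1_l2_le power_mono)
  then show ?thesis
    by (rule hilbert_schmidt_other_basis[OF bounded_linear_compose[OF bounded_linear_h1_l2 \<Phi>] assms(2) f(1)])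
qed

section \<open>Exponential moments of Gaussian random walks\<close>

lemma nn_integral_normal_density: "0 < \<sigma> \<Longrightarrow> (\<integral>\<^sup>+x. ennreal (normal_density \<mu> \<sigma> x) \<partial>lborel) = 1"
  by (subst nn_integral_eq_integral) auto

lemma nn_integral_normal_exp:
  assumes "0 < \<sigma>"
  shows "(\<integral>\<^sup>+x. ennreal (normal_density 0 \<sigma> x) * ennreal (exp (a * x)) \<partial>lborel) = ennreal (exp (a\<^sup>2 * \<sigma>\<^sup>2 / 2))"
proof -
  have "normal_density 0 \<sigma> x * exp (a * x) = exp (a\<^sup>2 * \<sigma>\<^sup>2 / 2) * normal_density (a * \<sigma>\<^sup>2) \<sigma> x" for x
  proof -
    have "- x\<^sup>2 / (2 * \<sigma>\<^sup>2) + a * x = a\<^sup>2 * \<sigma>\<^sup>2 / 2 + - (x - a * \<sigma>\<^sup>2)\<^sup>2 / (2 * \<sigma>\<^sup>2)"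
      using assms by (simp add: field_simps power2_eq_square)
    then have "exp (- x\<^sup>2 / (2 * \<sigma>\<^sup>2)) * exp (a * x) = exp (a\<^sup>2 * \<sigma>\<^sup>2 / 2) * exp (- (x - a * \<sigma>\<^sup>2)\<^sup>2 / (2 * \<sigma>\<^sup>2))"
      by (simp only: exp_add[symmetric])
    then show ?thesis by (simp add: normal_density_def)
  qed
  then have "(\<integral>\<^sup>+x. ennreal (normal_density 0 \<sigma> x) * ennreal (exp (a * x)) \<partial>lborel)
      = (\<integral>\<^sup>+x. ennreal (exp (a\<^sup>2 * \<sigma>\<^sup>2 / 2)) * ennreal (normal_density (a * \<sigma>\<^sup>2) \<sigma> x) \<partial>lborel)"
    by (simp add: ennreal_mult[symmetric])
  then show ?thesis by (simp add: nn_integral_cmult nn_integral_normal_density[OF assms])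
qed

text \<open>The integral is exactly \<open>1 / sqrt (1 - 2 * k)\<close>. Up to
  \<open>k = 1 / 4\<close>, the bound \<open>- x - 2 * x^2 \<le> ln (1 - x)\<close> at
  \<open>x = 2 * k\<close> shows that the logarithm is at least \<open>- 4 * k\<close>, and the
  square root halves this.\<close>

lemma nn_integral_std_normal_exp_sq:
  assumes "0 \<le> k" "k \<le> 1 / 4"
  shows "(\<integral>\<^sup>+x. ennreal (std_normal_density x) * ennreal (exp (k * x\<^sup>2)) \<partial>lborel) \<le> ennreal (exp (2 * k))"
proof -
  define s where "s = 1 / sqrt (1 - 2 * k)"
  have s: "0 < s" "s\<^sup>2 = 1 / (1 - 2 * k)" using assms by (auto simp: s_def power_divide)
  have "std_normal_density x * exp (k * x\<^sup>2) = s * normal_density 0 s x" for x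
  proof -
    have "- x\<^sup>2 / 2 + k * x\<^sup>2 = - x\<^sup>2 / (2 * s\<^sup>2)"
      using assms by (simp add: s field_simps)
    then have "exp (- x\<^sup>2 / 2) * exp (k * x\<^sup>2) = exp (- x\<^sup>2 / (2 * s\<^sup>2))"
      by (simp only: exp_add[symmetric])
    moreover have "sqrt (2 * pi * s\<^sup>2) = sqrt (2 * pi) * s"
      using s(1) by (simp add: real_sqrt_mult)
    ultimately show ?thesis using s(1) by (simp add: normal_density_def)
  qed
  then have "(\<integral>\<^sup>+x. ennreal (std_normal_density x) * ennreal (exp (k * x\<^sup>2)) \<partial>lborel)
      = (\<integral>\<^sup>+x. ennreal s * ennreal (normal_density 0 s x) \<partial>lborel)"
    using s(1) by (simp add: ennreal_mult[symmetric])
  also have "\<dots> = ennreal s" by (simp add: nn_integral_cmult nn_integral_normal_density[OF s(1)])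
  also have "\<dots> \<le> ennreal (exp (2 * k))"
  proof (rule ennreal_leI)
    have "- (2 * k) - 2 * (2 * k)\<^sup>2 \<le> ln (1 - 2 * k)"
      by (rule ln_one_minus_pos_lower_bound) (use assms in auto)
    moreover have "2 * (2 * k)\<^sup>2 \<le> 2 * k"
      using assms mult_left_mono[of "2 * k" "1 / 2" "2 * k"] by (simp add: power2_eq_square)
    ultimately have "- (4 * k) \<le> ln (1 - 2 * k)" by linarith
    then have "exp (- (4 * k)) \<le> 1 - 2 * k" using assms by (simp add: ln_ge_iff)
    then have "sqrt (exp (- (4 * k))) \<le> sqrt (1 - 2 * k)" by simp
    also have "sqrt (exp (- (4 * k))) = exp (- (2 * k))"
      by (rule real_sqrt_unique) (simp_all add: power2_eq_square exp_add[symmetric])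
    finally have "1 / sqrt (1 - 2 * k) \<le> 1 / exp (- (2 * k))"
      by (intro divide_left_mono) (use assms in auto)
    then show "s \<le> exp (2 * k)" by (simp add: s_def exp_minus inverse_eq_divide)
  qed
  finally show ?thesis .
qed

section \<open>Random walks driven by independent grid increments\<close>

lemma (in prob_space) nn_integral_indep_var:
  assumes XY: "indep_var S X T Y" and [measurable]: "f \<in> borel_measurable (S \<Otimes>\<^sub>M T)"
  shows "(\<integral>\<^sup>+\<omega>. f (X \<omega>, Y \<omega>) \<partial>M) = (\<integral>\<^sup>+\<omega>. \<integral>\<^sup>+\<omega>'. f (X \<omega>, Y \<omega>') \<partial>M \<partial>M)"
proof -
  have [measurable]: "X \<in> measurable M S" "Y \<in> measurable M T"
    and d: "distr M S X \<Otimes>\<^sub>M distr M T Y = distr M (S \<Otimes>\<^sub>M T) (\<lambda>x. (X x, Y x))"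
    using XY by (auto simp: indep_var_distribution_eq)
  interpret Y: prob_space "distr M T Y" by (rule prob_space_distr) simp
  have "(\<integral>\<^sup>+\<omega>. f (X \<omega>, Y \<omega>) \<partial>M) = integral\<^sup>N (distr M S X \<Otimes>\<^sub>M distr M T Y) f"
    unfolding d by (subst nn_integral_distr) auto
  also have "\<dots> = (\<integral>\<^sup>+x. \<integral>\<^sup>+y. f (x, y) \<partial>distr M T Y \<partial>distr M S X)"
    by (rule Y.nn_integral_fst[symmetric]) simp
  also have "\<dots> = (\<integral>\<^sup>+\<omega>. \<integral>\<^sup>+y. f (X \<omega>, y) \<partial>distr M T Y \<partial>M)"
    by (subst nn_integral_distr) auto
  also have "\<dots> = (\<integral>\<^sup>+\<omega>. \<integral>\<^sup>+\<omega>'. f (X \<omega>, Y \<omega>') \<partial>M \<partial>M)"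
  proof (rule nn_integral_cong)
    fix \<omega> assume "\<omega> \<in> space M"
    then have "X \<omega> \<in> space S" using measurable_space[of X M S] by simp
    then show "(\<integral>\<^sup>+y. f (X \<omega>, y) \<partial>distr M T Y) = (\<integral>\<^sup>+\<omega>'. f (X \<omega>, Y \<omega>') \<partial>M)"
      by (subst nn_integral_distr) auto
  qed
  finally show ?thesis .
qed

text \<open>A deterministic function of the array of increments: which of them a given step has seen
  can then be read off from the coordinates. \<open>A n\<close> will be norm preserving, and
  \<open>c n j\<close> is the direction of mode \<open>j\<close> at step \<open>n\<close>.\<close>

primrec walk :: "(nat \<Rightarrow> l2 \<Rightarrow> l2) \<Rightarrow> (nat \<Rightarrow> nat \<Rightarrow> l2) \<Rightarrow> nat \<Rightarrow> l2 \<Rightarrow> nat \<Rightarrow> (nat \<times> nat \<Rightarrow> real) \<Rightarrow> l2" where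
  "walk A c J v 0 x = v"
| "walk A c J v (Suc n) x = A n (walk A c J v n x) + (\<Sum>j<J. x (n, j) *\<^sub>R c n j)"

lemma walk_cong:
  "(\<And>k j. k < n \<Longrightarrow> j < J \<Longrightarrow> x (k, j) = y (k, j)) \<Longrightarrow> walk A c J v n x = walk A c J v n y"
  by (induction n) (auto intro!: arg_cong2[where f = "(+)"] arg_cong[where f = "A _"] sum.cong)

text \<open>Continuity for the product topology on a countable index set yields measurability for
  the product sigma algebra.\<close>

lemma continuous_on_walk:
  assumes A: "\<And>n. continuous_on UNIV (A n)"
  shows "continuous_on UNIV (walk A c J v n)"
proof (induction n)
  case (Suc n)
  have "continuous_on UNIV (\<lambda>x. A n (walk A c J v n x))"
    by (rule continuous_on_compose2[OF A Suc]) simp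
  moreover have "continuous_on UNIV (\<lambda>x::nat \<times> nat \<Rightarrow> real. \<Sum>j<J. x (n, j) *\<^sub>R c n j)"
    by (intro continuous_intros continuous_on_product_coordinates)
  ultimately show ?case by (simp add: continuous_on_add)
qed simp

context white_noise
begin

definition grid_inc :: "real \<Rightarrow> nat \<times> nat \<Rightarrow> 'w \<Rightarrow> real" where
  "grid_inc h p \<omega> = inc (snd p) (real (fst p) * h) (real (Suc (fst p)) * h) \<omega>"

lemma measurable_grid_inc [measurable]: "0 < h \<Longrightarrow> grid_inc h p \<in> borel_measurable M"
  unfolding grid_inc_def[abs_def] by (intro measurable_inc) auto

lemma distributed_grid_inc: "0 < h \<Longrightarrow> distributed M lborel (grid_inc h p) (normal_density 0 (sqrt h))"
  using distributed_inc[of "real (fst p) * h" "real (Suc (fst p)) * h" "snd p"]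
  by (simp add: grid_inc_def[abs_def] algebra_simps)

text \<open>Independence is given in two separate directions: between the motions, as paths, and
  between consecutive increments of one motion. An event on the rectangle is therefore factored over
  the modes \<open>j\<close>, and each factor over the time steps \<open>k\<close>.\<close>

lemma indep_grid_inc:
  assumes h: "0 < h"
  shows "indep_vars (\<lambda>_. borel) (grid_inc h) ({..<N} \<times> {..<J})"
  unfolding indep_vars_def2
proof (intro conjI ballI indep_setsI)
  show "random_variable borel (grid_inc h p)" for p using h by simp
  show "{grid_inc h p -` A \<inter> space M |A. A \<in> sets borel} \<subseteq> events" for p
    using h by (auto intro: measurable_sets)
  fix A K assume K: "K \<noteq> {}" "K \<subseteq> {..<N} \<times> {..<J}" "finite K"
    and A: "\<forall>p\<in>K. A p \<in> {grid_inc h p -` A \<inter> space M |A. A \<in> sets borel}"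
  then have "\<forall>p\<in>K. \<exists>B. B \<in> sets borel \<and> A p = grid_inc h p -` B \<inter> space M" by auto
  then obtain B where B: "\<And>p. p \<in> K \<Longrightarrow> B p \<in> sets borel" "\<And>p. p \<in> K \<Longrightarrow> A p = grid_inc h p -` B p \<inter> space M"
    by metis
  \<comment> \<open>Filling up with \<open>UNIV\<close> outside \<open>K\<close> turns an arbitrary
    finite subfamily into the full rectangle.\<close>
  define B' where "B' p = (if p \<in> K then B p else UNIV)" for p
  have B'[measurable]: "B' p \<in> sets borel" for p using B(1) by (simp add: B'_def)
  define V where "V j \<omega> = (\<lambda>k\<in>{..<N}. grid_inc h (k, j) \<omega>)" for j \<omega>
  have ne: "{..<N} \<noteq> {}" "{..<J} \<noteq> {}" using K by auto
  have V: "indep_vars (\<lambda>j. \<Pi>\<^sub>M k\<in>{..<N}. borel) V {..<J}"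
  proof -
    have "indep_vars (\<lambda>j. \<Pi>\<^sub>M t\<in>{0..}. borel) (\<lambda>j \<omega>. \<lambda>t\<in>{0..}. \<beta> j t \<omega>) {..<J}"
      using noise by (auto simp: independent_brownian_motions_def intro: indep_vars_subset)
    then have "indep_vars (\<lambda>j. \<Pi>\<^sub>M k\<in>{..<N}. borel)
        (\<lambda>j \<omega>. (\<lambda>p. \<lambda>k\<in>{..<N}. p (real (Suc k) * h) - p (real k * h)) (\<lambda>t\<in>{0..}. \<beta> j t \<omega>)) {..<J}"
      by (rule indep_vars_compose2[where Y = "\<lambda>j p. \<lambda>k\<in>{..<N}. p (real (Suc k) * h) - p (real k * h)"])
        (rule measurable_restrict, rule borel_measurable_diff; rule measurable_component_singleton, use h in simp)
    moreover have "(\<lambda>k\<in>{..<N}. (\<lambda>t\<in>{0..}. \<beta> j t \<omega>) (real (Suc k) * h) - (\<lambda>t\<in>{0..}. \<beta> j t \<omega>) (real k * h)) = V j \<omega>" for j \<omega>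
      using h by (auto simp: V_def grid_inc_def inc_def fun_eq_iff restrict_def)
    ultimately show ?thesis by simp
  qed
  have W: "indep_vars (\<lambda>_. borel) (\<lambda>k. grid_inc h (k, j)) {..<N}" for j
  proof -
    have "0 \<le> real 0 * h \<longrightarrow> mono (\<lambda>k. real k * h) \<longrightarrow>
      indep_vars (\<lambda>k. borel) (\<lambda>k \<omega>. \<beta> j (real (Suc k) * h) \<omega> - \<beta> j (real k * h) \<omega>) {..<N}"
      using brownian[of j] unfolding brownian_motion_def by (elim conjE allE[where x = N] allE[where x = "\<lambda>k. real k * h"])
    moreover have "mono (\<lambda>k. real k * h)" using h by (intro monoI mult_right_mono) auto
    ultimately show ?thesis by (simp add: grid_inc_def[abs_def] inc_def)
  qed
  define E where "E j = (\<Inter>k\<in>{..<N}. grid_inc h (k, j) -` B' (k, j) \<inter> space M)" for j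
  have EV: "E j = V j -` (\<Pi>\<^sub>E k\<in>{..<N}. B' (k, j)) \<inter> space M" for j
    using ne by (auto simp: E_def V_def PiE_iff)
  have set_eq: "(\<Inter>p\<in>K. A p) = (\<Inter>j\<in>{..<J}. E j)"
  proof (intro set_eqI iffI)
    fix \<omega> assume "\<omega> \<in> (\<Inter>p\<in>K. A p)"
    then have \<omega>: "\<omega> \<in> A p" if "p \<in> K" for p using that by blast
    obtain p0 where "p0 \<in> K" using K(1) by blast
    then have "\<omega> \<in> space M" using \<omega>[of p0] B(2)[of p0] by simp
    then have "\<omega> \<in> grid_inc h p -` B' p \<inter> space M" for p
      using \<omega>[of p] B(2)[of p] by (cases "p \<in> K") (simp_all add: B'_def)
    then show "\<omega> \<in> (\<Inter>j\<in>{..<J}. E j)" unfolding E_def by blast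
  next
    fix \<omega> assume \<omega>: "\<omega> \<in> (\<Inter>j\<in>{..<J}. E j)"
    show "\<omega> \<in> (\<Inter>p\<in>K. A p)"
    proof
      fix p assume p: "p \<in> K"
      then have "fst p < N" "snd p < J" using K(2) by auto
      then have "\<omega> \<in> grid_inc h (fst p, snd p) -` B' (fst p, snd p) \<inter> space M"
      proof -
        have "\<omega> \<in> E (snd p)" using \<omega> \<open>snd p < J\<close> by blast
        then show ?thesis unfolding E_def using \<open>fst p < N\<close> by blast
      qed
      then show "\<omega> \<in> A p" using p B(2)[OF p] by (simp add: B'_def)
    qed
  qed
  have E_prod: "prob (\<Inter>j\<in>{..<J}. E j) = (\<Prod>j<J. prob (E j))"
    unfolding EV
    by (rule indep_varsD_finite[OF V ne(2), where A = "\<lambda>j. \<Pi>\<^sub>E k\<in>{..<N}. B' (k, j)"])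
      (auto intro!: sets_PiM_I_finite)
  have E_prob: "prob (E j) = (\<Prod>k<N. prob (grid_inc h (k, j) -` B' (k, j) \<inter> space M))" for j
    unfolding E_def by (rule indep_varsD_finite[OF W ne(1), where A = "\<lambda>k. B' (k, j)"]) auto
  have "prob (\<Inter>p\<in>K. A p) = (\<Prod>j<J. \<Prod>k<N. prob (grid_inc h (k, j) -` B' (k, j) \<inter> space M))"
    by (simp only: set_eq E_prod E_prob)
  also have "\<dots> = (\<Prod>k<N. \<Prod>j<J. prob (grid_inc h (k, j) -` B' (k, j) \<inter> space M))"
    by (rule prod.swap)
  also have "\<dots> = (\<Prod>p\<in>{..<N} \<times> {..<J}. prob (grid_inc h p -` B' p \<inter> space M))"
    by (simp add: prod.cartesian_product)
  also have "\<dots> = (\<Prod>p\<in>K. prob (A p))"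
    using K B(2) by (intro prod.mono_neutral_cong_right) (auto simp: B'_def prob_space)
  finally show "prob (\<Inter>p\<in>K. A p) = (\<Prod>p\<in>K. prob (A p))" .
qed

lemma nn_integral_exp_grid_sum:
  assumes h: "0 < h"
  shows "(\<integral>\<^sup>+\<omega>. ennreal (exp (\<Sum>j<J. grid_inc h (n, j) \<omega> * a j)) \<partial>M) = ennreal (exp (h / 2 * (\<Sum>j<J. (a j)\<^sup>2)))"
proof -
  have [measurable]: "grid_inc h p \<in> borel_measurable M" for p using h by simp
  have "indep_vars (\<lambda>_. borel) (\<lambda>j. inc j (real n * h) (real (Suc n) * h)) {..<J}"
    by (rule indep_vars_subset[OF indep_inc_modes]) (use h in auto)
  then have "indep_vars (\<lambda>_. borel) (\<lambda>j. grid_inc h (n, j)) {..<J}"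
    by (simp add: grid_inc_def[abs_def])
  then have "indep_vars (\<lambda>_. borel) (\<lambda>j \<omega>. ennreal (exp (grid_inc h (n, j) \<omega> * a j))) {..<J}"
    by (rule indep_vars_compose2[where Y = "\<lambda>j y. ennreal (exp (y * a j))"]) auto
  then have "(\<integral>\<^sup>+\<omega>. (\<Prod>j<J. ennreal (exp (grid_inc h (n, j) \<omega> * a j))) \<partial>M)
      = (\<Prod>j<J. \<integral>\<^sup>+\<omega>. ennreal (exp (grid_inc h (n, j) \<omega> * a j)) \<partial>M)"
    by (intro indep_vars_nn_integral) auto
  also have "\<dots> = (\<Prod>j<J. ennreal (exp (h / 2 * (a j)\<^sup>2)))"
  proof (rule prod.cong[OF refl])
    fix j
    have "(\<integral>\<^sup>+\<omega>. ennreal (exp (grid_inc h (n, j) \<omega> * a j)) \<partial>M) = (\<integral>\<^sup>+x. ennreal (normal_density 0 (sqrt h) x) * ennreal (exp (a j * x)) \<partial>lborel)"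
      by (subst distributed_nn_integral[OF distributed_grid_inc[OF h]]) (simp_all add: mult.commute)
    also have "\<dots> = ennreal (exp (h / 2 * (a j)\<^sup>2))"
      using h by (subst nn_integral_normal_exp) (simp_all add: mult.commute)
    finally show "(\<integral>\<^sup>+\<omega>. ennreal (exp (grid_inc h (n, j) \<omega> * a j)) \<partial>M) = ennreal (exp (h / 2 * (a j)\<^sup>2))" .
  qed
  also have "\<dots> = ennreal (exp (h / 2 * (\<Sum>j<J. (a j)\<^sup>2)))"
    by (simp add: prod_ennreal exp_sum sum_distrib_left)
  finally show ?thesis by (simp add: prod_ennreal exp_sum)
qed

definition grid_noise :: "real \<Rightarrow> (nat \<Rightarrow> l2) \<Rightarrow> nat \<Rightarrow> nat \<Rightarrow> 'w \<Rightarrow> l2" where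
  "grid_noise h c J n \<omega> = (\<Sum>j<J. grid_inc h (n, j) \<omega> *\<^sub>R c j)"

lemma nn_integral_exp_inner_noise:
  assumes h: "0 < h" and q: "h * (\<Sum>j<J. (inner (c j) y)\<^sup>2) \<le> q * (norm y)\<^sup>2"
  shows "(\<integral>\<^sup>+\<omega>. ennreal (exp (s * inner (grid_noise h c J n \<omega>) y)) \<partial>M) \<le> ennreal (exp (s\<^sup>2 * q / 2 * (norm y)\<^sup>2))"
proof -
  have "s * inner (grid_noise h c J n \<omega>) y = (\<Sum>j<J. grid_inc h (n, j) \<omega> * (s * inner (c j) y))" for \<omega>
    by (simp add: grid_noise_def inner_sum_left sum_distrib_left ac_simps)
  then have "(\<integral>\<^sup>+\<omega>. ennreal (exp (s * inner (grid_noise h c J n \<omega>) y)) \<partial>M)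
      = ennreal (exp (h / 2 * (\<Sum>j<J. (s * inner (c j) y)\<^sup>2)))"
    by (simp add: nn_integral_exp_grid_sum[OF h])
  also have "h / 2 * (\<Sum>j<J. (s * inner (c j) y)\<^sup>2) = s\<^sup>2 / 2 * (h * (\<Sum>j<J. (inner (c j) y)\<^sup>2))"
    by (simp add: power_mult_distrib sum_distrib_left ac_simps)
  also have "ennreal (exp \<dots>) \<le> ennreal (exp (s\<^sup>2 / 2 * (q * (norm y)\<^sup>2)))"
    using q by (intro ennreal_leI) (simp add: mult_left_mono)
  finally show ?thesis by (simp add: mult.assoc)
qed

text \<open>The square is linearised by \<open>\<parallel>z\<parallel>\<^sup>2 \<ge> 2 (z, y) - \<parallel>y\<parallel>\<^sup>2\<close>; the choice of \<open>y\<close> below makes the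
  bound sharp.\<close>

lemma nn_integral_exp_minus_noise:
  assumes h: "0 < h" and q: "\<And>y. h * (\<Sum>j<J. (inner (c j) y)\<^sup>2) \<le> q * (norm y)\<^sup>2"
    and "0 \<le> \<theta>" "0 \<le> q"
  shows "(\<integral>\<^sup>+\<omega>. ennreal (exp (- \<theta> * (norm (a + grid_noise h c J n \<omega>))\<^sup>2)) \<partial>M)
    \<le> ennreal (exp (- (\<theta> / (1 + 2 * \<theta> * q)) * (norm a)\<^sup>2))"
proof -
  define r where "r = 1 / (1 + 2 * \<theta> * q)"
  have pos: "0 < 1 + 2 * \<theta> * q" using assms by (intro add_pos_nonneg) auto
  define y where "y = r *\<^sub>R a"
  define C where "C = - 2 * \<theta> * inner a y + \<theta> * (norm y)\<^sup>2"
  have "(\<integral>\<^sup>+\<omega>. ennreal (exp (- \<theta> * (norm (a + grid_noise h c J n \<omega>))\<^sup>2)) \<partial>M)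
      \<le> (\<integral>\<^sup>+\<omega>. ennreal (exp C) * ennreal (exp ((- 2 * \<theta>) * inner (grid_noise h c J n \<omega>) y)) \<partial>M)"
  proof (rule nn_integral_mono)
    fix \<omega>
    let ?z = "a + grid_noise h c J n \<omega>"
    have "0 \<le> (norm (?z - y))\<^sup>2" by simp
    also have "\<dots> = (norm ?z)\<^sup>2 - 2 * inner ?z y + (norm y)\<^sup>2"
      by (simp add: power2_norm_eq_inner inner_diff_left inner_diff_right inner_commute)
    finally have "\<theta> * (2 * inner ?z y - (norm y)\<^sup>2) \<le> \<theta> * (norm ?z)\<^sup>2"
      using \<open>0 \<le> \<theta>\<close> by (intro mult_left_mono) auto
    then have "- \<theta> * (norm ?z)\<^sup>2 \<le> C + (- 2 * \<theta>) * inner (grid_noise h c J n \<omega>) y"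
      by (simp add: C_def inner_add_left algebra_simps)
    then have "exp (- \<theta> * (norm ?z)\<^sup>2) \<le> exp C * exp ((- 2 * \<theta>) * inner (grid_noise h c J n \<omega>) y)"
      by (simp only: exp_add[symmetric] exp_le_cancel_iff)
    then show "ennreal (exp (- \<theta> * (norm ?z)\<^sup>2))
      \<le> ennreal (exp C) * ennreal (exp ((- 2 * \<theta>) * inner (grid_noise h c J n \<omega>) y))"
      by (simp only: ennreal_mult[symmetric] exp_ge_zero ennreal_leI)
  qed
  also have "\<dots> = ennreal (exp C) * (\<integral>\<^sup>+\<omega>. ennreal (exp ((- 2 * \<theta>) * inner (grid_noise h c J n \<omega>) y)) \<partial>M)"
  proof (rule nn_integral_cmult)
    show "(\<lambda>\<omega>. ennreal (exp ((- 2 * \<theta>) * inner (grid_noise h c J n \<omega>) y))) \<in> borel_measurable M"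
      using h by (simp add: grid_noise_def inner_sum_left)
  qed
  also have "\<dots> \<le> ennreal (exp C) * ennreal (exp ((- 2 * \<theta>)\<^sup>2 * q / 2 * (norm y)\<^sup>2))"
    by (intro mult_left_mono nn_integral_exp_inner_noise h q) simp
  also have "\<dots> = ennreal (exp (C + (- 2 * \<theta>)\<^sup>2 * q / 2 * (norm y)\<^sup>2))"
    by (simp add: ennreal_mult[symmetric] exp_add)
  also have "C + (- 2 * \<theta>)\<^sup>2 * q / 2 * (norm y)\<^sup>2 = - (\<theta> / (1 + 2 * \<theta> * q)) * (norm a)\<^sup>2"
  proof -
    have "C + (- 2 * \<theta>)\<^sup>2 * q / 2 * (norm y)\<^sup>2 = (norm a)\<^sup>2 * \<theta> * (r * (r * (1 + 2 * \<theta> * q)) - 2 * r)"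
    proof -
      have n: "inner a y = r * (norm a)\<^sup>2" "(norm y)\<^sup>2 = r\<^sup>2 * (norm a)\<^sup>2"
        by (simp_all only: y_def inner_scaleR_right power2_norm_eq_inner norm_scaleR power_mult_distrib power2_abs)
      show ?thesis unfolding C_def n by (simp add: algebra_simps power2_eq_square)
    qed
    also have "r * (1 + 2 * \<theta> * q) = 1" using pos by (simp add: r_def)
    finally show ?thesis by (simp add: r_def)
  qed
  finally show ?thesis .
qed

text \<open>Gaussian linearisation: \<open>exp (b * Y^2)\<close> is the mean of
  \<open>exp (sqrt (2 * b) * Y * z)\<close> over a standard normal variable \<open>z\<close>. After
  the exchange of integrals only a linear exponential of the increments and a one-dimensional
  integral over \<open>z\<close> remain.\<close>

lemma nn_integral_exp_square_grid_sum:
  assumes h: "0 < h" and "0 \<le> b" and k: "b * (h * (\<Sum>j<J. (a j)\<^sup>2)) \<le> 1 / 4"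
  shows "(\<integral>\<^sup>+\<omega>. ennreal (exp (b * (\<Sum>j<J. grid_inc h (n, j) \<omega> * a j)\<^sup>2)) \<partial>M)
    \<le> ennreal (exp (2 * (b * (h * (\<Sum>j<J. (a j)\<^sup>2)))))"
proof -
  have [measurable]: "grid_inc h p \<in> borel_measurable M" for p using h by simp
  define Y where "Y \<omega> = (\<Sum>j<J. grid_inc h (n, j) \<omega> * a j)" for \<omega>
  have [measurable]: "Y \<in> borel_measurable M" unfolding Y_def by measurable
  interpret P: pair_sigma_finite lborel M ..
  have "(\<integral>\<^sup>+\<omega>. ennreal (exp (b * (Y \<omega>)\<^sup>2)) \<partial>M)
      = (\<integral>\<^sup>+\<omega>. \<integral>\<^sup>+z. ennreal (std_normal_density z) * ennreal (exp (sqrt (2 * b) * Y \<omega> * z)) \<partial>lborel \<partial>M)"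
    using \<open>0 \<le> b\<close> by (subst nn_integral_normal_exp) (simp_all add: power_mult_distrib)
  also have "\<dots> = (\<integral>\<^sup>+z. \<integral>\<^sup>+\<omega>. ennreal (std_normal_density z) * ennreal (exp (sqrt (2 * b) * Y \<omega> * z)) \<partial>M \<partial>lborel)"
    by (rule P.Fubini') measurable
  also have "\<dots> = (\<integral>\<^sup>+z. ennreal (std_normal_density z) * ennreal (exp (b * (h * (\<Sum>j<J. (a j)\<^sup>2)) * z\<^sup>2)) \<partial>lborel)"
  proof (rule nn_integral_cong)
    fix z
    have "(\<integral>\<^sup>+\<omega>. ennreal (exp (sqrt (2 * b) * Y \<omega> * z)) \<partial>M)
        = (\<integral>\<^sup>+\<omega>. ennreal (exp (\<Sum>j<J. grid_inc h (n, j) \<omega> * (sqrt (2 * b) * z * a j))) \<partial>M)"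
      by (simp add: Y_def sum_distrib_left sum_distrib_right ac_simps)
    also have "\<dots> = ennreal (exp (h / 2 * (\<Sum>j<J. (sqrt (2 * b) * z * a j)\<^sup>2)))"
      by (rule nn_integral_exp_grid_sum[OF h])
    also have "h / 2 * (\<Sum>j<J. (sqrt (2 * b) * z * a j)\<^sup>2) = b * (h * (\<Sum>j<J. (a j)\<^sup>2)) * z\<^sup>2"
      using \<open>0 \<le> b\<close> by (simp add: power_mult_distrib sum_distrib_left sum_distrib_right ac_simps)
    finally show "(\<integral>\<^sup>+\<omega>. ennreal (std_normal_density z) * ennreal (exp (sqrt (2 * b) * Y \<omega> * z)) \<partial>M)
        = ennreal (std_normal_density z) * ennreal (exp (b * (h * (\<Sum>j<J. (a j)\<^sup>2)) * z\<^sup>2))"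
      by (subst nn_integral_cmult) (simp_all, measurable)
  qed
  also have "\<dots> \<le> ennreal (exp (2 * (b * (h * (\<Sum>j<J. (a j)\<^sup>2)))))"
    by (rule nn_integral_std_normal_exp_sq) (use assms in \<open>auto intro!: mult_nonneg_nonneg sum_nonneg\<close>)
  finally show ?thesis by (simp add: Y_def)
qed

text \<open>The coordinates of the noise in the basis \<open>e\<close> may be correlated, so their
  exponential moments need not multiply. Convexity of \<open>exp\<close> with weights proportional
  to the variances is used instead; the variances sum to at most \<open>\<tau>\<close>, and Fatou's
  lemma passes to infinitely many coordinates.\<close>

lemma nn_integral_exp_norm_noise:
  assumes e: "orthonormal_basis (e :: nat \<Rightarrow> l2)" and h: "0 < h"
    and \<tau>: "h * (\<Sum>j<J. (norm (c j))\<^sup>2) \<le> \<tau>" and "0 \<le> \<theta>" "\<theta> * \<tau> \<le> 1 / 4"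
  shows "(\<integral>\<^sup>+\<omega>. ennreal (exp (\<theta> * (norm (grid_noise h c J n \<omega>))\<^sup>2)) \<partial>M) \<le> ennreal (exp (2 * \<theta> * \<tau>))"
proof -
  have [measurable]: "grid_inc h p \<in> borel_measurable M" for p using h by simp
  define g where "g k \<omega> = inner (grid_noise h c J n \<omega>) (e k)" for k \<omega>
  have g: "g k \<omega> = (\<Sum>j<J. grid_inc h (n, j) \<omega> * inner (c j) (e k))" for k \<omega>
    by (simp add: g_def grid_noise_def inner_sum_left)
  have [measurable]: "g k \<in> borel_measurable M" for k unfolding g by measurable
  define s where "s k = h * (\<Sum>j<J. (inner (c j) (e k))\<^sup>2)" for k
  have s0: "0 \<le> s k" for k using h by (simp add: s_def sum_nonneg)
  have fin: "(\<integral>\<^sup>+\<omega>. ennreal (exp (\<theta> * (\<Sum>k<K. (g k \<omega>)\<^sup>2))) \<partial>M) \<le> ennreal (exp (2 * \<theta> * \<tau>))" for K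
  proof -
    define Sg where "Sg = (\<Sum>k<K. s k)"
    have Sg0: "0 \<le> Sg" by (simp add: Sg_def sum_nonneg s0)
    have "Sg = h * (\<Sum>j<J. \<Sum>k<K. (inner (c j) (e k))\<^sup>2)"
      by (simp add: Sg_def s_def sum_distrib_left[symmetric] sum.swap[of _ "{..<K}"])
    also have "\<dots> \<le> h * (\<Sum>j<J. (norm (c j))\<^sup>2)"
    proof (intro mult_left_mono sum_mono)
      show "(\<Sum>k<K. (inner (c j) (e k))\<^sup>2) \<le> (norm (c j))\<^sup>2" for j
        using parseval[OF e, of "c j"] sum_le_suminf[of "\<lambda>k. (inner (c j) (e k))\<^sup>2" "{..<K}"]
        by (simp add: sums_iff)
    qed (use h in simp)
    finally have Sg\<tau>: "Sg \<le> \<tau>" using \<tau> by simp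
    \<comment> \<open>A coordinate of variance zero vanishes identically, so the value
      \<open>0\<close> that division by \<open>s k = 0\<close> gives to \<open>b k\<close> does no
      harm.\<close>
    have zero: "g k \<omega> = 0" if "s k = 0" for k \<omega>
    proof -
      have "(\<Sum>j<J. (inner (c j) (e k))\<^sup>2) = 0" using that h by (simp add: s_def)
      then have "\<forall>j\<in>{..<J}. (inner (c j) (e k))\<^sup>2 = 0" by (subst (asm) sum_nonneg_eq_0_iff) auto
      then show ?thesis by (simp add: g)
    qed
    have mono: "ennreal (exp (2 * (\<theta> * Sg))) \<le> ennreal (exp (2 * \<theta> * \<tau>))"
      using Sg\<tau> \<open>0 \<le> \<theta>\<close> by (intro ennreal_leI) (simp add: mult_left_mono)
    show ?thesis
    proof (cases "Sg = 0")
      case True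
      then have "s k = 0" if "k < K" for k
        using that s0 unfolding Sg_def by (subst (asm) sum_nonneg_eq_0_iff) auto
      then have "(\<Sum>k<K. (g k \<omega>)\<^sup>2) = 0" for \<omega> by (intro sum.neutral) (auto simp: zero)
      then show ?thesis using mono True by (simp add: emeasure_space_1)
    next
      case False
      then have Sgp: "0 < Sg" using Sg0 by simp
      have K: "{..<K} \<noteq> {}" using False by (auto simp: Sg_def)
      \<comment> \<open>With these weights \<open>b k * s k\<close> equals
        \<open>\<theta> * Sg\<close> for every coordinate of positive variance, so all terms of the
        convex combination have the same bound.\<close>
      define w where "w k = s k / Sg" for k
      define b where "b k = \<theta> * Sg / s k" for k
      have w: "0 \<le> w k" for k using s0 Sg0 by (simp add: w_def)
      have w1: "(\<Sum>k<K. w k) = 1" using Sgp by (simp add: w_def sum_divide_distrib[symmetric] Sg_def)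
      have "(\<integral>\<^sup>+\<omega>. ennreal (exp (\<theta> * (\<Sum>k<K. (g k \<omega>)\<^sup>2))) \<partial>M)
          \<le> (\<integral>\<^sup>+\<omega>. (\<Sum>k<K. ennreal (w k) * ennreal (exp (b k * (g k \<omega>)\<^sup>2))) \<partial>M)"
      proof (rule nn_integral_mono)
        fix \<omega>
        have eq: "\<theta> * (g k \<omega>)\<^sup>2 = w k * (b k * (g k \<omega>)\<^sup>2)" for k
          using Sgp zero[of k \<omega>] by (cases "s k = 0") (simp_all add: w_def b_def)
        have "\<theta> * (\<Sum>k<K. (g k \<omega>)\<^sup>2) = (\<Sum>k<K. w k *\<^sub>R (b k * (g k \<omega>)\<^sup>2))"
          unfolding sum_distrib_left real_scaleR_def by (rule sum.cong[OF refl eq])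
        then have "exp (\<theta> * (\<Sum>k<K. (g k \<omega>)\<^sup>2)) \<le> (\<Sum>k<K. w k * exp (b k * (g k \<omega>)\<^sup>2))"
          using convex_on_sum[OF _ K exp_convex w1, of "\<lambda>k. b k * (g k \<omega>)\<^sup>2"] w by simp
        then have "ennreal (exp (\<theta> * (\<Sum>k<K. (g k \<omega>)\<^sup>2))) \<le> ennreal (\<Sum>k<K. w k * exp (b k * (g k \<omega>)\<^sup>2))"
          by (rule ennreal_leI)
        also have "\<dots> = (\<Sum>k<K. ennreal (w k) * ennreal (exp (b k * (g k \<omega>)\<^sup>2)))"
          using w by (simp add: sum_ennreal[symmetric] ennreal_mult)
        finally show "ennreal (exp (\<theta> * (\<Sum>k<K. (g k \<omega>)\<^sup>2))) \<le> (\<Sum>k<K. ennreal (w k) * ennreal (exp (b k * (g k \<omega>)\<^sup>2)))" .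
      qed
      also have "\<dots> = (\<Sum>k<K. ennreal (w k) * (\<integral>\<^sup>+\<omega>. ennreal (exp (b k * (g k \<omega>)\<^sup>2)) \<partial>M))"
        by (subst nn_integral_sum) (auto simp: nn_integral_cmult)
      also have "\<dots> \<le> (\<Sum>k<K. ennreal (w k) * ennreal (exp (2 * (\<theta> * Sg))))"
      proof (intro sum_mono mult_left_mono)
        fix k
        have b0: "0 \<le> b k" using \<open>0 \<le> \<theta>\<close> Sg0 s0 by (simp add: b_def)
        have bs: "b k * s k \<le> \<theta> * Sg"
          using \<open>0 \<le> \<theta>\<close> Sg0 by (cases "s k = 0") (simp_all add: b_def)
        have le: "\<theta> * Sg \<le> 1 / 4"
          using mult_left_mono[OF Sg\<tau> \<open>0 \<le> \<theta>\<close>] assms(5) by linarith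
        have "(\<integral>\<^sup>+\<omega>. ennreal (exp (b k * (g k \<omega>)\<^sup>2)) \<partial>M) \<le> ennreal (exp (2 * (b k * s k)))"
          unfolding g s_def
          by (rule nn_integral_exp_square_grid_sum[OF h b0]) (use bs le in \<open>simp add: s_def\<close>)
        also have "\<dots> \<le> ennreal (exp (2 * (\<theta> * Sg)))" using bs by (intro ennreal_leI) simp
        finally show "(\<integral>\<^sup>+\<omega>. ennreal (exp (b k * (g k \<omega>)\<^sup>2)) \<partial>M) \<le> ennreal (exp (2 * (\<theta> * Sg)))" .
      qed simp
      also have "\<dots> = ennreal (exp (2 * (\<theta> * Sg)))"
        using w w1 by (simp add: sum_distrib_right[symmetric] sum_ennreal)
      finally show ?thesis using mono by (rule order_trans)
    qed
  qed
  have "(\<integral>\<^sup>+\<omega>. ennreal (exp (\<theta> * (norm (grid_noise h c J n \<omega>))\<^sup>2)) \<partial>M)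
      = (\<integral>\<^sup>+\<omega>. liminf (\<lambda>K. ennreal (exp (\<theta> * (\<Sum>k<K. (g k \<omega>)\<^sup>2)))) \<partial>M)"
  proof (rule nn_integral_cong)
    fix \<omega>
    have "(\<lambda>K. (\<Sum>k<K. (g k \<omega>)\<^sup>2)) \<longlonglongrightarrow> (norm (grid_noise h c J n \<omega>))\<^sup>2"
      using parseval[OF e, of "grid_noise h c J n \<omega>"] by (simp add: sums_def g_def)
    then have "(\<lambda>K. ennreal (exp (\<theta> * (\<Sum>k<K. (g k \<omega>)\<^sup>2)))) \<longlonglongrightarrow> ennreal (exp (\<theta> * (norm (grid_noise h c J n \<omega>))\<^sup>2))"
      by (intro tendsto_intros)
    then show "ennreal (exp (\<theta> * (norm (grid_noise h c J n \<omega>))\<^sup>2)) = liminf (\<lambda>K. ennreal (exp (\<theta> * (\<Sum>k<K. (g k \<omega>)\<^sup>2))))"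
      by (rule lim_imp_Liminf[OF sequentially_bot, symmetric])
  qed
  also have "\<dots> \<le> liminf (\<lambda>K. \<integral>\<^sup>+\<omega>. ennreal (exp (\<theta> * (\<Sum>k<K. (g k \<omega>)\<^sup>2))) \<partial>M)"
    by (intro nn_integral_liminf) measurable
  also have "\<dots> \<le> ennreal (exp (2 * \<theta> * \<tau>))"
    by (rule Liminf_le) (use fin in simp_all)
  finally show ?thesis .
qed

lemma ennreal_linear_combination:
  "0 \<le> a \<Longrightarrow> 0 \<le> b \<Longrightarrow> 0 \<le> x \<Longrightarrow> 0 \<le> y \<Longrightarrow>
    ennreal (a * x + b * y) = ennreal a * ennreal x + ennreal b * ennreal y"
  by (simp add: ennreal_mult ennreal_plus)

text \<open>In the expanded square the cross term is governed by the operator bound \<open>q\<close>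
  and the pure noise term by the trace bound \<open>\<tau>\<close>. Separating them by
  \<open>u * v \<le> r / 2 * u^2 + 1 / (2 * r) * v^2\<close> keeps \<open>\<tau>\<close> out of the
  coefficient of \<open>(norm a)^2\<close>; the price is \<open>4 * q\<close> there, where the cross
  term alone would give \<open>2 * q\<close>.\<close>

lemma nn_integral_exp_plus_noise:
  assumes e: "orthonormal_basis (e :: nat \<Rightarrow> l2)" and h: "0 < h"
    and q: "\<And>y. h * (\<Sum>j<J. (inner (c j) y)\<^sup>2) \<le> q * (norm y)\<^sup>2"
    and \<tau>: "h * (\<Sum>j<J. (norm (c j))\<^sup>2) \<le> \<tau>" and "0 \<le> \<theta>" "2 * \<theta> * \<tau> \<le> 1 / 4"
  shows "(\<integral>\<^sup>+\<omega>. ennreal (exp (\<theta> * (norm (a + grid_noise h c J n \<omega>))\<^sup>2)) \<partial>M)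
    \<le> ennreal (exp (2 * \<theta> * \<tau>)) * ennreal (exp (\<theta> * (1 + 4 * \<theta> * q) * (norm a)\<^sup>2))"
proof -
  have [measurable]: "grid_inc h p \<in> borel_measurable M" for p using h by simp
  have [measurable]: "(\<lambda>\<omega>. inner (grid_noise h c J n \<omega>) a) \<in> borel_measurable M"
    by (simp add: grid_noise_def inner_sum_left)
  have [measurable]: "(\<lambda>\<omega>. norm (grid_noise h c J n \<omega>)) \<in> borel_measurable M"
    unfolding grid_noise_def
    by (intro weakly_measurable_norm[OF e] weakly_measurable_sum weakly_measurable_scaleR weakly_measurable_const) simp
  define A B where "A = exp (4 * \<theta>\<^sup>2 * q * (norm a)\<^sup>2)" and "B = exp (2 * \<theta> * \<tau>)"
  have AB: "0 < A" "0 < B" by (simp_all add: A_def B_def)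
  \<comment> \<open>This weight makes the two halves equal, so that their sum is the product
    \<open>A * B\<close> that Cauchy-Schwarz would give.\<close>
  define r where "r = B / A"
  have r: "0 < r" using AB by (simp add: r_def)
  let ?G = "grid_noise h c J n"
  let ?U = "\<lambda>\<omega>. exp ((4 * \<theta>) * inner (?G \<omega>) a)" and ?V = "\<lambda>\<omega>. exp ((2 * \<theta>) * (norm (?G \<omega>))\<^sup>2)"
  have U: "(\<integral>\<^sup>+\<omega>. ennreal (?U \<omega>) \<partial>M) \<le> ennreal (A\<^sup>2)"
  proof -
    have "(\<integral>\<^sup>+\<omega>. ennreal (?U \<omega>) \<partial>M) \<le> ennreal (exp ((4 * \<theta>)\<^sup>2 * q / 2 * (norm a)\<^sup>2))"
      by (rule nn_integral_exp_inner_noise[OF h q])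
    also have "exp ((4 * \<theta>)\<^sup>2 * q / 2 * (norm a)\<^sup>2) = A\<^sup>2"
      by (simp add: A_def power2_eq_square exp_add[symmetric])
    finally show ?thesis .
  qed
  have V: "(\<integral>\<^sup>+\<omega>. ennreal (?V \<omega>) \<partial>M) \<le> ennreal (B\<^sup>2)"
  proof -
    have "(\<integral>\<^sup>+\<omega>. ennreal (?V \<omega>) \<partial>M) \<le> ennreal (exp (2 * (2 * \<theta>) * \<tau>))"
      using assms by (intro nn_integral_exp_norm_noise[OF e h \<tau>]) auto
    also have "exp (2 * (2 * \<theta>) * \<tau>) = B\<^sup>2"
      by (simp add: B_def power2_eq_square exp_add[symmetric])
    finally show ?thesis .
  qed
  define D where "D = exp (\<theta> * (norm a)\<^sup>2)"
  have "(\<integral>\<^sup>+\<omega>. ennreal (exp (\<theta> * (norm (a + ?G \<omega>))\<^sup>2)) \<partial>M)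
      \<le> (\<integral>\<^sup>+\<omega>. ennreal (D * (r / 2)) * ennreal (?U \<omega>) + ennreal (D * (1 / (2 * r))) * ennreal (?V \<omega>) \<partial>M)"
  proof (rule nn_integral_mono)
    fix \<omega>
    define u v where "u = exp (2 * \<theta> * inner (?G \<omega>) a)" and "v = exp (\<theta> * (norm (?G \<omega>))\<^sup>2)"
    have "(norm (a + ?G \<omega>))\<^sup>2 = (norm a)\<^sup>2 + 2 * inner (?G \<omega>) a + (norm (?G \<omega>))\<^sup>2"
      by (simp add: power2_norm_eq_inner inner_add_left inner_add_right inner_commute)
    then have "exp (\<theta> * (norm (a + ?G \<omega>))\<^sup>2) = D * (u * v)"
      by (simp add: D_def u_def v_def exp_add[symmetric] algebra_simps)
    also have "u * v \<le> r / 2 * u\<^sup>2 + 1 / (2 * r) * v\<^sup>2"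
    proof -
      have "0 \<le> (r * u - v)\<^sup>2 / (2 * r)" using r by simp
      also have "\<dots> = r / 2 * u\<^sup>2 + 1 / (2 * r) * v\<^sup>2 - u * v"
        using r by (simp add: field_simps power2_eq_square)
      finally show ?thesis by simp
    qed
    finally have "exp (\<theta> * (norm (a + ?G \<omega>))\<^sup>2) \<le> D * (r / 2 * u\<^sup>2 + 1 / (2 * r) * v\<^sup>2)"
      by (simp add: D_def)
    also have "u\<^sup>2 = ?U \<omega>" by (simp add: u_def power2_eq_square exp_add[symmetric])
    also have "v\<^sup>2 = ?V \<omega>" by (simp add: v_def power2_eq_square exp_add[symmetric])
    finally have "exp (\<theta> * (norm (a + ?G \<omega>))\<^sup>2) \<le> (D * (r / 2)) * ?U \<omega> + (D * (1 / (2 * r))) * ?V \<omega>"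
      by (simp add: algebra_simps)
    then have "ennreal (exp (\<theta> * (norm (a + ?G \<omega>))\<^sup>2)) \<le> ennreal ((D * (r / 2)) * ?U \<omega> + (D * (1 / (2 * r))) * ?V \<omega>)"
      by (rule ennreal_leI)
    also have "\<dots> = ennreal (D * (r / 2)) * ennreal (?U \<omega>) + ennreal (D * (1 / (2 * r))) * ennreal (?V \<omega>)"
      by (rule ennreal_linear_combination) (use r in \<open>simp_all add: D_def\<close>)
    finally show "ennreal (exp (\<theta> * (norm (a + ?G \<omega>))\<^sup>2))
        \<le> ennreal (D * (r / 2)) * ennreal (?U \<omega>) + ennreal (D * (1 / (2 * r))) * ennreal (?V \<omega>)" .
  qed
  also have "\<dots> = ennreal (D * (r / 2)) * (\<integral>\<^sup>+\<omega>. ennreal (?U \<omega>) \<partial>M) + ennreal (D * (1 / (2 * r))) * (\<integral>\<^sup>+\<omega>. ennreal (?V \<omega>) \<partial>M)"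
    by (simp add: nn_integral_add nn_integral_cmult)
  also have "\<dots> \<le> ennreal (D * (r / 2)) * ennreal (A\<^sup>2) + ennreal (D * (1 / (2 * r))) * ennreal (B\<^sup>2)"
    by (intro add_mono mult_left_mono U V) auto
  also have "\<dots> = ennreal (D * (r / 2) * A\<^sup>2 + D * (1 / (2 * r)) * B\<^sup>2)"
    using r by (simp add: D_def ennreal_mult[symmetric] ennreal_plus[symmetric] del: ennreal_plus)
  also have "D * (r / 2) * A\<^sup>2 + D * (1 / (2 * r)) * B\<^sup>2 = B * (D * A)"
    using AB by (simp add: r_def power2_eq_square field_simps)
  also have "D * A = exp (\<theta> * (1 + 4 * \<theta> * q) * (norm a)\<^sup>2)"
    by (simp add: D_def A_def exp_add[symmetric] power2_eq_square algebra_simps)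
  finally show ?thesis by (simp add: B_def ennreal_mult)
qed

section \<open>Iterating the one-step bounds along the walk\<close>

definition grid_path :: "real \<Rightarrow> 'w \<Rightarrow> nat \<times> nat \<Rightarrow> real" where
  "grid_path h \<omega> p = grid_inc h p \<omega>"

lemma measurable_walk_grid_path:
  assumes h: "0 < h" and A: "\<And>n. continuous_on UNIV (A n)" and F: "continuous_on UNIV (F :: l2 \<Rightarrow> real)"
  shows "(\<lambda>\<omega>. F (walk A c J v n (grid_path h \<omega>))) \<in> borel_measurable M"
proof -
  have "(\<lambda>x. F (walk A c J v n x)) \<in> borel_measurable borel"
    by (intro borel_measurable_continuous_onI continuous_on_compose2[OF F continuous_on_walk[OF A]]) auto
  then have "(\<lambda>x. F (walk A c J v n x)) \<in> borel_measurable (\<Pi>\<^sub>M p\<in>UNIV. borel)"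
    by (subst measurable_cong_sets[OF sets_PiM_equal_borel refl])
  moreover have "grid_path h \<in> measurable M (\<Pi>\<^sub>M p\<in>UNIV. borel)"
    unfolding grid_path_def[abs_def] using h by (intro measurable_PiM_single') auto
  ultimately show ?thesis by (rule measurable_compose[rotated])
qed

text \<open>Row \<open>n\<close> of the increments is independent of the earlier rows, so the walk
  up to \<open>n\<close> is frozen while the new noise is averaged; \<open>A n\<close> then drops
  out because \<open>F'\<close> sees only the norm.\<close>

lemma walk_step:
  assumes h: "0 < h" and A: "\<And>n. continuous_on UNIV (A n)" "\<And>n u. norm (A n u) = norm u"
    and F: "continuous_on UNIV F"
    and bound: "\<And>a. (\<integral>\<^sup>+\<omega>. ennreal (F (a + grid_noise h (c n) J n \<omega>)) \<partial>M) \<le> ennreal K * ennreal (F' (norm a))"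
    and F': "continuous_on UNIV F'"
  shows "(\<integral>\<^sup>+\<omega>. ennreal (F (walk A c J v (Suc n) (grid_path h \<omega>))) \<partial>M)
    \<le> ennreal K * (\<integral>\<^sup>+\<omega>. ennreal (F' (norm (walk A c J v n (grid_path h \<omega>)))) \<partial>M)"
proof -
  define P Q where "P = {..<n} \<times> {..<J}" and "Q = {n} \<times> {..<J}"
  define X where "X I \<omega> = (\<lambda>p\<in>I. grid_inc h p \<omega>)" for I \<omega>
  \<comment> \<open>\<open>z\<close> glues the two independent blocks into one array and fills the
    rest with \<open>0\<close>, which the first \<open>n + 1\<close> steps never read.\<close>
  define z where "z xy p = (if p \<in> P then fst xy p else if p \<in> Q then snd xy p else 0)"
    for xy :: "(nat \<times> nat \<Rightarrow> real) \<times> (nat \<times> nat \<Rightarrow> real)" and p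
  have ind: "indep_var (\<Pi>\<^sub>M p\<in>P. borel) (X P) (\<Pi>\<^sub>M p\<in>Q. borel) (X Q)"
    unfolding X_def
    by (rule indep_var_restrict[OF indep_grid_inc[OF h, of "Suc n" J]]) (auto simp: P_def Q_def)
  have z: "z \<in> measurable ((\<Pi>\<^sub>M p\<in>P. borel) \<Otimes>\<^sub>M (\<Pi>\<^sub>M p\<in>Q. borel)) (\<Pi>\<^sub>M p\<in>UNIV. borel)"
    unfolding z_def[abs_def]
  proof (rule measurable_PiM_single')
    fix p :: "nat \<times> nat"
    show "(\<lambda>xy. if p \<in> P then fst xy p else if p \<in> Q then snd xy p else 0)
        \<in> borel_measurable ((\<Pi>\<^sub>M p\<in>P. borel) \<Otimes>\<^sub>M (\<Pi>\<^sub>M p\<in>Q. borel))"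
      by (cases "p \<in> P"; cases "p \<in> Q") auto
  qed auto
  have "(\<lambda>x. F (walk A c J v (Suc n) x)) \<in> borel_measurable borel"
    by (intro borel_measurable_continuous_onI continuous_on_compose2[OF F continuous_on_walk[OF A(1)]]) auto
  then have "(\<lambda>x. F (walk A c J v (Suc n) x)) \<in> borel_measurable (\<Pi>\<^sub>M p\<in>UNIV. borel)"
    by (subst measurable_cong_sets[OF sets_PiM_equal_borel refl])
  from measurable_compose[OF z this]
  have m: "(\<lambda>xy. ennreal (F (walk A c J v (Suc n) (z xy)))) \<in> borel_measurable ((\<Pi>\<^sub>M p\<in>P. borel) \<Otimes>\<^sub>M (\<Pi>\<^sub>M p\<in>Q. borel))"
    by measurable
  have wz: "walk A c J v n (z (X P \<omega>, X Q \<omega>')) = walk A c J v n (grid_path h \<omega>)" for \<omega> \<omega>'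
    by (rule walk_cong) (auto simp: z_def X_def P_def grid_path_def)
  have wz': "walk A c J v (Suc n) (z (X P \<omega>, X Q \<omega>'))
      = A n (walk A c J v n (grid_path h \<omega>)) + grid_noise h (c n) J n \<omega>'" for \<omega> \<omega>'
  proof -
    have "z (X P \<omega>, X Q \<omega>') (n, j) = grid_inc h (n, j) \<omega>'" if "j < J" for j
      using that by (simp add: z_def X_def P_def Q_def)
    then show ?thesis by (simp add: wz grid_noise_def)
  qed
  have "(\<integral>\<^sup>+\<omega>. ennreal (F (walk A c J v (Suc n) (grid_path h \<omega>))) \<partial>M)
      = (\<integral>\<^sup>+\<omega>. ennreal (F (walk A c J v (Suc n) (z (X P \<omega>, X Q \<omega>)))) \<partial>M)"
    unfolding wz' by (simp add: grid_noise_def grid_path_def)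
  also have "\<dots> = (\<integral>\<^sup>+\<omega>. \<integral>\<^sup>+\<omega>'. ennreal (F (walk A c J v (Suc n) (z (X P \<omega>, X Q \<omega>')))) \<partial>M \<partial>M)"
    by (rule nn_integral_indep_var[OF ind m])
  also have "\<dots> \<le> (\<integral>\<^sup>+\<omega>. ennreal K * ennreal (F' (norm (A n (walk A c J v n (grid_path h \<omega>))))) \<partial>M)"
    unfolding wz' by (intro nn_integral_mono bound)
  also have "\<dots> = ennreal K * (\<integral>\<^sup>+\<omega>. ennreal (F' (norm (walk A c J v n (grid_path h \<omega>)))) \<partial>M)"
    unfolding A(2)
    by (intro nn_integral_cmult measurable_compose[OF measurable_walk_grid_path[OF h A(1), where F = "\<lambda>u. F' (norm u)"]]
        continuous_on_compose2[OF F'] continuous_intros) auto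
  finally show ?thesis .
qed

text \<open>The one-step map \<open>\<theta> \<mapsto> \<theta> / (1 + 2 * \<theta> * q)\<close> is
  a translation by \<open>2 * q\<close> in the variable \<open>\<rho> = 1 / \<theta>\<close>. Hence
  this parametrisation, and an induction that lets \<open>\<rho>\<close> vary.\<close>

lemma walk_exp_minus:
  assumes h: "0 < h" and A: "\<And>n. continuous_on UNIV (A n)" "\<And>n u. norm (A n u) = norm u"
    and q: "\<And>n y. h * (\<Sum>j<J. (inner (c n j) y)\<^sup>2) \<le> q * (norm y)\<^sup>2" "0 \<le> q"
  shows "0 < \<rho> \<Longrightarrow> (\<integral>\<^sup>+\<omega>. ennreal (exp (- (norm (walk A c J v n (grid_path h \<omega>)))\<^sup>2 / \<rho>)) \<partial>M)
    \<le> ennreal (exp (- (norm v)\<^sup>2 / (\<rho> + 2 * q * n)))"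
proof (induction n arbitrary: \<rho>)
  case 0
  then show ?case by (simp add: emeasure_space_1)
next
  case (Suc n)
  have "(\<integral>\<^sup>+\<omega>. ennreal (exp (- (norm (walk A c J v (Suc n) (grid_path h \<omega>)))\<^sup>2 / \<rho>)) \<partial>M)
      \<le> ennreal 1 * (\<integral>\<^sup>+\<omega>. ennreal (exp (- (norm (walk A c J v n (grid_path h \<omega>)))\<^sup>2 / (\<rho> + 2 * q))) \<partial>M)"
  proof (rule walk_step[OF h A])
    fix a
    have "(\<integral>\<^sup>+\<omega>. ennreal (exp (- (1 / \<rho>) * (norm (a + grid_noise h (c n) J n \<omega>))\<^sup>2)) \<partial>M)
        \<le> ennreal (exp (- ((1 / \<rho>) / (1 + 2 * (1 / \<rho>) * q)) * (norm a)\<^sup>2))"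
      using Suc.prems q by (intro nn_integral_exp_minus_noise h) auto
    moreover have "(1 / \<rho>) / (1 + 2 * (1 / \<rho>) * q) = 1 / (\<rho> + 2 * q)"
      using Suc.prems q(2) by (simp add: field_simps)
    ultimately show "(\<integral>\<^sup>+\<omega>. ennreal (exp (- (norm (a + grid_noise h (c n) J n \<omega>))\<^sup>2 / \<rho>)) \<partial>M)
        \<le> ennreal 1 * ennreal (exp (- (norm a)\<^sup>2 / (\<rho> + 2 * q)))"
      by simp
  qed (use Suc.prems q(2) in \<open>auto intro!: continuous_intros\<close>)
  also have "\<dots> \<le> ennreal (exp (- (norm v)\<^sup>2 / (\<rho> + 2 * q + 2 * q * n)))"
    using Suc.IH[of "\<rho> + 2 * q"] Suc.prems q(2) by simp
  finally show ?case by (simp add: algebra_simps)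
qed

text \<open>Going back one step lowers \<open>\<rho>\<close> by \<open>4 * q\<close>, since
  \<open>(\<rho> + 4 * q) / \<rho>^2 \<le> 1 / (\<rho> - 4 * q)\<close>. The premise on
  \<open>\<rho>\<close> keeps it at least \<open>\<rho>0\<close> throughout, so every step costs at
  most the factor \<open>exp (2 * \<tau> / \<rho>0)\<close>; the start at \<open>0\<close>
  contributes the factor \<open>1\<close>.\<close>

lemma walk_exp_plus:
  assumes e: "orthonormal_basis (e :: nat \<Rightarrow> l2)"
    and h: "0 < h" and A: "\<And>n. continuous_on UNIV (A n)" "\<And>n u. norm (A n u) = norm u"
    and q: "\<And>n y. h * (\<Sum>j<J. (inner (c n j) y)\<^sup>2) \<le> q * (norm y)\<^sup>2" "0 \<le> q"
    and \<tau>: "\<And>n. h * (\<Sum>j<J. (norm (c n j))\<^sup>2) \<le> \<tau>" "0 \<le> \<tau>"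
    and \<rho>0: "0 < \<rho>0" "2 * \<tau> / \<rho>0 \<le> 1 / 4"
  shows "\<rho>0 + 4 * q * n \<le> \<rho> \<Longrightarrow> (\<integral>\<^sup>+\<omega>. ennreal (exp ((norm (walk A c J 0 n (grid_path h \<omega>)))\<^sup>2 / \<rho>)) \<partial>M)
    \<le> ennreal (exp (2 * \<tau> / \<rho>0 * n))"
proof (induction n arbitrary: \<rho>)
  case 0
  then show ?case by (simp add: emeasure_space_1)
next
  case (Suc n)
  have \<rho>: "\<rho>0 + 4 * q * n \<le> \<rho> - 4 * q" using Suc.prems by (simp add: algebra_simps)
  have pos: "0 < \<rho> - 4 * q" "\<rho>0 \<le> \<rho>" "0 < \<rho>"
  proof -
    have "0 \<le> 4 * q * real n" using q(2) by simp
    then show "0 < \<rho> - 4 * q" "\<rho>0 \<le> \<rho>" "0 < \<rho>" using \<rho> \<rho>0(1) q(2) by linarith+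
  qed
  have \<tau>\<rho>: "2 * \<tau> / \<rho> \<le> 2 * \<tau> / \<rho>0" using pos \<rho>0 \<tau>(2) by (intro divide_left_mono) auto
  have "(\<integral>\<^sup>+\<omega>. ennreal (exp ((norm (walk A c J 0 (Suc n) (grid_path h \<omega>)))\<^sup>2 / \<rho>)) \<partial>M)
      \<le> ennreal (exp (2 * \<tau> / \<rho>0)) * (\<integral>\<^sup>+\<omega>. ennreal (exp ((norm (walk A c J 0 n (grid_path h \<omega>)))\<^sup>2 / (\<rho> - 4 * q))) \<partial>M)"
  proof (rule walk_step[OF h A])
    fix a
    have "(\<integral>\<^sup>+\<omega>. ennreal (exp ((1 / \<rho>) * (norm (a + grid_noise h (c n) J n \<omega>))\<^sup>2)) \<partial>M)
        \<le> ennreal (exp (2 * (1 / \<rho>) * \<tau>)) * ennreal (exp ((1 / \<rho>) * (1 + 4 * (1 / \<rho>) * q) * (norm a)\<^sup>2))"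
      using pos q \<tau> \<tau>\<rho> \<rho>0 by (intro nn_integral_exp_plus_noise[OF e h]) auto
    also have "\<dots> \<le> ennreal (exp (2 * \<tau> / \<rho>0)) * ennreal (exp ((norm a)\<^sup>2 / (\<rho> - 4 * q)))"
    proof (intro mult_mono ennreal_leI)
      have "(1 / \<rho>) * (1 + 4 * (1 / \<rho>) * q) = (\<rho> + 4 * q) / \<rho>\<^sup>2"
        using pos by (simp add: field_simps power2_eq_square)
      also have "\<dots> \<le> 1 / (\<rho> - 4 * q)"
      proof -
        have "(\<rho> + 4 * q) * (\<rho> - 4 * q) \<le> \<rho>\<^sup>2" by (simp add: power2_eq_square algebra_simps)
        moreover have "0 < \<rho>\<^sup>2" using pos by simp
        ultimately show ?thesis
          using pos(1) by (simp only: pos_divide_le_eq times_divide_eq_left mult_1 pos_le_divide_eq)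
      qed
      finally have "(1 / \<rho>) * (1 + 4 * (1 / \<rho>) * q) * (norm a)\<^sup>2 \<le> 1 / (\<rho> - 4 * q) * (norm a)\<^sup>2"
        by (rule mult_right_mono) simp
      then show "exp ((1 / \<rho>) * (1 + 4 * (1 / \<rho>) * q) * (norm a)\<^sup>2) \<le> exp ((norm a)\<^sup>2 / (\<rho> - 4 * q))" by simp
    qed (use \<tau>\<rho> in auto)
    finally show "(\<integral>\<^sup>+\<omega>. ennreal (exp ((norm (a + grid_noise h (c n) J n \<omega>))\<^sup>2 / \<rho>)) \<partial>M)
        \<le> ennreal (exp (2 * \<tau> / \<rho>0)) * ennreal (exp ((norm a)\<^sup>2 / (\<rho> - 4 * q)))"
      by simp
  qed (use pos in \<open>auto intro!: continuous_intros\<close>)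
  also have "\<dots> \<le> ennreal (exp (2 * \<tau> / \<rho>0)) * ennreal (exp (2 * \<tau> / \<rho>0 * n))"
    by (intro mult_left_mono Suc.IH \<rho>) simp
  also have "\<dots> = ennreal (exp (2 * \<tau> / \<rho>0 * Suc n))"
    by (simp add: ennreal_mult[symmetric] exp_add[symmetric] algebra_simps add_divide_distrib)
  finally show ?case .
qed

end

section \<open>Convergence of the splitting scheme\<close>

text \<open>The sum is both the squared norm of \<open>z\<close>, built from the coefficients, and
  \<open>inner (L z) y\<close>; dividing by \<open>norm z\<close> gives the bound. This is how an
  operator norm controls the covariance of the noise.\<close>

lemma sum_inner_sq_le:
  fixes L :: "l2 \<Rightarrow> l2"
  assumes L: "bounded_linear L" and e: "orthonormal_basis e" and B: "\<And>x. norm (L x) \<le> B * norm x"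
  shows "(\<Sum>j<J. (inner (L (e j)) y)\<^sup>2) \<le> B\<^sup>2 * (norm y)\<^sup>2"
proof -
  interpret L: bounded_linear L by (rule L)
  define z where "z = (\<Sum>j<J. inner (L (e j)) y *\<^sub>R e j)"
  define A where "A = (\<Sum>j<J. (inner (L (e j)) y)\<^sup>2)"
  have nz: "(norm z)\<^sup>2 = A" by (simp add: z_def A_def orthonormal_expansion_norm[OF e])
  have "A = inner (L z) y"
    by (simp add: A_def z_def L.sum L.scaleR inner_sum_left power2_eq_square)
  also have "\<dots> \<le> norm (L z) * norm y" by (rule norm_cauchy_schwarz)
  also have "\<dots> \<le> (B * norm z) * norm y" by (intro mult_right_mono B) simp
  finally have le: "A \<le> norm z * (B * norm y)" by (simp add: ac_simps)
  have "norm z \<le> B * norm y \<or> norm z = 0"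
  proof (cases "norm z = 0")
    case False
    then have "0 < norm z" by simp
    moreover have "norm z * norm z \<le> norm z * (B * norm y)" using le nz by (simp add: power2_eq_square)
    ultimately show ?thesis by (simp add: mult_le_cancel_left_pos)
  qed simp
  then have "(norm z)\<^sup>2 \<le> (B * norm y)\<^sup>2"
  proof
    assume "norm z \<le> B * norm y"
    then show ?thesis by (intro power_mono) auto
  qed simp
  then show ?thesis using nz by (simp add: A_def power_mult_distrib)
qed

lemma grid_cell:
  assumes "0 < h" "0 < s" "s \<le> real n * h"
  shows "\<exists>k<n. real k * h < s \<and> s \<le> real (Suc k) * h"
  using assms(3)
proof (induction n)
  case 0
  then show ?case using assms by simp
next
  case (Suc n)
  show ?case
  proof (cases "s \<le> real n * h")
    case True
    then show ?thesis using Suc.IH less_Suc_eq by blast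
  next
    case False
    then show ?thesis using Suc.prems by (intro exI[of _ n]) auto
  qed
qed

lemma grid_step_value:
  fixes c :: "nat \<Rightarrow> 'a::real_vector"
  assumes h: "0 < h" and k: "k < n" "real k * h < s" "s \<le> real (Suc k) * h"
  shows "(\<Sum>i<n. indicat_real {real i * h<..real (Suc i) * h} s *\<^sub>R c i) = c k"
proof -
  have "indicat_real {real i * h<..real (Suc i) * h} s = (if i = k then 1 else 0)" for i
  proof (cases "i = k")
    case False
    have "\<not> (real i * h < s \<and> s \<le> real (Suc i) * h)"
    proof (cases "i < k")
      case True
      then have "real (Suc i) * h \<le> real k * h" using h by (intro mult_right_mono) auto
      then show ?thesis using k by auto
    next
      case i: False
      then have "real (Suc k) * h \<le> real i * h" using h False by (intro mult_right_mono) auto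
      then show ?thesis using k by auto
    qed
    then show ?thesis using False by (auto simp: indicator_def)
  qed (use k in auto)
  then have "(\<Sum>i<n. indicat_real {real i * h<..real (Suc i) * h} s *\<^sub>R c i) = (\<Sum>i<n. if i = k then c i else 0)"
    by (intro sum.cong) auto
  then show ?thesis using k by simp
qed

section \<open>The discretised noise and its distance from the stochastic convolution\<close>

locale stochastic_schroedinger = white_noise M \<beta> + schroedinger S
  for M :: "'w measure" and \<beta> S +
  fixes e :: "nat \<Rightarrow> l2" and \<Phi> :: "l2 \<Rightarrow> h1"
  assumes basis: "orthonormal_basis e" and hs: "hilbert_schmidt \<Phi>"
begin

definition mode :: "nat \<Rightarrow> l2" where "mode j = h1_l2 (\<Phi> (e j))"

definition op_norm :: real where "op_norm = onorm (\<lambda>f. h1_l2 (\<Phi> f))"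

text \<open>The squared Hilbert-Schmidt norm of \<open>\<Phi>\<close> as an operator into
  \<open>l2\<close>, that is, the trace of the covariance of the noise per unit time.\<close>

definition trace :: real where "trace = (\<Sum>j. (norm (mode j))\<^sup>2)"

lemma bounded_linear_\<Phi>: "bounded_linear (\<lambda>f. h1_l2 (\<Phi> f))"
  using hs by (intro bounded_linear_compose[OF bounded_linear_h1_l2]) (simp add: hilbert_schmidt_def)

lemma summable_mode: "summable (\<lambda>j. (norm (mode j))\<^sup>2)"
  unfolding mode_def by (rule hilbert_schmidt_summable[OF hs basis])

lemma trace_nonneg: "0 \<le> trace"
  unfolding trace_def by (intro suminf_nonneg summable_mode) simp

text \<open>The integrand of the noise in the interaction picture, frozen at the left end of step
  \<open>n\<close>; it carries the factor \<open>- i\<close> of the mild equation.\<close>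

definition coeff :: "real \<Rightarrow> real \<Rightarrow> nat \<Rightarrow> nat \<Rightarrow> l2" where
  "coeff \<epsilon> h n j = - cscale \<i> (sqrt \<epsilon> *\<^sub>R S (- (real n * h)) (mode j))"

lemma coeff_inner_bound:
  assumes "0 < \<epsilon>" "0 < h"
  shows "h * (\<Sum>j<J. (inner (coeff \<epsilon> h n j) y)\<^sup>2) \<le> (\<epsilon> * op_norm\<^sup>2 * h) * (norm y)\<^sup>2"
proof -
  let ?L = "\<lambda>x. - cscale \<i> (sqrt \<epsilon> *\<^sub>R S (- (real n * h)) (h1_l2 (\<Phi> x)))"
  have "(\<Sum>j<J. (inner (?L (e j)) y)\<^sup>2) \<le> (sqrt \<epsilon> * op_norm)\<^sup>2 * (norm y)\<^sup>2"
  proof (rule sum_inner_sq_le[OF _ basis])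
    show "bounded_linear ?L"
      by (intro bounded_linear_minus bounded_linear_compose[OF bounded_linear_cscale]
          bounded_linear_compose[OF bounded_linear_scaleR_right] bounded_linear_compose[OF linear_S] bounded_linear_\<Phi>)
    show "norm (?L x) \<le> sqrt \<epsilon> * op_norm * norm x" for x
      using onorm[OF bounded_linear_\<Phi>, of x] assms
      by (simp add: norm_cscale norm_S op_norm_def mult.assoc mult_left_mono)
  qed
  then have "(\<Sum>j<J. (inner (coeff \<epsilon> h n j) y)\<^sup>2) \<le> \<epsilon> * op_norm\<^sup>2 * (norm y)\<^sup>2"
    using assms by (simp add: coeff_def mode_def power_mult_distrib)
  then show ?thesis using mult_left_mono[of _ _ h] assms by (simp add: ac_simps)
qed

lemma coeff_trace_bound:
  assumes "0 < \<epsilon>" "0 < h"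
  shows "h * (\<Sum>j<J. (norm (coeff \<epsilon> h n j))\<^sup>2) \<le> \<epsilon> * h * trace"
proof -
  have "(\<Sum>j<J. (norm (coeff \<epsilon> h n j))\<^sup>2) = \<epsilon> * (\<Sum>j<J. (norm (mode j))\<^sup>2)"
    using assms by (simp add: coeff_def norm_cscale norm_S power_mult_distrib sum_distrib_left)
  also have "\<dots> \<le> \<epsilon> * trace"
    unfolding trace_def using assms by (intro mult_left_mono sum_le_suminf summable_mode) auto
  finally show ?thesis using assms by (simp add: mult_left_mono mult.left_commute)
qed

text \<open>The stochastic convolution at the \<open>n\<close>-th grid time, with \<open>J\<close>
  modes and with the group evaluated at left end points.\<close>

definition grid_convolution :: "real \<Rightarrow> nat \<Rightarrow> nat \<Rightarrow> 'w \<Rightarrow> l2" where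
  "grid_convolution h J n \<omega> = (\<Sum>k<n. \<Sum>j<J. grid_inc h (k, j) \<omega> *\<^sub>R S (real n * h - real k * h) (mode j))"

text \<open>Pulled back by \<open>S (- (real n * h))\<close>, the discrete convolution becomes the
  plain sum of the increments of the walk, so the noise term of the scheme error is a mean-square
  error of stochastic integrals.\<close>

lemma grid_convolution_eq:
  assumes "0 < \<epsilon>"
  shows "norm (S (- (real n * h)) (cscale \<i> (sqrt \<epsilon> *\<^sub>R z)) + (\<Sum>k<n. \<Sum>j<J. grid_inc h (k, j) \<omega> *\<^sub>R coeff \<epsilon> h k j))
    = sqrt \<epsilon> * norm (z - grid_convolution h J n \<omega>)"
proof -
  have 1: "S (- (real n * h)) (grid_convolution h J n \<omega>)
      = (\<Sum>k<n. \<Sum>j<J. grid_inc h (k, j) \<omega> *\<^sub>R S (- (real k * h)) (mode j))"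
    by (simp add: grid_convolution_def S_sum S_scaleR S_add[symmetric])
  have cs: "cscale \<i> (sum w I) = (\<Sum>i\<in>I. cscale \<i> (w i))" for w :: "nat \<Rightarrow> l2" and I
    using bounded_linear_cscale[of \<i>] by (simp add: bounded_linear.linear linear_sum)
  have 2: "(\<Sum>k<n. \<Sum>j<J. grid_inc h (k, j) \<omega> *\<^sub>R coeff \<epsilon> h k j)
      = - cscale \<i> (sqrt \<epsilon> *\<^sub>R S (- (real n * h)) (grid_convolution h J n \<omega>))"
    unfolding 1 by (simp add: cs scaleR_sum_right coeff_def cscale_scaleR sum_negf scaleR_left_commute mult.commute)
  have "S (- (real n * h)) (cscale \<i> (sqrt \<epsilon> *\<^sub>R z)) + (\<Sum>k<n. \<Sum>j<J. grid_inc h (k, j) \<omega> *\<^sub>R coeff \<epsilon> h k j)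
      = cscale \<i> (sqrt \<epsilon> *\<^sub>R S (- (real n * h)) (z - grid_convolution h J n \<omega>))"
    unfolding 2 by (simp add: S_i S_scaleR S_diff scaleR_diff_right cscale_diff)
  then show ?thesis using assms by (simp add: norm_cscale norm_S)
qed

lemma grid_convolution_step_pair:
  assumes h: "0 < h"
  shows "step_pair J (grid_convolution h J n) (\<lambda>i s. if i < J then
    (\<Sum>k<n. indicat_real {real k * h<..real (Suc k) * h} s *\<^sub>R S (real n * h - real k * h) (mode i)) else 0)"
proof -
  have "step_pair J (\<lambda>\<omega>. \<Sum>k<n. \<Sum>j<J. inc j (real k * h) (real (Suc k) * h) \<omega> *\<^sub>R S (real n * h - real k * h) (mode j))
    (\<lambda>i s. \<Sum>k<n. \<Sum>j<J. if i = j then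
      indicat_real {real k * h<..real (Suc k) * h} s *\<^sub>R S (real n * h - real k * h) (mode j) else 0)"
    using h by (intro step_pair_sum step_pair_single mult_right_mono) auto
  moreover have "(\<lambda>i s. \<Sum>k<n. \<Sum>j<J. if i = j then
      indicat_real {real k * h<..real (Suc k) * h} s *\<^sub>R S (real n * h - real k * h) (mode j) else 0)
    = (\<lambda>i s. if i < J then
    (\<Sum>k<n. indicat_real {real k * h<..real (Suc k) * h} s *\<^sub>R S (real n * h - real k * h) (mode i)) else 0)"
    by (intro ext) simp
  ultimately show ?thesis by (simp add: grid_convolution_def[abs_def] grid_inc_def)
qed

lemma mode_grid_error:
  assumes h: "0 < h" and "0 \<le> w" and w: "\<And>r. 0 \<le> r \<Longrightarrow> r \<le> h \<Longrightarrow> norm (S (- r) (mode i) - mode i) \<le> w"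
  shows "(\<integral>\<^sup>+s. ennreal ((norm (indicator {0..real n * h} s *\<^sub>R S (real n * h - s) (mode i)
      - (\<Sum>k<n. indicat_real {real k * h<..real (Suc k) * h} s *\<^sub>R S (real n * h - real k * h) (mode i))))\<^sup>2) \<partial>lborel)
    \<le> ennreal (real n * h * w\<^sup>2)"
proof -
  have "(\<integral>\<^sup>+s. ennreal ((norm (indicator {0..real n * h} s *\<^sub>R S (real n * h - s) (mode i)
      - (\<Sum>k<n. indicat_real {real k * h<..real (Suc k) * h} s *\<^sub>R S (real n * h - real k * h) (mode i))))\<^sup>2) \<partial>lborel)
    \<le> (\<integral>\<^sup>+s. ennreal (w\<^sup>2) * indicator {0..real n * h} s \<partial>lborel)"
  proof (rule nn_integral_mono_AE, use AE_lborel_singleton[of "0::real"] in eventually_elim)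
    case (elim s)
    show ?case
    proof (cases "0 < s \<and> s \<le> real n * h")
      case True
      then obtain k where k: "k < n" "real k * h < s" "s \<le> real (Suc k) * h" using grid_cell[OF h] by blast
      \<comment> \<open>Isometry removes the common factor and leaves the continuity of one orbit at
        time \<open>0\<close>, uniformly over the grid cells.\<close>
      have "S (real n * h - s) (mode i) = S (real n * h - real k * h) (S (- (s - real k * h)) (mode i))"
        by (simp add: S_add[symmetric])
      then have "norm (S (real n * h - s) (mode i) - S (real n * h - real k * h) (mode i))
          = norm (S (- (s - real k * h)) (mode i) - mode i)"
        by (simp only: S_diff[symmetric] norm_S)
      also have "\<dots> \<le> w" using k by (intro w) (auto simp: algebra_simps)
      finally have "ennreal ((norm (S (real n * h - s) (mode i) - S (real n * h - real k * h) (mode i)))\<^sup>2) \<le> ennreal (w\<^sup>2)"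
        by (intro ennreal_leI power_mono) auto
      then show ?thesis unfolding grid_step_value[OF h k] using True by simp
    next
      case False
      have "indicat_real {real k * h<..real (Suc k) * h} s = 0" if "k < n" for k
      proof -
        have "real (Suc k) * h \<le> real n * h" "0 \<le> real k * h" using that h by (auto intro!: mult_right_mono)
        then show ?thesis using False by (auto simp: indicator_def)
      qed
      then have "(\<Sum>k<n. indicat_real {real k * h<..real (Suc k) * h} s *\<^sub>R S (real n * h - real k * h) (mode i)) = 0"
        by (intro sum.neutral) simp
      moreover have "indicat_real {0..real n * h} s = 0" using False elim by (auto simp: indicator_def)
      ultimately show ?thesis by simp
    qed
  qed
  also have "\<dots> = ennreal (real n * h * w\<^sup>2)"
    by (subst nn_integral_cmult_indicator) (use h in \<open>simp_all add: ennreal_mult[symmetric] mult.commute\<close>)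
  finally show ?thesis .
qed

lemma mode_tail_error:
  assumes h: "0 < h"
  shows "(\<integral>\<^sup>+s. ennreal ((norm (indicator {0..real n * h} s *\<^sub>R S (real n * h - s) (mode i)))\<^sup>2) \<partial>lborel)
    = ennreal (real n * h * (norm (mode i))\<^sup>2)"
proof -
  have "(\<integral>\<^sup>+s. ennreal ((norm (indicator {0..real n * h} s *\<^sub>R S (real n * h - s) (mode i)))\<^sup>2) \<partial>lborel)
    = (\<integral>\<^sup>+s. ennreal ((norm (mode i))\<^sup>2) * indicator {0..real n * h} s \<partial>lborel)"
    by (intro nn_integral_cong) (auto simp: norm_S indicator_def)
  also have "\<dots> = ennreal (real n * h * (norm (mode i))\<^sup>2)"
    by (subst nn_integral_cmult_indicator) (use h in \<open>simp_all add: ennreal_mult[symmetric] mult.commute\<close>)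
  finally show ?thesis .
qed

lemma modes_uniformly_continuous:
  assumes "0 < w"
  shows "\<exists>r>0. \<forall>i<J. \<forall>x. 0 \<le> x \<longrightarrow> x \<le> r \<longrightarrow> norm (S (- x) (mode i) - mode i) \<le> w"
proof (induction J)
  case 0
  then show ?case by (auto intro: exI[of _ 1])
next
  case (Suc J)
  then obtain r where r: "0 < r" "\<And>i x. i < J \<Longrightarrow> 0 \<le> x \<Longrightarrow> x \<le> r \<Longrightarrow> norm (S (- x) (mode i) - mode i) \<le> w" by blast
  obtain d where d: "0 < d" "\<And>t. dist t 0 < d \<Longrightarrow> dist (S t (mode J)) (S 0 (mode J)) < w"
    using continuous_S[of "mode J"] assms unfolding continuous_on_iff by (meson UNIV_I)
  have "norm (S (- x) (mode J) - mode J) \<le> w" if "0 \<le> x" "x \<le> d / 2" for x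
    using d(2)[of "- x"] that d(1) by (simp add: dist_norm S_0)
  then have "\<forall>i<Suc J. \<forall>x. 0 \<le> x \<longrightarrow> x \<le> min r (d / 2) \<longrightarrow> norm (S (- x) (mode i) - mode i) \<le> w"
    using r(2) by (auto simp: less_Suc_eq)
  moreover have "0 < min r (d / 2)" using r(1) d(1) by simp
  ultimately show ?case by blast
qed

text \<open>First \<open>J\<close> is chosen so that the remaining modes carry little trace, then
  the grid is made fine enough for these \<open>J\<close> modes. Both estimates hold uniformly over
  the grid times up to \<open>T\<close>.\<close>

lemma noise_grid_error:
  assumes Z: "\<And>t. 0 \<le> t \<Longrightarrow> has_cylindrical_integral M \<beta> e t (\<lambda>s f. S (t - s) (h1_l2 (\<Phi> f))) (Z t)"
    and "0 < T" "0 < \<delta>"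
  shows "\<exists>J (N0::nat). \<forall>N\<ge>N0. 0 < N \<longrightarrow> (\<forall>n\<le>N.
    (\<integral>\<^sup>+\<omega>. ennreal ((norm (Z (real n * (T / real N)) \<omega> - grid_convolution (T / real N) J n \<omega>))\<^sup>2) \<partial>M) \<le> ennreal \<delta>)"
proof -
  \<comment> \<open>\<open>16\<close> is twice the constant \<open>8\<close> of the step error: one
    half is for the neglected modes, the other for the time discretisation.\<close>
  have "0 < \<delta> / (16 * T)" using assms by simp
  then obtain J where J: "\<bar>\<Sum>i. (norm (mode (i + J)))\<^sup>2\<bar> < \<delta> / (16 * T)"
    using suminf_exist_split[OF _ summable_mode, of "\<delta> / (16 * T)"] by auto
  \<comment> \<open>\<open>J + 1\<close> instead of \<open>J\<close> covers the case
    \<open>J = 0\<close>.\<close>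
  define w where "w = sqrt (\<delta> / (16 * T * (real J + 1)))"
  have w: "0 < w" "w\<^sup>2 = \<delta> / (16 * T * (real J + 1))" using assms by (auto simp: w_def)
  obtain r where r: "0 < r" "\<And>i x. i < J \<Longrightarrow> 0 \<le> x \<Longrightarrow> x \<le> r \<Longrightarrow> norm (S (- x) (mode i) - mode i) \<le> w"
    using modes_uniformly_continuous[OF w(1), of J] by blast
  obtain N0 :: nat where N0: "T / r < N0" using reals_Archimedean2 by blast
  have "(\<integral>\<^sup>+\<omega>. ennreal ((norm (Z (real n * (T / real N)) \<omega> - grid_convolution (T / real N) J n \<omega>))\<^sup>2) \<partial>M) \<le> ennreal \<delta>"
    if N: "N0 \<le> N" "0 < N" and n: "n \<le> N" for N n
  proof -
    define h where "h = T / real N"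
    have h: "0 < h" using assms N by (simp add: h_def)
    have "T / r < real N" using N0 N(1) by linarith
    then have hr: "h \<le> r" using r(1) N by (simp add: h_def field_simps)
    have nh: "real n * h \<le> T" using n N \<open>0 < T\<close> by (simp add: h_def field_simps)
    have nh0: "0 \<le> real n * h" using h by simp
    define b where "b i = (if i < J then T * w\<^sup>2 else T * (norm (mode i))\<^sup>2)" for i
    have b0: "0 \<le> b i" for i using \<open>0 < T\<close> by (simp add: b_def)
    have sb: "summable b"
    proof (rule summable_iff_shift[of b J, THEN iffD1])
      have "(\<lambda>i. b (i + J)) = (\<lambda>i. T * (norm (mode (i + J)))\<^sup>2)" by (simp add: b_def)
      then show "summable (\<lambda>i. b (i + J))"
        using summable_mode by (simp add: summable_mult summable_iff_shift[of "\<lambda>i. (norm (mode i))\<^sup>2"])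
    qed
    have b1: "(\<Sum>i. b i) = (\<Sum>i. b (i + J)) + (\<Sum>i<J. b i)"
      by (rule suminf_split_initial_segment[OF sb])
    have "(\<Sum>i. b (i + J)) = T * (\<Sum>i. (norm (mode (i + J)))\<^sup>2)"
      using summable_mode by (simp add: b_def suminf_mult summable_iff_shift[of "\<lambda>i. (norm (mode i))\<^sup>2"])
    also have "\<dots> \<le> T * (\<delta> / (16 * T))" using J \<open>0 < T\<close> by (intro mult_left_mono) auto
    finally have b2: "(\<Sum>i. b (i + J)) \<le> \<delta> / 16" using \<open>0 < T\<close> by simp
    have "(\<Sum>i<J. b i) = real J * (T * w\<^sup>2)" by (simp add: b_def)
    also have "\<dots> \<le> (real J + 1) * (T * w\<^sup>2)" using \<open>0 < T\<close> by (intro mult_right_mono) auto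
    also have "\<dots> = \<delta> / 16"
    proof -
      have "real J + 1 \<noteq> 0" by linarith
      then show ?thesis unfolding w(2) using \<open>0 < T\<close> by (simp add: divide_simps)
    qed
    finally have sumb: "8 * (\<Sum>i. b i) \<le> \<delta>" using b1 b2 \<open>0 < \<delta>\<close> by linarith
    have "(\<integral>\<^sup>+\<omega>. ennreal ((norm (Z (real n * h) \<omega> - grid_convolution h J n \<omega>))\<^sup>2) \<partial>M)
      \<le> 8 * (\<Sum>i. \<integral>\<^sup>+s. ennreal ((norm (indicator {0..real n * h} s *\<^sub>R S (real n * h - s) (h1_l2 (\<Phi> (e i)))
        - (if i < J then (\<Sum>k<n. indicat_real {real k * h<..real (Suc k) * h} s *\<^sub>R S (real n * h - real k * h) (mode i)) else 0)))\<^sup>2) \<partial>lborel)"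
      by (rule cylindrical_integral_step_error[OF basis Z[OF nh0] grid_convolution_step_pair[OF h]])
    also have "\<dots> \<le> 8 * (\<Sum>i. ennreal (b i))"
    proof (intro mult_left_mono suminf_le)
      fix i
      show "(\<integral>\<^sup>+s. ennreal ((norm (indicator {0..real n * h} s *\<^sub>R S (real n * h - s) (h1_l2 (\<Phi> (e i)))
        - (if i < J then (\<Sum>k<n. indicat_real {real k * h<..real (Suc k) * h} s *\<^sub>R S (real n * h - real k * h) (mode i)) else 0)))\<^sup>2) \<partial>lborel)
        \<le> ennreal (b i)"
      proof (cases "i < J")
        case True
        have "(\<integral>\<^sup>+s. ennreal ((norm (indicator {0..real n * h} s *\<^sub>R S (real n * h - s) (mode i)
          - (\<Sum>k<n. indicat_real {real k * h<..real (Suc k) * h} s *\<^sub>R S (real n * h - real k * h) (mode i))))\<^sup>2) \<partial>lborel)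
          \<le> ennreal (real n * h * w\<^sup>2)"
          using r(2)[OF True] hr w(1) by (intro mode_grid_error[OF h]) auto
        also have "\<dots> \<le> ennreal (b i)"
          using True nh by (simp add: b_def mult_right_mono ennreal_leI)
        finally show ?thesis using True by (simp add: mode_def)
      next
        case False
        then show ?thesis
          using mode_tail_error[OF h, of n i] nh
          by (simp add: b_def mode_def[symmetric] mult_right_mono ennreal_leI)
      qed
    qed auto
    also have "\<dots> = ennreal (8 * (\<Sum>i. b i))"
      using b0 sb by (simp add: suminf_ennreal2 ennreal_mult suminf_nonneg)
    also have "\<dots> \<le> ennreal \<delta>" using sumb by (rule ennreal_leI)
    finally show ?thesis by (simp add: h_def)
  qed
  then show ?thesis by (intro exI[of _ J] exI[of _ N0] allI impI)
qed

end

section \<open>The splitting scheme and its almost sure limit\<close>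

lemma (in prob_space) AE_tendsto_zero_if_summable:
  fixes W :: "nat \<Rightarrow> 'a \<Rightarrow> real"
  assumes [measurable]: "\<And>m. W m \<in> borel_measurable M" and nonneg: "\<And>m \<omega>. 0 \<le> W m \<omega>"
    and le: "\<And>m. (\<integral>\<^sup>+\<omega>. ennreal (W m \<omega>) \<partial>M) \<le> ennreal (b m)" and b: "summable b" "\<And>m. 0 \<le> b m"
  shows "AE \<omega> in M. (\<lambda>m. W m \<omega>) \<longlonglongrightarrow> 0"
proof -
  have "(\<integral>\<^sup>+\<omega>. (\<Sum>m. ennreal (W m \<omega>)) \<partial>M) = (\<Sum>m. \<integral>\<^sup>+\<omega>. ennreal (W m \<omega>) \<partial>M)"
    by (rule nn_integral_suminf) measurable
  also have "\<dots> \<le> (\<Sum>m. ennreal (b m))" by (intro suminf_le le) auto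
  also have "\<dots> < \<infinity>" using b by (simp add: suminf_ennreal2)
  finally have "AE \<omega> in M. (\<Sum>m. ennreal (W m \<omega>)) \<noteq> \<infinity>"
    by (intro nn_integral_PInf_AE) (auto simp: less_top)
  then show ?thesis
  proof eventually_elim
    case (elim \<omega>)
    then have "summable (\<lambda>m. W m \<omega>)" using nonneg by (intro summable_suminf_not_top) auto
    then show ?case by (rule summable_LIMSEQ_zero)
  qed
qed

context stochastic_schroedinger
begin

definition splitting_map :: "real \<Rightarrow> real \<Rightarrow> nat \<Rightarrow> l2 \<Rightarrow> l2" where
  "splitting_map R h n u = S (- (real n * h)) (pmap (kick R h) (S (real n * h) u))"

lemma norm_splitting_map: "norm (splitting_map R h n u) = norm u"
  by (simp add: splitting_map_def norm_S norm_pmap_kick)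

lemma continuous_splitting_map:
  assumes "0 \<le> R" "0 \<le> h"
  shows "continuous_on UNIV (splitting_map R h n)"
proof -
  have "norm (splitting_map R h n u - splitting_map R h n v) \<le> (1 + 3 * (h * R\<^sup>2)) * norm (u - v)" for u v
  proof -
    let ?k = "pmap (kick R h)" and ?u = "S (real n * h) u" and ?v = "S (real n * h) v"
    have "norm (splitting_map R h n u - splitting_map R h n v) = norm (((?k ?u - ?u) - (?k ?v - ?v)) + (?u - ?v))"
    proof -
      have "((?k ?u - ?u) - (?k ?v - ?v)) + (?u - ?v) = ?k ?u - ?k ?v" by simp
      then show ?thesis unfolding splitting_map_def by (simp only: S_diff[symmetric] norm_S)
    qed
    also have "\<dots> \<le> norm ((?k ?u - ?u) - (?k ?v - ?v)) + norm (?u - ?v)" by (rule norm_triangle_ineq)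
    also have "norm ((?k ?u - ?u) - (?k ?v - ?v)) \<le> 3 * (h * R\<^sup>2) * norm (?u - ?v)"
      by (rule pmap_kick_increment_lipschitz[OF assms(2,1)])
    also have "norm (?u - ?v) = norm (u - v)" by (simp add: S_diff[symmetric] norm_S)
    finally show ?thesis by (simp add: algebra_simps)
  qed
  then have "(1 + 3 * (h * R\<^sup>2))-lipschitz_on UNIV (splitting_map R h n)"
    using assms by (intro lipschitz_onI) (auto simp: dist_norm)
  then show ?thesis by (rule lipschitz_on_continuous_on)
qed

definition scheme :: "real \<Rightarrow> real \<Rightarrow> real \<Rightarrow> nat \<Rightarrow> l2 \<Rightarrow> nat \<Rightarrow> 'w \<Rightarrow> l2" where
  "scheme R \<epsilon> h J u0 n \<omega> = walk (splitting_map R h) (coeff \<epsilon> h) J u0 n (grid_path h \<omega>)"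

text \<open>The factor \<open>E\<close> depends on \<open>R\<close> and \<open>T\<close> but not on
  the grid. All that remains of the noise is \<open>D\<close> at the last grid time plus a Riemann
  sum of \<open>D\<close>, so means at single grid times suffice and no maximal inequality is
  involved.\<close>

lemma scheme_path_error:
  fixes J N :: nat and \<omega> :: 'w and z :: "nat \<Rightarrow> l2" and R \<epsilon> h T \<kappa> B :: real
  assumes \<epsilon>: "0 < \<epsilon>" and R: "0 \<le> R" and h: "0 < h" and T: "real N * h = T"
    and u: "\<And>n. n \<le> N \<Longrightarrow> u (real n * h) = S (real n * h) u0
        - cscale \<i> (integral {0..real n * h} (\<lambda>s. S (real n * h - s) (pmap (trunc_cubic R) (u s))))
        - cscale \<i> (sqrt \<epsilon> *\<^sub>R z n)"
    and cont: "continuous_on {0..T} u"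
    and B: "\<And>s. s \<in> {0..T} \<Longrightarrow> norm (u s) \<le> B"
    and \<kappa>: "\<And>s t. s \<in> {0..T} \<Longrightarrow> t \<in> {0..T} \<Longrightarrow> \<bar>s - t\<bar> \<le> h \<Longrightarrow>
      norm (S (- s) (pmap (trunc_cubic R) (u s)) - S (- t) (pmap (trunc_cubic R) (u t))) \<le> \<kappa>"
  defines "D \<equiv> \<lambda>n. norm (z n - grid_convolution h J n \<omega>)"
    and "E \<equiv> 3 * R\<^sup>2 * exp (3 * R\<^sup>2 * T)"
  shows "norm (S (- T) (u T) - scheme R \<epsilon> h J u0 N \<omega>)
    \<le> (1 + E) * sqrt \<epsilon> * (D N + h * (\<Sum>k<N. D k)) + (1 + E * T) * (T * \<kappa> + T * h * (R\<^sup>2)\<^sup>2 * B)"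
proof -
  define \<eta> where "\<eta> = T * \<kappa> + T * h * (R\<^sup>2)\<^sup>2 * B"
  define c where "c = 3 * (h * R\<^sup>2)"
  have T0: "0 \<le> T" using T h by (simp add: T[symmetric])
  have B0: "0 \<le> B" using order_trans[OF norm_ge_zero B[of 0]] T0 by simp
  have \<kappa>0: "0 \<le> \<kappa>" using \<kappa>[of 0 0] T0 h by simp
  have \<eta>0: "0 \<le> \<eta>" using T0 B0 \<kappa>0 h by (simp add: \<eta>_def)
  have D0: "0 \<le> D n" for n by (simp add: D_def)
  have c0: "0 \<le> c" using h by (simp add: c_def)
  have E0: "0 \<le> E" by (simp add: E_def)
  define d where "d n = sqrt \<epsilon> * D n + \<eta>" for n
  have d_eq: "norm (S (- (real n * h)) (cscale \<i> (sqrt \<epsilon> *\<^sub>R z n)) + (\<Sum>k<n. \<Sum>j<J. grid_path h \<omega> (k, j) *\<^sub>R coeff \<epsilon> h k j))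
      + real N * (h * \<kappa> + (h * R\<^sup>2)\<^sup>2 * B) = d n" for n
  proof -
    have "real N * (h * \<kappa> + (h * R\<^sup>2)\<^sup>2 * B) = \<eta>"
      by (simp add: \<eta>_def T[symmetric] power_mult_distrib power2_eq_square algebra_simps)
    then show ?thesis using grid_convolution_eq[OF \<epsilon>] by (simp add: grid_path_def d_def D_def)
  qed
  have "norm (S (- (real N * h)) (u (real N * h)) - scheme R \<epsilon> h J u0 N \<omega>) \<le> d N + c * (1 + c) ^ N * (\<Sum>k<N. d k)"
    unfolding c_def d_eq[symmetric]
    by (rule scheme_error[where ?u0.0 = u0]) (use assms(1-8) h in \<open>simp_all add: scheme_def splitting_map_def T\<close>)
  also have "\<dots> \<le> d N + h * E * (\<Sum>k<N. d k)"
  proof (intro add_left_mono mult_right_mono)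
    \<comment> \<open>The exponent \<open>c * N = 3 * R^2 * T\<close> of the bounding exponential is
      independent of the grid.\<close>
    have "(1 + c) ^ N \<le> exp c ^ N" using c0 by (intro power_mono exp_ge_add_one_self) auto
    also have "\<dots> = exp (3 * R\<^sup>2 * T)" by (simp add: exp_of_nat_mult[symmetric] c_def T[symmetric] ac_simps)
    finally have "c * (1 + c) ^ N \<le> c * exp (3 * R\<^sup>2 * T)" using c0 by (rule mult_left_mono)
    then show "c * (1 + c) ^ N \<le> h * E" by (simp add: c_def E_def ac_simps)
    show "0 \<le> (\<Sum>k<N. d k)" using D0 \<eta>0 \<epsilon> by (simp add: d_def sum_nonneg)
  qed
  also have "(\<Sum>k<N. d k) = sqrt \<epsilon> * (\<Sum>k<N. D k) + real N * \<eta>"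
    by (simp add: d_def sum.distrib sum_distrib_left)
  also have "d N + h * E * (sqrt \<epsilon> * (\<Sum>k<N. D k) + real N * \<eta>)
      = (sqrt \<epsilon> * D N + E * sqrt \<epsilon> * (h * (\<Sum>k<N. D k))) + (1 + E * T) * \<eta>"
    by (simp add: d_def T[symmetric] algebra_simps)
  also have "\<dots> \<le> (1 + E) * sqrt \<epsilon> * (D N + h * (\<Sum>k<N. D k)) + (1 + E * T) * \<eta>"
  proof (rule add_right_mono)
    have "0 \<le> E * sqrt \<epsilon> * D N" "0 \<le> sqrt \<epsilon> * (h * (\<Sum>k<N. D k))"
      using E0 \<epsilon> D0 h by (simp_all add: sum_nonneg)
    then show "sqrt \<epsilon> * D N + E * sqrt \<epsilon> * (h * (\<Sum>k<N. D k)) \<le> (1 + E) * sqrt \<epsilon> * (D N + h * (\<Sum>k<N. D k))"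
      by (simp add: algebra_simps)
  qed
  finally show ?thesis by (simp add: T \<eta>_def)
qed

text \<open>Grids and numbers of modes are chosen once, from the noise alone, and serve all
  truncation levels. Only the threshold \<open>R0\<close> depends on the path, through its bound in
  \<open>h1\<close>.\<close>

lemma mild_solution_scheme_limit:
  assumes \<epsilon>: "0 < \<epsilon>" and T: "0 < T" and sol: "mild_solution M \<beta> e S \<Phi> \<epsilon> u0 u"
  shows "\<exists>J (N :: nat \<Rightarrow> nat). (\<forall>m. 0 < N m) \<and> filterlim N at_top sequentially \<and>
    (AE \<omega> in M. \<exists>R0. \<forall>R\<ge>R0. (\<lambda>m. scheme (real R) \<epsilon> (T / real (N m)) (J m) u0 (N m) \<omega>) \<longlonglongrightarrow> S (- T) (h1_l2 (u T \<omega>)))"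
proof -
  have "\<forall>t. \<exists>Z. 0 \<le> t \<longrightarrow> has_cylindrical_integral M \<beta> e t (\<lambda>s f. S (t - s) (h1_l2 (\<Phi> f))) Z \<and>
        (AE \<omega> in M. h1_l2 (u t \<omega>) =
           S t u0 - cscale \<i> (integral {0..t} (\<lambda>s. S (t - s) (cubic (u s \<omega>))))
             - cscale \<i> (sqrt \<epsilon> *\<^sub>R Z \<omega>))"
    using sol unfolding mild_solution_def by blast
  from choice[OF this] obtain Z where
    Z: "\<And>t. 0 \<le> t \<Longrightarrow> has_cylindrical_integral M \<beta> e t (\<lambda>s f. S (t - s) (h1_l2 (\<Phi> f))) (Z t)"
    and eq: "\<And>t. 0 \<le> t \<Longrightarrow> AE \<omega> in M. h1_l2 (u t \<omega>) =
           S t u0 - cscale \<i> (integral {0..t} (\<lambda>s. S (t - s) (cubic (u s \<omega>))))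
             - cscale \<i> (sqrt \<epsilon> *\<^sub>R Z t \<omega>)"
    by blast
  have cont: "AE \<omega> in M. continuous_on {0..} (\<lambda>t. u t \<omega>)"
    using sol by (simp add: mild_solution_def)
  \<comment> \<open>Second moments of order \<open>16^(-m)\<close> give first moments of order
    \<open>4^(-m)\<close>, which are summable.\<close>
  define \<delta> :: "nat \<Rightarrow> real" where "\<delta> m = (1 / 16) ^ m" for m
  have "\<forall>m. \<exists>J (N::nat). 0 < N \<and> m \<le> N \<and> (\<forall>n\<le>N.
    (\<integral>\<^sup>+\<omega>. ennreal ((norm (Z (real n * (T / real N)) \<omega> - grid_convolution (T / real N) J n \<omega>))\<^sup>2) \<partial>M) \<le> ennreal (\<delta> m))"
  proof
    fix m
    obtain J and N0 :: nat where JN: "\<forall>N\<ge>N0. 0 < N \<longrightarrow> (\<forall>n\<le>N.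
      (\<integral>\<^sup>+\<omega>. ennreal ((norm (Z (real n * (T / real N)) \<omega> - grid_convolution (T / real N) J n \<omega>))\<^sup>2) \<partial>M) \<le> ennreal (\<delta> m))"
      using noise_grid_error[OF Z T, of "\<delta> m"] by (auto simp: \<delta>_def)
    show "\<exists>J (N::nat). 0 < N \<and> m \<le> N \<and> (\<forall>n\<le>N.
      (\<integral>\<^sup>+\<omega>. ennreal ((norm (Z (real n * (T / real N)) \<omega> - grid_convolution (T / real N) J n \<omega>))\<^sup>2) \<partial>M) \<le> ennreal (\<delta> m))"
    proof (intro exI conjI)
      show "0 < Suc (max N0 m)" "m \<le> Suc (max N0 m)" by auto
    qed (rule JN[THEN spec, THEN mp, THEN mp], auto)
  qed
  from choice[OF this] obtain J where "\<forall>m. \<exists>N::nat. 0 < N \<and> m \<le> N \<and> (\<forall>n\<le>N.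
    (\<integral>\<^sup>+\<omega>. ennreal ((norm (Z (real n * (T / real N)) \<omega> - grid_convolution (T / real N) (J m) n \<omega>))\<^sup>2) \<partial>M) \<le> ennreal (\<delta> m))" ..
  from choice[OF this] obtain N where N: "\<And>m. 0 < N m" "\<And>m. m \<le> N m"
    and err: "\<And>m n. n \<le> N m \<Longrightarrow>
      (\<integral>\<^sup>+\<omega>. ennreal ((norm (Z (real n * (T / real (N m))) \<omega> - grid_convolution (T / real (N m)) (J m) n \<omega>))\<^sup>2) \<partial>M) \<le> ennreal (\<delta> m)"
    by auto
  define h where "h m = T / real (N m)" for m
  have h: "0 < h m" "real (N m) * h m = T" for m using N(1)[of m] T by (simp_all add: h_def)
  have Nlim: "filterlim N at_top sequentially"
    by (rule filterlim_at_top_mono[OF filterlim_ident]) (simp add: N(2))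
  have hlim: "h \<longlonglongrightarrow> 0"
    unfolding h_def by (rule real_tendsto_divide_at_top[OF tendsto_const filterlim_compose[OF filterlim_real_sequentially Nlim]])
  define D where "D m n \<omega> = norm (Z (real n * h m) \<omega> - grid_convolution (h m) (J m) n \<omega>)" for m n \<omega>
  have wZ: "weakly_measurable M (Z t)" if "0 \<le> t" for t
    using Z[OF that] by (intro weakly_measurableI) (simp add: has_cylindrical_integral_def)
  have Dm[measurable]: "D m n \<in> borel_measurable M" for m n
  proof -
    have "weakly_measurable M (grid_convolution (h m) (J m) n)"
      by (rule step_pair_measurable(1)[OF grid_convolution_step_pair[OF h(1)]])
    moreover have "0 \<le> real n * h m" using h(1)[of m] by simp
    ultimately show ?thesis
      unfolding D_def[abs_def] by (intro weakly_measurable_norm[OF basis] weakly_measurable_diff wZ)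
  qed
  have D1: "(\<integral>\<^sup>+\<omega>. ennreal (D m n \<omega>) \<partial>M) \<le> ennreal (2 * (1 / 4) ^ m)" if "n \<le> N m" for m n
  proof -
    have "(\<integral>\<^sup>+\<omega>. ennreal (D m n \<omega>) \<partial>M) \<le> (\<integral>\<^sup>+\<omega>. ennreal ((1 / 4) ^ m) + ennreal (4 ^ m) * ennreal ((D m n \<omega>)\<^sup>2) \<partial>M)"
    proof (rule nn_integral_mono)
      fix \<omega>
      \<comment> \<open>An elementary substitute for Cauchy-Schwarz: with
        \<open>x = D m n \<omega>\<close>, both terms on the right have mean at most
        \<open>4^(-m)\<close>.\<close>
      have "x \<le> (1 / 4) ^ m + 4 ^ m * x\<^sup>2" if "0 \<le> x" for x :: real
      proof (cases "x \<le> (1 / 4) ^ m")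
        case True
        have "0 \<le> 4 ^ m * x\<^sup>2" by simp
        then show ?thesis using True by linarith
      next
        case False
        then have "1 \<le> 4 ^ m * x" by (simp add: power_divide field_simps)
        then have "1 * x \<le> 4 ^ m * x * x" using that by (intro mult_right_mono) auto
        moreover have "0 \<le> (1 / 4 :: real) ^ m" by simp
        ultimately show ?thesis unfolding power2_eq_square mult.assoc mult_1 by linarith
      qed
      then have "D m n \<omega> \<le> (1 / 4) ^ m + 4 ^ m * (D m n \<omega>)\<^sup>2" by (simp add: D_def)
      then have "ennreal (D m n \<omega>) \<le> ennreal ((1 / 4) ^ m + 4 ^ m * (D m n \<omega>)\<^sup>2)" by (rule ennreal_leI)
      also have "\<dots> = ennreal ((1 / 4) ^ m) + ennreal (4 ^ m) * ennreal ((D m n \<omega>)\<^sup>2)"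
        by (subst ennreal_plus) (simp_all add: ennreal_mult)
      finally show "ennreal (D m n \<omega>) \<le> ennreal ((1 / 4) ^ m) + ennreal (4 ^ m) * ennreal ((D m n \<omega>)\<^sup>2)" .
    qed
    also have "\<dots> = ennreal ((1 / 4) ^ m) + ennreal (4 ^ m) * (\<integral>\<^sup>+\<omega>. ennreal ((D m n \<omega>)\<^sup>2) \<partial>M)"
      by (simp add: nn_integral_add nn_integral_cmult emeasure_space_1)
    also have "\<dots> \<le> ennreal ((1 / 4) ^ m) + ennreal (4 ^ m) * ennreal (\<delta> m)"
      using err[OF that] by (intro add_left_mono mult_left_mono) (auto simp: D_def h_def)
    also have "\<dots> = ennreal ((1 / 4) ^ m + 4 ^ m * \<delta> m)"
      by (simp add: \<delta>_def ennreal_mult[symmetric] ennreal_plus[symmetric] del: ennreal_plus)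
    also have "4 ^ m * \<delta> m = (1 / 4) ^ m"
      by (simp add: \<delta>_def power_mult_distrib[symmetric])
    finally show ?thesis by simp
  qed
  define W where "W m \<omega> = D m (N m) \<omega> + h m * (\<Sum>k<N m. D m k \<omega>)" for m \<omega>
  have Wlim: "AE \<omega> in M. (\<lambda>m. W m \<omega>) \<longlonglongrightarrow> 0"
  proof (rule AE_tendsto_zero_if_summable[where b = "\<lambda>m. (1 + T) * (2 * (1 / 4) ^ m)"])
    show "W m \<in> borel_measurable M" for m unfolding W_def[abs_def] by measurable
    show "0 \<le> W m \<omega>" for m \<omega>
      unfolding W_def using h(1)[of m] by (simp add: D_def sum_nonneg)
    show "summable (\<lambda>m. (1 + T) * (2 * (1 / 4) ^ m))"
      by (intro summable_mult summable_geometric) simp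
    show "0 \<le> (1 + T) * (2 * (1 / 4) ^ m)" for m using T by simp
    show "(\<integral>\<^sup>+\<omega>. ennreal (W m \<omega>) \<partial>M) \<le> ennreal ((1 + T) * (2 * (1 / 4) ^ m))" for m
    proof -
      let ?b = "2 * (1 / 4 :: real) ^ m"
      have "(\<integral>\<^sup>+\<omega>. ennreal (W m \<omega>) \<partial>M) = (\<integral>\<^sup>+\<omega>. ennreal (D m (N m) \<omega>) + ennreal (h m) * (\<Sum>k<N m. ennreal (D m k \<omega>)) \<partial>M)"
        using h(1)[of m] by (intro nn_integral_cong)
          (simp add: W_def ennreal_plus ennreal_mult sum_ennreal D_def sum_nonneg)
      also have "\<dots> = (\<integral>\<^sup>+\<omega>. ennreal (D m (N m) \<omega>) \<partial>M) + ennreal (h m) * (\<Sum>k<N m. \<integral>\<^sup>+\<omega>. ennreal (D m k \<omega>) \<partial>M)"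
        by (simp add: nn_integral_add nn_integral_cmult nn_integral_sum)
      also have "\<dots> \<le> ennreal ?b + ennreal (h m) * (\<Sum>k<N m. ennreal ?b)"
        by (intro add_mono mult_left_mono sum_mono D1) auto
      also have "\<dots> = ennreal (?b + h m * (real (N m) * ?b))"
        using h(1)[of m] by (simp add: ennreal_plus ennreal_mult ennreal_of_nat_eq_real_of_nat)
      also have "?b + h m * (real (N m) * ?b) = (1 + T) * ?b"
        using h(2)[of m, symmetric] by (simp add: algebra_simps)
      finally show ?thesis .
    qed
  qed
  \<comment> \<open>The null set of the mild equation may depend on the time. Only countably many
    grid times occur, so a single null set suffices.\<close>
  have "AE \<omega> in M. \<forall>m n. h1_l2 (u (real n * h m) \<omega>) =
           S (real n * h m) u0 - cscale \<i> (integral {0..real n * h m} (\<lambda>s. S (real n * h m - s) (cubic (u s \<omega>))))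
             - cscale \<i> (sqrt \<epsilon> *\<^sub>R Z (real n * h m) \<omega>)"
    unfolding AE_all_countable using h(1) by (intro allI eq) (simp add: less_imp_le)
  with cont Wlim have lim: "AE \<omega> in M. \<exists>R0. \<forall>R\<ge>R0. (\<lambda>m. scheme (real R) \<epsilon> (h m) (J m) u0 (N m) \<omega>) \<longlonglongrightarrow> S (- T) (h1_l2 (u T \<omega>))"
  proof eventually_elim
    case (elim \<omega>)
    define U where "U s = h1_l2 (u s \<omega>)" for s
    have cu: "continuous_on {0..T} (\<lambda>t. u t \<omega>)"
      using elim(1) by (rule continuous_on_subset) auto
    have cU: "continuous_on {0..T} U"
      unfolding U_def by (rule bounded_linear.continuous_on[OF bounded_linear_h1_l2 cu])
    have "bounded ((\<lambda>t. u t \<omega>) ` {0..T})"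
      by (intro compact_imp_bounded compact_continuous_image cu) simp
    then obtain C where C: "\<And>t. t \<in> {0..T} \<Longrightarrow> norm (u t \<omega>) \<le> C"
      by (auto simp: bounded_iff simp del: atLeastAtMost_iff)
    \<comment> \<open>\<open>2 + C^2\<close> is the pointwise bound for elements of
      \<open>h1\<close> of norm at most \<open>C\<close>; from this level on, the true and the
      truncated cubic term agree along the path up to time \<open>T\<close>.\<close>
    obtain R0 :: nat where R0: "2 + C\<^sup>2 \<le> real R0" using real_arch_simple by blast
    show ?case
    proof (intro exI[of _ R0] allI impI)
      fix R assume "R0 \<le> R"
      then have R: "2 + C\<^sup>2 \<le> real R" using R0 by linarith
      have cub: "cubic (u s \<omega>) = pmap (trunc_cubic (real R)) (U s)" if "s \<in> {0..T}" for s
      proof -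
        have "(norm (u s \<omega>))\<^sup>2 \<le> C\<^sup>2" by (intro power_mono C that) simp
        then show ?thesis unfolding U_def using R by (intro cubic_eq_pmap) linarith
      qed
      have UB: "norm (U s) \<le> C" if "s \<in> {0..T}" for s
        using norm_h1_l2_le[of "u s \<omega>"] C[OF that] by (simp add: U_def)
      have C0: "0 \<le> C" using order_trans[OF norm_ge_zero C[of 0]] T by simp
      define H where "H s = S (- s) (pmap (trunc_cubic (real R)) (U s))" for s
      have "continuous_on {0..T} H"
        unfolding H_def by (intro continuous_on_S_comp continuous_on_pmap_trunc_cubic continuous_intros cU) simp
      then have uc: "uniformly_continuous_on {0..T} H"
        by (rule compact_uniformly_continuous) simp
      define E where "E = 3 * (real R)\<^sup>2 * exp (3 * (real R)\<^sup>2 * T)"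
      define P where "P = (1 + E * T) * T"
      have E0: "0 \<le> E" by (simp add: E_def)
      have P0: "0 < P" using E0 T unfolding P_def by (intro mult_pos_pos add_pos_nonneg) auto
      have bound: "norm (S (- T) (U T) - scheme (real R) \<epsilon> (h m) (J m) u0 (N m) \<omega>)
          \<le> (1 + E) * sqrt \<epsilon> * W m \<omega> + (1 + E * T) * (T * \<kappa> + T * h m * ((real R)\<^sup>2)\<^sup>2 * C)"
        if \<kappa>: "\<And>s t. s \<in> {0..T} \<Longrightarrow> t \<in> {0..T} \<Longrightarrow> \<bar>s - t\<bar> \<le> h m \<Longrightarrow> norm (H s - H t) \<le> \<kappa>" for m \<kappa>
        unfolding W_def D_def E_def
      proof (rule scheme_path_error[OF \<epsilon> _ h])
        fix n assume n: "n \<le> N m"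
        have "real n * h m \<le> real (N m) * h m" using n h(1)[of m] by (intro mult_right_mono) auto
        then have sub: "{0..real n * h m} \<subseteq> {0..T}" using h(2)[of m] by auto
        have "integral {0..real n * h m} (\<lambda>s. S (real n * h m - s) (cubic (u s \<omega>)))
            = integral {0..real n * h m} (\<lambda>s. S (real n * h m - s) (pmap (trunc_cubic (real R)) (U s)))"
          using sub by (intro integral_cong) (auto simp: cub)
        then show "U (real n * h m) = S (real n * h m) u0
          - cscale \<i> (integral {0..real n * h m} (\<lambda>s. S (real n * h m - s) (pmap (trunc_cubic (real R)) (U s))))
          - cscale \<i> (sqrt \<epsilon> *\<^sub>R Z (real n * h m) \<omega>)"
          using elim(3) by (simp add: U_def)
      next
        fix s t assume "s \<in> {0..T}" "t \<in> {0..T}" "\<bar>s - t\<bar> \<le> h m"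
        from \<kappa>[OF this] show "norm (S (- s) (pmap (trunc_cubic (real R)) (U s)) - S (- t) (pmap (trunc_cubic (real R)) (U t))) \<le> \<kappa>"
          by (simp add: H_def)
      qed (use cU UB in auto)
      have "(\<lambda>m. S (- T) (U T) - scheme (real R) \<epsilon> (h m) (J m) u0 (N m) \<omega>) \<longlonglongrightarrow> 0"
      proof (rule LIMSEQ_I)
        fix r :: real assume "0 < r"
        \<comment> \<open>A third of \<open>r\<close> each goes to the noise, the local error and
          the modulus of continuity.\<close>
        define \<kappa> where "\<kappa> = r / (3 * P)"
        have \<kappa>: "0 < \<kappa>" using \<open>0 < r\<close> P0 by (simp add: \<kappa>_def)
        obtain d where d: "0 < d" "\<And>s t. s \<in> {0..T} \<Longrightarrow> t \<in> {0..T} \<Longrightarrow> dist t s < d \<Longrightarrow> dist (H t) (H s) < \<kappa>"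
          using uc \<kappa> unfolding uniformly_continuous_on_def by meson
        have "(\<lambda>m. (1 + E) * sqrt \<epsilon> * W m \<omega>) \<longlonglongrightarrow> (1 + E) * sqrt \<epsilon> * 0"
          by (intro tendsto_intros elim(2))
        then have e1: "\<forall>\<^sub>F m in sequentially. (1 + E) * sqrt \<epsilon> * W m \<omega> < r / 3"
          using \<open>0 < r\<close> by (intro order_tendstoD(2)) auto
        have "(\<lambda>m. P * (h m * ((real R)\<^sup>2)\<^sup>2 * C)) \<longlonglongrightarrow> P * (0 * ((real R)\<^sup>2)\<^sup>2 * C)"
          by (intro tendsto_intros hlim)
        then have e2: "\<forall>\<^sub>F m in sequentially. P * (h m * ((real R)\<^sup>2)\<^sup>2 * C) < r / 3"
          using \<open>0 < r\<close> by (intro order_tendstoD(2)) auto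
        have e3: "\<forall>\<^sub>F m in sequentially. h m < d"
          using hlim d(1) by (rule order_tendstoD(2))
        from e1 e2 e3 have "\<forall>\<^sub>F m in sequentially. norm (S (- T) (U T) - scheme (real R) \<epsilon> (h m) (J m) u0 (N m) \<omega>) < r"
        proof eventually_elim
          case (elim m)
          have "norm (S (- T) (U T) - scheme (real R) \<epsilon> (h m) (J m) u0 (N m) \<omega>)
              \<le> (1 + E) * sqrt \<epsilon> * W m \<omega> + (1 + E * T) * (T * \<kappa> + T * h m * ((real R)\<^sup>2)\<^sup>2 * C)"
          proof (rule bound)
            fix s t assume "s \<in> {0..T}" "t \<in> {0..T}" "\<bar>s - t\<bar> \<le> h m"
            then have "dist (H s) (H t) < \<kappa>" using elim(3) by (intro d(2)) (auto simp: dist_real_def)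
            then show "norm (H s - H t) \<le> \<kappa>" by (simp add: dist_norm)
          qed
          also have "(1 + E * T) * (T * \<kappa> + T * h m * ((real R)\<^sup>2)\<^sup>2 * C) = P * \<kappa> + P * (h m * ((real R)\<^sup>2)\<^sup>2 * C)"
            by (simp add: P_def algebra_simps)
          also have "P * \<kappa> = r / 3" using P0 by (simp add: \<kappa>_def)
          finally show ?case using elim(1,2) by linarith
        qed
        then show "\<exists>no. \<forall>m\<ge>no. norm (S (- T) (U T) - scheme (real R) \<epsilon> (h m) (J m) u0 (N m) \<omega> - 0) < r"
          by (simp add: eventually_sequentially)
      qed
      then have "(\<lambda>m. S (- T) (U T) - (S (- T) (U T) - scheme (real R) \<epsilon> (h m) (J m) u0 (N m) \<omega>)) \<longlonglongrightarrow> S (- T) (U T) - 0"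
        by (intro tendsto_intros)
      then show "(\<lambda>m. scheme (real R) \<epsilon> (h m) (J m) u0 (N m) \<omega>) \<longlonglongrightarrow> S (- T) (h1_l2 (u T \<omega>))"
        by (simp add: U_def)
    qed
  qed
  show ?thesis
    using N(1) Nlim lim[unfolded h_def] by (intro exI[of _ J] exI[of _ N] conjI allI)
qed

text \<open>Fatou's lemma is applied twice, in \<open>m\<close> for a fixed truncation level and
  then in \<open>R\<close>, because the level from which the scheme converges depends on the path.
  Hence \<open>bound\<close> has to be uniform in \<open>R\<close>, \<open>J\<close> and
  \<open>N\<close>, though only for small steps.\<close>

lemma mild_solution_expectation_le:
  fixes F :: "real \<Rightarrow> real"
  assumes \<epsilon>: "0 < \<epsilon>" and T: "0 < T" and sol: "mild_solution M \<beta> e S \<Phi> \<epsilon> u0 u"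
    and F: "continuous_on UNIV F"
    and h0: "0 < h0"
    and bound: "\<And>R J N. 0 < N \<Longrightarrow> T / real N < h0 \<Longrightarrow>
      (\<integral>\<^sup>+\<omega>. ennreal (F (norm (scheme (real R) \<epsilon> (T / real N) J u0 N \<omega>))) \<partial>M) \<le> K"
  shows "(\<integral>\<^sup>+\<omega>. ennreal (F (norm (h1_l2 (u T \<omega>)))) \<partial>M) \<le> K"
proof -
  obtain J and N :: "nat \<Rightarrow> nat" where N: "\<And>m. 0 < N m" "filterlim N at_top sequentially"
    and lim: "AE \<omega> in M. \<exists>R0. \<forall>R\<ge>R0. (\<lambda>m. scheme (real R) \<epsilon> (T / real (N m)) (J m) u0 (N m) \<omega>) \<longlonglongrightarrow> S (- T) (h1_l2 (u T \<omega>))"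
    using mild_solution_scheme_limit[OF \<epsilon> T sol] by blast
  define f where "f R m \<omega> = ennreal (F (norm (scheme (real R) \<epsilon> (T / real (N m)) (J m) u0 (N m) \<omega>)))" for R m \<omega>
  have [measurable]: "f R m \<in> borel_measurable M" for R m
  proof -
    have "0 < T / real (N m)" using N(1)[of m] T by simp
    then have "(\<lambda>\<omega>. (F \<circ> norm) (scheme (real R) \<epsilon> (T / real (N m)) (J m) u0 (N m) \<omega>)) \<in> borel_measurable M"
      unfolding scheme_def
      by (intro measurable_walk_grid_path continuous_splitting_map continuous_on_compose
          continuous_on_norm continuous_on_id continuous_on_subset[OF F]) auto
    then show ?thesis unfolding f_def[abs_def] by simp
  qed
  have "(\<lambda>m. T / real (N m)) \<longlonglongrightarrow> 0"
    by (rule real_tendsto_divide_at_top[OF tendsto_const filterlim_compose[OF filterlim_real_sequentially N(2)]])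
  then have "\<forall>\<^sub>F m in sequentially. T / real (N m) < h0"
    using h0 by (rule order_tendstoD(2))
  then have fK: "\<forall>\<^sub>F m in sequentially. (\<integral>\<^sup>+\<omega>. f R m \<omega> \<partial>M) \<le> K" for R
    by eventually_elim (simp add: f_def bound N(1))
  have "(\<integral>\<^sup>+\<omega>. ennreal (F (norm (h1_l2 (u T \<omega>)))) \<partial>M) = (\<integral>\<^sup>+\<omega>. liminf (\<lambda>R. liminf (\<lambda>m. f R m \<omega>)) \<partial>M)"
  proof (rule nn_integral_cong_AE, use lim in eventually_elim)
    case (elim \<omega>)
    then obtain R0 where R0: "\<And>R. R \<ge> R0 \<Longrightarrow> (\<lambda>m. scheme (real R) \<epsilon> (T / real (N m)) (J m) u0 (N m) \<omega>) \<longlonglongrightarrow> S (- T) (h1_l2 (u T \<omega>))"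
      by blast
    let ?L = "ennreal (F (norm (h1_l2 (u T \<omega>))))"
    have "liminf (\<lambda>m. f R m \<omega>) = ?L" if "R \<ge> R0" for R
    proof (rule lim_imp_Liminf[OF sequentially_bot])
      have "isCont F (norm (S (- T) (h1_l2 (u T \<omega>))))" using F by (simp add: continuous_on_eq_continuous_at)
      then have "(\<lambda>m. F (norm (scheme (real R) \<epsilon> (T / real (N m)) (J m) u0 (N m) \<omega>))) \<longlonglongrightarrow> F (norm (S (- T) (h1_l2 (u T \<omega>))))"
        by (rule isCont_tendsto_compose) (intro tendsto_norm R0 that)
      then show "(\<lambda>m. f R m \<omega>) \<longlonglongrightarrow> ?L"
        unfolding f_def norm_S by (intro tendsto_ennrealI)
    qed
    then have "(\<lambda>R. liminf (\<lambda>m. f R m \<omega>)) \<longlonglongrightarrow> ?L"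
      by (intro tendsto_eventually eventually_sequentiallyI[of R0])
    then show "?L = liminf (\<lambda>R. liminf (\<lambda>m. f R m \<omega>))"
      by (rule lim_imp_Liminf[OF sequentially_bot, symmetric])
  qed
  also have "\<dots> \<le> liminf (\<lambda>R. \<integral>\<^sup>+\<omega>. liminf (\<lambda>m. f R m \<omega>) \<partial>M)"
    by (rule nn_integral_liminf) measurable
  also have "\<dots> \<le> K"
  proof (rule Liminf_le[OF sequentially_bot always_eventually], rule allI)
    fix R
    have "(\<integral>\<^sup>+\<omega>. liminf (\<lambda>m. f R m \<omega>) \<partial>M) \<le> liminf (\<lambda>m. \<integral>\<^sup>+\<omega>. f R m \<omega> \<partial>M)"
      by (rule nn_integral_liminf) measurable
    also have "\<dots> \<le> K" by (rule Liminf_le[OF sequentially_bot fK])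
    finally show "(\<integral>\<^sup>+\<omega>. liminf (\<lambda>m. f R m \<omega>) \<partial>M) \<le> K" .
  qed
  finally show ?thesis .
qed

end

section \<open>Error probabilities\<close>

lemma lborel_integral_sech_sq:
  shows "integrable lborel (\<lambda>x::real. 1 / (cosh x)\<^sup>2)" and "(\<integral>x. 1 / (cosh x)\<^sup>2 \<partial>lborel) = (2::real)"
proof -
  have D: "DERIV tanh x :> 1 / (cosh x)\<^sup>2" for x :: real
  proof -
    have "1 - (tanh x)\<^sup>2 = 1 / (cosh x)\<^sup>2"
      by (simp add: tanh_def power_divide field_simps sinh_square_eq)
    moreover have "DERIV tanh x :> 1 - (tanh x)\<^sup>2" by (auto intro!: derivative_eq_intros)
    ultimately show ?thesis by simp
  qed
  note FTC = interval_integral_FTC_nonneg[of "-\<infinity>" "\<infinity>" tanh "\<lambda>x. 1 / (cosh x)\<^sup>2" "-1" 1,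
      unfolded ereal_tendsto_simps, OF _ D _ _ tanh_real_at_bot tanh_real_at_top]
  have c: "isCont (\<lambda>x. 1 / (cosh x)\<^sup>2) x" for x :: real
    by (intro continuous_intros) simp
  show "integrable lborel (\<lambda>x::real. 1 / (cosh x)\<^sup>2)"
    using FTC(1) c by (simp add: set_integrable_def)
  show "(\<integral>x. 1 / (cosh x)\<^sup>2 \<partial>lborel) = (2::real)"
    using FTC(2) c by (simp add: interval_lebesgue_integral_def set_lebesgue_integral_def)
qed

lemma norm_soliton: "(norm soliton)\<^sup>2 = 4"
proof -
  have eq: "(cmod (complex_of_real (sqrt 2 / cosh x)))\<^sup>2 = 2 * (1 / (cosh x)\<^sup>2)" for x
    by (simp only: norm_of_real power2_abs) (simp add: power_divide)
  have "(\<lambda>x::real. complex_of_real (sqrt 2 / cosh x)) \<in> borel_measurable borel"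
    by (intro borel_measurable_continuous_onI continuous_intros) simp
  then have "sq_integrable (\<lambda>x. complex_of_real (sqrt 2 / cosh x))"
    unfolding sq_integrable_def eq using integrable_mult_right[OF lborel_integral_sech_sq(1), of 2] by simp
  then have "(norm soliton)\<^sup>2 = (\<integral>x. 2 * (1 / (cosh x)\<^sup>2) \<partial>lborel)"
    unfolding soliton_def by (simp only: norm_l2_of_sq eq)
  also have "\<dots> = 2 * 2" by (simp only: integral_mult_right_zero lborel_integral_sech_sq(2))
  finally show ?thesis by simp
qed

lemma mass_eq_norm_sq: "mass u = (norm (h1_l2 u))\<^sup>2"
  by (simp add: mass_def norm_l2_sq)

lemma (in prob_space) prob_le_if_nn_integral_le:
  assumes A: "A \<in> sets M" and c: "0 < c" and g: "\<And>\<omega>. \<omega> \<in> A \<Longrightarrow> c \<le> g \<omega>"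
    and K: "(\<integral>\<^sup>+\<omega>. ennreal (g \<omega>) \<partial>M) \<le> ennreal K" "0 \<le> K"
  shows "prob A \<le> K / c"
proof -
  have "ennreal (c * prob A) = (\<integral>\<^sup>+\<omega>. ennreal c * indicator A \<omega> \<partial>M)"
    using c A by (simp add: ennreal_mult nn_integral_cmult_indicator emeasure_eq_measure)
  also have "\<dots> \<le> (\<integral>\<^sup>+\<omega>. ennreal (g \<omega>) \<partial>M)"
    by (rule nn_integral_mono) (use g in \<open>auto simp: indicator_def intro: ennreal_leI\<close>)
  also have "\<dots> \<le> ennreal K" by (rule K)
  finally have "c * prob A \<le> K" using K(2) by simp
  then show ?thesis using c by (simp add: field_simps)
qed

text \<open>A prefactor \<open>C\<close> independent of \<epsilon> contributes
  \<open>\<epsilon> * ln C\<close>, which tends to \<open>0\<close>.\<close>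

lemma Limsup_elog_le:
  assumes C: "0 < C" and p: "\<And>\<epsilon>. 0 < \<epsilon> \<Longrightarrow> 0 \<le> p \<epsilon>" "\<And>\<epsilon>. 0 < \<epsilon> \<Longrightarrow> p \<epsilon> \<le> C * exp (- (\<kappa> / \<epsilon>))"
  shows "Limsup (at_right 0) (\<lambda>\<epsilon>. ereal \<epsilon> * elog (p \<epsilon>)) \<le> ereal (- \<kappa>)"
proof -
  have le: "ereal \<epsilon> * elog (p \<epsilon>) \<le> ereal (\<epsilon> * ln C - \<kappa>)" if \<epsilon>: "0 < \<epsilon>" for \<epsilon>
  proof (cases "p \<epsilon> = 0")
    case True
    then show ?thesis using \<epsilon> by (simp add: elog_def)
  next
    case False
    then have pos: "0 < p \<epsilon>" using p(1)[OF \<epsilon>] by simp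
    then have "ln (p \<epsilon>) \<le> ln (C * exp (- (\<kappa> / \<epsilon>)))" using p(2)[OF \<epsilon>] by simp
    also have "\<dots> = ln C - \<kappa> / \<epsilon>" using C by (simp add: ln_mult)
    finally have "\<epsilon> * ln (p \<epsilon>) \<le> \<epsilon> * (ln C - \<kappa> / \<epsilon>)" using \<epsilon> by (intro mult_left_mono) auto
    also have "\<dots> = \<epsilon> * ln C - \<kappa>" using \<epsilon> by (simp add: right_diff_distrib)
    finally show ?thesis using False by (simp add: elog_def)
  qed
  have "Limsup (at_right 0) (\<lambda>\<epsilon>. ereal \<epsilon> * elog (p \<epsilon>)) \<le> Limsup (at_right 0) (\<lambda>\<epsilon>. ereal (\<epsilon> * ln C - \<kappa>))"
    by (intro Limsup_mono) (use le in \<open>auto simp: eventually_at_filter\<close>)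
  also have "\<dots> = ereal (- \<kappa>)"
  proof (rule lim_imp_Limsup)
    have "((\<lambda>\<epsilon>. \<epsilon> * ln C - \<kappa>) \<longlongrightarrow> 0 * ln C - \<kappa>) (at_right 0)" by (intro tendsto_intros)
    then show "((\<lambda>\<epsilon>. ereal (\<epsilon> * ln C - \<kappa>)) \<longlongrightarrow> ereal (- \<kappa>)) (at_right 0)" by simp
  qed simp
  finally show ?thesis .
qed

section \<open>Exponential moments of the mass and Chernoff bounds\<close>

context stochastic_schroedinger
begin

lemma measurable_mass:
  assumes "mild_solution M \<beta> e S \<Phi> \<epsilon> u0 u" "0 \<le> T"
  shows "(\<lambda>\<omega>. mass (u T \<omega>)) \<in> borel_measurable M"
proof -
  have "u T \<in> borel_measurable M" using assms by (simp add: mild_solution_def)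
  moreover have "(\<lambda>v. (norm (h1_l2 v))\<^sup>2) \<in> borel_measurable borel"
    by (intro borel_measurable_continuous_onI continuous_intros
        bounded_linear.continuous_on[OF bounded_linear_h1_l2])
  ultimately show ?thesis unfolding mass_eq_norm_sq by (rule measurable_compose)
qed

text \<open>\<open>N\<close> steps with \<open>q = \<epsilon> * op_norm^2 * h\<close> add
  \<open>2 * \<epsilon> * op_norm^2 * T\<close> to \<open>\<rho>\<close> on every grid. The choice
  \<open>\<rho> = \<epsilon> * r\<close> makes the exponent proportional to
  \<open>1 / \<epsilon>\<close>.\<close>

lemma expectation_exp_minus_mass:
  assumes \<epsilon>: "0 < \<epsilon>" and T: "0 < T" and sol: "mild_solution M \<beta> e S \<Phi> \<epsilon> u0 u" and r: "0 < r"
  shows "(\<integral>\<^sup>+\<omega>. ennreal (exp (- mass (u T \<omega>) / (\<epsilon> * r))) \<partial>M)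
    \<le> ennreal (exp (- (norm u0)\<^sup>2 / (\<epsilon> * (r + 2 * op_norm\<^sup>2 * T))))"
  unfolding mass_eq_norm_sq
proof (rule mild_solution_expectation_le[OF \<epsilon> T sol, where F = "\<lambda>x. exp (- x\<^sup>2 / (\<epsilon> * r))" and ?h0.0 = 1])
  show "continuous_on UNIV (\<lambda>x. exp (- x\<^sup>2 / (\<epsilon> * r)))"
    using \<epsilon> r by (intro continuous_intros) auto
  fix R J N :: nat assume N: "0 < N"
  define h where "h = T / real N"
  have h: "0 < h" using N T by (simp add: h_def)
  have Nh: "h * real N = T" using N by (simp add: h_def)
  have "\<epsilon> * r + 2 * (\<epsilon> * op_norm\<^sup>2 * h) * real N = \<epsilon> * r + 2 * (\<epsilon> * op_norm\<^sup>2) * (h * real N)"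
    by (simp only: mult.assoc)
  also have "\<dots> = \<epsilon> * (r + 2 * op_norm\<^sup>2 * T)" by (simp add: Nh algebra_simps)
  finally have eq: "\<epsilon> * r + 2 * (\<epsilon> * op_norm\<^sup>2 * h) * real N = \<epsilon> * (r + 2 * op_norm\<^sup>2 * T)" .
  have "(\<integral>\<^sup>+\<omega>. ennreal (exp (- (norm (scheme (real R) \<epsilon> h J u0 N \<omega>))\<^sup>2 / (\<epsilon> * r))) \<partial>M)
      \<le> ennreal (exp (- (norm u0)\<^sup>2 / (\<epsilon> * r + 2 * (\<epsilon> * op_norm\<^sup>2 * h) * real N)))"
    unfolding scheme_def
  proof (rule walk_exp_minus[OF h])
    show "h * (\<Sum>j<J. (inner (coeff \<epsilon> h n j) y)\<^sup>2) \<le> (\<epsilon> * op_norm\<^sup>2 * h) * (norm y)\<^sup>2" for n y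
      by (rule coeff_inner_bound[OF \<epsilon> h])
  qed (use \<epsilon> h r in \<open>auto intro!: continuous_splitting_map norm_splitting_map\<close>)
  then show "(\<integral>\<^sup>+\<omega>. ennreal (exp (- (norm (scheme (real R) \<epsilon> (T / real N) J u0 N \<omega>))\<^sup>2 / (\<epsilon> * r))) \<partial>M)
      \<le> ennreal (exp (- (norm u0)\<^sup>2 / (\<epsilon> * (r + 2 * op_norm\<^sup>2 * T))))"
    unfolding eq unfolding h_def .
qed simp

text \<open>Of the \<open>8\<close>, the steps of the walk consume \<open>4\<close>, and the other
  \<open>4\<close> stay in \<open>\<rho>0\<close>. The accumulated factor is then independent of
  \<epsilon> and of the grid.\<close>

lemma expectation_exp_plus_mass:
  assumes \<epsilon>: "0 < \<epsilon>" and T: "0 < T" and sol: "mild_solution M \<beta> e S \<Phi> \<epsilon> 0 u" and a: "op_norm \<noteq> 0"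
  shows "(\<integral>\<^sup>+\<omega>. ennreal (exp (mass (u T \<omega>) / (8 * \<epsilon> * op_norm\<^sup>2 * T))) \<partial>M)
    \<le> ennreal (exp (trace / (2 * op_norm\<^sup>2)))"
  unfolding mass_eq_norm_sq
proof (rule mild_solution_expectation_le[OF \<epsilon> T sol,
      where F = "\<lambda>x. exp (x\<^sup>2 / (8 * \<epsilon> * op_norm\<^sup>2 * T))" and ?h0.0 = "op_norm\<^sup>2 * T / (2 * (trace + 1))"])
  have a2: "0 < op_norm\<^sup>2" using a by simp
  show "continuous_on UNIV (\<lambda>x. exp (x\<^sup>2 / (8 * \<epsilon> * op_norm\<^sup>2 * T)))"
    using \<epsilon> a T by (intro continuous_intros) auto
  show "0 < op_norm\<^sup>2 * T / (2 * (trace + 1))"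
    using a2 T trace_nonneg by (intro divide_pos_pos mult_pos_pos) auto
  fix R J N :: nat assume N: "0 < N" and small: "T / real N < op_norm\<^sup>2 * T / (2 * (trace + 1))"
  define h where "h = T / real N"
  have h: "0 < h" using N T by (simp add: h_def)
  have Nh: "h * real N = T" using N by (simp add: h_def)
  define \<rho>0 where "\<rho>0 = 4 * \<epsilon> * op_norm\<^sup>2 * T"
  have \<rho>0: "0 < \<rho>0" using \<epsilon> a2 T by (simp add: \<rho>0_def)
  \<comment> \<open>The restriction on the step size is chosen to give
    \<open>2 * \<tau> / \<rho>0 \<le> 1 / 4\<close>; \<open>trace + 1\<close> keeps its denominator
    positive when the trace is \<open>0\<close>.\<close>
  have "h * (2 * (trace + 1)) < op_norm\<^sup>2 * T"
    using small trace_nonneg by (simp add: h_def pos_less_divide_eq)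
  then have "2 * (h * trace) \<le> op_norm\<^sup>2 * T" using h by (simp add: algebra_simps)
  then have "\<epsilon> * (2 * (h * trace)) \<le> \<epsilon> * (op_norm\<^sup>2 * T)" using \<epsilon> by (intro mult_left_mono) auto
  then have \<tau>: "2 * (\<epsilon> * h * trace) / \<rho>0 \<le> 1 / 4"
    using \<rho>0 by (simp add: divide_le_eq) (simp add: \<rho>0_def algebra_simps)
  have "\<rho>0 + 4 * (\<epsilon> * op_norm\<^sup>2 * h) * real N = \<rho>0 + 4 * (\<epsilon> * op_norm\<^sup>2) * (h * real N)"
    by (simp only: mult.assoc)
  then have eq: "\<rho>0 + 4 * (\<epsilon> * op_norm\<^sup>2 * h) * real N = 8 * \<epsilon> * op_norm\<^sup>2 * T"
    by (simp add: Nh \<rho>0_def)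
  have "2 * (\<epsilon> * h * trace) / \<rho>0 * real N = 2 * \<epsilon> * trace * (h * real N) / \<rho>0"
    by (simp add: ac_simps)
  also have "\<dots> = trace / (2 * op_norm\<^sup>2)"
    unfolding Nh \<rho>0_def using \<epsilon> T by (simp add: field_simps)
  finally have eq': "2 * (\<epsilon> * h * trace) / \<rho>0 * real N = trace / (2 * op_norm\<^sup>2)" .
  have "(\<integral>\<^sup>+\<omega>. ennreal (exp ((norm (scheme (real R) \<epsilon> h J 0 N \<omega>))\<^sup>2 / (8 * \<epsilon> * op_norm\<^sup>2 * T))) \<partial>M)
      \<le> ennreal (exp (2 * (\<epsilon> * h * trace) / \<rho>0 * real N))"
    unfolding scheme_def
  proof (rule walk_exp_plus[OF basis h])
    show "h * (\<Sum>j<J. (inner (coeff \<epsilon> h n j) y)\<^sup>2) \<le> (\<epsilon> * op_norm\<^sup>2 * h) * (norm y)\<^sup>2" for n y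
      by (rule coeff_inner_bound[OF \<epsilon> h])
    show "h * (\<Sum>j<J. (norm (coeff \<epsilon> h n j))\<^sup>2) \<le> \<epsilon> * h * trace" for n
      by (rule coeff_trace_bound[OF \<epsilon> h])
    show "0 \<le> \<epsilon> * h * trace" using \<epsilon> h trace_nonneg by simp
    show "\<rho>0 + 4 * (\<epsilon> * op_norm\<^sup>2 * h) * real N \<le> 8 * \<epsilon> * op_norm\<^sup>2 * T" by (simp only: eq order_refl)
  qed (use \<epsilon> h \<rho>0 \<tau> in \<open>auto intro!: continuous_splitting_map norm_splitting_map\<close>)
  then show "(\<integral>\<^sup>+\<omega>. ennreal (exp ((norm (scheme (real R) \<epsilon> (T / real N) J 0 N \<omega>))\<^sup>2 / (8 * \<epsilon> * op_norm\<^sup>2 * T))) \<partial>M)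
      \<le> ennreal (exp (trace / (2 * op_norm\<^sup>2)))"
    unfolding eq' unfolding h_def .
qed

lemma prob_mass_ge:
  assumes \<epsilon>: "0 < \<epsilon>" and T: "0 < T" and sol: "mild_solution M \<beta> e S \<Phi> \<epsilon> 0 u" and a: "op_norm \<noteq> 0"
  shows "prob {\<omega> \<in> space M. m \<le> mass (u T \<omega>)}
    \<le> exp (trace / (2 * op_norm\<^sup>2)) * exp (- (m / (8 * op_norm\<^sup>2 * T) / \<epsilon>))"
proof -
  let ?c = "8 * \<epsilon> * op_norm\<^sup>2 * T"
  have c: "0 < ?c" using \<epsilon> T a by simp
  have [measurable]: "(\<lambda>\<omega>. mass (u T \<omega>)) \<in> borel_measurable M" using measurable_mass[OF sol] T by simp
  have "prob {\<omega> \<in> space M. m \<le> mass (u T \<omega>)} \<le> exp (trace / (2 * op_norm\<^sup>2)) / exp (m / ?c)"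
  proof (rule prob_le_if_nn_integral_le[OF _ _ _ expectation_exp_plus_mass[OF \<epsilon> T sol a]])
    show "exp (m / ?c) \<le> exp (mass (u T \<omega>) / ?c)" if "\<omega> \<in> {\<omega> \<in> space M. m \<le> mass (u T \<omega>)}" for \<omega>
      using that c by (simp add: divide_right_mono)
  qed auto
  moreover have "m / (8 * op_norm\<^sup>2 * T) / \<epsilon> = m / ?c" by (simp add: ac_simps)
  ultimately show ?thesis by (simp only: exp_minus divide_inverse)
qed

lemma prob_mass_less:
  assumes \<epsilon>: "0 < \<epsilon>" and T: "0 < T" and sol: "mild_solution M \<beta> e S \<Phi> \<epsilon> u0 u" and r: "0 < r"
  shows "prob {\<omega> \<in> space M. mass (u T \<omega>) < m}
    \<le> exp (- (((norm u0)\<^sup>2 / (r + 2 * op_norm\<^sup>2 * T) - m / r) / \<epsilon>))"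
proof -
  have c: "0 < \<epsilon> * r" using \<epsilon> r by simp
  have [measurable]: "(\<lambda>\<omega>. mass (u T \<omega>)) \<in> borel_measurable M" using measurable_mass[OF sol] T by simp
  have "prob {\<omega> \<in> space M. mass (u T \<omega>) < m}
      \<le> exp (- (norm u0)\<^sup>2 / (\<epsilon> * (r + 2 * op_norm\<^sup>2 * T))) / exp (- m / (\<epsilon> * r))"
  proof (rule prob_le_if_nn_integral_le[OF _ _ _ expectation_exp_minus_mass[OF \<epsilon> T sol r]])
    show "exp (- m / (\<epsilon> * r)) \<le> exp (- mass (u T \<omega>) / (\<epsilon> * r))"
      if "\<omega> \<in> {\<omega> \<in> space M. mass (u T \<omega>) < m}" for \<omega>
      using that c by (simp add: divide_right_mono)
  qed auto
  also have "\<dots> = exp (- (norm u0)\<^sup>2 / (\<epsilon> * (r + 2 * op_norm\<^sup>2 * T)) - - m / (\<epsilon> * r))"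
    by (rule exp_diff[symmetric])
  also have "- (norm u0)\<^sup>2 / (\<epsilon> * (r + 2 * op_norm\<^sup>2 * T)) - - m / (\<epsilon> * r)
      = - (((norm u0)\<^sup>2 / (r + 2 * op_norm\<^sup>2 * T) - m / r) / \<epsilon>)"
    by (simp add: diff_divide_distrib mult.commute)
  finally show ?thesis .
qed

end

text \<open>With \<open>s = sqrt (1 - \<gamma>)\<close>, the factorisation
  \<open>\<gamma> = (1 - s) * (1 + s)\<close> and \<open>1 + s \<le> 2\<close> give
  \<open>\<gamma>^2 \<le> 4 * (1 - s)^2 * (1 + \<gamma>)\<close>. The square root on the left is
  then estimated by \<open>sqrt (1 + 2 * d) \<le> 1 + d\<close>.\<close>

lemma error_exponent_le:
  fixes \<gamma> :: real
  assumes "0 \<le> \<gamma>" "\<gamma> \<le> 1"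
  shows "(1 + \<gamma>) * (sqrt (1 + (\<gamma> / (1 + \<gamma>))\<^sup>2) - 1) \<le> 2 * (1 - sqrt (1 - \<gamma>))\<^sup>2"
proof -
  define s where "s = sqrt (1 - \<gamma>)"
  have s: "0 \<le> s" "s \<le> 1" "s\<^sup>2 = 1 - \<gamma>" using assms by (auto simp: s_def)
  have \<gamma>: "\<gamma> = (1 - s) * (1 + s)" using s(3) by (simp add: power2_eq_square algebra_simps)
  let ?d = "2 * (1 - s)\<^sup>2 / (1 + \<gamma>)"
  have g: "0 < 1 + \<gamma>" using assms by simp
  have "(1 + s)\<^sup>2 \<le> 4 * (1 + \<gamma>)"
  proof -
    have "(1 + s)\<^sup>2 \<le> 2\<^sup>2" using s by (intro power_mono) auto
    then show ?thesis using assms by simp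
  qed
  then have "(1 - s)\<^sup>2 * (1 + s)\<^sup>2 \<le> (1 - s)\<^sup>2 * (4 * (1 + \<gamma>))" by (intro mult_left_mono) auto
  then have "\<gamma>\<^sup>2 \<le> 4 * (1 - s)\<^sup>2 * (1 + \<gamma>)"
    using arg_cong[OF \<gamma>, of "\<lambda>x. x\<^sup>2"] unfolding power_mult_distrib by (simp only: mult_ac)
  then have "\<gamma>\<^sup>2 / (1 + \<gamma>)\<^sup>2 \<le> 4 * (1 - s)\<^sup>2 * (1 + \<gamma>) / (1 + \<gamma>)\<^sup>2" by (intro divide_right_mono) auto
  also have "\<dots> = 2 * ?d" using g by (simp add: power2_eq_square)
  finally have "1 + (\<gamma> / (1 + \<gamma>))\<^sup>2 \<le> 1 + 2 * ?d" by (simp add: power_divide)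
  also have "\<dots> \<le> (1 + ?d)\<^sup>2" by (simp add: power2_sum)
  finally have "sqrt (1 + (\<gamma> / (1 + \<gamma>))\<^sup>2) \<le> 1 + ?d"
    using g by (intro real_le_lsqrt) auto
  then have "(1 + \<gamma>) * (sqrt (1 + (\<gamma> / (1 + \<gamma>))\<^sup>2) - 1) \<le> (1 + \<gamma>) * ?d"
    using g by (intro mult_left_mono) auto
  then show ?thesis using g by (simp add: s_def)
qed

theorem proposition6p2:
  fixes M :: "'w measure"
    and \<beta> :: "nat \<Rightarrow> real \<Rightarrow> 'w \<Rightarrow> real"
    and e :: "nat \<Rightarrow> l2"
    and S :: "real \<Rightarrow> l2 \<Rightarrow> l2"
    and \<Phi> :: "l2 \<Rightarrow> h1"
    and u un :: "real \<Rightarrow> real \<Rightarrow> 'w \<Rightarrow> h1"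
    and T \<gamma> :: real
  assumes "prob_space M"
    and "independent_brownian_motions M \<beta>"
    and "orthonormal_basis e"
    and "schroedinger_group S"
    and "hilbert_schmidt \<Phi>" and "\<exists>f. \<Phi> f \<noteq> 0"
    and "T > 0" and "0 \<le> \<gamma>" and "\<gamma> \<le> 1"
    and "\<And>\<epsilon>. \<epsilon> > 0 \<Longrightarrow> mild_solution M \<beta> e S \<Phi> \<epsilon> soliton (u \<epsilon>)"
    and "\<And>\<epsilon>. \<epsilon> > 0 \<Longrightarrow> mild_solution M \<beta> e S \<Phi> \<epsilon> 0 (un \<epsilon>)"
  shows "Limsup (at_right 0) (\<lambda>\<epsilon>. ereal \<epsilon> *
             elog (measure M {\<omega> \<in> space M. mass (un \<epsilon> T \<omega>) \<ge> 4 * (1 - \<gamma>)}))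
           \<le> ereal (- ((1 - \<gamma>) / (2 * T * (onorm (\<lambda>f. h1_l2 (\<Phi> f)))\<^sup>2)))
       \<and> Limsup (at_right 0) (\<lambda>\<epsilon>. ereal \<epsilon> *
             elog (measure M {\<omega> \<in> space M. mass (u \<epsilon> T \<omega>) < 4 * (1 - \<gamma>)}))
           \<le> ereal (- ((1 + \<gamma>) / (T * (onorm (\<lambda>f. h1_l2 (\<Phi> f)))\<^sup>2) * (sqrt (1 + (\<gamma> / (1 + \<gamma>))\<^sup>2) - 1)))"
proof -
  interpret prob_space M by fact
  interpret stochastic_schroedinger M \<beta> S e \<Phi>
    by unfold_locales fact+
  define a where "a = op_norm\<^sup>2"
  have a: "(onorm (\<lambda>f. h1_l2 (\<Phi> f)))\<^sup>2 = a" by (simp add: a_def op_norm_def)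
  have sol: "mild_solution M \<beta> e S \<Phi> \<epsilon> soliton (u \<epsilon>)" "mild_solution M \<beta> e S \<Phi> \<epsilon> 0 (un \<epsilon>)" if "0 < \<epsilon>" for \<epsilon>
    using that assms(10,11) by auto
  \<comment> \<open>Probabilities are at most \<open>1\<close>, so the upper limit is never
    positive. This settles the cases in which the exponent is \<open>0\<close>, by \<gamma> = 0 or
    through a division by zero.\<close>
  have trivial: "Limsup (at_right 0) (\<lambda>\<epsilon>. ereal \<epsilon> * elog (prob (A \<epsilon>))) \<le> ereal (- 0)" for A
    by (rule Limsup_elog_le[where C = 1]) auto
  let ?p0 = "\<lambda>\<epsilon>. prob {\<omega> \<in> space M. mass (un \<epsilon> T \<omega>) \<ge> 4 * (1 - \<gamma>)}"
  let ?p1 = "\<lambda>\<epsilon>. prob {\<omega> \<in> space M. mass (u \<epsilon> T \<omega>) < 4 * (1 - \<gamma>)}"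
  have "Limsup (at_right 0) (\<lambda>\<epsilon>. ereal \<epsilon> * elog (?p0 \<epsilon>)) \<le> ereal (- ((1 - \<gamma>) / (2 * T * a)))"
  proof (cases "op_norm = 0")
    case True
    then show ?thesis using trivial by (simp add: a_def)
  next
    case False
    \<comment> \<open>The \<open>4\<close> of the threshold against the \<open>8\<close> of the
      exponential moment leaves the \<open>2\<close> of the claimed exponent.\<close>
    have "8 * op_norm\<^sup>2 * T = 4 * (2 * T * a)" by (simp add: a_def)
    then have "4 * (1 - \<gamma>) / (8 * op_norm\<^sup>2 * T) = (1 - \<gamma>) / (2 * T * a)"
      by (simp only: mult_divide_mult_cancel_left_if) simp
    then show ?thesis
      using prob_mass_ge[OF _ \<open>0 < T\<close> sol(2) False, of _ "4 * (1 - \<gamma>)"]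
      by (intro Limsup_elog_le[where C = "exp (trace / (2 * op_norm\<^sup>2))"]) auto
  qed
  moreover have "Limsup (at_right 0) (\<lambda>\<epsilon>. ereal \<epsilon> * elog (?p1 \<epsilon>))
      \<le> ereal (- ((1 + \<gamma>) / (T * a) * (sqrt (1 + (\<gamma> / (1 + \<gamma>))\<^sup>2) - 1)))"
  proof (cases "op_norm = 0 \<or> \<gamma> = 0")
    case True
    then show ?thesis using trivial by (auto simp: a_def)
  next
    case False
    then have a0: "0 < a" and \<gamma>: "0 < \<gamma>" using \<open>0 \<le> \<gamma>\<close> by (auto simp: a_def)
    define s where "s = sqrt (1 - \<gamma>)"
    define \<kappa> where "\<kappa> = 2 * (1 - s)\<^sup>2 / (T * a)"
    have s: "0 \<le> s" "s < 1" "s\<^sup>2 = 1 - \<gamma>" using \<gamma> \<open>\<gamma> \<le> 1\<close> by (auto simp: s_def)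
    have "Limsup (at_right 0) (\<lambda>\<epsilon>. ereal \<epsilon> * elog (?p1 \<epsilon>)) \<le> ereal (- \<kappa>)"
    proof (rule Limsup_elog_le[where C = 1])
      fix \<epsilon> :: real assume \<epsilon>: "0 < \<epsilon>"
      show "?p1 \<epsilon> \<le> 1 * exp (- (\<kappa> / \<epsilon>))"
      \<comment> \<open>\<open>s = 0\<close> means \<gamma> = 1: the threshold is \<open>0\<close>,
        the mass is never negative, and the event is empty.\<close>
      proof (cases "s = 0")
        case True
        then have "4 * (1 - \<gamma>) = 0" using s(3) by simp
        then have "{\<omega> \<in> space M. mass (u \<epsilon> T \<omega>) < 4 * (1 - \<gamma>)} = {}"
          by (auto simp: mass_eq_norm_sq not_less)
        then show ?thesis by (simp only: measure_empty) simp
      next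
        case False
        then have s0: "0 < s" using s(1) by simp
        \<comment> \<open>The maximiser of \<open>4 / (r + 2 * a * T) - 4 * s^2 / r\<close> over
          positive \<open>r\<close>, that is, the solution of
          \<open>r = s * (r + 2 * a * T)\<close>; the value there is
          \<open>\<kappa>\<close>.\<close>
        define r where "r = 2 * a * T * s / (1 - s)"
        have r: "0 < r" using a0 s0 s(2) \<open>0 < T\<close> by (simp add: r_def)
        have rr: "r + 2 * a * T = 2 * a * T / (1 - s)" using s(2) by (simp add: r_def field_simps)
        have "4 / (r + 2 * a * T) - 4 * (1 - \<gamma>) / r = \<kappa>"
          unfolding rr s(3)[symmetric] r_def \<kappa>_def using s0 s(2) a0 \<open>0 < T\<close>
          by (simp add: field_simps power2_eq_square)
        then show ?thesis
          using prob_mass_less[OF \<epsilon> \<open>0 < T\<close> sol(1)[OF \<epsilon>] r, of "4 * (1 - \<gamma>)"]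
          by (simp add: norm_soliton a_def)
      qed
    qed auto
    also have "\<dots> \<le> ereal (- ((1 + \<gamma>) / (T * a) * (sqrt (1 + (\<gamma> / (1 + \<gamma>))\<^sup>2) - 1)))"
      using divide_right_mono[OF error_exponent_le[of \<gamma>], of "T * a"] \<gamma> \<open>\<gamma> \<le> 1\<close> a0 \<open>0 < T\<close>
      by (simp add: \<kappa>_def s_def)
    finally show ?thesis .
  qed
  ultimately show ?thesis unfolding a by blast
qed

end
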